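(* Let $d\in\mathbb{N}$, $d\ge 1$. There are constants $c(d)>0$ and $c'(d)>0$ depending only on $d$ such that the following holds for every $f\in \mathrm{dom}(S^d)=\Lambda_{\varphi_d}(\mathbb{R}^d)$. (i) $\mu(H^{\otimes d}f)\leq c(d)\,S^d\mu(f)$ pointwise on $(0,\infty)$. (ii) There exists a sequence $\{f_{N,d}\}_{N\in\mathbb{N}}$ of measurable functions $f_{N,d}:\mathbb{R}^d\to\mathbb{R}$ such that $\mu(f_{N,d})=\mu(f)\chi_{(0,N^d)}$ for every $N$ and $$\liminf_{N\to\infty}\mu(H^{\otimes d}f_{N,d})\geq c'(d)\,S^d\mu(f)$$ pointwise on $(0,\infty)$.
   Context: $m$ is Lebesgue measure. For measurable $I\subset\mathbb{R}^d$, $S(I)$ is the space of measurable functions $f$ on $I$ (modulo a.e. equality) with $m(\{|f|>s\})<\infty$ for some $s>0$. The non-increasing rearrangement of $|f|$ is $\mu(t,f)=\inf\{s\ge 0: m(\{|f|>s\})\le t\}$, $t>0$; $\mu(f)$ denotes the function $t\mapsto\mu(t,f)$ on $(0,\infty)$. $\mathbb{R}_+=(0,\infty)$. The function $\varphi_d$ is $$\varphi_d(t)=\frac{1}{\Gamma(d+1)}\int_0^t\log^d(1/s)\,ds+t\quad (0<t<1),\qquad \varphi_d(t)=2+\frac1{\Gamma(d)}\int_1^t\Big(\int_0^{1/s}\log^{d-1}(1/u)\,du\Big)ds\quad (t\ge 1),$$ and $\Lambda_{\varphi_d}(I)=\{f\in S(I):\int_0^{m(I)}\mu(s,f)\,d\varphi_d(s)<\infty\}$.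 The notation $\mathrm{dom}(S^d)$ means $\Lambda_{\varphi_d}(I)$ (for $I=\mathbb{R}^d$ here; $f\in\Lambda_{\varphi_d}(\mathbb{R}^d)$ iff $\mu(f)\in\Lambda_{\varphi_d}(\mathbb{R}_+)$). The Calderón operator is $(Sg)(t)=\frac1t\int_0^t g(s)\,ds+\int_t^\infty g(s)\frac{ds}{s}=\int_0^\infty \min\{\tfrac1t,\tfrac1s\}g(s)\,ds$, and $S^d=S\circ\cdots\circ S$ is its $d$-fold composition with itself, defined on $\Lambda_{\varphi_d}(\mathbb{R}_+)$. The multiple Hilbert transform is $H^{\otimes d}f=H_1H_2\cdots H_df$, where $H_j$ is the one-dimensional principal value Hilbert transform in the $j$-th variable, $H_jg(x)=\lim_{\varepsilon\to0^+}\frac1\pi\int_{|y|>\varepsilon}\frac{g(x-ye_j)}{y}\,dy$ ($e_j$ the $j$-th standard basis vector); i.e. $(H^{\otimes d}f)(t)=\mathrm{p.v.}\ \frac{1}{\pi^d}\int_{\mathbb{R}}\cdots\int_{\mathbb R}\frac{f(s_1,\dots,s_d)}{\prod_{k=1}^d(t_k-s_k)}\,ds_1\cdots ds_d$. *)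

theory Defs
  imports "HOL-Analysis.Analysis"
begin

(* Lebesgue measure on R^d. Points of R^d are the extensional functions {1..d} -> R.
   The completion makes "measurable" mean Lebesgue measurable. *)
definition lebesgue_Rd :: "nat \<Rightarrow> (nat \<Rightarrow> real) measure" where
  "lebesgue_Rd d = completion (PiM {1..d} (\<lambda>_. lborel))"

(* Elements of the space S(I) are represented by functions, not by a.e. classes. *)
definition S_space :: "'a measure \<Rightarrow> ('a \<Rightarrow> real) set" where
  "S_space M = {f \<in> borel_measurable M.
     \<exists>s>0. emeasure M {x \<in> space M. \<bar>f x\<bar> > s} < \<infinity>}"

(* mu(t,f), with values in [0,\<infinity>]: the infimum of the empty set is \<infinity>.
   For f in S_space M and t > 0 the value is finite. *)
definition rearrangement :: "'a measure \<Rightarrow> ('a \<Rightarrow> real) \<Rightarrow> real \<Rightarrow> ennreal" where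
  "rearrangement M f t =
     Inf {ennreal s | s. s \<ge> 0 \<and> emeasure M {x \<in> space M. \<bar>f x\<bar> > s} \<le> ennreal t}"

(* Extended by 0 to (-\<infinity>,0], so that it generates a Stieltjes measure on the real line;
   since phi d is continuous at 0, that measure has no atom there. *)
definition phi :: "nat \<Rightarrow> real \<Rightarrow> real" where
  "phi d t =
    (if t \<le> 0 then 0
     else if t < 1 then
       1 / Gamma (real d + 1) * (LBINT s:{0<..<t}. ln (1 / s) ^ d) + t
     else
       2 + 1 / Gamma (real d) *
         (LBINT s:{1<..<t}. (LBINT u:{0<..<1 / s}. ln (1 / u) ^ (d - 1))))"

definition Lorentz_space :: "(real \<Rightarrow> real) \<Rightarrow> 'a measure \<Rightarrow> ('a \<Rightarrow> real) set" where
  "Lorentz_space \<phi> M = {f \<in> S_space M.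
     (\<integral>\<^sup>+ s \<in> {s. 0 < s \<and> ennreal s < emeasure M (space M)}.
        rearrangement M f s \<partial>interval_measure \<phi>) < \<infinity>}"

(* The Calderon operator on nonnegative functions on (0,\<infinity>). *)
definition calderon :: "(real \<Rightarrow> ennreal) \<Rightarrow> real \<Rightarrow> ennreal" where
  "calderon g t =
     ennreal (1 / t) * (\<integral>\<^sup>+ s \<in> {0<..<t}. g s \<partial>lborel)
     + (\<integral>\<^sup>+ s \<in> {t<..}. g s * ennreal (1 / s) \<partial>lborel)"

(* Principal value Hilbert transform in the j-th variable; x(j := x j - y) is x - y e_j.
   The integral is taken with respect to the completed measure: sections of a Lebesgue
   measurable function need not be Borel measurable. Lim is unspecified where the limit
   does not exist. *)
definition hilbert_coord ::
    "nat \<Rightarrow> ((nat \<Rightarrow> real) \<Rightarrow> real) \<Rightarrow> (nat \<Rightarrow> real) \<Rightarrow> real" where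
  "hilbert_coord j g x =
     Lim (at_right 0)
       (\<lambda>\<epsilon>. 1 / pi * (LINT y:{y. \<bar>y\<bar> > \<epsilon>}|lebesgue. g (x(j := x j - y)) / y))"

(* H_1 (H_2 (... (H_d f))) *)
definition multiple_hilbert ::
    "nat \<Rightarrow> ((nat \<Rightarrow> real) \<Rightarrow> real) \<Rightarrow> (nat \<Rightarrow> real) \<Rightarrow> real" where
  "multiple_hilbert d f = foldr hilbert_coord [1..<d + 1] f"

end

theory Submission
  imports Defs "HOL-Analysis.Analysis" "HOL-Computational_Algebra.Polynomial"
begin

text \<open>
  For (i), Loomis' count of the level points of a sum of simple poles gives the weak type \<open>(1,1)\<close>
  bound for the maximal truncated Hilbert transform on the line, and partial fractions give the
  \<open>L\<^sup>2\<close> bound. Fubini transfers both to a single coordinate of \<open>\<real>\<^sup>d\<close>. Splitting \<open>f\<close> at the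
  height \<open>\<mu>(t,f)\<close>, the unbounded part is controlled by the weak type bound and the bounded part by
  duality, which yields \<open>\<mu>(H\<^sub>j f) \<le> 1000 S \<mu>(f)\<close>; this is iterated over the coordinates. The iteration
  needs \<open>S\<^sup>n \<mu>(f) < \<infinity>\<close> for \<open>n \<le> d\<close>: writing \<open>S = P + Q\<close> with the Hardy operator \<open>P\<close> and its dual
  \<open>Q\<close>, the kernels of the powers of \<open>P\<close> and \<open>Q\<close> are powers of logarithms, and these are dominated by
  the density of \<open>d\<phi>\<^sub>d\<close>.

  For (ii), \<open>f\<^sub>N\<close> is a decreasing function of the product \<open>x\<^sub>1 \<cdots> x\<^sub>d\<close> on the region \<open>x\<^sub>1 > 0\<close>,
  \<open>1 < x\<^sub>i < e\<^sup>L\<close> for \<open>i \<ge> 2\<close>. At points with negative coordinates the iterated principal values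
  are integrals of one sign, and for \<open>e\<^sup>A < - x\<^sub>i < e\<^sup>L\<^sup>-\<^sup>A\<close> each of them is at least a
  truncated Calderon operator in the variable \<open>\<bar>x\<^sub>1 \<cdots> x\<^sub>d\<bar>\<close>. With \<open>L = 4 A\<close> the region of such points
  is smaller than the support of \<open>f\<^sub>N\<close> only by a constant factor, which costs a dilation of \<open>t\<close> by
  \<open>2\<^sup>d\<close>. Letting \<open>A \<rightarrow> \<infinity>\<close> removes the truncation by monotone convergence.
\<close>

section \<open>Loomis' estimate for sums of simple poles\<close>

text \<open>The Lorentz condition does not place \<open>f\<close> in any \<open>L^p\<close> space,
  so the iterated principal values must be shown to exist from \<open>S \<mu> < \<infinity>\<close>
  alone, which makes almost every section integrable against \<open>1 / (1 + \<bar>s\<bar>)\<close>.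
  As \<open>Lim\<close> is arbitrary where no limit exists, each partial transform has to agree
  almost everywhere with a Borel function before the next coordinate is taken up. The weak type
  bound alone does not control the duality pairing for the bounded part, since the tail
  \<open>1/l\<close> of a distribution function is not integrable at infinity; the
  \<open>L^2\<close> bound supplies the decay \<open>1/l^2\<close> for large \<open>l\<close>. The
  range of \<open>l\<close> where \<open>1/l\<close> is the better bound produces a logarithm, and
  this is the origin of the integral of \<open>\<mu>(u)/u\<close> in \<open>S\<close>. In (ii) the
  measure \<open>dx/x\<close> is the natural one: the integral against
  \<open>ds / (s + \<bar>x\<bar>)\<close> depends only on the ratio
  \<open>s / \<bar>x\<bar>\<close>, with a kernel comparable to that of \<open>S\<close>. A function
  of the product of the coordinates therefore sees one operator \<open>S\<close> per
  coordinate.\<close>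

lemma prod_linear_coeffs:
  fixes r :: "'a \<Rightarrow> real"
  assumes "finite A"
  shows "degree (\<Prod>a\<in>A. [:- r a, 1:]) = card A \<and> coeff (\<Prod>a\<in>A. [:- r a, 1:]) (card A) = 1
    \<and> (A \<noteq> {} \<longrightarrow> coeff (\<Prod>a\<in>A. [:- r a, 1:]) (card A - 1) = - sum r A)"
  using assms
proof (induction A rule: finite_induct)
  case (insert x F)
  let ?p = "\<Prod>a\<in>F. [:- r a, 1:]"
  have d: "degree ?p = card F" and l: "coeff ?p (card F) = 1" using insert by auto
  have nz: "?p \<noteq> 0" using l by auto
  have deg: "degree ([:- r x, 1:] * ?p) = Suc (card F)"
    by (subst degree_mult_eq) (use nz d in auto)
  have e: "[:- r x, 1:] * ?p = pCons 0 ?p - smult (r x) ?p"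
    by (simp add: algebra_simps)
  have z: "coeff ?p (Suc (card F)) = 0" using d by (intro coeff_eq_0) simp
  have "coeff ([:- r x, 1:] * ?p) (Suc (card F)) = 1"
    unfolding e by (simp add: l z)
  moreover have "coeff ([:- r x, 1:] * ?p) (card F) = - sum r (insert x F)"
  proof (cases "F = {}")
    case True
    then show ?thesis by simp
  next
    case False
    then obtain m where m: "card F = Suc m"
      using insert(1) by (metis card_gt_0_iff gr0_conv_Suc)
    have "coeff ?p m = - sum r F" using insert.IH False m by auto
    moreover have "coeff ?p (Suc m) = 1" using l m by simp
    ultimately show ?thesis unfolding e using insert(1,2) m by simp
  qed
  ultimately show ?case using deg insert(1,2) by simp
qed simp

text \<open>Vieta: clearing denominators, both sides are the sum of the roots of the same polynomial.\<close>

lemma sum_level_points: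
  fixes c r :: "real \<Rightarrow> real"
  assumes A: "finite A" "A \<noteq> {}" and l: "l > 0" and inj: "inj_on r A"
    and rA: "\<And>a. a \<in> A \<Longrightarrow> r a \<notin> A"
    and eq: "\<And>a. a \<in> A \<Longrightarrow> (\<Sum>b\<in>A. c b / (r a - b)) = l"
  shows "(\<Sum>a\<in>A. r a - a) = (\<Sum>a\<in>A. c a) / l"
proof -
  define n where "n = card A"
  have n: "n > 0" using A by (simp add: n_def card_gt_0_iff)
  define P where "P = (\<Prod>a\<in>A. [:- a, 1:])"
  define Q where "Q = (\<Prod>a\<in>A. [:- r a, 1:])"
  define R where "R a = (\<Prod>b\<in>A-{a}. [:- b, 1:])" for a
  \<comment> \<open>The level equations say that \<open>l P\<close> minus the sum of the
    \<open>c a R a\<close> vanishes at every \<open>r a\<close>, as \<open>l Q\<close> does. The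
    leading terms of \<open>l P\<close> and \<open>l Q\<close> cancel, so \<open>D\<close> has fewer
    than \<open>n\<close> roots unless it is zero.\<close>
  define D where "D = smult l P - (\<Sum>a\<in>A. smult (c a) (R a)) - smult l Q"
  note cP = prod_linear_coeffs[OF A(1), of "\<lambda>x. x", folded P_def n_def]
  note cQ = prod_linear_coeffs[OF A(1), of r, folded Q_def n_def]
  have cR: "degree (R a) = n - 1 \<and> coeff (R a) (n - 1) = 1" if "a \<in> A" for a
    using prod_linear_coeffs[of "A-{a}" "\<lambda>x. x"] A(1) that by (simp add: R_def n_def)
  have cRn: "coeff (R a) n = 0" if "a \<in> A" for a
    using cR[OF that] n by (intro coeff_eq_0) auto
  have dS: "degree (\<Sum>a\<in>A. smult (c a) (R a)) \<le> n"
  proof (intro degree_sum_le A(1))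
    fix a assume "a \<in> A"
    then show "degree (smult (c a) (R a)) \<le> n"
      using degree_smult_le[of "c a" "R a"] cR[of a] by linarith
  qed
  have "degree D \<le> n"
    unfolding D_def using cP cQ dS
    by (intro degree_diff_le) (auto intro: le_trans[OF degree_smult_le])
  moreover have "coeff D n = 0"
    unfolding D_def using cP cQ cRn by (simp add: coeff_sum)
  ultimately have deg: "degree D < n"
    by (metis n degree_0 le_neq_implies_less leading_coeff_0_iff)
  have root: "poly D (r a) = 0" if a: "a \<in> A" for a
  proof -
    have "poly (R b) (r a) = poly P (r a) / (r a - b)" if "b \<in> A" for b
    proof -
      have "P = [:- b, 1:] * R b" unfolding P_def R_def
        by (rule prod.remove[OF A(1) that])
      moreover have "r a \<noteq> b" using rA a that by auto
      ultimately show ?thesis by (simp only: poly_mult) (simp add: field_simps)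
    qed
    then have "poly (\<Sum>b\<in>A. smult (c b) (R b)) (r a) = poly P (r a) * (\<Sum>b\<in>A. c b / (r a - b))"
      by (simp add: poly_sum sum_distrib_left field_simps cong: sum.cong)
    moreover have "poly Q (r a) = 0"
      unfolding Q_def using A a by (auto simp: poly_prod)
    ultimately show ?thesis unfolding D_def using eq[OF a] by simp
  qed
  have "D = 0"
  proof (rule ccontr)
    assume "D \<noteq> 0"
    then have "card {x. poly D x = 0} \<le> degree D" "finite {x. poly D x = 0}"
      by (auto simp: card_poly_roots_bound poly_roots_finite)
    moreover have "r ` A \<subseteq> {x. poly D x = 0}" using root by auto
    ultimately have "card (r ` A) \<le> degree D"
      by (meson card_mono le_trans)
    then show False using deg card_image[OF inj] by (simp add: n_def)
  qed
  \<comment> \<open>The second highest coefficient compares the sum of the poles, the total weight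
    and the sum of the level points.\<close>
  then have "coeff D (n - 1) = 0" by simp
  then have "- l * (\<Sum>a\<in>A. a) - (\<Sum>a\<in>A. c a) + l * sum r A = 0"
    unfolding D_def using cP cQ cR A by (simp add: coeff_sum)
  then show ?thesis using l by (simp add: sum_subtractf field_simps)
qed

section \<open>Boole's formula for the level sets of a sum of simple poles\<close>

lemma cauchy_sum_antimono:
  fixes c :: "real \<Rightarrow> real"
  assumes "\<And>a. a \<in> A \<Longrightarrow> c a \<ge> 0" "x \<le> y" "A \<inter> {x..y} = {}"
  shows "(\<Sum>a\<in>A. c a / (y - a)) \<le> (\<Sum>a\<in>A. c a / (x - a))"
proof (rule sum_mono)
  fix a assume a: "a \<in> A"
  then have "a \<notin> {x..y}" using assms by auto
  then consider "a < x" | "a > y" by force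
  then have "inverse (y - a) \<le> inverse (x - a)"
  proof cases
    case 1 then show ?thesis using assms by (intro le_imp_inverse_le) auto
  next
    case 2 then show ?thesis using assms by (intro le_imp_inverse_le_neg) auto
  qed
  then show "c a / (y - a) \<le> c a / (x - a)"
    using assms(1)[OF a] by (simp add: divide_inverse mult_left_mono)
qed

lemma cauchy_sum_split:
  fixes c :: "real \<Rightarrow> real"
  assumes "finite A" "a \<in> A"
  shows "(\<Sum>b\<in>A. c b / (x - b)) = c a / (x - a) + (\<Sum>b\<in>A-{a}. c b / (x - b))"
  using assms by (rule sum.remove)

lemma cauchy_sum_at_right:
  fixes c :: "real \<Rightarrow> real"
  assumes "finite A" "a \<in> A" "c a > 0"
  shows "filterlim (\<lambda>x. \<Sum>b\<in>A. c b / (x - b)) at_top (at_right a)"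
proof -
  have "((\<lambda>x. \<Sum>b\<in>A-{a}. c b / (x - b)) \<longlongrightarrow> (\<Sum>b\<in>A-{a}. c b / (a - b))) (at_right a)"
    by (intro tendsto_intros) auto
  moreover have "filterlim (\<lambda>x. c a / (x - a)) at_top (at_right a)"
  proof -
    have "filterlim (\<lambda>x. x - a) (at_right 0) (at_right a)"
      by (auto simp: filterlim_at eventually_at_right_field intro!: tendsto_eq_intros exI[of _ "a + 1"])
    then have "filterlim (\<lambda>x. inverse (x - a)) at_top (at_right a)"
      by (rule filterlim_compose[OF filterlim_inverse_at_top_right])
    from filterlim_tendsto_pos_mult_at_top[OF tendsto_const assms(3) this]
    show ?thesis by (simp add: divide_inverse)
  qed
  ultimately show ?thesis
    unfolding cauchy_sum_split[OF assms(1,2)]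
    by (subst add.commute) (rule filterlim_tendsto_add_at_top)
qed

text \<open>Reflecting the poles turns the behaviour to the left of a pole, and the sets where the
  sum is very negative, into the cases treated to the right and for large values.\<close>

lemma cauchy_sum_reflect:
  fixes c :: "real \<Rightarrow> real"
  shows "(\<Sum>b\<in>uminus ` A. c (- b) / (- x - b)) = - (\<Sum>b\<in>A. c b / (x - b))"
proof -
  have "(\<Sum>b\<in>uminus ` A. c (- b) / (- x - b)) = (\<Sum>b\<in>A. c b / (- x + b))"
    by (subst sum.reindex) (auto simp: inj_on_def)
  also have "\<dots> = (\<Sum>b\<in>A. - (c b / (x - b)))"
    by (intro sum.cong refl) (simp add: minus_divide_right)
  finally show ?thesis by (simp add: sum_negf)
qed

text \<open>To the right of its pole the sum comes down from \<infinity>. Before the next pole it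
  goes to -\<infinity>, and after the last pole it tends to 0, so by continuity it passes the level
  \<open>l\<close> before meeting another pole.\<close>

lemma level_point_exists:
  fixes c :: "real \<Rightarrow> real"
  assumes A: "finite A" "a \<in> A" and c: "\<And>a. a \<in> A \<Longrightarrow> c a > 0" and l: "l > 0"
  shows "\<exists>r>a. r \<notin> A \<and> A \<inter> {a<..r} = {} \<and> (\<Sum>b\<in>A. c b / (r - b)) = l"
proof -
  let ?g = "\<lambda>x. \<Sum>b\<in>A. c b / (x - b)"
  have ev1: "\<exists>b>a. \<forall>y>a. y < b \<longrightarrow> ?g y > l"
    using cauchy_sum_at_right[of A a c] A c[OF A(2)]
    unfolding filterlim_at_top_dense eventually_at_right_field by blast
  obtain y where y: "y > a" "A \<inter> {a<..y} = {}" "?g y < l"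
  proof (cases "A \<inter> {a<..} = {}")
    case True
    have "filterlim (\<lambda>x. x - b) at_top at_top" for b :: real
      using filterlim_tendsto_add_at_top[OF tendsto_const filterlim_ident, of "- b"] by simp
    then have "((\<lambda>x. \<Sum>b\<in>A. c b / (x - b)) \<longlongrightarrow> (\<Sum>b\<in>A. 0)) at_top"
      by (intro tendsto_sum real_tendsto_divide_at_top[OF tendsto_const])
    then have "eventually (\<lambda>x. ?g x < l) at_top"
      using l by (auto dest: order_tendstoD)
    moreover have "eventually (\<lambda>x. x > a) at_top" by (rule eventually_gt_at_top)
    ultimately obtain y where y: "?g y < l" "y > a"
      by (metis (mono_tags, lifting) eventually_conj eventually_happens trivial_limit_at_top_linorder)
    have "A \<inter> {a<..y} = {}" using True by auto
    then show ?thesis using y by (intro that)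
  next
    case False
    define b where "b = Min (A \<inter> {a<..})"
    have "finite (A \<inter> {a<..})" using A(1) by simp
    from Min_in[OF this False] have b12: "b \<in> A" "a < b" unfolding b_def by auto
    have b3: "b \<le> z" if "z \<in> A" "z > a" for z
      unfolding b_def using A(1) that by (intro Min_le) auto
    note b = b12 b3
    let ?g' = "\<lambda>x. \<Sum>b\<in>uminus ` A. c (- b) / (x - b)"
    have "filterlim ?g' at_top (at_right (- b))"
      using A b c by (intro cauchy_sum_at_right) auto
    then have "\<exists>e>-b. \<forall>y>-b. y < e \<longrightarrow> ?g' y > 0"
      unfolding filterlim_at_top_dense eventually_at_right_field by blast
    then obtain e where e: "e > -b" "\<And>y. y > -b \<Longrightarrow> y < e \<Longrightarrow> ?g' y > 0" by blast
    obtain y where y: "max a (- e) < y" "y < b"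
      using dense[of "max a (-e)" b] b(2) e(1) by auto
    have "?g' (- y) > 0" using y by (intro e(2)) auto
    then have "?g y < l" using cauchy_sum_reflect[where c = c and A = A and x = y] l by linarith
    moreover have "A \<inter> {a<..y} = {}" using b3 y by fastforce
    moreover have "y > a" using y by simp
    ultimately show ?thesis by (intro that)
  qed
  obtain b where b: "b > a" "\<And>y. y > a \<Longrightarrow> y < b \<Longrightarrow> ?g y > l" using ev1 by blast
  obtain x where x: "a < x" "x < min b y" using dense[of a "min b y"] b y by auto
  have noA: "A \<inter> {x..y} = {}" using y x by auto
  have cont: "continuous_on {x..y} ?g"
    using noA by (intro continuous_intros) auto
  have "\<exists>r. x \<le> r \<and> r \<le> y \<and> ?g r = l"
    using IVT2'[of ?g y l x] b x y cont by (simp add: less_imp_le)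
  then obtain r where r: "x \<le> r" "r \<le> y" "?g r = l" by blast
  then show ?thesis using x y by (intro exI[of _ r]) (auto simp: disjoint_iff)
qed

text \<open>Between consecutive poles the sum decreases, so the set where it exceeds
  \<open>l\<close> is covered by the intervals that lead from a pole to its level point. Their total
  length is the left-hand side of \<open>sum_level_points\<close>.\<close>

lemma boole_upper:
  fixes c :: "real \<Rightarrow> real"
  assumes A: "finite A" and c: "\<And>a. a \<in> A \<Longrightarrow> c a > 0" and l: "l > 0"
  shows "emeasure lborel {x. l < (\<Sum>a\<in>A. c a / (x - a))} \<le> ennreal (sum c A / l)"
proof (cases "A = {}")
  case True
  then show ?thesis using l by simp
next
  case False
  let ?g = "\<lambda>x. \<Sum>b\<in>A. c b / (x - b)"
  have "\<exists>r. \<forall>a\<in>A. r a > a \<and> r a \<notin> A \<and> A \<inter> {a<..r a} = {} \<and> ?g (r a) = l"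
    by (intro bchoice ballI) (rule level_point_exists[OF A _ c l])
  then obtain r where r: "\<And>a. a \<in> A \<Longrightarrow> r a > a" "\<And>a. a \<in> A \<Longrightarrow> r a \<notin> A"
    "\<And>a. a \<in> A \<Longrightarrow> A \<inter> {a<..r a} = {}" "\<And>a. a \<in> A \<Longrightarrow> ?g (r a) = l" by blast
  have lt: "r a < r b" if "a \<in> A" "b \<in> A" "a < b" for a b
  proof -
    have "\<not> b \<le> r a" using r(3)[OF that(1)] that by auto
    then show ?thesis using r(1)[OF that(2)] by linarith
  qed
  have inj: "inj_on r A"
  proof (rule inj_onI)
    fix a b assume "a \<in> A" "b \<in> A" "r a = r b"
    then show "a = b" using lt[of a b] lt[of b a] by (cases a b rule: linorder_cases) auto
  qed
  have "{x. l < ?g x} \<subseteq> (\<Union>a\<in>A. {a..r a})"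
  proof (rule subsetI, goal_cases)
    case (1 x)
    then have gx: "?g x > l" by simp
    show ?case
    proof (cases "x \<in> A")
      \<comment> \<open>At a pole its own term is \<open>0\<close> by the convention for division by
        zero, so the value of the sum there carries no information; the closed intervals contain the
        poles in any case.\<close>
      case True
      then show ?thesis using r(1) by (auto intro!: bexI[of _ x] less_imp_le)
    next
      case False
      have "\<exists>a\<in>A. a < x"
      proof (rule ccontr)
        assume "\<not> ?thesis"
        then have "?g x \<le> 0"
          using c by (intro sum_nonpos divide_nonneg_nonpos) (auto simp: less_imp_le)
        then show False using gx l by simp
      qed
      \<comment> \<open>The nearest pole to the left of \<open>x\<close>. Between its level point
        and \<open>x\<close> there is no pole, so beyond the level point the sum could not exceed
        \<open>l\<close> again.\<close>
      define a where "a = Max (A \<inter> {..<x})"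
      have ne: "A \<inter> {..<x} \<noteq> {}" using \<open>\<exists>a\<in>A. a < x\<close> by auto
      have a: "a \<in> A" "a < x" using Max_in[OF _ ne] A unfolding a_def by auto
      have a': "z \<le> a" if "z \<in> A" "z < x" for z
        unfolding a_def using A that by (intro Max_ge) auto
      have "x \<le> r a"
      proof (rule ccontr)
        assume "\<not> ?thesis"
        then have "r a \<le> x" by simp
        moreover have "A \<inter> {r a..x} = {}"
        proof -
          have "z \<notin> {r a..x}" if "z \<in> A" for z
            using a'[OF that] r(1)[OF a(1)] False that by (cases "z = x") force+
          then show ?thesis by auto
        qed
        ultimately have "?g x \<le> ?g (r a)"
          using c by (intro cauchy_sum_antimono) (auto simp: less_imp_le)
        then show False using r(4)[OF a(1)] gx by simp
      qed
      then show ?thesis using a by (intro UN_I[of a]) auto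
    qed
  qed
  then have "emeasure lborel {x. l < ?g x} \<le> emeasure lborel (\<Union>a\<in>A. {a..r a})"
    using A by (intro emeasure_mono) auto
  also have "\<dots> \<le> (\<Sum>a\<in>A. emeasure lborel {a..r a})"
    by (intro emeasure_subadditive_finite A) auto
  also have "\<dots> = (\<Sum>a\<in>A. ennreal (r a - a))"
    using r(1) by (intro sum.cong) (auto simp: less_imp_le)
  also have "\<dots> = ennreal (\<Sum>a\<in>A. r a - a)"
    using r(1) by (intro sum_ennreal) (auto simp: less_imp_le)
  also have "(\<Sum>a\<in>A. r a - a) = sum c A / l"
    by (intro sum_level_points A False l inj r)
  finally show ?thesis .
qed

text \<open>A pole of weight 0 has no level point and must be discarded before the count.\<close>

lemma boole_upper_nonneg:
  fixes c :: "real \<Rightarrow> real"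
  assumes A: "finite A" and c: "\<And>a. a \<in> A \<Longrightarrow> c a \<ge> 0" and l: "l > 0"
  shows "emeasure lborel {x. l < (\<Sum>a\<in>A. c a / (x - a))} \<le> ennreal (sum c A / l)"
proof -
  let ?A = "{a\<in>A. c a > 0}"
  have 0: "c a = 0" if "a \<in> A - ?A" for a using c that by force
  have 1: "(\<Sum>a\<in>A. c a / (x - a)) = (\<Sum>a\<in>?A. c a / (x - a))" for x
    using 0 A by (intro sum.mono_neutral_right ballI) auto
  have 2: "sum c A = sum c ?A"
    using 0 A by (intro sum.mono_neutral_right ballI) auto
  show ?thesis unfolding 1 2 using A l by (intro boole_upper) auto
qed

lemma boole_lower_nonneg:
  fixes c :: "real \<Rightarrow> real"
  assumes A: "finite A" and c: "\<And>a. a \<in> A \<Longrightarrow> c a \<ge> 0" and l: "l > 0"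
  shows "emeasure lborel {x. (\<Sum>a\<in>A. c a / (x - a)) < - l} \<le> ennreal (sum c A / l)"
proof -
  let ?g = "\<lambda>x. \<Sum>a\<in>A. c a / (x - a)"
  let ?h = "\<lambda>x. \<Sum>a\<in>uminus ` A. c (- a) / (x - a)"
  have "emeasure lborel {x. ?g x < - l} = emeasure (distr lborel borel uminus) {x. ?g x < - l}"
    by (simp add: lborel_distr_uminus)
  also have "\<dots> = emeasure lborel (uminus -` {x. ?g x < - l})"
    by (subst emeasure_distr) auto
  also have "uminus -` {x. ?g x < - l} = {x. l < ?h x}"
  proof -
    have "?h x = - ?g (- x)" for x using cauchy_sum_reflect[where c = c and A = A and x = "- x"] by simp
    then show ?thesis by (simp add: less_minus_iff vimage_def)
  qed
  also have "emeasure lborel {x. l < ?h x} \<le> ennreal (sum (\<lambda>a. c (- a)) (uminus ` A) / l)"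
    using assms by (intro boole_upper_nonneg) auto
  also have "sum (\<lambda>a. c (- a)) (uminus ` A) = sum c A"
    by (subst sum.reindex) (auto simp: inj_on_def)
  finally show ?thesis .
qed

section \<open>Maximal truncations of a sum of simple poles\<close>

definition trunc_kernel :: "real \<Rightarrow> real \<Rightarrow> real" where
  "trunc_kernel e y = (if e < \<bar>y\<bar> then 1 / y else 0)"

text \<open>Loomis' argument: on the left half of a ball around \<open>x\<close> whose poles have been removed the
  remaining sum is larger than at \<open>x\<close>, so the full sum can only be small there where the sum over
  the poles in the ball is very negative. Disjointness of the balls makes the errors add up.\<close>

lemma loomis_upper:
  fixes c :: "real \<Rightarrow> real"
  assumes A: "finite A" and c: "\<And>a. a \<in> A \<Longrightarrow> c a \<ge> 0" and M: "M > 0"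
    and E: "finite E" "\<And>e. e \<in> E \<Longrightarrow> e > 0"
  shows "emeasure lborel {x. \<exists>e\<in>E. M < (\<Sum>a\<in>A. c a * trunc_kernel e (x - a))}
    \<le> ennreal (40 * sum c A / M)"
proof -
  let ?B = "{x. \<exists>e\<in>E. M < (\<Sum>a\<in>A. c a * trunc_kernel e (x - a))}"
  let ?G = "{x. M / 2 < (\<Sum>a\<in>A. c a / (x - a))}"
  have "\<exists>e. \<forall>x\<in>?B. e x \<in> E \<and> M < (\<Sum>a\<in>A. c a * trunc_kernel (e x) (x - a))"
    by (intro bchoice ballI) blast
  then obtain e where e: "\<And>x. x \<in> ?B \<Longrightarrow> e x \<in> E"
    "\<And>x. x \<in> ?B \<Longrightarrow> M < (\<Sum>a\<in>A. c a * trunc_kernel (e x) (x - a))" by blast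
  have epos: "e x > 0" if "x \<in> ?B" for x using e(1)[OF that] E(2) by auto
  have "\<exists>m. \<forall>x\<in>?B. e x \<le> m"
    using e(1) E(1) by (intro exI[of _ "Max E"]) auto
  then obtain m where m: "\<And>x. x \<in> ?B \<Longrightarrow> e x \<le> m" by blast
  have cov: "?B \<subseteq> (\<Union>x\<in>?B. cball x (e x))" 
  proof
    fix x assume "x \<in> ?B"
    then show "x \<in> (\<Union>x\<in>?B. cball x (e x))"
      using epos[of x] by (intro UN_I[of x]) auto
  qed
  \<comment> \<open>The radii are truncation parameters from the finite set \<open>E\<close>, hence
    bounded as Vitali's lemma requires. Passing to disjoint balls costs the factor 5 in the
    radius.\<close>
  obtain C where C: "countable C" "C \<subseteq> ?B"
     "pairwise (\<lambda>i j. disjnt (cball i (e i)) (cball j (e j))) C"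
     "?B \<subseteq> (\<Union>i\<in>C. cball i (5 * e i))"
    by (rule Vitali_covering_lemma_cballs[where a = "\<lambda>x. x" and r = e and K = ?B and B = m, OF cov])
      (use epos m in auto)
  have dj: "disjoint_family_on (\<lambda>i. cball i (e i)) C"
    using C(3) by (auto simp: disjoint_family_on_def pairwise_def disjnt_def)
  have loc: "ennreal (e x) \<le> emeasure lborel (?G \<inter> cball x (e x)) + ennreal (2 / M) * ennreal (sum c (A \<inter> cball x (e x)))"
    if x: "x \<in> C" for x
  proof -
    have xB: "x \<in> ?B" using x C by auto
    let ?O = "{a\<in>A. e x < \<bar>x - a\<bar>}" and ?N = "A \<inter> cball x (e x)"
    let ?H = "{y. (\<Sum>a\<in>?N. c a / (y - a)) < - (M / 2)}"
    have sp: "A = ?O \<union> ?N" "?O \<inter> ?N = {}" by (auto simp: dist_real_def)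
    have o: "(\<Sum>a\<in>A. c a * trunc_kernel (e x) (x - a)) = (\<Sum>a\<in>?O. c a / (x - a))"
      using A by (intro sum.mono_neutral_cong_right) (auto simp: trunc_kernel_def)
    have "{x - e x..x} \<subseteq> (?G \<inter> cball x (e x)) \<union> ?H"
    proof
      fix y assume y: "y \<in> {x - e x..x}"
      have "(\<Sum>a\<in>?O. c a / (x - a)) \<le> (\<Sum>a\<in>?O. c a / (y - a))"
        using y c by (intro cauchy_sum_antimono) auto
      then have "M < (\<Sum>a\<in>?O. c a / (y - a))" using e(2)[OF xB] o by simp
      moreover have "(\<Sum>a\<in>A. c a / (y - a)) = (\<Sum>a\<in>?O. c a / (y - a)) + (\<Sum>a\<in>?N. c a / (y - a))"
        by (subst sp(1), rule sum.union_disjoint) (use A sp in auto)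
      moreover have "y \<in> cball x (e x)" using y by (auto simp: dist_real_def)
      ultimately show "y \<in> (?G \<inter> cball x (e x)) \<union> ?H" by (simp add: field_simps) linarith
    qed
    then have "emeasure lborel {x - e x..x} \<le> emeasure lborel ((?G \<inter> cball x (e x)) \<union> ?H)"
      by (intro emeasure_mono) measurable
    also have "\<dots> \<le> emeasure lborel (?G \<inter> cball x (e x)) + emeasure lborel ?H"
      by (intro emeasure_subadditive) measurable
    also have "emeasure lborel ?H \<le> ennreal (sum c ?N / (M / 2))"
      using A c M by (intro boole_lower_nonneg) auto
    also have "ennreal (sum c ?N / (M / 2)) = ennreal (2 / M) * ennreal (sum c ?N)"
      using M c by (subst ennreal_mult[symmetric]) (auto intro!: sum_nonneg simp: mult.commute)
    finally show ?thesis using epos[OF xB] by (simp add: add_left_mono)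
  qed
  have "(\<integral>\<^sup>+i. emeasure lborel (?G \<inter> cball i (e i)) \<partial>count_space C)
    = emeasure lborel (\<Union>i\<in>C. ?G \<inter> cball i (e i))"
  proof (intro emeasure_UN_countable[symmetric] C(1))
    show "disjoint_family_on (\<lambda>i. ?G \<inter> cball i (e i)) C"
      using dj unfolding disjoint_family_on_def by blast
  qed measurable
  also have "\<dots> \<le> emeasure lborel ?G"
    using C(1) by (intro emeasure_mono) auto
  also have "\<dots> \<le> ennreal (sum c A / (M / 2))"
    using A c M by (intro boole_upper_nonneg) auto
  finally have b1: "(\<integral>\<^sup>+i. emeasure lborel (?G \<inter> cball i (e i)) \<partial>count_space C) \<le> ennreal (sum c A / (M / 2))" .
  have "(\<integral>\<^sup>+i. ennreal (sum c (A \<inter> cball i (e i))) \<partial>count_space C)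
    = (\<integral>\<^sup>+i. emeasure (point_measure A (\<lambda>a. ennreal (c a))) (A \<inter> cball i (e i)) \<partial>count_space C)"
    using A c by (intro nn_integral_cong) (subst emeasure_point_measure_finite, auto intro!: sum_ennreal[symmetric])
  also have "\<dots> = emeasure (point_measure A (\<lambda>a. ennreal (c a))) (\<Union>i\<in>C. A \<inter> cball i (e i))"
  proof (intro emeasure_UN_countable[symmetric] C(1))
    show "disjoint_family_on (\<lambda>i. A \<inter> cball i (e i)) C"
      using dj unfolding disjoint_family_on_def by blast
  qed (simp add: sets_point_measure)
  also have "\<dots> \<le> emeasure (point_measure A (\<lambda>a. ennreal (c a))) A"
    by (intro emeasure_mono) (auto simp: sets_point_measure)
  also have "\<dots> = ennreal (sum c A)"
    using A c by (simp add: emeasure_point_measure_finite sum_ennreal)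
  finally have b2: "(\<integral>\<^sup>+i. ennreal (sum c (A \<inter> cball i (e i))) \<partial>count_space C) \<le> ennreal (sum c A)" .
  have "emeasure lborel ?B \<le> emeasure lborel (\<Union>i\<in>C. cball i (5 * e i))"
    using C by (intro emeasure_mono sets.countable_UN'') auto
  also have "\<dots> = (\<integral>\<^sup>+y. indicator (\<Union>i\<in>C. cball i (5 * e i)) y \<partial>lborel)"
    using C(1) by (subst nn_integral_indicator) (auto intro!: sets.countable_UN'')
  also have "\<dots> \<le> (\<integral>\<^sup>+y. \<integral>\<^sup>+i. indicator (cball i (5 * e i)) y \<partial>count_space C \<partial>lborel)"
  proof (intro nn_integral_mono)
    fix y
    show "indicator (\<Union>i\<in>C. cball i (5 * e i)) y \<le> (\<integral>\<^sup>+i. indicator (cball i (5 * e i)) y \<partial>count_space C)"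
    proof (cases "y \<in> (\<Union>i\<in>C. cball i (5 * e i))")
      case True
      then obtain j where j: "j \<in> C" "y \<in> cball j (5 * e j)" by auto
      have "(1::ennreal) = (\<integral>\<^sup>+i. indicator {j} i \<partial>count_space C)"
        using j by (simp add: nn_integral_indicator)
      also have "\<dots> \<le> (\<integral>\<^sup>+i. indicator (cball i (5 * e i)) y \<partial>count_space C)"
        using j by (intro nn_integral_mono) (auto simp: indicator_def)
      finally show ?thesis using True by simp
    qed simp
  qed
  also have "\<dots> = (\<integral>\<^sup>+i. \<integral>\<^sup>+y. indicator (cball i (5 * e i)) y \<partial>lborel \<partial>count_space C)"
    by (intro nn_integral_count_space_nn_integral C borel_measurable_indicator) auto
  also have "\<dots> = (\<integral>\<^sup>+i. 10 * ennreal (e i) \<partial>count_space C)"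
  proof (intro nn_integral_cong, goal_cases)
    case (1 i)
    then have "e i > 0" using C epos by auto
    moreover have "cball i (5 * e i) = {i - 5 * e i..i + 5 * e i}" by (auto simp: dist_real_def)
    ultimately have "(\<integral>\<^sup>+y. indicator (cball i (5 * e i)) y \<partial>lborel) = ennreal (10 * e i)" by simp
    then show ?case using \<open>e i > 0\<close> by (simp add: ennreal_mult)
  qed
  also have "\<dots> \<le> (\<integral>\<^sup>+i. 10 * (emeasure lborel (?G \<inter> cball i (e i)) + ennreal (2 / M) * ennreal (sum c (A \<inter> cball i (e i)))) \<partial>count_space C)"
    using loc by (intro nn_integral_mono mult_left_mono) auto
  also have "\<dots> = 10 * ((\<integral>\<^sup>+i. emeasure lborel (?G \<inter> cball i (e i)) \<partial>count_space C)
     + ennreal (2 / M) * (\<integral>\<^sup>+i. ennreal (sum c (A \<inter> cball i (e i))) \<partial>count_space C))"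
    by (simp add: nn_integral_cmult nn_integral_add)
  also have "\<dots> \<le> 10 * (ennreal (sum c A / (M / 2)) + ennreal (2 / M) * ennreal (sum c A))"
    using b1 b2 by (intro mult_left_mono add_mono) auto
  \<comment> \<open>The origin of 40: a dilated ball has length \<open>10 * e i\<close>, and the
    full sum and the poles inside the balls each contribute \<open>2 * sum c A / M\<close>.\<close>
  also have "10 * (ennreal (sum c A / (M / 2)) + ennreal (2 / M) * ennreal (sum c A)) = ennreal (40 * sum c A / M)"
  proof -
    let ?s = "sum c A"
    have s: "?s \<ge> 0" using c by (intro sum_nonneg) auto
    have "ennreal (?s / (M / 2)) + ennreal (2 / M) * ennreal ?s = ennreal (?s / (M / 2) + 2 / M * ?s)"
      using s M by (subst ennreal_plus) (auto simp: ennreal_mult[of "2 / M" ?s, symmetric])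
    moreover have "10 * ennreal z = ennreal (10 * z)" if "z \<ge> 0" for z
      using that by (simp add: ennreal_mult')
    moreover have "10 * (?s / (M / 2) + 2 / M * ?s) = 40 * ?s / M" using M by (simp add: field_simps)
    moreover have "?s / (M / 2) + 2 / M * ?s \<ge> 0" using s M by simp
    ultimately show ?thesis by metis
  qed
  finally show ?thesis .
qed

lemma trunc_kernel_uminus: "trunc_kernel e (- y) = - trunc_kernel e y"
  by (simp add: trunc_kernel_def)

lemma trunc_kernel_measurable [measurable]:
  "(\<lambda>x. trunc_kernel (f x) (g x)) \<in> borel_measurable M" 
  if [measurable]: "f \<in> borel_measurable M" "g \<in> borel_measurable M"
  unfolding trunc_kernel_def by measurable

lemma trunc_kernel_bound: "e > 0 \<Longrightarrow> \<bar>trunc_kernel e y\<bar> \<le> 1 / e"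
  by (auto simp: trunc_kernel_def field_simps)

lemma mult_trunc_kernel_bound:
  assumes "e > 0"
  shows "\<bar>f\<bar> * \<bar>trunc_kernel e y\<bar> \<le> \<bar>f\<bar> / e"
  using mult_left_mono[OF trunc_kernel_bound[OF assms, of y], of "\<bar>f\<bar>"] by simp

lemma loomis_maximal_sum:
  fixes c :: "real \<Rightarrow> real"
  assumes A: "finite A" and c: "\<And>a. a \<in> A \<Longrightarrow> c a \<ge> 0" and M: "M > 0"
    and E: "finite E" "\<And>e. e \<in> E \<Longrightarrow> e > 0"
  shows "emeasure lborel {x. \<exists>e\<in>E. M < \<bar>\<Sum>a\<in>A. c a * trunc_kernel e (x - a)\<bar>}
    \<le> ennreal (80 * sum c A / M)"
proof -
  let ?g = "\<lambda>e x. \<Sum>a\<in>A. c a * trunc_kernel e (x - a)"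
  let ?h = "\<lambda>e x. \<Sum>a\<in>uminus ` A. c (- a) * trunc_kernel e (x - a)"
  have refl: "?h e x = - ?g e (- x)" for e x
  proof -
    have "?h e x = (\<Sum>a\<in>A. c a * trunc_kernel e (- (- x - a)))"
      by (subst sum.reindex) (auto simp: inj_on_def algebra_simps)
    then show ?thesis unfolding trunc_kernel_uminus by (simp add: sum_negf)
  qed
  let ?L = "{x. \<exists>e\<in>E. M < ?h e x}" and ?U = "{x. \<exists>e\<in>E. M < ?g e x}"
  have [measurable]: "{x. \<exists>e\<in>E. M < ?h e x} \<in> sets borel" "{x. \<exists>e\<in>E. M < ?g e x} \<in> sets borel"
    using E(1) by measurable
  have [measurable]: "uminus -` ?L \<in> sets borel"
    by (rule measurable_sets_borel[of uminus borel]) auto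
  have "{x. \<exists>e\<in>E. M < \<bar>?g e x\<bar>} \<subseteq> ?U \<union> uminus -` ?L"
    unfolding refl by (auto simp: abs_if split: if_splits)
  then have "emeasure lborel {x. \<exists>e\<in>E. M < \<bar>?g e x\<bar>} \<le> emeasure lborel (?U \<union> uminus -` ?L)"
    by (rule emeasure_mono) measurable
  also have "\<dots> \<le> emeasure lborel ?U + emeasure lborel (uminus -` ?L)"
    by (rule emeasure_subadditive) measurable
  also have "emeasure lborel (uminus -` ?L) = emeasure (distr lborel borel uminus) ?L"
    by (subst emeasure_distr) auto
  also have "\<dots> = emeasure lborel ?L"
    by (simp add: lborel_distr_uminus)
  also have "\<dots> \<le> ennreal (40 * sum (\<lambda>a. c (- a)) (uminus ` A) / M)"
    using assms by (intro loomis_upper) auto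
  also have "sum (\<lambda>a. c (- a)) (uminus ` A) = sum c A"
    by (subst sum.reindex) (auto simp: inj_on_def)
  also have "emeasure lborel ?U \<le> ennreal (40 * sum c A / M)"
    using assms by (intro loomis_upper) auto
  also have "ennreal (40 * sum c A / M) + ennreal (40 * sum c A / M) = ennreal (80 * sum c A / M)"
    using M sum_nonneg[of A c] c by (subst ennreal_plus[symmetric]) auto
  finally show ?thesis by (simp add: add_mono)
qed

section \<open>From sums of poles to integrals\<close>

definition trunc_hilbert :: "real \<Rightarrow> (real \<Rightarrow> real) \<Rightarrow> real \<Rightarrow> real" where
  "trunc_hilbert e f x = (LBINT s. f s * trunc_kernel e (x - s))"

lemma trunc_hilbert_measurable [measurable]:
  assumes [measurable]: "f \<in> borel_measurable borel" "g \<in> borel_measurable M" "h \<in> borel_measurable M"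
  shows "(\<lambda>x. trunc_hilbert (g x) f (h x)) \<in> borel_measurable M"
  unfolding trunc_hilbert_def by measurable

lemma trunc_hilbert_integrable:
  assumes "integrable lborel f" "e > 0"
  shows "integrable lborel (\<lambda>s. f s * trunc_kernel e (x - s))"
proof (rule Bochner_Integration.integrable_bound[of _ "\<lambda>s. f s * (1 / e)"])
  have [measurable]: "f \<in> borel_measurable borel" using assms(1) by auto
  show "(\<lambda>s. f s * trunc_kernel e (x - s)) \<in> borel_measurable lborel" by measurable
  show "AE s in lborel. norm (f s * trunc_kernel e (x - s)) \<le> norm (f s * (1 / e))"
    using mult_trunc_kernel_bound[OF assms(2)] assms(2)
    by (intro AE_I2) (auto simp: abs_mult)
qed (use assms in auto)

lemma trunc_kernel_tendsto:
  assumes "X \<longlonglongrightarrow> y" "\<bar>y\<bar> \<noteq> e" "e > 0"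
  shows "(\<lambda>n. trunc_kernel e (X n)) \<longlonglongrightarrow> trunc_kernel e y"
proof (cases "e < \<bar>y\<bar>")
  case True
  have "\<forall>\<^sub>F n in sequentially. e < \<bar>X n\<bar>"
    using order_tendstoD(1)[OF tendsto_rabs[OF assms(1)] True] .
  then have "\<forall>\<^sub>F n in sequentially. 1 / X n = trunc_kernel e (X n)"
    by eventually_elim (simp add: trunc_kernel_def)
  moreover have "(\<lambda>n. 1 / X n) \<longlonglongrightarrow> 1 / y"
    using True assms by (intro tendsto_intros) auto
  ultimately show ?thesis using True by (subst (asm) tendsto_cong) (auto simp: trunc_kernel_def)
next
  case False
  then have "\<bar>y\<bar> < e" using assms by simp
  have "\<forall>\<^sub>F n in sequentially. \<bar>X n\<bar> < e"
    using order_tendstoD(2)[OF tendsto_rabs[OF assms(1)] \<open>\<bar>y\<bar> < e\<close>] .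
  then have "\<forall>\<^sub>F n in sequentially. 0 = trunc_kernel e (X n)"
    by eventually_elim (simp add: trunc_kernel_def)
  then have "(\<lambda>n. trunc_kernel e (X n)) \<longlonglongrightarrow> 0"
    by (rule Lim_transform_eventually[OF tendsto_const])
  then show ?thesis using False by (simp add: trunc_kernel_def)
qed

definition dyadic_floor :: "nat \<Rightarrow> real \<Rightarrow> real" where
  "dyadic_floor n s = \<lfloor>2 ^ n * s\<rfloor> / 2 ^ n"

text \<open>With step \<open>1 / 2 ^ n\<close> the indices up to \<open>4 ^ n\<close> reach from
  \<open>- (2 ^ n)\<close> to \<open>2 ^ n\<close>, so the grid becomes fine and exhausts the line
  at the same time.\<close>

definition dyadic_grid :: "nat \<Rightarrow> real set" where
  "dyadic_grid n = (\<lambda>k. real_of_int k / 2 ^ n) ` {- (4 ^ n)..4 ^ n}"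

lemma dyadic_floor_measurable [measurable]: "dyadic_floor n \<in> borel_measurable borel"
  unfolding dyadic_floor_def by measurable

lemma dyadic_floor_tendsto: "(\<lambda>n. dyadic_floor n s) \<longlonglongrightarrow> s"
proof (rule LIMSEQ_I)
  fix r :: real assume "r > 0"
  obtain N where N: "(1 / 2) ^ N < r" using real_arch_pow_inv[OF \<open>r > 0\<close>, of "1/2"] by auto
  have "norm (dyadic_floor n s - s) < r" if "n \<ge> N" for n
  proof -
    have "\<bar>real_of_int \<lfloor>2 ^ n * s\<rfloor> - 2 ^ n * s\<bar> \<le> 1" by linarith
    then have "\<bar>dyadic_floor n s - s\<bar> \<le> (1 / 2) ^ n"
    proof -
      have "dyadic_floor n s - s = (real_of_int \<lfloor>2 ^ n * s\<rfloor> - 2 ^ n * s) / 2 ^ n"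
        unfolding dyadic_floor_def by (simp add: diff_divide_distrib)
      then have "\<bar>dyadic_floor n s - s\<bar> = \<bar>real_of_int \<lfloor>2 ^ n * s\<rfloor> - 2 ^ n * s\<bar> / 2 ^ n"
        by (simp add: abs_divide)
      also have "\<dots> \<le> 1 / 2 ^ n" by (intro divide_right_mono) (use \<open>_ \<le> 1\<close> in auto)
      finally show ?thesis by (simp add: power_one_over)
    qed
    also have "\<dots> \<le> (1 / 2) ^ N" using that by (intro power_decreasing) auto
    finally show ?thesis using N by simp
  qed
  then show "\<exists>N. \<forall>n\<ge>N. norm (dyadic_floor n s - s) < r" by blast
qed

lemma eventually_dyadic_grid: "\<forall>\<^sub>F n in sequentially. dyadic_floor n s \<in> dyadic_grid n"
proof -
  obtain N where N: "\<bar>s\<bar> + 1 < 2 ^ N" using real_arch_pow[of 2 "\<bar>s\<bar> + 1"] by auto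
  have "dyadic_floor n s \<in> dyadic_grid n" if "n \<ge> N" for n
  proof -
    have "\<bar>s\<bar> + 1 \<le> 2 ^ n" using N power_increasing[OF that, of "2::real"] by linarith
    then have "2 ^ n * (\<bar>s\<bar> + 1) \<le> (2::real) ^ n * 2 ^ n" by (intro mult_left_mono) auto
    also have "\<dots> = 4 ^ n" by (simp add: power_mult_distrib[symmetric])
    finally have "2 ^ n * \<bar>s\<bar> + 2 ^ n \<le> (4::real) ^ n" by (simp add: distrib_left)
    moreover have "(1::real) \<le> 2 ^ n" by simp
    moreover have "\<bar>2 ^ n * s\<bar> = 2 ^ n * \<bar>s\<bar>" by (simp add: abs_mult)
    ultimately have "\<bar>2 ^ n * s\<bar> + 1 \<le> (4::real) ^ n" by linarith
    then have "real_of_int \<lfloor>2 ^ n * s\<rfloor> \<le> 4 ^ n" "- (4 ^ n) \<le> real_of_int \<lfloor>2 ^ n * s\<rfloor>" by linarith+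
    then have "real_of_int \<lfloor>2 ^ n * s\<rfloor> \<le> real_of_int (4 ^ n)"
      "real_of_int (- (4 ^ n)) \<le> real_of_int \<lfloor>2 ^ n * s\<rfloor>" by simp_all
    then have "\<lfloor>2 ^ n * s\<rfloor> \<in> {- (4 ^ n)..4 ^ n}"
      unfolding of_int_le_iff by simp
    then show ?thesis unfolding dyadic_floor_def dyadic_grid_def by auto
  qed
  then show ?thesis unfolding eventually_sequentially by blast
qed

text \<open>The mass of \<open>f\<close> in each dyadic cell is moved to the left endpoint of the
  cell. For fixed \<open>x\<close> the truncated kernel is bounded and jumps only at the two points
  at distance \<open>e\<close>, so dominated convergence applies.\<close>

lemma trunc_hilbert_discretize:
  assumes f: "integrable lborel f" and e: "e > 0"
  shows "(\<lambda>n. \<Sum>a\<in>dyadic_grid n. (LBINT s. f s * indicator {a} (dyadic_floor n s)) * trunc_kernel e (x - a))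
    \<longlonglongrightarrow> trunc_hilbert e f x"
proof -
  have [measurable]: "f \<in> borel_measurable borel" using f by auto
  let ?k = "\<lambda>n s. trunc_kernel e (x - dyadic_floor n s) * indicator (dyadic_grid n) (dyadic_floor n s)"
  have fin: "finite (dyadic_grid n)" for n by (simp add: dyadic_grid_def)
  have [measurable]: "dyadic_grid n \<in> sets borel" for n
    using fin by (intro borel_closed finite_imp_closed)
  have eq: "(\<Sum>a\<in>dyadic_grid n. (LBINT s. f s * indicator {a} (dyadic_floor n s)) * trunc_kernel e (x - a))
    = (LBINT s. f s * ?k n s)" for n
  proof -
    have i: "integrable lborel (\<lambda>s. f s * indicator {a} (dyadic_floor n s))" for a
      by (rule Bochner_Integration.integrable_bound[OF f]) (auto simp: indicator_def)
    have "(\<Sum>a\<in>dyadic_grid n. (LBINT s. f s * indicator {a} (dyadic_floor n s)) * trunc_kernel e (x - a))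
      = (LBINT s. (\<Sum>a\<in>dyadic_grid n. f s * indicator {a} (dyadic_floor n s) * trunc_kernel e (x - a)))"
      using i by (subst Bochner_Integration.integral_sum) auto
    also have "\<dots> = (LBINT s. f s * ?k n s)"
    proof (rule Bochner_Integration.integral_cong[OF refl], goal_cases)
      case (1 s)
      have "(\<Sum>a\<in>dyadic_grid n. f s * indicator {a} (dyadic_floor n s) * trunc_kernel e (x - a))
        = (\<Sum>a\<in>dyadic_grid n. if a = dyadic_floor n s then f s * trunc_kernel e (x - a) else 0)"
        by (intro sum.cong) (auto simp: indicator_def)
      then show ?case using fin by (simp add: indicator_def)
    qed
    finally show ?thesis .
  qed
  show ?thesis unfolding eq trunc_hilbert_def
  proof (rule integral_dominated_convergence[where w = "\<lambda>s. \<bar>f s\<bar> * (1 / e)"])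
    show "AE s in lborel. (\<lambda>n. f s * ?k n s) \<longlonglongrightarrow> f s * trunc_kernel e (x - s)"
    proof -
      have "AE s in lborel. s \<noteq> x - e \<and> s \<noteq> x + e"
        using AE_lborel_singleton[of "x - e"] AE_lborel_singleton[of "x + e"] by auto
      then show ?thesis
      proof eventually_elim
        case (elim s)
        then have ne: "\<bar>x - s\<bar> \<noteq> e" by auto
        have "(\<lambda>n. trunc_kernel e (x - dyadic_floor n s)) \<longlonglongrightarrow> trunc_kernel e (x - s)"
          by (intro trunc_kernel_tendsto ne e tendsto_intros dyadic_floor_tendsto)
        moreover have "\<forall>\<^sub>F n in sequentially. trunc_kernel e (x - dyadic_floor n s) = ?k n s"
          using eventually_dyadic_grid[of s] by eventually_elim simp
        ultimately have "(\<lambda>n. ?k n s) \<longlonglongrightarrow> trunc_kernel e (x - s)"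
          by (rule Lim_transform_eventually)
        then show ?case by (intro tendsto_intros)
      qed
    qed
    show "AE s in lborel. norm (f s * ?k n s) \<le> \<bar>f s\<bar> * (1 / e)" for n
      using mult_trunc_kernel_bound[OF e] e
      by (intro AE_I2) (auto simp: abs_mult indicator_def)
  qed (use f in auto)
qed

section \<open>The weak type bound on the line\<close>

text \<open>A strict inequality for the integral holds for the discretized sums from some index on.
  Fatou's lemma then transfers the bound for sums of poles, whose total weight never exceeds the
  integral of \<open>f\<close>.\<close>

lemma maximal_weak_nonneg:
  assumes f: "integrable lborel f" "\<And>s. f s \<ge> 0" and M: "M > 0"
    and E: "finite E" "\<And>e. e \<in> E \<Longrightarrow> e > 0"
  shows "emeasure lborel {x. \<exists>e\<in>E. M < \<bar>trunc_hilbert e f x\<bar>} \<le> ennreal (80 * (LBINT s. f s) / M)"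
proof -
  have [measurable]: "f \<in> borel_measurable borel" using f by auto
  let ?c = "\<lambda>n a. LBINT s. f s * indicator {a} (dyadic_floor n s)"
  let ?B = "\<lambda>n. {x. \<exists>e\<in>E. M < \<bar>\<Sum>a\<in>dyadic_grid n. ?c n a * trunc_kernel e (x - a)\<bar>}"
  let ?S = "{x. \<exists>e\<in>E. M < \<bar>trunc_hilbert e f x\<bar>}"
  have fin: "finite (dyadic_grid n)" for n by (simp add: dyadic_grid_def)
  have [measurable]: "dyadic_grid n \<in> sets borel" for n
    using fin by (intro borel_closed finite_imp_closed)
  have [measurable]: "?B n \<in> sets borel" "?S \<in> sets borel" for n
    using E(1) by measurable
  have c: "?c n a \<ge> 0" for n a using f by (intro integral_nonneg_AE) auto
  have s: "sum (?c n) (dyadic_grid n) \<le> (LBINT s. f s)" for n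
  proof -
    have i: "integrable lborel (\<lambda>s. f s * indicator {a} (dyadic_floor n s))" for a
      by (rule Bochner_Integration.integrable_bound[OF f(1)]) (auto simp: indicator_def)
    have "sum (?c n) (dyadic_grid n) = (LBINT s. (\<Sum>a\<in>dyadic_grid n. f s * indicator {a} (dyadic_floor n s)))"
      using i by (subst Bochner_Integration.integral_sum) auto
    also have "\<dots> \<le> (LBINT s. f s)"
    proof (rule integral_mono)
      fix s
      have "(\<Sum>a\<in>dyadic_grid n. f s * indicator {a} (dyadic_floor n s))
        = (\<Sum>a\<in>dyadic_grid n. if a = dyadic_floor n s then f s else 0)"
        by (intro sum.cong) (auto simp: indicator_def)
      also have "\<dots> \<le> f s" using fin f(2)[of s] by simp
      finally show "(\<Sum>a\<in>dyadic_grid n. f s * indicator {a} (dyadic_floor n s)) \<le> f s" .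
    qed (use i f in auto)
    finally show ?thesis .
  qed
  have ind: "indicator ?S x \<le> liminf (\<lambda>n. indicator (?B n) x :: ennreal)" for x
  proof (cases "x \<in> ?S")
    case True
    then obtain e where e: "e \<in> E" "M < \<bar>trunc_hilbert e f x\<bar>" by auto
    have "\<forall>\<^sub>F n in sequentially. M < \<bar>\<Sum>a\<in>dyadic_grid n. ?c n a * trunc_kernel e (x - a)\<bar>"
      using E(2)[OF e(1)] by (intro order_tendstoD(1)[OF tendsto_rabs[OF trunc_hilbert_discretize] e(2)] f)
    then have "\<forall>\<^sub>F n in sequentially. indicator ?S x \<le> (indicator (?B n) x :: ennreal)"
      by eventually_elim (use e True in \<open>auto simp: indicator_def\<close>)
    then show ?thesis by (rule Liminf_bounded)
  qed simp
  have bnd: "(\<integral>\<^sup>+x. indicator (?B n) x \<partial>lborel) \<le> ennreal (80 * (LBINT s. f s) / M)" for n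
  proof -
    have "(\<integral>\<^sup>+x. indicator (?B n) x \<partial>lborel) = emeasure lborel (?B n)" by simp
    also have "\<dots> \<le> ennreal (80 * sum (?c n) (dyadic_grid n) / M)"
      using fin c M E by (intro loomis_maximal_sum) auto
    also have "\<dots> \<le> ennreal (80 * (LBINT s. f s) / M)"
      using s[of n] M by (intro ennreal_leI divide_right_mono mult_left_mono) auto
    finally show ?thesis .
  qed
  have "emeasure lborel ?S = (\<integral>\<^sup>+x. indicator ?S x \<partial>lborel)" by simp
  also have "\<dots> \<le> (\<integral>\<^sup>+x. liminf (\<lambda>n. indicator (?B n) x) \<partial>lborel)"
    using ind by (intro nn_integral_mono)
  also have "\<dots> \<le> liminf (\<lambda>n. \<integral>\<^sup>+x. indicator (?B n) x \<partial>lborel)"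
    by (intro nn_integral_liminf) measurable
  also have "\<dots> \<le> ennreal (80 * (LBINT s. f s) / M)"
    using Liminf_le_Limsup[OF sequentially_bot] Limsup_bounded[OF always_eventually[OF allI[OF bnd]]]
    by (rule order_trans)
  finally show ?thesis .
qed

lemma trunc_hilbert_diff:
  assumes "integrable lborel (\<lambda>s. f s * trunc_kernel e (x - s))"
    and "integrable lborel (\<lambda>s. g s * trunc_kernel e (x - s))"
  shows "trunc_hilbert e (\<lambda>s. f s - g s) x = trunc_hilbert e f x - trunc_hilbert e g x"
  unfolding trunc_hilbert_def using assms
  by (simp add: left_diff_distrib)

lemma trunc_hilbert_add:
  assumes "integrable lborel (\<lambda>s. f s * trunc_kernel e (x - s))"
    and "integrable lborel (\<lambda>s. g s * trunc_kernel e (x - s))"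
  shows "trunc_hilbert e (\<lambda>s. f s + g s) x = trunc_hilbert e f x + trunc_hilbert e g x"
  unfolding trunc_hilbert_def using assms
  by (simp add: distrib_right)

text \<open>Because the inequality in \<open>trunc_kernel\<close> is strict, the kernel is right
  continuous in the truncation parameter at every point. This reduces statements about all
  truncations to rational ones.\<close>

lemma trunc_hilbert_right_continuous:
  assumes i: "integrable lborel (\<lambda>s. f s * trunc_kernel a (x - s))" and a: "a > 0"
    and [measurable]: "f \<in> borel_measurable borel"
    and X: "\<And>n. X n \<ge> e" "X \<longlonglongrightarrow> e" "e \<ge> a"
  shows "(\<lambda>n. trunc_hilbert (X n) f x) \<longlonglongrightarrow> trunc_hilbert e f x"
  unfolding trunc_hilbert_def
proof (rule integral_dominated_convergence[where w = "\<lambda>s. \<bar>f s * trunc_kernel a (x - s)\<bar>"])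
  show "AE s in lborel. (\<lambda>n. f s * trunc_kernel (X n) (x - s)) \<longlonglongrightarrow> f s * trunc_kernel e (x - s)"
  proof (intro AE_I2 tendsto_intros)
    fix s
    have "\<forall>\<^sub>F n in sequentially. trunc_kernel e (x - s) = trunc_kernel (X n) (x - s)"
    proof (cases "e < \<bar>x - s\<bar>")
      case True
      from order_tendstoD(2)[OF X(2) this] show ?thesis
        by eventually_elim (use True in \<open>auto simp: trunc_kernel_def\<close>)
    next
      case False
      have "\<not> X n < \<bar>x - s\<bar>" for n using False X(1)[of n] by linarith
      then show ?thesis using False by (simp add: trunc_kernel_def)
    qed
    then show "(\<lambda>n. trunc_kernel (X n) (x - s)) \<longlonglongrightarrow> trunc_kernel e (x - s)"
      by (rule Lim_transform_eventually[OF tendsto_const])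
  qed
  show "AE s in lborel. norm (f s * trunc_kernel (X n) (x - s)) \<le> \<bar>f s * trunc_kernel a (x - s)\<bar>" for n
  proof (intro AE_I2)
    fix s
    have "X n < \<bar>x - s\<bar> \<Longrightarrow> a < \<bar>x - s\<bar>" using X(1)[of n] X(3) by linarith
    then show "norm (f s * trunc_kernel (X n) (x - s)) \<le> \<bar>f s * trunc_kernel a (x - s)\<bar>"
      by (simp add: trunc_kernel_def)
  qed
qed (use i in auto)

lemma rational_right_approx:
  fixes e :: real
  obtains X :: "nat \<Rightarrow> rat" where "\<And>n. of_rat (X n) > e" "(\<lambda>n. of_rat (X n)) \<longlonglongrightarrow> e"
proof -
  have "\<forall>n. \<exists>q. e < of_rat q \<and> of_rat q < e + 1 / real (Suc n)"
    by (intro allI of_rat_dense) auto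
  then obtain X where X: "\<And>n. e < of_rat (X n)" "\<And>n. of_rat (X n) < e + 1 / real (Suc n)" by metis
  have "(\<lambda>n. of_rat (X n)) \<longlonglongrightarrow> e"
  proof (rule tendsto_sandwich[of "\<lambda>_. e" _ _ "\<lambda>n. e + 1 / real (Suc n)"])
    have "(\<lambda>n. e + 1 / real (Suc n)) \<longlonglongrightarrow> e + 0"
      by (intro tendsto_intros LIMSEQ_Suc[OF lim_1_over_n])
    then show "(\<lambda>n. e + 1 / real (Suc n)) \<longlonglongrightarrow> e" by simp
  qed (use X in \<open>auto intro!: always_eventually less_imp_le\<close>)
  with X(1) show ?thesis by (rule that)
qed

text \<open>Rational truncations keep the predicate measurable; right continuity in the parameter
  recovers the others.\<close>

definition max_trunc_gt :: "(real \<Rightarrow> real) \<Rightarrow> real \<Rightarrow> real \<Rightarrow> bool" where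
  "max_trunc_gt f M x \<longleftrightarrow> (\<exists>q::rat. 0 < q \<and> M < \<bar>trunc_hilbert (of_rat q) f x\<bar>)"

lemma max_trunc_gt_measurable [measurable]:
  assumes [measurable]: "f \<in> borel_measurable borel"
  shows "Measurable.pred borel (max_trunc_gt f M)"
  unfolding max_trunc_gt_def[abs_def] by measurable

lemma max_trunc_gtI:
  assumes f: "integrable lborel f" and e: "e > 0" "M < \<bar>trunc_hilbert e f x\<bar>"
  shows "max_trunc_gt f M x"
proof -
  obtain X :: "nat \<Rightarrow> rat" where X: "\<And>n. of_rat (X n) > e" "(\<lambda>n. of_rat (X n)) \<longlonglongrightarrow> e"
    using rational_right_approx[of e] by blast
  have "(\<lambda>n. trunc_hilbert (of_rat (X n)) f x) \<longlonglongrightarrow> trunc_hilbert e f x"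
    using X f e by (intro trunc_hilbert_right_continuous[of _ e] trunc_hilbert_integrable) (auto intro: less_imp_le)
  from order_tendstoD(1)[OF tendsto_rabs[OF this] e(2)]
  obtain n where "M < \<bar>trunc_hilbert (of_rat (X n)) f x\<bar>" by (auto simp: eventually_sequentially)
  moreover have "X n > 0" using X(1)[of n] e by (metis less_trans zero_less_of_rat_iff)
  ultimately show ?thesis unfolding max_trunc_gt_def by blast
qed

text \<open>The bound does not depend on the finite set of truncations, so it survives the
  increasing union over finite sets of rationals.\<close>

lemma maximal_weak_nonneg':
  assumes f: "integrable lborel f" "\<And>s. f s \<ge> 0" and M: "M > 0"
  shows "emeasure lborel {x. max_trunc_gt f M x} \<le> ennreal (80 * (LBINT s. f s) / M)"
proof -
  have [measurable]: "f \<in> borel_measurable borel" using f by auto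
  let ?Q = "\<lambda>n. real_of_rat ` {q \<in> from_nat ` {..n}. 0 < q}"
  let ?B = "\<lambda>n. {x. \<exists>e\<in>?Q n. M < \<bar>trunc_hilbert e f x\<bar>}"
  have [measurable]: "?B n \<in> sets borel" for n by measurable
  have "{x. max_trunc_gt f M x} = (\<Union>n. ?B n)"
  proof (intro equalityI subsetI)
    fix x assume "x \<in> {x. max_trunc_gt f M x}"
    then obtain q :: rat where q: "0 < q" "M < \<bar>trunc_hilbert (of_rat q) f x\<bar>"
      by (auto simp: max_trunc_gt_def)
    have "q \<in> from_nat ` {..to_nat q}" by (intro image_eqI[of _ _ "to_nat q"]) auto
    then have "x \<in> ?B (to_nat q)" using q by auto
    then show "x \<in> (\<Union>n. ?B n)" by blast
  qed (auto simp: max_trunc_gt_def)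
  moreover have "(SUP n. emeasure lborel (?B n)) = emeasure lborel (\<Union>n. ?B n)"
  proof (intro SUP_emeasure_incseq)
    show "incseq ?B"
    proof (rule incseq_SucI)
      fix n
      have "?Q n \<subseteq> ?Q (Suc n)" by auto
      then show "?B n \<subseteq> ?B (Suc n)" by blast
    qed
  qed auto
  moreover have "(SUP n. emeasure lborel (?B n)) \<le> ennreal (80 * (LBINT s. f s) / M)"
    by (intro SUP_least maximal_weak_nonneg f M) auto
  ultimately show ?thesis by simp
qed

lemma maximal_weak:
  assumes f: "integrable lborel f" and M: "M > 0"
  shows "emeasure lborel {x. max_trunc_gt f M x} \<le> ennreal (160 * (LBINT s. \<bar>f s\<bar>) / M)"
proof -
  have [measurable]: "f \<in> borel_measurable borel" using f by auto
  let ?p = "\<lambda>s. max 0 (f s)" and ?n = "\<lambda>s. max 0 (- f s)"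
  have i: "integrable lborel ?p" "integrable lborel ?n" using f by auto
  have sp: "f = (\<lambda>s. ?p s - ?n s)" by auto
  \<comment> \<open>One of the two parts must exceed half the level, which doubles the constant to
    160; the integrals of the two parts add up to that of \<open>\<bar>f s\<bar>\<close>.\<close>
  have "{x. max_trunc_gt f M x} \<subseteq> {x. max_trunc_gt ?p (M/2) x} \<union> {x. max_trunc_gt ?n (M/2) x}"
  proof (rule subsetI)
    fix x assume "x \<in> {x. max_trunc_gt f M x}"
    then obtain q :: rat where q: "q > 0" "M < \<bar>trunc_hilbert (of_rat q) f x\<bar>" by (auto simp: max_trunc_gt_def)
    define e where "e = real_of_rat q"
    have e: "e > 0" "M < \<bar>trunc_hilbert e f x\<bar>" using q by (auto simp: e_def)
    have "trunc_hilbert e f x = trunc_hilbert e ?p x - trunc_hilbert e ?n x"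
      by (subst sp, rule trunc_hilbert_diff) (use trunc_hilbert_integrable i e in auto)
    then have "M / 2 < \<bar>trunc_hilbert e ?p x\<bar> \<or> M / 2 < \<bar>trunc_hilbert e ?n x\<bar>"
      using e(2) by linarith
    then show "x \<in> {x. max_trunc_gt ?p (M/2) x} \<union> {x. max_trunc_gt ?n (M/2) x}"
      using q(1) by (auto simp: max_trunc_gt_def e_def)
  qed
  then have "emeasure lborel {x. max_trunc_gt f M x}
    \<le> emeasure lborel ({x. max_trunc_gt ?p (M/2) x} \<union> {x. max_trunc_gt ?n (M/2) x})"
    by (intro emeasure_mono) measurable
  also have "\<dots> \<le> emeasure lborel {x. max_trunc_gt ?p (M/2) x} + emeasure lborel {x. max_trunc_gt ?n (M/2) x}"
    by (intro emeasure_subadditive) measurable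
  also have "\<dots> \<le> ennreal (80 * (LBINT s. ?p s) / (M/2)) + ennreal (80 * (LBINT s. ?n s) / (M/2))"
    using i M by (intro add_mono maximal_weak_nonneg') auto
  also have "\<dots> = ennreal (160 * (LBINT s. ?p s + ?n s) / M)"
    using M i by (subst ennreal_plus[symmetric]) (auto simp: field_simps intro!: integral_nonneg_AE)
  also have "(\<lambda>s. ?p s + ?n s) = (\<lambda>s. \<bar>f s\<bar>)" by auto
  finally show ?thesis .
qed

section \<open>Existence of principal values\<close>

definition pv_exists :: "(real \<Rightarrow> real) \<Rightarrow> real \<Rightarrow> bool" where
  "pv_exists f x \<longleftrightarrow> (\<exists>L. ((\<lambda>e. trunc_hilbert e f x) \<longlongrightarrow> L) (at_right 0))"

text \<open>Uniform limits of convergent functions converge, also when each approximation holds only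
  eventually along the filter. The limits of the approximants form a Cauchy sequence.\<close>

lemma tendsto_exists_uniform_approx:
  fixes h :: "'a \<Rightarrow> real"
  assumes F: "F \<noteq> bot"
    and approx: "\<And>k::nat. \<exists>u L. (u \<longlongrightarrow> L) F \<and> (\<forall>\<^sub>F e in F. \<bar>h e - u e\<bar> \<le> 1 / real (Suc k))"
  shows "\<exists>L. (h \<longlongrightarrow> L) F"
proof -
  obtain u L where u: "\<And>k. (u k \<longlongrightarrow> L k) F" "\<And>k. \<forall>\<^sub>F e in F. \<bar>h e - u k e\<bar> \<le> 1 / real (Suc k)"
    using approx by metis
  have near: "\<bar>L j - L k\<bar> \<le> 1 / real (Suc j) + 1 / real (Suc k)" for j k
  proof (rule tendsto_upperbound)
    show "((\<lambda>e. \<bar>u j e - u k e\<bar>) \<longlongrightarrow> \<bar>L j - L k\<bar>) F" by (intro tendsto_intros u)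
    show "\<forall>\<^sub>F e in F. \<bar>u j e - u k e\<bar> \<le> 1 / real (Suc j) + 1 / real (Suc k)"
      using u(2)[of j] u(2)[of k] by eventually_elim linarith
  qed (rule F)
  have "Cauchy L"
  proof (rule metric_CauchyI)
    fix r :: real assume "r > 0"
    then obtain N where N: "1 / real (Suc N) < r / 2" using reals_Archimedean[of "r/2"] 
      by (auto simp: inverse_eq_divide)
    have "dist (L m) (L n) < r" if "m \<ge> N" "n \<ge> N" for m n
    proof -
      have "1 / real (Suc m) \<le> 1 / real (Suc N)" "1 / real (Suc n) \<le> 1 / real (Suc N)"
        using that by (auto intro!: divide_left_mono)
      then show ?thesis using near[of m n] N unfolding dist_real_def by linarith
    qed
    then show "\<exists>M. \<forall>m\<ge>M. \<forall>n\<ge>M. dist (L m) (L n) < r" by blast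
  qed
  then obtain l where l: "L \<longlonglongrightarrow> l" using Cauchy_convergent convergent_def by blast
  have Ll: "\<bar>L j - l\<bar> \<le> 1 / real (Suc j)" for j
  proof (rule tendsto_le)
    show "(\<lambda>k. 1 / real (Suc j) + 1 / real (Suc k)) \<longlonglongrightarrow> 1 / real (Suc j)"
      using tendsto_add[OF tendsto_const LIMSEQ_Suc[OF lim_1_over_n]] by simp
    show "(\<lambda>k. \<bar>L j - L k\<bar>) \<longlonglongrightarrow> \<bar>L j - l\<bar>" by (intro tendsto_intros l)
  qed (use near in auto)
  have "(h \<longlongrightarrow> l) F"
  proof (rule tendstoI)
    fix r :: real assume "r > 0"
    then obtain k where k: "1 / real (Suc k) < r / 3" using reals_Archimedean[of "r/3"] 
      by (auto simp: inverse_eq_divide)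
    have "\<forall>\<^sub>F e in F. dist (u k e) (L k) < r / 3" using u(1)[of k] \<open>r > 0\<close> by (intro tendstoD) auto
    with u(2)[of k] show "\<forall>\<^sub>F e in F. dist (h e) l < r"
      by eventually_elim (use k Ll[of k] in \<open>unfold dist_real_def, linarith\<close>)
  qed
  then show ?thesis by blast
qed

lemma pv_exists_cmult:
  assumes "pv_exists f x"
  shows "pv_exists (\<lambda>s. c * f s) x"
proof -
  obtain L where "((\<lambda>e. trunc_hilbert e f x) \<longlongrightarrow> L) (at_right 0)"
    using assms unfolding pv_exists_def by blast
  then have "((\<lambda>e. c * trunc_hilbert e f x) \<longlongrightarrow> c * L) (at_right 0)" by (rule tendsto_mult_left)
  moreover have "c * trunc_hilbert e f x = trunc_hilbert e (\<lambda>s. c * f s) x" for e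
    unfolding trunc_hilbert_def by (simp add: mult.assoc)
  ultimately show ?thesis unfolding pv_exists_def by auto
qed

lemma pv_exists_add:
  assumes "\<And>e. e > 0 \<Longrightarrow> integrable lborel (\<lambda>s. f s * trunc_kernel e (x - s))"
    and "\<And>e. e > 0 \<Longrightarrow> integrable lborel (\<lambda>s. g s * trunc_kernel e (x - s))"
    and "pv_exists f x" "pv_exists g x"
  shows "pv_exists (\<lambda>s. f s + g s) x"
proof -
  obtain L K where l: "((\<lambda>e. trunc_hilbert e f x) \<longlongrightarrow> L) (at_right 0)"
    "((\<lambda>e. trunc_hilbert e g x) \<longlongrightarrow> K) (at_right 0)"
    using assms by (auto simp: pv_exists_def)
  have "\<forall>\<^sub>F e in at_right 0. trunc_hilbert e f x + trunc_hilbert e g x = trunc_hilbert e (\<lambda>s. f s + g s) x"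
    using eventually_at_right_less[of 0] by eventually_elim (use trunc_hilbert_add assms in auto)
  from Lim_transform_eventually[OF tendsto_add[OF l] this] show ?thesis
    unfolding pv_exists_def by blast
qed

lemma pv_exists_diff:
  assumes "\<And>e. e > 0 \<Longrightarrow> integrable lborel (\<lambda>s. f s * trunc_kernel e (x - s))"
    and "\<And>e. e > 0 \<Longrightarrow> integrable lborel (\<lambda>s. g s * trunc_kernel e (x - s))"
    and "pv_exists f x" "pv_exists g x"
  shows "pv_exists (\<lambda>s. f s - g s) x"
proof -
  have "pv_exists (\<lambda>s. f s + (- 1) * g s) x"
  proof (rule pv_exists_add)
    show "integrable lborel (\<lambda>s. - 1 * g s * trunc_kernel e (x - s))" if "e > 0" for e
      using assms(2)[OF that] by simp
  qed (use assms pv_exists_cmult[of g x "-1"] in auto)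
  then show ?thesis by simp
qed

text \<open>The standard use of a maximal inequality: outside a null set, for each tolerance some
  \<open>g n\<close> is so close to \<open>f\<close> that all truncations of the difference stay
  below it. Convergence of the truncations is then inherited from \<open>g n\<close>.\<close>

lemma pv_exists_L1_limit:
  assumes f: "integrable lborel f"
    and g: "\<And>n. integrable lborel (g n)" "\<And>n. AE x in lborel. pv_exists (g n) x"
    and lim: "(\<lambda>n. LBINT s. \<bar>f s - g n s\<bar>) \<longlonglongrightarrow> 0"
  shows "AE x in lborel. pv_exists f x"
proof -
  let ?d = "\<lambda>n s. f s - g n s"
  have i: "integrable lborel (?d n)" for n by (intro Bochner_Integration.integrable_diff f g(1))
  have [measurable]: "f \<in> borel_measurable borel" "g n \<in> borel_measurable borel" for n
    using borel_measurable_integrable[OF f] borel_measurable_integrable[OF g(1)[of n]] by simp_all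
  have "AE x in lborel. \<exists>n. \<not> max_trunc_gt (?d n) (1 / real (Suc k)) x" for k
  proof (rule AE_I)
    \<comment> \<open>The exceptional set for one tolerance is contained in the set where the
      maximal function of \<open>f - g n\<close> is large, for every \<open>n\<close>. Its measure
      is thus below bounds that tend to 0.\<close>
    let ?N = "{x \<in> space lborel. \<not> (\<exists>n. \<not> max_trunc_gt (?d n) (1 / real (Suc k)) x)}"
    show "?N \<in> sets lborel" by measurable
    have b: "emeasure lborel ?N \<le> ennreal (160 * (LBINT s. \<bar>?d n s\<bar>) / (1 / real (Suc k)))" for n
    proof -
      have "emeasure lborel ?N \<le> emeasure lborel {x. max_trunc_gt (?d n) (1 / real (Suc k)) x}"
        by (intro emeasure_mono) auto
      also have "\<dots> \<le> ennreal (160 * (LBINT s. \<bar>?d n s\<bar>) / (1 / real (Suc k)))"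
        by (intro maximal_weak i) auto
      finally show ?thesis .
    qed
    have "(\<lambda>n. ennreal (160 * (LBINT s. \<bar>?d n s\<bar>) / (1 / real (Suc k)))) \<longlonglongrightarrow> ennreal (160 * 0 / (1 / real (Suc k)))"
      by (intro tendsto_ennrealI tendsto_intros lim) auto
    then have "emeasure lborel ?N \<le> ennreal 0"
      using b by (intro LIMSEQ_le_const) auto
    then show "emeasure lborel ?N = 0" by simp
  qed simp
  then have "AE x in lborel. \<forall>k. \<exists>n. \<not> max_trunc_gt (?d n) (1 / real (Suc k)) x"
    unfolding AE_all_countable by blast
  moreover have "AE x in lborel. \<forall>n. pv_exists (g n) x"
    using g(2) unfolding AE_all_countable by blast
  ultimately show ?thesis
  proof eventually_elim
    case (elim x)
    show ?case unfolding pv_exists_def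
    proof (rule tendsto_exists_uniform_approx)
      fix k
      from elim obtain n where n: "\<not> max_trunc_gt (?d n) (1 / real (Suc k)) x" by blast
      obtain L where L: "((\<lambda>e. trunc_hilbert e (g n) x) \<longlongrightarrow> L) (at_right 0)"
        using elim(2) by (auto simp: pv_exists_def)
      have "\<forall>\<^sub>F e in at_right 0. \<bar>trunc_hilbert e f x - trunc_hilbert e (g n) x\<bar> \<le> 1 / real (Suc k)"
        using eventually_at_right_less[of 0]
      proof eventually_elim
        case (elim e)
        have "trunc_hilbert e (?d n) x = trunc_hilbert e f x - trunc_hilbert e (g n) x"
          by (intro trunc_hilbert_diff trunc_hilbert_integrable f g(1) elim)
        then show ?case using max_trunc_gtI[OF i elim] n by (metis not_le)
      qed
      with L show "\<exists>u L. (u \<longlongrightarrow> L) (at_right 0) \<and> (\<forall>\<^sub>F e in at_right 0. \<bar>trunc_hilbert e f x - u e\<bar> \<le> 1 / real (Suc k))"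
        by blast
    qed simp
  qed
qed

lemma pv_exists_dominated:
  fixes f w :: "real \<Rightarrow> real" and g :: "nat \<Rightarrow> real \<Rightarrow> real"
  assumes w: "integrable lborel w"
    and [measurable]: "f \<in> borel_measurable borel" "\<And>n. g n \<in> borel_measurable borel"
    and b: "\<And>n s. \<bar>g n s\<bar> \<le> w s"
    and lim: "\<And>s. (\<lambda>n. g n s) \<longlonglongrightarrow> f s"
    and g: "\<And>n. AE x in lborel. pv_exists (g n) x"
  shows "AE x in lborel. pv_exists f x"
proof -
  have bf: "\<bar>f s\<bar> \<le> w s" for s
    using b by (intro LIMSEQ_le_const2[OF tendsto_rabs[OF lim]]) auto
  have w0: "w s \<ge> 0" for s using bf[of s] by linarith
  have f: "integrable lborel f" and gi: "integrable lborel (g n)" for n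
    by (rule Bochner_Integration.integrable_bound[OF w]; use bf b w0 in force)+
  have "(\<lambda>n. LBINT s. \<bar>f s - g n s\<bar>) \<longlonglongrightarrow> (LBINT s::real. 0)"
  proof (rule integral_dominated_convergence[where w = "\<lambda>s. 2 * w s"])
    show "AE s in lborel. (\<lambda>n. \<bar>f s - g n s\<bar>) \<longlonglongrightarrow> 0"
    proof (rule AE_I2)
      fix s
      have "(\<lambda>n. \<bar>f s - g n s\<bar>) \<longlonglongrightarrow> \<bar>f s - f s\<bar>" by (intro tendsto_intros lim)
      then show "(\<lambda>n. \<bar>f s - g n s\<bar>) \<longlonglongrightarrow> 0" by simp
    qed
    show "AE s in lborel. norm \<bar>f s - g n s\<bar> \<le> 2 * w s" for n
    proof (rule AE_I2)
      fix s show "norm \<bar>f s - g n s\<bar> \<le> 2 * w s" using bf[of s] b[of n s] by simp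
    qed
  qed (use w in auto)
  then have "(\<lambda>n. LBINT s. \<bar>f s - g n s\<bar>) \<longlonglongrightarrow> 0" by simp
  then show ?thesis by (rule pv_exists_L1_limit[OF f gi g])
qed

lemma odd_integral_zero:
  fixes w :: "real \<Rightarrow> real"
  assumes "\<And>y. w (- y) = - w y"
  shows "(LBINT s. w (x - s)) = 0"
proof -
  have "(LBINT s. w (x - s)) = (LBINT s. w (x - (2 * x + (- 1) * s)))"
    using lborel_integral_real_affine[of "-1" "\<lambda>s. w (x - s)" "2 * x"] by simp
  also have "\<dots> = (LBINT s. - w (x - s))"
    by (intro Bochner_Integration.integral_cong refl) (simp flip: assms)
  finally show ?thesis by simp
qed

text \<open>Between the radii \<open>e\<close> and \<open>d\<close> the integrand is a constant
  times an odd kernel and integrates to 0. Shrinking the truncation below \<open>d\<close> therefore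
  changes nothing.\<close>

lemma trunc_hilbert_locally_constant:
  assumes i: "\<And>e. e > 0 \<Longrightarrow> integrable lborel (\<lambda>s. f s * trunc_kernel e (x - s))"
    and d: "\<And>s. \<bar>s - x\<bar> \<le> d \<Longrightarrow> f s = f x" and e: "0 < e" "e \<le> d"
  shows "trunc_hilbert e f x = trunc_hilbert d f x"
proof -
  have "trunc_hilbert e f x - trunc_hilbert d f x
    = (LBINT s. f s * trunc_kernel e (x - s) - f s * trunc_kernel d (x - s))"
    unfolding trunc_hilbert_def using i e by (subst Bochner_Integration.integral_diff) auto
  also have "\<dots> = (LBINT s. f x * (trunc_kernel e (x - s) - trunc_kernel d (x - s)))"
  proof (rule Bochner_Integration.integral_cong[OF refl])
    fix s
    show "f s * trunc_kernel e (x - s) - f s * trunc_kernel d (x - s)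
      = f x * (trunc_kernel e (x - s) - trunc_kernel d (x - s))"
    proof (cases "\<bar>s - x\<bar> \<le> d")
      case True
      then show ?thesis using d[OF True] by (simp add: right_diff_distrib)
    next
      case False
      then have "trunc_kernel e (x - s) = trunc_kernel d (x - s)" using e by (auto simp: trunc_kernel_def)
      then show ?thesis by simp
    qed
  qed
  also have "\<dots> = f x * (LBINT s. (\<lambda>y. trunc_kernel e y - trunc_kernel d y) (x - s))" by simp
  also have "\<dots> = 0" by (subst odd_integral_zero) (auto simp: trunc_kernel_uminus)
  finally show ?thesis by simp
qed

lemma trunc_hilbert_locally_constant_tendsto:
  assumes i: "\<And>e. e > 0 \<Longrightarrow> integrable lborel (\<lambda>s. f s * trunc_kernel e (x - s))"
    and d: "\<And>s. \<bar>s - x\<bar> \<le> d \<Longrightarrow> f s = f x" "d > 0"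
  shows "((\<lambda>e. trunc_hilbert e f x) \<longlongrightarrow> trunc_hilbert d f x) (at_right 0)"
proof -
  have "\<forall>\<^sub>F e in at_right 0. e < d \<and> 0 < e"
    using d(2) by (auto simp: eventually_at_right_field)
  then have "\<forall>\<^sub>F e in at_right 0. trunc_hilbert d f x = trunc_hilbert e f x"
  proof eventually_elim
    case (elim e)
    then show ?case by (intro trunc_hilbert_locally_constant[OF i d(1), symmetric]) auto
  qed
  then show ?thesis by (rule Lim_transform_eventually[OF tendsto_const])
qed

lemma pv_exists_interval: "AE x in lborel. pv_exists (indicator {p..q}) x"
proof -
  have "AE x in lborel. x \<noteq> p \<and> x \<noteq> q"
    using AE_lborel_singleton[of p] AE_lborel_singleton[of q] by auto
  then show ?thesis
  proof eventually_elim
    case (elim x)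
    define d where "d = min \<bar>x - p\<bar> \<bar>x - q\<bar> / 2"
    have "d > 0" using elim by (auto simp: d_def)
    moreover have "indicator {p..q} s = (indicator {p..q} x :: real)" if "\<bar>s - x\<bar> \<le> d" for s
    proof -
      have "(p \<le> s) = (p \<le> x)" "(s \<le> q) = (x \<le> q)"
        using that elim unfolding d_def by (auto simp: min_def abs_if split: if_splits)
      then show ?thesis by (simp add: indicator_def)
    qed
    moreover have "integrable lborel (\<lambda>s. indicator {p..q} s * trunc_kernel e (x - s))" if "e > 0" for e
      using that by (intro trunc_hilbert_integrable integrable_real_indicator)
        (auto simp: emeasure_lborel_Icc_eq)
    ultimately show ?case
      unfolding pv_exists_def using trunc_hilbert_locally_constant_tendsto by blast
  qed
qed

lemma pv_exists_zero: "pv_exists (\<lambda>_. 0) x"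
  unfolding pv_exists_def trunc_hilbert_def by (intro exI[of _ 0]) simp

text \<open>Indicators of sets take the place of a dense class of smooth functions. The indicator of
  an interval is locally constant off its endpoints, and the property passes to complements and to
  disjoint countable unions. Cutting with a bounded interval keeps all functions integrable along
  the way.\<close>

lemma pv_exists_bounded_set:
  assumes "A \<in> sets borel"
  shows "AE x in lborel. pv_exists (indicator (A \<inter> {- real n..real n})) x"
proof -
  let ?I = "{- real n..real n}"
  have int: "integrable lborel (indicator (B \<inter> ?I) :: real \<Rightarrow> real)" if "B \<in> sets borel" for B
  proof (rule integrable_real_indicator)
    have "emeasure lborel (B \<inter> ?I) \<le> emeasure lborel ?I"
      using that by (intro emeasure_mono) auto
    then show "emeasure lborel (B \<inter> ?I) < \<infinity>" by (auto simp: order_le_less_trans)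
  qed (use that in auto)
  have A: "A \<in> sigma_sets UNIV (range (\<lambda>a::real. {..a}))"
    using assms unfolding borel_eq_atMost by (subst (asm) sets_measure_of) auto
  have "Int_stable (range (\<lambda>a::real. {..a}))" by (auto simp: Int_stable_def)
  moreover have "range (\<lambda>a::real. {..a}) \<subseteq> Pow UNIV" by simp
  moreover note A
  ultimately show ?thesis
  proof (induction rule: sigma_sets_induct_disjoint)
    case (basic A)
    then obtain a where "A = {..a}" by auto
    then have "A \<inter> ?I = {- real n..min a (real n)}" by auto
    then show ?case using pv_exists_interval by simp
  next
    case empty
    then show ?case using pv_exists_zero by (simp add: indicator_def)
  next
    case (compl A)
    then have A: "A \<in> sets borel" by (simp add: borel_eq_atMost)
    have eq: "indicator ((UNIV - A) \<inter> ?I) = (\<lambda>s. indicator ?I s - indicator (A \<inter> ?I) s :: real)"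
      by (auto simp: indicator_def fun_eq_iff)
    from compl.IH pv_exists_interval[of "- real n" "real n"] show ?case
    proof eventually_elim
      case (elim x)
      then show ?case unfolding eq
        using int[OF A] int[of UNIV] by (intro pv_exists_diff trunc_hilbert_integrable) auto
    qed
  next
    case (union A)
    then have A[measurable]: "A i \<in> sets borel" for i by (auto simp: borel_eq_atMost)
    let ?g = "\<lambda>m s. \<Sum>i<m. indicator (A i \<inter> ?I) s :: real"
    have g: "?g m s = indicator ((\<Union>i<m. A i) \<inter> ?I) s" for m s
    proof -
      have "disjoint_family_on (\<lambda>i. A i \<inter> ?I) {..<m}"
        using union(1) by (auto simp: disjoint_family_on_def)
      then have "?g m s = indicator (\<Union>i<m. A i \<inter> ?I) s"
        by (intro indicator_UN_disjoint[symmetric]) simp_all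
      also have "(\<Union>i<m. A i \<inter> ?I) = (\<Union>i<m. A i) \<inter> ?I" by blast
      finally show ?thesis .
    qed
    have pv: "AE x in lborel. pv_exists (?g m) x" for m
    proof (induction m)
      case 0
      then show ?case using pv_exists_zero by simp
    next
      case (Suc m)
      have i: "integrable lborel (?g m)" using int[OF A] by (intro Bochner_Integration.integrable_sum)
      from Suc union.IH[of m] show ?case
      proof eventually_elim
        case (elim x)
        then show ?case using i int[OF A]
          by (simp, intro pv_exists_add trunc_hilbert_integrable) auto
      qed
    qed
    show ?case
    proof (rule pv_exists_dominated[where g = ?g and w = "indicator (UNIV \<inter> ?I)"])
      show "(\<lambda>n. ?g n s) \<longlonglongrightarrow> indicator (\<Union> (range A) \<inter> ?I) s" for s
      proof (cases "s \<in> \<Union> (range A) \<inter> ?I")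
        case True
        then obtain j where "s \<in> A j" by auto
        have "\<forall>\<^sub>F m in sequentially. 1 = ?g m s"
          using eventually_gt_at_top[of j] 
          by eventually_elim (subst g, use True \<open>s \<in> A j\<close> in \<open>auto simp: indicator_def\<close>)
        with True show ?thesis by (auto intro: Lim_transform_eventually[OF tendsto_const])
      next
        case False
        then have "?g m s = 0" for m unfolding g by (auto simp: indicator_def)
        then show ?thesis using False by simp
      qed
      show "\<bar>?g m s\<bar> \<le> indicator (UNIV \<inter> ?I) s" for m s
        unfolding g by (auto simp: indicator_def)
    qed (use int[of UNIV] pv in auto)
  qed
qed

lemma pv_exists_integrable:
  assumes "integrable lborel f"
  shows "AE x in lborel. pv_exists f x"
  using assms
proof (induction rule: integrable_induct)
  case (base A c)
  have A[measurable]: "A \<in> sets borel" using base by simp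
  have i: "integrable lborel (indicator A :: real \<Rightarrow> real)"
    using base by (intro integrable_real_indicator) auto
  have "AE x in lborel. pv_exists (indicator A) x"
  proof (rule pv_exists_dominated[where g = "\<lambda>n. indicator (A \<inter> {- real n..real n})" and w = "indicator A"])
    show "(\<lambda>n. indicator (A \<inter> {- real n..real n}) s) \<longlonglongrightarrow> (indicator A s :: real)" for s
    proof -
      obtain N where N: "\<bar>s\<bar> \<le> real N" using real_arch_simple by blast
      have "\<forall>\<^sub>F n in sequentially. indicator A s = (indicator (A \<inter> {- real n..real n}) s :: real)"
        using eventually_ge_at_top[of N]
        by eventually_elim (use N in \<open>auto simp: indicator_def\<close>)
      then show ?thesis by (rule Lim_transform_eventually[OF tendsto_const])
    qed
    show "AE x in lborel. pv_exists (indicator (A \<inter> {- real n..real n})) x" for n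
      by (rule pv_exists_bounded_set) simp
  qed (use i in \<open>auto simp: indicator_def\<close>)
  then show ?case
    by eventually_elim (use pv_exists_cmult[of "indicator A" _ c] in \<open>simp add: mult.commute\<close>)
next
  case (add f g)
  from add.IH show ?case
    by eventually_elim (intro pv_exists_add trunc_hilbert_integrable add.hyps)
next
  case (lim f s)
  show ?case
  proof (rule pv_exists_dominated[where g = s and w = "\<lambda>x. 2 * \<bar>f x\<bar>"])
    show "integrable lborel (\<lambda>x. 2 * \<bar>f x\<bar>)" using lim(4) by simp
    show "f \<in> borel_measurable borel" "s n \<in> borel_measurable borel" for n
      using borel_measurable_integrable[OF lim(4)] borel_measurable_integrable[OF lim(1)[of n]] by simp_all
    show "\<bar>s n x\<bar> \<le> 2 * \<bar>f x\<bar>" for n x using lim(3)[of x n] by simp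
    show "(\<lambda>n. s n x) \<longlonglongrightarrow> f x" for x using lim(2)[of x] by simp
    show "AE x in lborel. pv_exists (s n) x" for n by (rule lim(5))
  qed
qed

section \<open>Principal values of functions that are integrable only against the kernel\<close>

definition tail_integrable :: "(real \<Rightarrow> real) \<Rightarrow> bool" where
  "tail_integrable f \<longleftrightarrow> f \<in> borel_measurable borel \<and> integrable lborel (\<lambda>s. f s / (1 + \<bar>s\<bar>))"

text \<open>The weight \<open>1 / (1 + \<bar>s\<bar>)\<close> is the decay of the kernel at
  infinity, and away from the singularity the two are comparable up to a factor that depends on
  \<open>x\<close> and \<open>e\<close>.\<close>

lemma tail_integrable_trunc_hilbert:
  assumes f: "tail_integrable f" and e: "e > 0"
  shows "integrable lborel (\<lambda>s. f s * trunc_kernel e (x - s))"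
proof -
  have [measurable]: "f \<in> borel_measurable borel" using f by (auto simp: tail_integrable_def)
  let ?C = "(1 + \<bar>x\<bar>) / e + 1"
  have k: "\<bar>trunc_kernel e (x - s)\<bar> \<le> ?C / (1 + \<bar>s\<bar>)" for s
  proof (cases "e < \<bar>x - s\<bar>")
    case True
    have "1 + \<bar>s\<bar> \<le> (1 + \<bar>x\<bar>) + \<bar>x - s\<bar>" by linarith
    also have "(1 + \<bar>x\<bar>) \<le> (1 + \<bar>x\<bar>) / e * \<bar>x - s\<bar>"
    proof -
      have "(1 + \<bar>x\<bar>) / e * e \<le> (1 + \<bar>x\<bar>) / e * \<bar>x - s\<bar>"
        using True e by (intro mult_left_mono) auto
      then show ?thesis using e by simp
    qed
    finally have "1 + \<bar>s\<bar> \<le> ?C * \<bar>x - s\<bar>" by (simp add: distrib_right)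
    moreover have "\<bar>x - s\<bar> > 0" "1 + \<bar>s\<bar> > 0" using True e by auto
    ultimately have "1 / \<bar>x - s\<bar> \<le> ?C / (1 + \<bar>s\<bar>)" by (simp only: divide_le_eq le_divide_eq times_divide_eq_left) (simp add: mult.commute)
    then show ?thesis using True by (simp add: trunc_kernel_def)
  next
    case False
    then show ?thesis using e by (simp add: trunc_kernel_def)
  qed
  show ?thesis
  proof (rule Bochner_Integration.integrable_bound)
    show "integrable lborel (\<lambda>s. ?C * (f s / (1 + \<bar>s\<bar>)))"
      using f unfolding tail_integrable_def by (intro integrable_mult_right) auto
    show "AE s in lborel. norm (f s * trunc_kernel e (x - s)) \<le> norm (?C * (f s / (1 + \<bar>s\<bar>)))"
    proof (rule AE_I2)
      fix s
      have "\<bar>f s\<bar> * \<bar>trunc_kernel e (x - s)\<bar> \<le> \<bar>f s\<bar> * (?C / (1 + \<bar>s\<bar>))"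
        using k by (intro mult_left_mono) auto
      then show "norm (f s * trunc_kernel e (x - s)) \<le> norm (?C * (f s / (1 + \<bar>s\<bar>)))"
        using e by (simp add: abs_mult mult.commute)
    qed
  qed measurable
qed

lemma integrable_imp_tail_integrable:
  assumes f: "integrable lborel f"
  shows "tail_integrable f"
proof -
  have [measurable]: "f \<in> borel_measurable borel" using f by auto
  have "\<bar>f s\<bar> / (1 + \<bar>s\<bar>) \<le> \<bar>f s\<bar>" for s
    using divide_left_mono[of 1 "1 + \<bar>s\<bar>" "\<bar>f s\<bar>"] by simp
  then show ?thesis unfolding tail_integrable_def
    by (auto intro!: Bochner_Integration.integrable_bound[OF f] simp: abs_divide)
qed

text \<open>Existence is local. For \<open>\<bar>x\<bar> \<le> n\<close> the part of
  \<open>f\<close> on \<open>\<bar>s\<bar> \<le> n + 1\<close> is integrable, while the rest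
  vanishes within distance 1 of \<open>x\<close>, so that its truncations are constant for small
  parameters.\<close>

lemma pv_exists_tail_integrable:
  assumes f: "tail_integrable f"
  shows "AE x in lborel. pv_exists f x"
proof -
  have [measurable]: "f \<in> borel_measurable borel" using f by (auto simp: tail_integrable_def)
  have "AE x in lborel. \<bar>x\<bar> \<le> real n \<longrightarrow> pv_exists f x" for n
  proof -
    let ?I = "{- (real n + 1)..real n + 1}"
    let ?g = "\<lambda>s. f s * indicator ?I s" and ?h = "\<lambda>s. f s * indicator (- ?I) s"
    have g: "integrable lborel ?g"
    proof (rule Bochner_Integration.integrable_bound)
      show "integrable lborel (\<lambda>s. (real n + 2) * (f s / (1 + \<bar>s\<bar>)))"
        using f unfolding tail_integrable_def by (intro integrable_mult_right) auto
      show "AE s in lborel. norm (?g s) \<le> norm ((real n + 2) * (f s / (1 + \<bar>s\<bar>)))"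
      proof (rule AE_I2)
        fix s
        have "\<bar>f s\<bar> * indicator ?I s \<le> \<bar>f s\<bar> * ((real n + 2) / (1 + \<bar>s\<bar>))"
          by (intro mult_left_mono) (auto simp: indicator_def divide_simps)
        then show "norm (?g s) \<le> norm ((real n + 2) * (f s / (1 + \<bar>s\<bar>)))"
          by (simp add: abs_mult mult.commute)
      qed
    qed measurable
    have h: "integrable lborel (\<lambda>s. ?h s * trunc_kernel e (x - s))" if "e > 0" for e x
      by (rule Bochner_Integration.integrable_bound[OF tail_integrable_trunc_hilbert[OF f that, of x]])
        (auto simp: indicator_def)
    from pv_exists_integrable[OF g] show ?thesis
    proof eventually_elim
     case pg: (elim x)
     show ?case
     proof
      assume x: "\<bar>x\<bar> \<le> real n"
      have ph: "pv_exists ?h x"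
      proof -
        have "s \<in> ?I" "x \<in> ?I" if "\<bar>s - x\<bar> \<le> 1" for s
          using that x by auto
        then have "?h s = ?h x" if "\<bar>s - x\<bar> \<le> 1" for s
          using that by simp
        from trunc_hilbert_locally_constant_tendsto[OF h this zero_less_one] show ?thesis
          unfolding pv_exists_def by auto
      qed
      have "pv_exists (\<lambda>s. ?g s + ?h s) x"
        by (rule pv_exists_add[OF trunc_hilbert_integrable[OF g] h pg ph])
      moreover have "(\<lambda>s. ?g s + ?h s) = f" by (auto simp: indicator_def)
      ultimately show "pv_exists f x" by simp
     qed
    qed
  qed
  then have "AE x in lborel. \<forall>n. \<bar>x\<bar> \<le> real n \<longrightarrow> pv_exists f x"
    unfolding AE_all_countable by blast
  then show ?thesis
    by eventually_elim (meson real_arch_simple)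
qed

section \<open>The square integral bound on the line\<close>

lemma integrable_indicator_Icc: "integrable lborel (indicator {a..b} :: real \<Rightarrow> real)"
  using integrable_real_indicator[of "{a..b}" lborel] emeasure_lborel_Icc_eq[of a b] by simp

lemma LBINT_indicator_Icc: "a \<le> b \<Longrightarrow> (LBINT y. indicator {a..b} y) = b - (a::real)"
  by simp

lemma trunc_kernel_sq_nn_integral:
  assumes e: "e > 0"
  shows "(\<integral>\<^sup>+y. ennreal ((trunc_kernel e (y + a))\<^sup>2) \<partial>lborel) \<le> ennreal (2 / e)"
proof -
  let ?f = "\<lambda>y. (trunc_kernel e y)\<^sup>2"
  have half: "(\<integral>\<^sup>+y. ennreal (inverse (y\<^sup>2)) * indicator {e..} y \<partial>lborel) = ennreal (1 / e)"
  proof -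
    have "((\<lambda>y::real. - inverse y) \<longlongrightarrow> - 0) at_top"
      by (intro tendsto_minus tendsto_inverse_0_at_top filterlim_ident)
    then have "(\<integral>\<^sup>+y. ennreal (inverse (y\<^sup>2)) * indicator {e..} y \<partial>lborel) = ennreal (0 - (- inverse e))"
      using e by (intro nn_integral_FTC_atLeast)
        (auto intro!: derivative_eq_intros simp: power2_eq_square field_simps)
    then show ?thesis by (simp add: inverse_eq_divide)
  qed
  have "(\<integral>\<^sup>+y. ennreal (?f (y + a)) \<partial>lborel) = (\<integral>\<^sup>+y. ennreal (?f y) \<partial>lborel)"
    using nn_integral_real_affine[of "\<lambda>y. ennreal (?f y)" 1 a] by (simp add: add.commute)
  also have "\<dots> \<le> (\<integral>\<^sup>+y. ennreal (inverse (y\<^sup>2)) * indicator {e..} y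
      + ennreal (inverse ((- y)\<^sup>2)) * indicator {e..} (- y) \<partial>lborel)"
    by (intro nn_integral_mono)
      (auto simp: trunc_kernel_def indicator_def power_divide inverse_eq_divide)
  also have "\<dots> = (\<integral>\<^sup>+y. ennreal (inverse (y\<^sup>2)) * indicator {e..} y \<partial>lborel)
      + (\<integral>\<^sup>+y. ennreal (inverse ((- y)\<^sup>2)) * indicator {e..} (- y) \<partial>lborel)"
    by (intro nn_integral_add) measurable
  also have "(\<integral>\<^sup>+y. ennreal (inverse ((- y)\<^sup>2)) * indicator {e..} (- y) \<partial>lborel)
      = (\<integral>\<^sup>+y. ennreal (inverse (y\<^sup>2)) * indicator {e..} y \<partial>lborel)"
    using nn_integral_real_affine[of "\<lambda>y. ennreal (inverse (y\<^sup>2)) * indicator {e..} y" "-1" 0] by simp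
  finally show ?thesis unfolding half using e by (simp flip: ennreal_plus)
qed

text \<open>The convolution kernel of the truncated transform composed with its adjoint. The square
  integral of \<open>trunc_hilbert e h\<close> is the quadratic form of this kernel, so a bound for
  its \<open>L^1\<close> norm that is independent of \<open>e\<close> suffices.\<close>

definition corr_kernel :: "real \<Rightarrow> real \<Rightarrow> real" where
  "corr_kernel e w = (LBINT y. trunc_kernel e y * trunc_kernel e (y + w))"

lemma trunc_kernel_prod_nn_integral:
  assumes e: "e > 0"
  shows "(\<integral>\<^sup>+y. ennreal \<bar>trunc_kernel e (y + a) * trunc_kernel e (y + b)\<bar> \<partial>lborel) \<le> ennreal (2 / e)"
proof -
  have am: "\<bar>x * y\<bar> \<le> (x\<^sup>2 + y\<^sup>2) / 2" for x y :: real
    using sum_squares_bound[of "\<bar>x\<bar>" "\<bar>y\<bar>"] by (simp add: abs_mult)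
  have "(\<integral>\<^sup>+y. ennreal \<bar>trunc_kernel e (y + a) * trunc_kernel e (y + b)\<bar> \<partial>lborel)
    \<le> (\<integral>\<^sup>+y. ennreal (1/2) * (ennreal ((trunc_kernel e (y + a))\<^sup>2) + ennreal ((trunc_kernel e (y + b))\<^sup>2)) \<partial>lborel)"
  proof (intro nn_integral_mono)
    fix y
    show "ennreal \<bar>trunc_kernel e (y + a) * trunc_kernel e (y + b)\<bar>
      \<le> ennreal (1/2) * (ennreal ((trunc_kernel e (y + a))\<^sup>2) + ennreal ((trunc_kernel e (y + b))\<^sup>2))"
      by (subst ennreal_plus[symmetric], simp, simp, subst ennreal_mult[symmetric])
        (use am[of "trunc_kernel e (y + a)" "trunc_kernel e (y + b)"] in auto)
  qed
  also have "\<dots> = ennreal (1/2) * ((\<integral>\<^sup>+y. ennreal ((trunc_kernel e (y + a))\<^sup>2) \<partial>lborel) + (\<integral>\<^sup>+y. ennreal ((trunc_kernel e (y + b))\<^sup>2) \<partial>lborel))"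
    by (subst nn_integral_cmult, measurable, subst nn_integral_add) measurable
  also have "\<dots> \<le> ennreal (1/2) * (ennreal (2 / e) + ennreal (2 / e))"
    by (intro mult_left_mono add_mono trunc_kernel_sq_nn_integral e) simp
  also have "\<dots> = ennreal (2 / e)"
  proof -
    have "ennreal (2 / e) + ennreal (2 / e) = ennreal (4 / e)" using e by (simp flip: ennreal_plus)
    moreover have "ennreal (1/2) * ennreal (4 / e) = ennreal (1/2 * (4 / e))"
      using e by (intro ennreal_mult[symmetric]) auto
    ultimately show ?thesis by simp
  qed
  finally show ?thesis .
qed

lemma trunc_kernel_prod_integrable:
  assumes e: "e > 0"
  shows "integrable lborel (\<lambda>y. trunc_kernel e (y + a) * trunc_kernel e (y + b))"
proof (rule integrableI_bounded)
  show "(\<integral>\<^sup>+y. ennreal (norm (trunc_kernel e (y + a) * trunc_kernel e (y + b))) \<partial>lborel) < \<infinity>"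
    using trunc_kernel_prod_nn_integral[OF e, of a b] by (simp add: order_le_less_trans)
qed measurable

text \<open>The two terms are not integrable separately. With a cutoff to \<open>{- n..n}\<close>
  they are, and after a shift in the second one they differ only by the cutoffs. The cutoffs differ
  near \<open>n\<close> and \<open>- n\<close> on sets of bounded length, where the kernel is of
  order \<open>1 / n\<close>.\<close>

lemma trunc_kernel_diff_integral:
  assumes e: "e > 0" and i: "integrable lborel (\<lambda>y. trunc_kernel e y - trunc_kernel e (y + w))"
  shows "(LBINT y. trunc_kernel e y - trunc_kernel e (y + w)) = 0"
proof -
  let ?D = "\<lambda>y. trunc_kernel e y - trunc_kernel e (y + w)"
  let ?I = "\<lambda>n::nat. indicator {- real n..real n} :: real \<Rightarrow> real"
  have int: "integrable lborel (\<lambda>y. ?I n (y + a) * trunc_kernel e (y + b))" for n a b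
  proof (rule Bochner_Integration.integrable_bound)
    show "integrable lborel (\<lambda>y. 1 / e * indicator {- real n - a..real n - a} y)"
      by (intro integrable_mult_right integrable_indicator_Icc)
    show "AE y in lborel. norm (?I n (y + a) * trunc_kernel e (y + b)) \<le> norm (1 / e * indicator {- real n - a..real n - a} y)"
      using trunc_kernel_bound[OF e] e by (intro AE_I2) (auto simp: indicator_def abs_mult)
  qed measurable
  have lim: "(\<lambda>n. LBINT y. ?I n y * ?D y) \<longlonglongrightarrow> (LBINT y. ?D y)"
  proof (rule integral_dominated_convergence[where w = "\<lambda>y. \<bar>?D y\<bar>"])
    show "AE y in lborel. (\<lambda>n. ?I n y * ?D y) \<longlonglongrightarrow> ?D y"
    proof (rule AE_I2)
      fix y
      obtain N where N: "\<bar>y\<bar> \<le> real N" using real_arch_simple by blast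
      have "\<forall>\<^sub>F n in sequentially. ?D y = ?I n y * ?D y"
        using eventually_ge_at_top[of N] by eventually_elim (use N in \<open>auto simp: indicator_def\<close>)
      then show "(\<lambda>n. ?I n y * ?D y) \<longlonglongrightarrow> ?D y"
        by (rule Lim_transform_eventually[OF tendsto_const])
    qed
  qed (use i in \<open>auto simp: indicator_def\<close>)
  have bound: "\<bar>LBINT y. ?I n y * ?D y\<bar> \<le> 4 * \<bar>w\<bar> * (1 / (real n - \<bar>w\<bar>))" if n: "real n > \<bar>w\<bar> + e" for n
  proof -
    have "(LBINT y. ?I n y * ?D y) = (LBINT y. ?I n (y + 0) * trunc_kernel e (y + 0) - ?I n (y + 0) * trunc_kernel e (y + w))"
      by (simp add: right_diff_distrib)
    also have "\<dots> = (LBINT y. ?I n y * trunc_kernel e y) - (LBINT y. ?I n y * trunc_kernel e (y + w))"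
      by (subst Bochner_Integration.integral_diff[OF int int]) simp
    also have "(LBINT y. ?I n y * trunc_kernel e (y + w)) = (LBINT y. ?I n (y + - w) * trunc_kernel e y)"
      using lborel_integral_real_affine[of 1 "\<lambda>y. ?I n y * trunc_kernel e (y + w)" "- w"]
      by (simp add: algebra_simps)
    also have "(LBINT y. ?I n y * trunc_kernel e y) - (LBINT y. ?I n (y + - w) * trunc_kernel e y)
      = (LBINT y. (?I n y - ?I n (y + - w)) * trunc_kernel e y)"
      using Bochner_Integration.integral_diff[OF int[of n 0 0] int[of n "- w" 0]]
      by (simp add: left_diff_distrib)
    finally have E: "(LBINT y. ?I n y * ?D y) = (LBINT y. (?I n y - ?I n (y + - w)) * trunc_kernel e y)" .
    have "\<bar>LBINT y. ?I n y * ?D y\<bar> \<le> (LBINT y. (indicator {- real n - \<bar>w\<bar>..- real n + \<bar>w\<bar>} y + indicator {real n - \<bar>w\<bar>..real n + \<bar>w\<bar>} y) * (1 / (real n - \<bar>w\<bar>)))"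
      unfolding E
    proof (rule order_trans[OF integral_abs_bound], rule integral_mono)
      show "integrable lborel (\<lambda>y. \<bar>(?I n y - ?I n (y + - w)) * trunc_kernel e y\<bar>)"
        using Bochner_Integration.integrable_diff[OF int[of n 0 0] int[of n "- w" 0]]
        by (simp add: left_diff_distrib)
      show "integrable lborel (\<lambda>y. (indicator {- real n - \<bar>w\<bar>..- real n + \<bar>w\<bar>} y + indicator {real n - \<bar>w\<bar>..real n + \<bar>w\<bar>} y) * (1 / (real n - \<bar>w\<bar>)))"
        by (intro integrable_mult_left Bochner_Integration.integrable_add integrable_indicator_Icc)
      fix y
      show "\<bar>(?I n y - ?I n (y + - w)) * trunc_kernel e y\<bar>
        \<le> (indicator {- real n - \<bar>w\<bar>..- real n + \<bar>w\<bar>} y + indicator {real n - \<bar>w\<bar>..real n + \<bar>w\<bar>} y) * (1 / (real n - \<bar>w\<bar>))"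
      proof (cases "?I n y = ?I n (y + - w)")
        case True
        then show ?thesis using n e by simp
      next
        case False
        then have a: "y \<in> {- real n - \<bar>w\<bar>..- real n + \<bar>w\<bar>} \<or> y \<in> {real n - \<bar>w\<bar>..real n + \<bar>w\<bar>}"
        proof -
          have "(y \<in> {- real n..real n}) \<noteq> (y + - w \<in> {- real n..real n})"
            using False by (auto simp: indicator_def)
          then show ?thesis unfolding atLeastAtMost_iff using n e by (smt (verit))
        qed
        then have "real n - \<bar>w\<bar> \<le> \<bar>y\<bar>" using n e by auto
        then have k: "\<bar>trunc_kernel e y\<bar> \<le> 1 / (real n - \<bar>w\<bar>)"
          using n e by (auto simp: trunc_kernel_def intro!: divide_left_mono)
        have "\<bar>(?I n y - ?I n (y + - w)) * trunc_kernel e y\<bar> \<le> 1 * (1 / (real n - \<bar>w\<bar>))"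
          unfolding abs_mult by (intro mult_mono k) (auto simp: indicator_def)
        also have "\<dots> \<le> (indicator {- real n - \<bar>w\<bar>..- real n + \<bar>w\<bar>} y + indicator {real n - \<bar>w\<bar>..real n + \<bar>w\<bar>} y) * (1 / (real n - \<bar>w\<bar>))"
          using a n e by (intro mult_right_mono) (auto simp: indicator_def)
        finally show ?thesis .
      qed
    qed
    also have "\<dots> = 4 * \<bar>w\<bar> * (1 / (real n - \<bar>w\<bar>))"
    proof -
      have "(LBINT y. (indicator {- real n - \<bar>w\<bar>..- real n + \<bar>w\<bar>} y :: real) + indicator {real n - \<bar>w\<bar>..real n + \<bar>w\<bar>} y)
        = (LBINT y. indicator {- real n - \<bar>w\<bar>..- real n + \<bar>w\<bar>} y) + (LBINT y. indicator {real n - \<bar>w\<bar>..real n + \<bar>w\<bar>} y)"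
        by (rule Bochner_Integration.integral_add) (rule integrable_indicator_Icc)+
      also have "\<dots> = (- real n + \<bar>w\<bar> - (- real n - \<bar>w\<bar>)) + (real n + \<bar>w\<bar> - (real n - \<bar>w\<bar>))"
        by (intro arg_cong2[of _ _ _ _ "(+)"] LBINT_indicator_Icc) linarith+
      also have "\<dots> = 4 * \<bar>w\<bar>" by simp
      finally show ?thesis unfolding integral_mult_left_zero by (rule arg_cong)
    qed
    finally show ?thesis .
  qed
  have "(\<lambda>n. LBINT y. ?I n y * ?D y) \<longlonglongrightarrow> 0"
  proof (rule Lim_null_comparison)
    show "\<forall>\<^sub>F n in sequentially. norm (LBINT y. ?I n y * ?D y) \<le> 4 * \<bar>w\<bar> * (1 / (real n - \<bar>w\<bar>))"
      using filterlim_at_top_dense[THEN iffD1, OF filterlim_real_sequentially, rule_format, of "\<bar>w\<bar> + e"]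
      by eventually_elim (use bound in \<open>unfold real_norm_def, blast\<close>)
    have "filterlim (\<lambda>n. real n - \<bar>w\<bar>) at_top sequentially"
      using filterlim_tendsto_add_at_top[OF tendsto_const filterlim_real_sequentially, of "- \<bar>w\<bar>"] by simp
    then have "(\<lambda>n. 1 / (real n - \<bar>w\<bar>)) \<longlonglongrightarrow> 0"
      by (intro real_tendsto_divide_at_top[OF tendsto_const])
    from tendsto_mult_right_zero[OF this] show "(\<lambda>n. 4 * \<bar>w\<bar> * (1 / (real n - \<bar>w\<bar>))) \<longlonglongrightarrow> 0" .
  qed
  with lim show ?thesis by (rule LIMSEQ_unique)
qed

text \<open>Partial fractions: off the two excluded intervals the product of the kernels is a multiple of
  their difference, whose integral vanishes; only the excluded intervals contribute.\<close>

lemma corr_kernel_decay: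
  assumes e: "e > 0" and w: "\<bar>w\<bar> \<ge> 2 * e"
  shows "\<bar>corr_kernel e w\<bar> \<le> 8 * e / w\<^sup>2"
proof -
  have w0: "w \<noteq> 0" using e w by auto
  let ?k = "trunc_kernel e"
  let ?A = "{- e..e}" and ?B = "{- w - e..- w + e}"
  have k: "\<bar>?k y\<bar> \<le> 2 / \<bar>w\<bar>" if "\<bar>y\<bar> \<ge> \<bar>w\<bar> - e" for y
  proof -
    have "\<bar>w\<bar> / 2 \<le> \<bar>y\<bar>" "\<bar>y\<bar> > 0" using that w e by auto
    then show ?thesis using w0 by (auto simp: trunc_kernel_def divide_simps)
  qed
  have pf: "w * (?k y * ?k (y + w)) = (?k y - ?k (y + w)) + (indicator ?A y * ?k (y + w) - indicator ?B y * ?k y)" for y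
  proof -
    consider "e < \<bar>y\<bar>" "e < \<bar>y + w\<bar>" | "\<bar>y\<bar> \<le> e" "e < \<bar>y + w\<bar>" | "e < \<bar>y\<bar>" "\<bar>y + w\<bar> \<le> e" | "\<bar>y\<bar> \<le> e" "\<bar>y + w\<bar> \<le> e"
      by linarith
    then show ?thesis
    proof cases
      case 1
      then have "y \<noteq> 0" "y + w \<noteq> 0" "y \<notin> ?A" "y \<notin> ?B" using e by auto
      then have ind: "indicator ?A y = (0::real)" "indicator ?B y = (0::real)" and n: "y \<noteq> 0" "y + w \<noteq> 0"
        by auto
      have kk: "?k y = 1 / y" "?k (y + w) = 1 / (y + w)" using 1 by (simp_all add: trunc_kernel_def)
      show ?thesis unfolding ind kk using n by (simp add: field_simps)
    next
      case 2
      then have "y \<in> ?A" "y \<notin> ?B" by auto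
      then show ?thesis using 2 by (simp add: trunc_kernel_def indicator_def)
    next
      case 3
      then have "y \<notin> ?A" "y \<in> ?B" by auto
      then show ?thesis using 3 by (simp add: trunc_kernel_def indicator_def)
    next
      case 4
      then show ?thesis by (auto simp: trunc_kernel_def indicator_def)
    qed
  qed
  have bi: "integrable lborel (\<lambda>y. indicator {p..q} y * ?k (y + a))" for p q a
  proof (rule Bochner_Integration.integrable_bound)
    show "integrable lborel (\<lambda>y. 1 / e * indicator {p..q} y)"
      by (intro integrable_mult_right integrable_indicator_Icc)
    show "AE y in lborel. norm (indicator {p..q} y * ?k (y + a)) \<le> norm (1 / e * indicator {p..q} y)"
      using trunc_kernel_bound[OF e] e by (intro AE_I2) (auto simp: indicator_def)
  qed measurable
  have iA: "integrable lborel (\<lambda>y. indicator ?A y * ?k (y + w))" by (rule bi)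
  have iB: "integrable lborel (\<lambda>y. indicator ?B y * ?k y)" using bi[where a = 0] by simp
  have ip: "integrable lborel (\<lambda>y. w * (?k y * ?k (y + w)))"
    using trunc_kernel_prod_integrable[OF e, of 0 w] by simp
  have eqD: "(\<lambda>y. ?k y - ?k (y + w)) = (\<lambda>y. w * (?k y * ?k (y + w)) - (indicator ?A y * ?k (y + w) - indicator ?B y * ?k y))"
    unfolding pf by simp
  have iD: "integrable lborel (\<lambda>y. ?k y - ?k (y + w))"
    unfolding eqD by (intro Bochner_Integration.integrable_diff iA iB ip)
  have "w * corr_kernel e w = (LBINT y. w * (?k y * ?k (y + w)))"
    unfolding corr_kernel_def by simp
  also have "\<dots> = (LBINT y. (?k y - ?k (y + w)) + (indicator ?A y * ?k (y + w) - indicator ?B y * ?k y))"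
    unfolding pf ..
  also have "\<dots> = (LBINT y. indicator ?A y * ?k (y + w)) - (LBINT y. indicator ?B y * ?k y)"
    using iA iB iD trunc_kernel_diff_integral[OF e iD] by simp
  finally have 1: "w * corr_kernel e w = (LBINT y. indicator ?A y * ?k (y + w)) - (LBINT y. indicator ?B y * ?k y)" .
  have small: "\<bar>LBINT y. indicator {p - e..p + e} y * g y\<bar> \<le> 4 * e / \<bar>w\<bar>"
    if "\<And>y. y \<in> {p - e..p + e} \<Longrightarrow> \<bar>g y\<bar> \<le> 2 / \<bar>w\<bar>" "integrable lborel (\<lambda>y. indicator {p - e..p + e} y * g y)" for p g
  proof -
    have "\<bar>LBINT y. indicator {p - e..p + e} y * g y\<bar> \<le> (LBINT y. indicator {p - e..p + e} y * (2 / \<bar>w\<bar>))"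
    proof (rule order_trans[OF integral_abs_bound], rule integral_mono)
      show "integrable lborel (\<lambda>y. indicator {p - e..p + e} y * (2 / \<bar>w\<bar>))"
        by (intro integrable_mult_left integrable_indicator_Icc)
    qed (use that in \<open>auto simp: indicator_def\<close>)
    also have "\<dots> = 4 * e / \<bar>w\<bar>" using e by simp
    finally show ?thesis .
  qed
  have "\<bar>LBINT y. indicator ?A y * ?k (y + w)\<bar> \<le> 4 * e / \<bar>w\<bar>"
    using small[of 0 "\<lambda>y. ?k (y + w)"] iA k by force
  moreover have "\<bar>LBINT y. indicator ?B y * ?k y\<bar> \<le> 4 * e / \<bar>w\<bar>"
    using small[of "- w" ?k] iB k by force
  ultimately have "\<bar>w\<bar> * \<bar>corr_kernel e w\<bar> \<le> 8 * e / \<bar>w\<bar>"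
    unfolding abs_mult[symmetric] 1 by (simp add: abs_le_iff)
  moreover have "w\<^sup>2 = \<bar>w\<bar> * \<bar>w\<bar>" by (simp add: power2_eq_square)
  ultimately show ?thesis using w0 by (simp add: field_simps del: abs_mult_self_eq)
qed

lemma corr_kernel_bound:
  assumes e: "e > 0"
  shows "\<bar>corr_kernel e w\<bar> \<le> 2 / e"
proof -
  have "ennreal \<bar>corr_kernel e w\<bar> \<le> (\<integral>\<^sup>+y. ennreal \<bar>trunc_kernel e y * trunc_kernel e (y + w)\<bar> \<partial>lborel)"
    unfolding corr_kernel_def using integral_norm_bound_ennreal[OF trunc_kernel_prod_integrable[OF e, of 0 w]] by simp
  also have "\<dots> \<le> ennreal (2 / e)"
    using trunc_kernel_prod_nn_integral[OF e, of 0 w] by simp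
  finally show ?thesis using e by simp
qed

lemma corr_kernel_measurable [measurable]: "corr_kernel e \<in> borel_measurable borel"
  unfolding corr_kernel_def[abs_def] by measurable

text \<open>The constant is independent of \<open>e\<close> by scaling: the bound
  \<open>2 / e\<close> on \<open>\<bar>w\<bar> \<le> 2 e\<close> contributes 8, and the decay
  \<open>8 e / w^2\<close> contributes 4 on each side.\<close>

lemma corr_kernel_L1:
  assumes e: "e > 0"
  shows "(\<integral>\<^sup>+w. ennreal \<bar>corr_kernel e w\<bar> \<partial>lborel) \<le> 16"
proof -
  let ?t = "\<lambda>w::real. ennreal (8 * e * inverse (w\<^sup>2)) * indicator {2 * e..} w"
  have t: "(\<integral>\<^sup>+w. ?t w \<partial>lborel) = ennreal 4"
  proof -
    have "((\<lambda>y::real. - (8 * e) * inverse y) \<longlongrightarrow> - (8 * e) * 0) at_top"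
      by (intro tendsto_mult tendsto_const tendsto_inverse_0_at_top filterlim_ident)
    then have "(\<integral>\<^sup>+w. ?t w \<partial>lborel) = ennreal (0 - (- (8 * e) * inverse (2 * e)))"
      using e by (intro nn_integral_FTC_atLeast)
        (auto intro!: derivative_eq_intros simp: power2_eq_square field_simps)
    then show ?thesis using e by (simp add: field_simps)
  qed
  have "(\<integral>\<^sup>+w. ennreal \<bar>corr_kernel e w\<bar> \<partial>lborel)
    \<le> (\<integral>\<^sup>+w. (?t w + ?t (- w)) + ennreal (2 / e) * indicator {- 2 * e..2 * e} w \<partial>lborel)"
  proof (intro nn_integral_mono)
    fix w
    show "ennreal \<bar>corr_kernel e w\<bar> \<le> (?t w + ?t (- w)) + ennreal (2 / e) * indicator {- 2 * e..2 * e} w"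
    proof (cases "\<bar>w\<bar> \<ge> 2 * e")
      case True
      have "ennreal \<bar>corr_kernel e w\<bar> \<le> ennreal (8 * e * inverse (w\<^sup>2))"
        using corr_kernel_decay[OF e True] by (simp add: ennreal_leI inverse_eq_divide)
      also have "\<dots> \<le> ?t w + ?t (- w)"
        using True e by (cases "w \<ge> 0") (auto simp: indicator_def)
      finally show ?thesis by (simp add: add_increasing2)
    next
      case False
      then have "w \<in> {- 2 * e..2 * e}" by auto
      then show ?thesis using corr_kernel_bound[OF e, of w] by (simp add: add_increasing ennreal_leI)
    qed
  qed
  also have "\<dots> = ((\<integral>\<^sup>+w. ?t w \<partial>lborel) + (\<integral>\<^sup>+w. ?t (- w) \<partial>lborel)) + ennreal (2 / e) * emeasure lborel {- 2 * e..2 * e}"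
    by (subst nn_integral_add, measurable, subst nn_integral_add, measurable) (simp add: nn_integral_cmult_indicator)
  also have "(\<integral>\<^sup>+w. ?t (- w) \<partial>lborel) = (\<integral>\<^sup>+w. ?t w \<partial>lborel)"
    using nn_integral_real_affine[of ?t "-1" 0] by simp
  also have "ennreal (2 / e) * emeasure lborel {- 2 * e..2 * e} = ennreal 8"
    using e by (simp flip: ennreal_mult)
  also have "(\<integral>\<^sup>+w. ?t w \<partial>lborel) + (\<integral>\<^sup>+w. ?t w \<partial>lborel) + ennreal 8 = 16"
    unfolding t by (simp flip: ennreal_plus)
  finally show ?thesis .
qed

text \<open>Fubini turns the square into the quadratic form of \<open>corr_kernel\<close>; as
  \<open>h\<close> is integrable, the triple integral converges absolutely. The form is estimated as
  in Schur's test, by half the sum of the squares of the two values of \<open>h\<close> and the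
  \<open>L^1\<close> norm of the kernel.\<close>

lemma trunc_hilbert_L2:
  assumes h: "integrable lborel h" and e: "e > 0"
  shows "(\<integral>\<^sup>+x. ennreal ((trunc_hilbert e h x)\<^sup>2) \<partial>lborel) \<le> 16 * (\<integral>\<^sup>+x. ennreal ((h x)\<^sup>2) \<partial>lborel)"
proof -
  have [measurable]: "h \<in> borel_measurable borel" using h by auto
  let ?k = "trunc_kernel e"
  let ?P = "lborel \<Otimes>\<^sub>M lborel :: (real \<times> real) measure"
  let ?G = "\<lambda>p x. h (fst p) * h (snd p) * (?k (x - fst p) * ?k (x - snd p))"
  let ?F = "\<lambda>z. ?G (fst z) (snd z)"
  interpret P: pair_sigma_finite ?P "lborel :: real measure"
    unfolding pair_sigma_finite_def by (simp add: lborel.sigma_finite_measure_axioms lborel_pair.sigma_finite_measure_axioms)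
  have inner: "(LBINT x. ?k (x - u) * ?k (x - v)) = corr_kernel e (u - v)" for u v
    unfolding corr_kernel_def
    using lborel_integral_real_affine[of 1 "\<lambda>x. ?k (x - u) * ?k (x - v)" u] by (simp add: algebra_simps)
  have hi: "(\<integral>\<^sup>+u. ennreal \<bar>h u\<bar> \<partial>lborel) < \<infinity>" using h by (simp add: integrable_iff_bounded)
  have intF: "integrable (?P \<Otimes>\<^sub>M lborel) ?F"
  proof (rule integrableI_bounded)
    show "?F \<in> borel_measurable (?P \<Otimes>\<^sub>M lborel)" by simp
    have "(\<integral>\<^sup>+z. ennreal (norm (?F z)) \<partial>(?P \<Otimes>\<^sub>M lborel))
      = (\<integral>\<^sup>+p. \<integral>\<^sup>+x. ennreal (norm (?G p x)) \<partial>lborel \<partial>?P)"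
      by (subst lborel.nn_integral_fst[symmetric]) measurable
    also have "\<dots> \<le> (\<integral>\<^sup>+p. ennreal \<bar>h (fst p)\<bar> * ennreal \<bar>h (snd p)\<bar> * ennreal (2 / e) \<partial>?P)"
    proof (intro nn_integral_mono)
      fix p :: "real \<times> real"
      obtain u v where p: "p = (u, v)" by force
      have "(\<integral>\<^sup>+x. ennreal (norm (?G p x)) \<partial>lborel) = (\<integral>\<^sup>+x. ennreal (\<bar>h u\<bar> * \<bar>h v\<bar>) * ennreal \<bar>?k (x + - u) * ?k (x + - v)\<bar> \<partial>lborel)"
        unfolding p by (intro nn_integral_cong) (simp add: abs_mult ennreal_mult[symmetric])
      also have "\<dots> = ennreal (\<bar>h u\<bar> * \<bar>h v\<bar>) * (\<integral>\<^sup>+x. ennreal \<bar>?k (x + - u) * ?k (x + - v)\<bar> \<partial>lborel)"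
        by (intro nn_integral_cmult) measurable
      also have "\<dots> \<le> ennreal (\<bar>h u\<bar> * \<bar>h v\<bar>) * ennreal (2 / e)"
        by (intro mult_left_mono trunc_kernel_prod_nn_integral e) simp
      finally show "(\<integral>\<^sup>+x. ennreal (norm (?G p x)) \<partial>lborel) \<le> ennreal \<bar>h (fst p)\<bar> * ennreal \<bar>h (snd p)\<bar> * ennreal (2 / e)"
        unfolding p by (simp add: ennreal_mult)
    qed
    also have "\<dots> = (\<integral>\<^sup>+u. \<integral>\<^sup>+v. ennreal \<bar>h u\<bar> * ennreal \<bar>h v\<bar> * ennreal (2 / e) \<partial>lborel \<partial>lborel)"
      by (subst lborel.nn_integral_fst[symmetric]) auto
    also have "\<dots> = (\<integral>\<^sup>+u. ennreal \<bar>h u\<bar> \<partial>lborel) * (\<integral>\<^sup>+v. ennreal \<bar>h v\<bar> \<partial>lborel) * ennreal (2 / e)"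
      by (simp add: nn_integral_cmult nn_integral_multc)
    also have "\<dots> < \<infinity>" using hi by (simp add: ennreal_mult_less_top)
    finally show "(\<integral>\<^sup>+z. ennreal (norm (?F z)) \<partial>(?P \<Otimes>\<^sub>M lborel)) < \<infinity>" .
  qed
  have sq: "(\<integral>p. ?G p x \<partial>?P) = (trunc_hilbert e h x)\<^sup>2" for x
  proof -
    let ?a = "\<lambda>u. h u * ?k (x - u)"
    have a: "integrable lborel ?a" by (rule trunc_hilbert_integrable[OF h e])
    have "integrable ?P (\<lambda>p. ?a (fst p) * ?a (snd p))"
    proof (rule lborel_pair.Fubini_integrable)
      show "(\<lambda>p. ?a (fst p) * ?a (snd p)) \<in> borel_measurable ?P" by simp
      have "integrable lborel (\<lambda>u. \<bar>?a u\<bar> * (LBINT v. \<bar>?a v\<bar>))" using a by (intro integrable_mult_left integrable_abs)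
      then show "integrable lborel (\<lambda>u. LBINT v. norm (?a (fst (u, v)) * ?a (snd (u, v))))"
        unfolding fst_conv snd_conv real_norm_def abs_mult[of "?a _"] integral_mult_right_zero .
      show "AE u in lborel. integrable lborel (\<lambda>v. ?a (fst (u, v)) * ?a (snd (u, v)))"
        unfolding fst_conv snd_conv by (intro AE_I2 integrable_mult_right a)
    qed
    from lborel_pair.integral_fst'[OF this]
    have "(\<integral>p. ?a (fst p) * ?a (snd p) \<partial>?P) = (\<integral>u. \<integral>v. ?a u * ?a v \<partial>lborel \<partial>lborel)"
      by simp
    also have "\<dots> = (trunc_hilbert e h x)\<^sup>2"
      unfolding trunc_hilbert_def by (simp add: power2_eq_square)
    finally show ?thesis by (simp add: mult_ac)
  qed
  have int2: "integrable lborel (\<lambda>x. (trunc_hilbert e h x)\<^sup>2)"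
    using P.integrable_snd[of ?G] intF by (simp only: sq case_prod_unfold)
  have "(LBINT x. (trunc_hilbert e h x)\<^sup>2) = (LBINT x. (\<integral>p. ?G p x \<partial>?P))" unfolding sq ..
  also have "\<dots> = (\<integral>p. (LBINT x. ?G p x) \<partial>?P)"
    using P.Fubini_integral[of ?G] intF by (simp only: case_prod_unfold)
  also have "\<dots> = (\<integral>p. h (fst p) * h (snd p) * corr_kernel e (fst p - snd p) \<partial>?P)"
    by (intro Bochner_Integration.integral_cong refl) (simp add: case_prod_beta inner)
  finally have eq: "(LBINT x. (trunc_hilbert e h x)\<^sup>2) = (\<integral>p. h (fst p) * h (snd p) * corr_kernel e (fst p - snd p) \<partial>?P)" .
  have "(\<integral>\<^sup>+x. ennreal ((trunc_hilbert e h x)\<^sup>2) \<partial>lborel) = ennreal (LBINT x. (trunc_hilbert e h x)\<^sup>2)"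
    using int2 by (intro nn_integral_eq_integral) auto
  also have "\<dots> \<le> ennreal \<bar>LBINT x. (trunc_hilbert e h x)\<^sup>2\<bar>" by (intro ennreal_leI) simp
  also have "\<dots> \<le> (\<integral>\<^sup>+p. ennreal \<bar>h (fst p) * h (snd p) * corr_kernel e (fst p - snd p)\<bar> \<partial>?P)"
  \<comment> \<open>The Bochner integral of a nonintegrable function is \<open>0\<close>, so the
    bound holds in that case as well.\<close>
  proof (cases "integrable ?P (\<lambda>p. h (fst p) * h (snd p) * corr_kernel e (fst p - snd p))")
    case True
    then show ?thesis unfolding eq using integral_norm_bound_ennreal[OF True] by simp
  next
    case False
    then show ?thesis unfolding eq by (simp add: not_integrable_integral_eq)
  qed
  also have "\<dots> \<le> (\<integral>\<^sup>+p. ennreal (1/2) * (ennreal ((h (fst p))\<^sup>2) * ennreal \<bar>corr_kernel e (fst p - snd p)\<bar>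
      + ennreal ((h (snd p))\<^sup>2) * ennreal \<bar>corr_kernel e (fst p - snd p)\<bar>) \<partial>?P)"
  proof (intro nn_integral_mono)
    fix p :: "real \<times> real"
    have "\<bar>h (fst p) * h (snd p)\<bar> \<le> 1/2 * ((h (fst p))\<^sup>2 + (h (snd p))\<^sup>2)"
      using sum_squares_bound[of "\<bar>h (fst p)\<bar>" "\<bar>h (snd p)\<bar>"] by (simp add: abs_mult)
    then have "\<bar>h (fst p) * h (snd p) * corr_kernel e (fst p - snd p)\<bar>
      \<le> 1/2 * ((h (fst p))\<^sup>2 + (h (snd p))\<^sup>2) * \<bar>corr_kernel e (fst p - snd p)\<bar>"
      unfolding abs_mult[of "h (fst p) * h (snd p)"] by (intro mult_right_mono) auto
    then have "ennreal \<bar>h (fst p) * h (snd p) * corr_kernel e (fst p - snd p)\<bar>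
      \<le> ennreal (1/2 * ((h (fst p))\<^sup>2 + (h (snd p))\<^sup>2) * \<bar>corr_kernel e (fst p - snd p)\<bar>)"
      by (rule ennreal_leI)
    also have "\<dots> = ennreal (1/2) * (ennreal ((h (fst p))\<^sup>2) * ennreal \<bar>corr_kernel e (fst p - snd p)\<bar>
      + ennreal ((h (snd p))\<^sup>2) * ennreal \<bar>corr_kernel e (fst p - snd p)\<bar>)"
      by (subst ennreal_mult, simp, simp, subst ennreal_mult, simp, simp, subst ennreal_plus, simp, simp) 
        (simp add: algebra_simps)
    finally show "ennreal \<bar>h (fst p) * h (snd p) * corr_kernel e (fst p - snd p)\<bar>
      \<le> ennreal (1/2) * (ennreal ((h (fst p))\<^sup>2) * ennreal \<bar>corr_kernel e (fst p - snd p)\<bar>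
      + ennreal ((h (snd p))\<^sup>2) * ennreal \<bar>corr_kernel e (fst p - snd p)\<bar>)" .
  qed
  also have "\<dots> = ennreal (1/2) * ((\<integral>\<^sup>+p. ennreal ((h (fst p))\<^sup>2) * ennreal \<bar>corr_kernel e (fst p - snd p)\<bar> \<partial>?P)
      + (\<integral>\<^sup>+p. ennreal ((h (snd p))\<^sup>2) * ennreal \<bar>corr_kernel e (fst p - snd p)\<bar> \<partial>?P))"
    by (subst nn_integral_cmult, measurable, subst nn_integral_add) measurable
  also have "\<dots> \<le> ennreal (1/2) * ((\<integral>\<^sup>+u. ennreal ((h u)\<^sup>2) \<partial>lborel) * 16 + (\<integral>\<^sup>+u. ennreal ((h u)\<^sup>2) \<partial>lborel) * 16)"
  proof (intro mult_left_mono add_mono)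
    have "(\<integral>\<^sup>+p. ennreal ((h (fst p))\<^sup>2) * ennreal \<bar>corr_kernel e (fst p - snd p)\<bar> \<partial>?P)
      = (\<integral>\<^sup>+u. \<integral>\<^sup>+v. ennreal ((h u)\<^sup>2) * ennreal \<bar>corr_kernel e (u - v)\<bar> \<partial>lborel \<partial>lborel)"
      by (subst lborel.nn_integral_fst[symmetric]) auto
    also have "\<dots> = (\<integral>\<^sup>+u. ennreal ((h u)\<^sup>2) * (\<integral>\<^sup>+v. ennreal \<bar>corr_kernel e (u - v)\<bar> \<partial>lborel) \<partial>lborel)"
      by (intro nn_integral_cong nn_integral_cmult) measurable
    also have "\<dots> = (\<integral>\<^sup>+u. ennreal ((h u)\<^sup>2) * (\<integral>\<^sup>+v. ennreal \<bar>corr_kernel e v\<bar> \<partial>lborel) \<partial>lborel)"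
      using nn_integral_real_affine[of "\<lambda>v. ennreal \<bar>corr_kernel e v\<bar>" "-1"] by simp
    also have "\<dots> \<le> (\<integral>\<^sup>+u. ennreal ((h u)\<^sup>2) * 16 \<partial>lborel)"
      by (intro nn_integral_mono mult_left_mono corr_kernel_L1 e) simp
    also have "\<dots> = (\<integral>\<^sup>+u. ennreal ((h u)\<^sup>2) \<partial>lborel) * 16"
      by (intro nn_integral_multc) measurable
    finally show "(\<integral>\<^sup>+p. ennreal ((h (fst p))\<^sup>2) * ennreal \<bar>corr_kernel e (fst p - snd p)\<bar> \<partial>?P)
      \<le> (\<integral>\<^sup>+u. ennreal ((h u)\<^sup>2) \<partial>lborel) * 16" .
    have "(\<integral>\<^sup>+p. ennreal ((h (snd p))\<^sup>2) * ennreal \<bar>corr_kernel e (fst p - snd p)\<bar> \<partial>?P)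
      = (\<integral>\<^sup>+v. \<integral>\<^sup>+u. ennreal ((h v)\<^sup>2) * ennreal \<bar>corr_kernel e (u - v)\<bar> \<partial>lborel \<partial>lborel)"
      by (subst lborel_pair.nn_integral_snd[symmetric]) auto
    also have "\<dots> = (\<integral>\<^sup>+v. ennreal ((h v)\<^sup>2) * (\<integral>\<^sup>+u. ennreal \<bar>corr_kernel e (u - v)\<bar> \<partial>lborel) \<partial>lborel)"
      by (intro nn_integral_cong nn_integral_cmult) measurable
    also have "\<dots> = (\<integral>\<^sup>+v. ennreal ((h v)\<^sup>2) * (\<integral>\<^sup>+u. ennreal \<bar>corr_kernel e u\<bar> \<partial>lborel) \<partial>lborel)"
    proof (intro nn_integral_cong, goal_cases)
      case (1 v)
      show ?case using nn_integral_real_affine[of "\<lambda>v. ennreal \<bar>corr_kernel e v\<bar>" 1 "- v"] by simp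
    qed
    also have "\<dots> \<le> (\<integral>\<^sup>+u. ennreal ((h u)\<^sup>2) * 16 \<partial>lborel)"
      by (intro nn_integral_mono mult_left_mono corr_kernel_L1 e) simp
    also have "\<dots> = (\<integral>\<^sup>+u. ennreal ((h u)\<^sup>2) \<partial>lborel) * 16"
      by (intro nn_integral_multc) measurable
    finally show "(\<integral>\<^sup>+p. ennreal ((h (snd p))\<^sup>2) * ennreal \<bar>corr_kernel e (fst p - snd p)\<bar> \<partial>?P)
      \<le> (\<integral>\<^sup>+u. ennreal ((h u)\<^sup>2) \<partial>lborel) * 16" .
  qed simp
  also have "\<dots> = 16 * (\<integral>\<^sup>+x. ennreal ((h x)\<^sup>2) \<partial>lborel)"
  proof -
    have h2: "ennreal (1/2) * (z * 16 + z * 16) = 16 * z" for z :: ennreal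
    proof -
      have "z * 16 + z * 16 = z * 32" by (simp flip: distrib_left)
      moreover have "ennreal (1/2) * (z * 32) = z * (ennreal (1/2) * ennreal 32)" by (simp add: mult_ac)
      moreover have "ennreal (1/2) * ennreal 32 = 16" by (subst ennreal_mult[symmetric]) auto
      ultimately show ?thesis by (simp add: mult.commute)
    qed
    show ?thesis by (rule h2)
  qed
  finally show ?thesis .
qed

section \<open>Rearrangements\<close>

lemma down_closed_borel:
  fixes S :: "real set"
  assumes "\<And>x y. x \<in> S \<Longrightarrow> y \<le> x \<Longrightarrow> y \<in> S"
  shows "S \<in> sets borel"
proof (cases "bdd_above S \<and> S \<noteq> {}")
  case True
  have "S = {..<Sup S} \<union> (S \<inter> {Sup S})"
  proof (intro equalityI subsetI)
    fix x assume "x \<in> S"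
    then have "x \<le> Sup S" using True by (intro cSup_upper) auto
    then show "x \<in> {..<Sup S} \<union> (S \<inter> {Sup S})" using \<open>x \<in> S\<close> by auto
  next
    fix x assume "x \<in> {..<Sup S} \<union> (S \<inter> {Sup S})"
    then show "x \<in> S" using True assms less_cSup_iff[of S x] by (auto dest: less_imp_le)
  qed
  moreover have "{..<Sup S} \<union> (S \<inter> {Sup S}) \<in> sets borel"
    by (cases "Sup S \<in> S") auto
  ultimately show ?thesis by metis
next
  case False
  have "S = UNIV" if ne: "S \<noteq> {}"
  proof -
    have "x \<in> S" for x
    proof -
      obtain y where "y \<in> S" "x < y"
        using False ne unfolding bdd_above_def by (meson not_le)
      then show ?thesis using assms less_imp_le by blast
    qed
    then show ?thesis by auto
  qed
  then show ?thesis by (cases "S = {}") auto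
qed

lemma antimono_borel_measurable_ennreal:
  fixes g :: "real \<Rightarrow> ennreal"
  assumes "\<And>x y. x \<le> y \<Longrightarrow> g y \<le> g x"
  shows "g \<in> borel_measurable borel"
proof (rule borel_measurableI_greater)
  fix c
  show "{x \<in> space borel. c < g x} \<in> sets borel"
    by (rule down_closed_borel) (use assms in \<open>auto intro: less_le_trans\<close>)
qed

lemma rearrangement_antimono: "t \<le> t' \<Longrightarrow> rearrangement M f t' \<le> rearrangement M f t"
  unfolding rearrangement_def
  by (rule Inf_superset_mono) (use order_trans[OF _ ennreal_leI] in blast)

lemma rearrangement_measurable [measurable]: "rearrangement M f \<in> borel_measurable borel"
  by (rule antimono_borel_measurable_ennreal[OF rearrangement_antimono])

lemma rearrangement_le:
  assumes "s \<ge> 0" "emeasure M {x \<in> space M. s < \<bar>f x\<bar>} \<le> ennreal t"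
  shows "rearrangement M f t \<le> ennreal s"
  unfolding rearrangement_def using assms by (intro Inf_lower) auto

text \<open>The distribution function is right continuous, so a measure above \<open>t\<close> at
  height \<open>s\<close> stays above \<open>t\<close> at some height
  \<open>s + 1 / (n + 1)\<close>. The equivalence lets distribution function and rearrangement be
  exchanged in double integrals over level sets.\<close>

lemma rearrangement_gt_iff:
  assumes [measurable]: "f \<in> borel_measurable M" and "s \<ge> 0"
  shows "ennreal s < rearrangement M f t \<longleftrightarrow> ennreal t < emeasure M {x \<in> space M. s < \<bar>f x\<bar>}"
proof
  assume *: "ennreal s < rearrangement M f t"
  show "ennreal t < emeasure M {x \<in> space M. s < \<bar>f x\<bar>}"
    using rearrangement_le[OF assms(2), of M f t] * by (meson not_le)
next
  assume *: "ennreal t < emeasure M {x \<in> space M. s < \<bar>f x\<bar>}"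
  let ?A = "\<lambda>n. {x \<in> space M. s + 1 / real (Suc n) < \<bar>f x\<bar>}"
  have "{x \<in> space M. s < \<bar>f x\<bar>} = (\<Union>n. ?A n)"
  proof (intro equalityI subsetI)
    fix x assume x: "x \<in> {x \<in> space M. s < \<bar>f x\<bar>}"
    then obtain n where "1 / real (Suc n) < \<bar>f x\<bar> - s"
      using reals_Archimedean[of "\<bar>f x\<bar> - s"] by (auto simp: inverse_eq_divide)
    then show "x \<in> (\<Union>n. ?A n)" using x by (auto intro!: exI[of _ n])
  next
    fix x assume "x \<in> (\<Union>n. ?A n)"
    then obtain n where "x \<in> space M" "s + 1 / real (Suc n) < \<bar>f x\<bar>" by auto
    moreover have "1 / real (Suc n) > 0" by simp
    ultimately show "x \<in> {x \<in> space M. s < \<bar>f x\<bar>}" by (smt (verit) mem_Collect_eq)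
  qed
  moreover have "(SUP n. emeasure M (?A n)) = emeasure M (\<Union>n. ?A n)"
  proof (intro SUP_emeasure_incseq)
    show "incseq ?A"
    proof (rule incseq_SucI)
      fix n
      have "1 / real (Suc (Suc n)) \<le> 1 / real (Suc n)" by (intro divide_left_mono) auto
      then show "?A n \<subseteq> ?A (Suc n)" by auto
    qed
  qed auto
  ultimately have "ennreal t < (SUP n. emeasure M (?A n))" using * by simp
  then obtain n where n: "ennreal t < emeasure M (?A n)" by (auto simp: less_SUP_iff)
  have "ennreal (s + 1 / real (Suc n)) \<le> rearrangement M f t"
    unfolding rearrangement_def
  proof (rule Inf_greatest, clarify)
    fix s' assume s': "0 \<le> s'" "emeasure M {x \<in> space M. s' < \<bar>f x\<bar>} \<le> ennreal t"
    show "ennreal (s + 1 / real (Suc n)) \<le> ennreal s'"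
    proof (rule ccontr)
      assume "\<not> ?thesis"
      then have "s' < s + 1 / real (Suc n)" using ennreal_leI not_le by blast
      then have "emeasure M (?A n) \<le> emeasure M {x \<in> space M. s' < \<bar>f x\<bar>}"
        by (intro emeasure_mono) auto
      then show False using n s' by (meson leD le_less_trans order_trans not_le)
    qed
  qed
  moreover have "ennreal s < ennreal (s + 1 / real (Suc n))"
    using assms(2) by (intro ennreal_lessI add_nonneg_pos) auto
  ultimately show "ennreal s < rearrangement M f t" by simp
qed

section \<open>Layer cake estimates\<close>

lemma nn_integral_layer:
  fixes r :: ennreal
  shows "(\<integral>\<^sup>+s. indicator {s. 0 < s \<and> ennreal s < r} s \<partial>lborel) = r"
proof (cases r)
  case (real a)
  then have "{s. 0 < s \<and> ennreal s < r} = {0<..<a}" by (auto simp: ennreal_less_iff)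
  then show ?thesis using real by simp
next
  case top
  then have "{s. 0 < s \<and> ennreal s < r} = {0<..}" by auto
  moreover have "emeasure lborel {0::real<..} = \<infinity>"
  proof -
    have "ennreal (real n) \<le> emeasure lborel {0::real<..}" for n
    proof -
      have "ennreal (real n) = emeasure lborel {0<..<real n}" by simp
      also have "\<dots> \<le> emeasure lborel {0::real<..}" by (intro emeasure_mono) auto
      finally show ?thesis .
    qed
    then show ?thesis
    proof (cases "emeasure lborel {0::real<..}")
      case (real a)
      obtain n where "a < real n" using reals_Archimedean2 by blast
      then have "ennreal a < ennreal (real n)" using real by (intro ennreal_lessI) auto
      then show ?thesis using \<open>\<And>n. ennreal (real n) \<le> _\<close>[of n] real by (simp add: not_less[symmetric] \<open>a < real n\<close>)
    qed simp
  qed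
  ultimately show ?thesis using top by simp
qed

lemma nn_integral_layer_measurable [measurable]:
  fixes r :: "'a \<Rightarrow> ennreal"
  assumes [measurable]: "r \<in> borel_measurable M"
  shows "(\<lambda>p. indicator {s. 0 < s \<and> ennreal s < r (fst p)} (snd p) :: ennreal) \<in> borel_measurable (M \<Otimes>\<^sub>M borel)"
proof -
  have "(\<lambda>p. indicator {p \<in> space (M \<Otimes>\<^sub>M borel). 0 < snd p \<and> ennreal (snd p) < r (fst p)} p :: ennreal) \<in> borel_measurable (M \<Otimes>\<^sub>M borel)"
    by measurable
  then show ?thesis
    by (rule measurable_cong[THEN iffD1, rotated]) (auto simp: indicator_def)
qed

lemma nn_integral_inverse_Icc:
  assumes "0 < a" "a \<le> b"
  shows "(\<integral>\<^sup>+x. ennreal (1 / x) * indicator {a..b} x \<partial>lborel) = ennreal (ln (b / a))"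
proof -
  have "(\<integral>\<^sup>+x. ennreal (1 / x) * indicator {a..b} x \<partial>lborel) = ennreal (ln b - ln a)"
    using assms by (intro nn_integral_FTC_Icc) (auto intro!: derivative_eq_intros)
  then show ?thesis using assms by (simp add: ln_div)
qed

lemma nn_integral_inverse_square_atLeast:
  assumes "(0::real) < a"
  shows "(\<integral>\<^sup>+x. ennreal (1 / x\<^sup>2) * indicator {a..} x \<partial>lborel) = ennreal (1 / a)"
proof -
  have "((\<lambda>y::real. - inverse y) \<longlongrightarrow> - 0) at_top"
    by (intro tendsto_minus tendsto_inverse_0_at_top filterlim_ident)
  then have "(\<integral>\<^sup>+x. ennreal (1 / x\<^sup>2) * indicator {a..} x \<partial>lborel) = ennreal (0 - (- inverse a))"
    using assms by (intro nn_integral_FTC_atLeast)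
      (auto intro!: derivative_eq_intros simp: power2_eq_square field_simps)
  then show ?thesis by (simp add: inverse_eq_divide)
qed

text \<open>The bound \<open>b\<close> is used up to \<open>t / b\<close>, then \<open>K / l\<close>
  up to 1, then \<open>K / l^2\<close>. The middle range gives \<open>K * ln (b / t)\<close>; it is
  written as an integral of \<open>1 / u\<close> so that it can later be exchanged with an integral
  over the levels of another function.\<close>

lemma capped_tail_integral:
  fixes g :: "real \<Rightarrow> ennreal"
  assumes [measurable]: "g \<in> borel_measurable borel" and b: "b \<ge> 0" and K: "K \<ge> 0" and t: "t > 0"
    and g: "\<And>l. l > 0 \<Longrightarrow> g l \<le> ennreal b" "\<And>l. l > 0 \<Longrightarrow> g l \<le> ennreal (K / l)"
      "\<And>l. l > 0 \<Longrightarrow> g l \<le> ennreal (K / l\<^sup>2)"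
  shows "(\<integral>\<^sup>+l. g l * indicator {0<..} l \<partial>lborel)
    \<le> ennreal (t + K) + ennreal K * (\<integral>\<^sup>+u. ennreal (1 / u) * indicator {t<..<b} u \<partial>lborel)"
proof -
  have K2: "ennreal (K / l\<^sup>2) = ennreal K * ennreal (1 / l\<^sup>2)" for l :: real
    using K by (simp flip: ennreal_mult)
  have tail: "(\<integral>\<^sup>+l. ennreal (K / l\<^sup>2) * indicator {1..} l \<partial>lborel) = ennreal K"
    unfolding K2 using nn_integral_inverse_square_atLeast[of 1]
    by (simp add: mult.assoc nn_integral_cmult)
  show ?thesis
  proof (cases "b \<le> t")
    case True
    have "(\<integral>\<^sup>+l. g l * indicator {0<..} l \<partial>lborel)
      \<le> (\<integral>\<^sup>+l. ennreal b * indicator {0..1} l + ennreal (K / l\<^sup>2) * indicator {1..} l \<partial>lborel)"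
    proof (intro nn_integral_mono)
      fix l
      show "g l * indicator {0<..} l \<le> ennreal b * indicator {0..1} l + ennreal (K / l\<^sup>2) * indicator {1..} l"
        using g(1)[of l] g(3)[of l] by (cases "l \<le> 1") (auto simp: indicator_def add_increasing2)
    qed
    also have "\<dots> = ennreal b + ennreal K"
      by (subst nn_integral_add) (auto simp: tail nn_integral_cmult_indicator)
    also have "\<dots> \<le> ennreal (t + K)"
      using True b K by (simp flip: ennreal_plus)
    finally show ?thesis by (simp add: add_increasing2)
  next
    case False
    then have bt: "t < b" "0 < t / b" "t / b \<le> 1" using t by auto
    have K1: "ennreal (K / l) = ennreal K * ennreal (1 / l)" if "l > 0" for l :: real
      using K that by (simp flip: ennreal_mult)
    have "(\<integral>\<^sup>+l. g l * indicator {0<..} l \<partial>lborel)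
      \<le> (\<integral>\<^sup>+l. ennreal b * indicator {0..t / b} l + (ennreal K * (ennreal (1 / l) * indicator {t / b..1} l) + ennreal (K / l\<^sup>2) * indicator {1..} l) \<partial>lborel)"
    proof (intro nn_integral_mono)
      fix l
      consider "l \<le> 0" | "0 < l" "l \<le> t / b" | "t / b < l" "l \<le> 1" | "1 < l" by linarith
      then show "g l * indicator {0<..} l \<le> ennreal b * indicator {0..t / b} l + (ennreal K * (ennreal (1 / l) * indicator {t / b..1} l) + ennreal (K / l\<^sup>2) * indicator {1..} l)"
      proof cases
        case 2
        then show ?thesis using g(1)[of l] by (auto simp: indicator_def intro!: add_increasing2)
      next
        case 3
        then have "l > 0" using bt by linarith
        then show ?thesis using 3 g(2)[of l] K1[of l] 
          by (auto simp: indicator_def intro!: add_increasing add_increasing2)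
      next
        case 4
        then show ?thesis using g(3)[of l] by (auto simp: indicator_def intro!: add_increasing)
      qed simp
    qed
    also have "\<dots> = ennreal b * ennreal (t / b) + (ennreal K * ennreal (ln (b / t)) + ennreal K)"
    proof -
      have "(\<integral>\<^sup>+l. ennreal K * (ennreal (1 / l) * indicator {t / b..1} l) \<partial>lborel) = ennreal K * ennreal (ln (b / t))"
        using nn_integral_inverse_Icc[OF bt(2,3)] by (subst nn_integral_cmult) auto
      then show ?thesis
        using bt by (subst nn_integral_add, measurable, subst nn_integral_add, measurable)
         (auto simp: tail nn_integral_cmult_indicator)
    qed
    also have "ennreal b * ennreal (t / b) = ennreal t" using bt b t by (simp flip: ennreal_mult)
    also have "ennreal t + (ennreal K * ennreal (ln (b / t)) + ennreal K) = ennreal (t + K) + ennreal K * ennreal (ln (b / t))"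
      using t K by (simp add: add_ac)
    also have "ennreal (ln (b / t)) = (\<integral>\<^sup>+u. ennreal (1 / u) * indicator {t..b} u \<partial>lborel)"
      using nn_integral_inverse_Icc[of t b] t bt by simp
    also have "\<dots> = (\<integral>\<^sup>+u. ennreal (1 / u) * indicator {t<..<b} u \<partial>lborel)"
    proof (rule nn_integral_cong_AE)
      have "AE u in lborel. u \<noteq> t \<and> u \<noteq> b"
        using AE_lborel_singleton[of t] AE_lborel_singleton[of b] by auto
      then show "AE u in lborel. ennreal (1 / u) * indicator {t..b} u = ennreal (1 / u) * indicator {t<..<b} u"
        by eventually_elim (auto simp: indicator_def)
    qed
    finally show ?thesis .
  qed
qed

context sigma_finite_measure
begin

lemma distribution_measurable [measurable]:
  "(\<lambda>s. emeasure M {x \<in> space M. s < \<bar>f x\<bar>}) \<in> borel_measurable borel" 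
  if [measurable]: "f \<in> borel_measurable M" for f :: "'a \<Rightarrow> real"
  by (rule antimono_borel_measurable_ennreal) (auto intro!: emeasure_mono)

text \<open>The layer cake formula is applied twice, first to the excess and then to the
  distribution function. All level sets above the height \<open>m\<close> have measure at most
  \<open>t\<close>, so after the exchange only \<open>u < t\<close> occurs.\<close>

lemma excess_le_rearrangement:
  fixes f :: "'a \<Rightarrow> real"
  assumes [measurable]: "f \<in> borel_measurable M" and m: "m \<ge> 0"
    and t: "emeasure M {x \<in> space M. m < \<bar>f x\<bar>} \<le> ennreal t"
  shows "(\<integral>\<^sup>+x. ennreal (\<bar>f x\<bar> - m) \<partial>M) \<le> (\<integral>\<^sup>+u \<in> {0<..<t}. rearrangement M f u \<partial>lborel)"
proof -
  interpret L: pair_sigma_finite M "lborel :: real measure"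
    unfolding pair_sigma_finite_def by (simp add: sigma_finite_measure_axioms lborel.sigma_finite_measure_axioms)
  let ?b = "\<lambda>s. emeasure M {x \<in> space M. s < \<bar>f x\<bar>}"
  have "(\<integral>\<^sup>+x. ennreal (\<bar>f x\<bar> - m) \<partial>M) = (\<integral>\<^sup>+x. \<integral>\<^sup>+s. indicator {s. m \<le> s \<and> s < \<bar>f x\<bar>} s \<partial>lborel \<partial>M)"
  proof (intro nn_integral_cong)
    fix x
    have "{s. m \<le> s \<and> s < \<bar>f x\<bar>} = {m..<\<bar>f x\<bar>}" by auto
    then show "ennreal (\<bar>f x\<bar> - m) = (\<integral>\<^sup>+s. indicator {s. m \<le> s \<and> s < \<bar>f x\<bar>} s \<partial>lborel)"
      by (cases "m \<le> \<bar>f x\<bar>") (auto simp: ennreal_neg)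
  qed
  also have "\<dots> = (\<integral>\<^sup>+x. \<integral>\<^sup>+s. indicator {p \<in> space (M \<Otimes>\<^sub>M lborel). m \<le> snd p \<and> snd p < \<bar>f (fst p)\<bar>} (x, s) \<partial>lborel \<partial>M)"
    by (intro nn_integral_cong) (auto simp: indicator_def space_pair_measure)
  also have "\<dots> = (\<integral>\<^sup>+s. \<integral>\<^sup>+x. indicator {p \<in> space (M \<Otimes>\<^sub>M lborel). m \<le> snd p \<and> snd p < \<bar>f (fst p)\<bar>} (x, s) \<partial>M \<partial>lborel)"
    by (rule L.Fubini'[symmetric]) measurable
  also have "\<dots> = (\<integral>\<^sup>+s. indicator {m..} s * ?b s \<partial>lborel)"
  proof (intro nn_integral_cong)
    fix s :: real
    have "(\<integral>\<^sup>+x. indicator {p \<in> space (M \<Otimes>\<^sub>M lborel). m \<le> snd p \<and> snd p < \<bar>f (fst p)\<bar>} (x, s) \<partial>M)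
      = (\<integral>\<^sup>+x. indicator {m..} s * indicator {x \<in> space M. s < \<bar>f x\<bar>} x \<partial>M)"
      by (intro nn_integral_cong) (auto simp: indicator_def space_pair_measure)
    then show "(\<integral>\<^sup>+x. indicator {p \<in> space (M \<Otimes>\<^sub>M lborel). m \<le> snd p \<and> snd p < \<bar>f (fst p)\<bar>} (x, s) \<partial>M) = indicator {m..} s * ?b s"
      by (simp add: nn_integral_cmult)
  qed
  also have "\<dots> = (\<integral>\<^sup>+s. \<integral>\<^sup>+u. indicator {m..} s * indicator {u. 0 < u \<and> ennreal u < ?b s} u \<partial>lborel \<partial>lborel)"
    by (intro nn_integral_cong) (simp add: nn_integral_cmult nn_integral_layer)
  also have "\<dots> = (\<integral>\<^sup>+u. \<integral>\<^sup>+s. indicator {m..} s * indicator {u. 0 < u \<and> ennreal u < ?b s} u \<partial>lborel \<partial>lborel)"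
    by (rule lborel_pair.Fubini'[symmetric]) measurable
  also have "\<dots> \<le> (\<integral>\<^sup>+u. (\<integral>\<^sup>+s. indicator {0<..<t} u * indicator {s. 0 < s \<and> ennreal s < rearrangement M f u} s \<partial>lborel) \<partial>lborel)"
  proof (rule nn_integral_mono, rule nn_integral_mono_AE)
    fix u :: real
    have "AE s in lborel. s \<noteq> 0" by (rule AE_lborel_singleton)
    then show "AE s in lborel. indicator {m..} s * indicator {u. 0 < u \<and> ennreal u < ?b s} u
      \<le> (indicator {0<..<t} u * indicator {s. 0 < s \<and> ennreal s < rearrangement M f u} s :: ennreal)"
    proof eventually_elim
      case (elim s)
      show ?case
      proof (cases "m \<le> s \<and> 0 < u \<and> ennreal u < ?b s")
        case True
        then have "s > 0" using m elim by auto
        moreover have "ennreal u < ennreal t"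
        proof -
          have "?b s \<le> ?b m" using True by (intro emeasure_mono) auto
          then show ?thesis using True t by (auto intro: less_le_trans)
        qed
        then have "u < t" using True by (simp add: ennreal_less_iff)
        moreover have "ennreal s < rearrangement M f u"
          using True \<open>s > 0\<close> by (subst rearrangement_gt_iff) auto
        ultimately show ?thesis using True by (simp add: indicator_def)
      qed (auto simp: indicator_def)
    qed
  qed
  also have "\<dots> = (\<integral>\<^sup>+u. indicator {0<..<t} u * rearrangement M f u \<partial>lborel)"
    by (intro nn_integral_cong) (simp add: nn_integral_cmult nn_integral_layer)
  finally show ?thesis by (simp add: mult.commute)
qed

text \<open>Both factors are decomposed into layers, and the intersection of two level sets is
  bounded by either of them. Integrating over the levels of \<open>G\<close> leaves a logarithm of
  the distribution function of \<open>f\<close>. Exchanged with the integral over the levels of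
  \<open>f\<close>, it becomes the dual Hardy term.\<close>

lemma rearrangement_pairing:
  fixes f G :: "'a \<Rightarrow> real"
  assumes [measurable]: "f \<in> borel_measurable M" "G \<in> borel_measurable M"
    and G: "\<And>l. l > 0 \<Longrightarrow> emeasure M {x \<in> space M. l < \<bar>G x\<bar>} \<le> ennreal (K / l)"
      "\<And>l. l > 0 \<Longrightarrow> emeasure M {x \<in> space M. l < \<bar>G x\<bar>} \<le> ennreal (K / l\<^sup>2)"
    and fin: "\<And>s. s > 0 \<Longrightarrow> emeasure M {x \<in> space M. s < \<bar>f x\<bar>} < \<infinity>"
    and K: "K \<ge> 0" and t: "t > 0" and m: "m \<ge> 0"
  shows "(\<integral>\<^sup>+x. ennreal (min \<bar>f x\<bar> m) * ennreal \<bar>G x\<bar> \<partial>M)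
    \<le> ennreal ((t + K) * m) + ennreal K * (\<integral>\<^sup>+u \<in> {t<..}. rearrangement M f u * ennreal (1 / u) \<partial>lborel)"
proof -
  interpret L: pair_sigma_finite M "lborel :: real measure"
    unfolding pair_sigma_finite_def by (simp add: sigma_finite_measure_axioms lborel.sigma_finite_measure_axioms)
  let ?b = "\<lambda>s. emeasure M {x \<in> space M. s < \<bar>f x\<bar>}"
  let ?A = "\<lambda>s x. indicator {s. 0 < s \<and> ennreal s < ennreal (min \<bar>f x\<bar> m)} s :: ennreal"
  let ?B = "\<lambda>l x. indicator {l. 0 < l \<and> ennreal l < ennreal \<bar>G x\<bar>} l :: ennreal"
  let ?S = "\<lambda>s l. {x \<in> space M. s < \<bar>f x\<bar> \<and> l < \<bar>G x\<bar>}"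
  have A[measurable]: "(\<lambda>p. ?A (snd p) (fst p)) \<in> borel_measurable (M \<Otimes>\<^sub>M borel)"
    by (rule nn_integral_layer_measurable) measurable
  have B[measurable]: "(\<lambda>p. ?B (snd p) (fst p)) \<in> borel_measurable (M \<Otimes>\<^sub>M borel)"
    by (rule nn_integral_layer_measurable) measurable
  have Am[measurable]: "(\<lambda>x. ?A s x) \<in> borel_measurable M" "(\<lambda>x. ?B s x) \<in> borel_measurable M" for s
    using measurable_compose[OF measurable_Pair2' A, of s] measurable_compose[OF measurable_Pair2' B, of s] by simp_all
  have As[measurable]: "(\<lambda>s. ?A s x) \<in> borel_measurable borel" "(\<lambda>s. ?B s x) \<in> borel_measurable borel" for x
    by measurable
  have "(\<integral>\<^sup>+x. ennreal (min \<bar>f x\<bar> m) * ennreal \<bar>G x\<bar> \<partial>M)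
    = (\<integral>\<^sup>+x. (\<integral>\<^sup>+s. ?A s x * ennreal \<bar>G x\<bar> \<partial>lborel) \<partial>M)"
    by (intro nn_integral_cong) (simp add: nn_integral_multc nn_integral_layer)
  also have "\<dots> = (\<integral>\<^sup>+s. (\<integral>\<^sup>+x. ?A s x * ennreal \<bar>G x\<bar> \<partial>M) \<partial>lborel)"
    by (rule L.Fubini'[symmetric]) (simp add: case_prod_beta)
  also have "\<dots> = (\<integral>\<^sup>+s. (\<integral>\<^sup>+x. (\<integral>\<^sup>+l. ?A s x * ?B l x \<partial>lborel) \<partial>M) \<partial>lborel)"
    by (intro nn_integral_cong) (simp add: nn_integral_cmult nn_integral_layer)
  also have "\<dots> = (\<integral>\<^sup>+s. (\<integral>\<^sup>+l. (\<integral>\<^sup>+x. ?A s x * ?B l x \<partial>M) \<partial>lborel) \<partial>lborel)"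
    by (intro nn_integral_cong L.Fubini'[symmetric]) (simp add: case_prod_beta)
  also have "\<dots> = (\<integral>\<^sup>+s. indicator {0<..<m} s * (\<integral>\<^sup>+l. emeasure M (?S s l) * indicator {0<..} l \<partial>lborel) \<partial>lborel)"
  proof (intro nn_integral_cong)
    fix s :: real
    have "(\<integral>\<^sup>+x. ?A s x * ?B l x \<partial>M) = indicator {0<..<m} s * (emeasure M (?S s l) * indicator {0<..} l)" for l
    proof -
      have "(\<integral>\<^sup>+x. ?A s x * ?B l x \<partial>M) = (\<integral>\<^sup>+x. (indicator {0<..<m} s * indicator {0<..} l) * indicator (?S s l) x \<partial>M)"
        by (intro nn_integral_cong) (auto simp: indicator_def ennreal_less_iff)
      then show ?thesis by (simp add: nn_integral_cmult mult_ac)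
    qed
    moreover have "(\<lambda>l. emeasure M (?S s l)) \<in> borel_measurable borel"
      by (rule antimono_borel_measurable_ennreal) (auto intro!: emeasure_mono)
    ultimately show "(\<integral>\<^sup>+l. (\<integral>\<^sup>+x. ?A s x * ?B l x \<partial>M) \<partial>lborel)
      = indicator {0<..<m} s * (\<integral>\<^sup>+l. emeasure M (?S s l) * indicator {0<..} l \<partial>lborel)"
      by (simp add: nn_integral_cmult)
  qed
  also have "\<dots> \<le> (\<integral>\<^sup>+s. indicator {0<..<m} s * (ennreal (t + K)
      + ennreal K * (\<integral>\<^sup>+u. ennreal (1 / u) * indicator {t<..<enn2real (?b s)} u \<partial>lborel)) \<partial>lborel)"
  proof (intro nn_integral_mono)
    fix s :: real
    show "indicator {0<..<m} s * (\<integral>\<^sup>+l. emeasure M (?S s l) * indicator {0<..} l \<partial>lborel)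
      \<le> indicator {0<..<m} s * (ennreal (t + K)
      + ennreal K * (\<integral>\<^sup>+u. ennreal (1 / u) * indicator {t<..<enn2real (?b s)} u \<partial>lborel))"
    proof (cases "0 < s")
      case True
      have bs: "ennreal (enn2real (?b s)) = ?b s" using fin[OF True] by simp
      have le: "emeasure M (?S s l) \<le> ?b s" "emeasure M (?S s l) \<le> emeasure M {x \<in> space M. l < \<bar>G x\<bar>}" for l
        by (auto intro!: emeasure_mono)
      have "(\<lambda>l. emeasure M (?S s l)) \<in> borel_measurable borel"
        by (rule antimono_borel_measurable_ennreal) (auto intro!: emeasure_mono)
      then show ?thesis
        using K t bs le(1) order_trans[OF le(2) G(1)] order_trans[OF le(2) G(2)]
        by (intro mult_left_mono capped_tail_integral) simp_all
    qed (simp add: indicator_def)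
  qed
  also have "\<dots> = ennreal (t + K) * ennreal m + ennreal K * (\<integral>\<^sup>+s. (\<integral>\<^sup>+u. indicator {0<..<m} s *
      (ennreal (1 / u) * indicator {t<..<enn2real (?b s)} u) \<partial>lborel) \<partial>lborel)"
  proof -
    have [measurable]: "(\<lambda>p. indicator {t<..<enn2real (?b (fst p))} (snd p) :: ennreal) \<in> borel_measurable (borel \<Otimes>\<^sub>M borel)"
    proof -
      have "(\<lambda>p. indicator {p \<in> space (borel \<Otimes>\<^sub>M borel). t < snd p \<and> snd p < enn2real (?b (fst p))} p :: ennreal) \<in> borel_measurable (borel \<Otimes>\<^sub>M borel)"
        by measurable
      then show ?thesis
        by (rule measurable_cong[THEN iffD1, rotated]) (auto simp: indicator_def space_pair_measure)
    qed
    have im[measurable]: "(\<lambda>s. (\<integral>\<^sup>+u. ennreal (1 / u) * indicator {t<..<enn2real (?b s)} u \<partial>lborel)) \<in> borel_measurable borel"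
      by measurable
    have "(\<integral>\<^sup>+s. indicator {0<..<m} s * (ennreal (t + K)
      + ennreal K * (\<integral>\<^sup>+u. ennreal (1 / u) * indicator {t<..<enn2real (?b s)} u \<partial>lborel)) \<partial>lborel)
      = (\<integral>\<^sup>+s. ennreal (t + K) * indicator {0<..<m} s
      + ennreal K * (indicator {0<..<m} s * (\<integral>\<^sup>+u. ennreal (1 / u) * indicator {t<..<enn2real (?b s)} u \<partial>lborel)) \<partial>lborel)"
      by (intro nn_integral_cong) (simp add: indicator_def)
    also have "\<dots> = ennreal (t + K) * ennreal m
      + ennreal K * (\<integral>\<^sup>+s. indicator {0<..<m} s * (\<integral>\<^sup>+u. ennreal (1 / u) * indicator {t<..<enn2real (?b s)} u \<partial>lborel) \<partial>lborel)"
      using m by (subst nn_integral_add, measurable, subst nn_integral_cmult, measurable)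
        (simp add: nn_integral_cmult_indicator)
    finally show ?thesis by (simp add: nn_integral_cmult)
  qed
  also have "(\<integral>\<^sup>+s. (\<integral>\<^sup>+u. indicator {0<..<m} s * (ennreal (1 / u) * indicator {t<..<enn2real (?b s)} u) \<partial>lborel) \<partial>lborel)
    \<le> (\<integral>\<^sup>+s. (\<integral>\<^sup>+u. indicator {s. 0 < s \<and> ennreal s < rearrangement M f u} s * (ennreal (1 / u) * indicator {t<..} u) \<partial>lborel) \<partial>lborel)"
  proof (intro nn_integral_mono)
    fix s u :: real
    show "indicator {0<..<m} s * (ennreal (1 / u) * indicator {t<..<enn2real (?b s)} u)
      \<le> indicator {s. 0 < s \<and> ennreal s < rearrangement M f u} s * (ennreal (1 / u) * indicator {t<..} u)"
    proof (cases "0 < s \<and> t < u \<and> u < enn2real (?b s)")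
      case True
      then have bs: "ennreal (enn2real (?b s)) = ?b s" using fin[of s] by simp
      have "ennreal u < ennreal (enn2real (?b s))" using True t by (intro ennreal_lessI) auto
      then have "ennreal s < rearrangement M f u"
        using True bs by (subst rearrangement_gt_iff) auto
      then show ?thesis using True by (simp add: indicator_def)
    qed (auto simp: indicator_def)
  qed
  also have "\<dots> = (\<integral>\<^sup>+u. (\<integral>\<^sup>+s. indicator {s. 0 < s \<and> ennreal s < rearrangement M f u} s * (ennreal (1 / u) * indicator {t<..} u) \<partial>lborel) \<partial>lborel)"
    by (rule lborel_pair.Fubini'[symmetric]) (simp add: case_prod_beta')
  also have "\<dots> = (\<integral>\<^sup>+u \<in> {t<..}. rearrangement M f u * ennreal (1 / u) \<partial>lborel)"
    by (intro nn_integral_cong) (simp add: nn_integral_multc nn_integral_layer mult.assoc)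
  finally show ?thesis
    using t K m by (simp add: ennreal_mult add_left_mono mult_left_mono)
qed

end

section \<open>The Hilbert transform in one coordinate\<close>

text \<open>The truncated kernel is odd, so moving the transform to the sign function only changes
  the sign. The boundedness of \<open>E\<close> makes the double integral converge absolutely
  although \<open>f\<close> is only integrable against the kernel.\<close>

lemma trunc_hilbert_duality:
  fixes f :: "real \<Rightarrow> real"
  assumes f: "tail_integrable f" and e: "e > 0"
    and E[measurable]: "E \<in> sets borel" "E \<subseteq> {- R..R}" 
  defines "h \<equiv> \<lambda>y. sgn (trunc_hilbert e f y) * indicator E y"
  shows "(\<integral>\<^sup>+y \<in> E. ennreal \<bar>trunc_hilbert e f y\<bar> \<partial>lborel)
    \<le> (\<integral>\<^sup>+s. ennreal \<bar>f s\<bar> * ennreal \<bar>trunc_hilbert e h s\<bar> \<partial>lborel)"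
proof -
  have [measurable]: "f \<in> borel_measurable borel" using f by (auto simp: tail_integrable_def)
  have hm[measurable]: "h \<in> borel_measurable borel" unfolding h_def by measurable
  have h1: "\<bar>h y\<bar> \<le> indicator {- R..R} y" for y
    using E(2) by (auto simp: h_def indicator_def abs_mult sgn_if)
  let ?F = "\<lambda>p. h (fst p) * (f (snd p) * trunc_kernel e (fst p - snd p))"
  let ?C = "(1 + \<bar>R\<bar>) / e + 1"
  have int: "integrable (lborel \<Otimes>\<^sub>M lborel) ?F"
  proof (rule integrableI_bounded)
    show "?F \<in> borel_measurable (lborel \<Otimes>\<^sub>M lborel)" by simp
    have "(\<integral>\<^sup>+p. ennreal (norm (?F p)) \<partial>(lborel \<Otimes>\<^sub>M lborel)) = (\<integral>\<^sup>+y. \<integral>\<^sup>+s. ennreal (norm (?F (y, s))) \<partial>lborel \<partial>lborel)"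
      by (subst lborel.nn_integral_fst[symmetric]) auto
    also have "\<dots> \<le> (\<integral>\<^sup>+y. \<integral>\<^sup>+s. indicator {- R..R} y * (ennreal ?C * ennreal (norm (f s / (1 + \<bar>s\<bar>)))) \<partial>lborel \<partial>lborel)"
    proof (intro nn_integral_mono)
      fix y s :: real
      show "ennreal (norm (?F (y, s))) \<le> indicator {- R..R} y * (ennreal ?C * ennreal (norm (f s / (1 + \<bar>s\<bar>))))"
      proof (cases "y \<in> {- R..R}")
        case True
        have k: "\<bar>trunc_kernel e (y - s)\<bar> \<le> ?C / (1 + \<bar>s\<bar>)"
        proof (cases "e < \<bar>y - s\<bar>")
          case big: True
          have "1 + \<bar>s\<bar> \<le> (1 + \<bar>R\<bar>) + \<bar>y - s\<bar>" using True by auto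
          also have "(1 + \<bar>R\<bar>) \<le> (1 + \<bar>R\<bar>) / e * \<bar>y - s\<bar>"
          proof -
            have "(1 + \<bar>R\<bar>) / e * e \<le> (1 + \<bar>R\<bar>) / e * \<bar>y - s\<bar>"
              using big e by (intro mult_left_mono) auto
            then show ?thesis using e by simp
          qed
          finally have "1 + \<bar>s\<bar> \<le> ?C * \<bar>y - s\<bar>" by (simp add: distrib_right)
          moreover have "\<bar>y - s\<bar> > 0" "1 + \<bar>s\<bar> > 0" using big e by auto
          ultimately have "1 / \<bar>y - s\<bar> \<le> ?C / (1 + \<bar>s\<bar>)"
            by (simp only: divide_le_eq le_divide_eq times_divide_eq_left) (simp add: mult.commute)
          then show ?thesis using big by (simp add: trunc_kernel_def)
        next
          case False
          then show ?thesis using e by (simp add: trunc_kernel_def)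
        qed
        have "norm (?F (y, s)) \<le> 1 * (\<bar>f s\<bar> * (?C / (1 + \<bar>s\<bar>)))"
          unfolding real_norm_def abs_mult fst_conv snd_conv
          using h1[of y] True k by (intro mult_mono) auto
        also have "\<dots> = ?C * norm (f s / (1 + \<bar>s\<bar>))" by (simp add: mult.commute)
        finally have "ennreal (norm (?F (y, s))) \<le> ennreal (?C * norm (f s / (1 + \<bar>s\<bar>)))" by (rule ennreal_leI)
        also have "\<dots> = ennreal ?C * ennreal (norm (f s / (1 + \<bar>s\<bar>)))" using e by (intro ennreal_mult) auto
        finally show ?thesis using True by simp
      next
        case False
        then have "indicator {- R..R} y = (0::real)" by simp
        then have "h y = 0" using h1[of y] by linarith
        then show ?thesis by simp
      qed
    qed
    also have "\<dots> = (ennreal ?C * (\<integral>\<^sup>+s. ennreal (norm (f s / (1 + \<bar>s\<bar>))) \<partial>lborel)) * emeasure lborel {- R..R}"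
      by (simp add: nn_integral_cmult nn_integral_multc mult.commute)
    also have "\<dots> < \<infinity>"
      using f by (auto simp: tail_integrable_def integrable_iff_bounded ennreal_mult_less_top emeasure_lborel_Icc_eq)
    finally show "(\<integral>\<^sup>+p. ennreal (norm (?F p)) \<partial>(lborel \<Otimes>\<^sub>M lborel)) < \<infinity>" .
  qed
  have i2: "integrable lborel (\<lambda>y. h y * trunc_hilbert e f y)"
    using lborel_pair.integrable_fst'[OF int] unfolding fst_conv snd_conv integral_mult_right_zero trunc_hilbert_def .
  have abs_eq: "h y * trunc_hilbert e f y = \<bar>trunc_hilbert e f y\<bar> * indicator E y" for y
    by (simp add: h_def mult.assoc mult.left_commute abs_sgn mult.commute)
  have "(\<integral>\<^sup>+y \<in> E. ennreal \<bar>trunc_hilbert e f y\<bar> \<partial>lborel) = (\<integral>\<^sup>+y. ennreal (h y * trunc_hilbert e f y) \<partial>lborel)"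
    unfolding abs_eq by (intro nn_integral_cong) (auto simp: indicator_def)
  also have "\<dots> = ennreal (LBINT y. h y * trunc_hilbert e f y)"
    using i2 unfolding abs_eq by (intro nn_integral_eq_integral) auto
  also have "(LBINT y. h y * trunc_hilbert e f y) = (LBINT y. LBINT s. ?F (y, s))"
    unfolding fst_conv snd_conv integral_mult_right_zero trunc_hilbert_def ..
  also have "\<dots> = (LBINT s. LBINT y. ?F (y, s))"
    using lborel_pair.Fubini_integral[of "\<lambda>y s. ?F (y, s)"] int
    by (simp only: fst_conv snd_conv case_prod_unfold)
  also have "\<dots> = (LBINT s. - (f s * trunc_hilbert e h s))"
  proof (intro Bochner_Integration.integral_cong refl)
    fix s
    have "(LBINT y. ?F (y, s)) = (LBINT y. - f s * (h y * trunc_kernel e (s - y)))"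
    proof (intro Bochner_Integration.integral_cong refl)
      fix y
      show "?F (y, s) = - f s * (h y * trunc_kernel e (s - y))"
        using trunc_kernel_uminus[of e "s - y"] by simp
    qed
    then show "(LBINT y. ?F (y, s)) = - (f s * trunc_hilbert e h s)"
      by (simp add: trunc_hilbert_def)
  qed
  finally have eq: "(\<integral>\<^sup>+y \<in> E. ennreal \<bar>trunc_hilbert e f y\<bar> \<partial>lborel) = ennreal (LBINT s. - (f s * trunc_hilbert e h s))" .
  also have "\<dots> \<le> (\<integral>\<^sup>+s. ennreal (norm (- (f s * trunc_hilbert e h s))) \<partial>lborel)"
  \<comment> \<open>As above, the default value \<open>0\<close> of the integral covers the
    nonintegrable case.\<close>
  proof (cases "integrable lborel (\<lambda>s. - (f s * trunc_hilbert e h s))")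
    case True
    have "ennreal (LBINT s. - (f s * trunc_hilbert e h s)) \<le> ennreal (norm (LBINT s. - (f s * trunc_hilbert e h s)))"
      by (intro ennreal_leI) simp
    also have "\<dots> \<le> (\<integral>\<^sup>+s. ennreal (norm (- (f s * trunc_hilbert e h s))) \<partial>lborel)"
      by (rule integral_norm_bound_ennreal[OF True])
    finally show ?thesis .
  next
    case False
    then have "(LBINT s. - (f s * trunc_hilbert e h s)) = 0" by (rule not_integrable_integral_eq)
    then show ?thesis by (simp only: ennreal_0 zero_le)
  qed
  also have "\<dots> = (\<integral>\<^sup>+s. ennreal \<bar>f s\<bar> * ennreal \<bar>trunc_hilbert e h s\<bar> \<partial>lborel)"
    by (intro nn_integral_cong) (simp add: abs_mult ennreal_mult)
  finally show ?thesis .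
qed

lemma set_integral_lebesgue_trunc_hilbert:
  assumes [measurable]: "f \<in> borel_measurable borel"
  shows "(LINT y:{y. \<bar>y\<bar> > e}|lebesgue. f (a - y) / y) = trunc_hilbert e f a"
proof -
  have "(LINT y:{y. \<bar>y\<bar> > e}|lebesgue. f (a - y) / y) = (LINT y|lebesgue. f (a - y) * trunc_kernel e y)"
    unfolding set_lebesgue_integral_def
    by (intro Bochner_Integration.integral_cong refl) (auto simp: trunc_kernel_def indicator_def)
  also have "\<dots> = (LBINT y. f (a - y) * trunc_kernel e y)"
    by (intro integral_completion) simp
  also have "\<dots> = trunc_hilbert e f a"
    unfolding trunc_hilbert_def
    using lborel_integral_real_affine[of "-1" "\<lambda>s. f s * trunc_kernel e (a - s)" a] by simp
  finally show ?thesis .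
qed

section \<open>Sections along one coordinate\<close>

abbreviation borel_Rd :: "nat \<Rightarrow> (nat \<Rightarrow> real) measure" where
  "borel_Rd d \<equiv> PiM {1..d} (\<lambda>_. lborel)"

interpretation PS: product_sigma_finite "\<lambda>_::nat. lborel :: real measure"
  by standard

lemma sigma_finite_borel_Rd: "sigma_finite_measure (borel_Rd d)"
  by (rule PS.sigma_finite) simp

lemma fun_upd_measurable:
  assumes "j \<in> {1..d}" and [measurable]: "f \<in> measurable N (borel_Rd d)" "h \<in> borel_measurable N"
  shows "(\<lambda>x. (f x)(j := h x)) \<in> measurable N (borel_Rd d)"
  by (rule measurable_fun_upd[where J = "{1..d}"]) (use assms in auto)

lemma fun_upd_section_measurable:
  assumes "j \<in> {1..d}" "x \<in> space (PiM ({1..d} - {j}) (\<lambda>_. lborel :: real measure))"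
  shows "(\<lambda>s. x(j := s)) \<in> measurable borel (borel_Rd d)"
  by (rule measurable_fun_upd[where J = "{1..d} - {j}"]) (use assms in auto)

lemma component_measurable_Rd: "j \<in> {1..d} \<Longrightarrow> (\<lambda>x. x j) \<in> borel_measurable (borel_Rd d)"
  using measurable_component_singleton[of j "{1..d}" "\<lambda>_. lborel :: real measure"] by simp

lemma nn_integral_split_coord:
  assumes j: "j \<in> {1..d}" and f: "f \<in> borel_measurable (borel_Rd d)"
  shows "(\<integral>\<^sup>+x. f x \<partial>borel_Rd d)
    = (\<integral>\<^sup>+x. (\<integral>\<^sup>+y. f (x(j := y)) \<partial>lborel) \<partial>PiM ({1..d} - {j}) (\<lambda>_. lborel))"
proof -
  have "insert j ({1..d} - {j}) = {1..d}" using j by auto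
  then show ?thesis using PS.product_nn_integral_insert[of "{1..d} - {j}" j f] f by simp
qed

lemma emeasure_split_coord:
  assumes j: "j \<in> {1..d}" and A: "A \<in> sets (borel_Rd d)"
  shows "emeasure (borel_Rd d) A
    = (\<integral>\<^sup>+x. emeasure lborel {y. x(j := y) \<in> A} \<partial>PiM ({1..d} - {j}) (\<lambda>_. lborel))"
proof -
  have "emeasure (borel_Rd d) A = (\<integral>\<^sup>+x. indicator A x \<partial>borel_Rd d)" using A by simp
  also have "\<dots> = (\<integral>\<^sup>+x. (\<integral>\<^sup>+y. indicator A (x(j := y)) \<partial>lborel) \<partial>PiM ({1..d} - {j}) (\<lambda>_. lborel))"
    by (rule nn_integral_split_coord[OF j]) (use A in simp)
  also have "\<dots> = (\<integral>\<^sup>+x. emeasure lborel {y. x(j := y) \<in> A} \<partial>PiM ({1..d} - {j}) (\<lambda>_. lborel))"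
  proof (intro nn_integral_cong)
    fix x assume x: "x \<in> space (PiM ({1..d} - {j}) (\<lambda>_. lborel :: real measure))"
    have "{y. x(j := y) \<in> A} \<in> sets lborel"
      using measurable_sets[OF fun_upd_section_measurable[OF j x] A] by (simp add: vimage_def)
    then have "emeasure lborel {y. x(j := y) \<in> A} = (\<integral>\<^sup>+y. indicator {y. x(j := y) \<in> A} y \<partial>lborel)" by simp
    then show "(\<integral>\<^sup>+y. indicator A (x(j := y)) \<partial>lborel) = emeasure lborel {y. x(j := y) \<in> A}"
      by (simp add: indicator_def)
  qed
  finally show ?thesis .
qed

lemma AE_split_coord:
  assumes j: "j \<in> {1..d}" and [measurable]: "Measurable.pred (borel_Rd d) P"
    and ae: "AE x in PiM ({1..d} - {j}) (\<lambda>_. lborel :: real measure). AE y in lborel. P (x(j := y))"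
  shows "AE x in borel_Rd d. P x"
proof (rule AE_I)
  let ?N = "{x \<in> space (borel_Rd d). \<not> P x}"
  show N: "?N \<in> sets (borel_Rd d)" by measurable
  have "emeasure (borel_Rd d) ?N = (\<integral>\<^sup>+x. emeasure lborel {y. x(j := y) \<in> ?N} \<partial>PiM ({1..d} - {j}) (\<lambda>_. lborel))"
    by (rule emeasure_split_coord[OF j N])
  also have "\<dots> = (\<integral>\<^sup>+x. 0 \<partial>PiM ({1..d} - {j}) (\<lambda>_. lborel :: real measure))"
  proof (rule nn_integral_cong_AE)
    show "AE x in PiM ({1..d} - {j}) (\<lambda>_. lborel). emeasure lborel {y. x(j := y) \<in> ?N} = 0"
      using ae AE_space
    proof eventually_elim
      case (elim x)
      have m: "{y. x(j := y) \<in> ?N} \<in> sets lborel"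
        using measurable_sets[OF fun_upd_section_measurable[OF j elim(2)] N] by (simp add: vimage_def)
      have "AE y in lborel. y \<notin> {y. x(j := y) \<in> ?N}"
        using elim(1) by eventually_elim auto
      then show ?case using AE_iff_measurable[OF m, of "\<lambda>y. y \<notin> {y. x(j := y) \<in> ?N}"] by simp
    qed
  qed
  finally show "emeasure (borel_Rd d) ?N = 0" by simp
qed simp

definition coord_trunc :: "nat \<Rightarrow> real \<Rightarrow> ((nat \<Rightarrow> real) \<Rightarrow> real) \<Rightarrow> (nat \<Rightarrow> real) \<Rightarrow> real" where
  "coord_trunc j e g x = trunc_hilbert e (\<lambda>s. g (x(j := s))) (x j)"

lemma coord_trunc_upd: "coord_trunc j e g (x(j := y)) = trunc_hilbert e (\<lambda>s. g (x(j := s))) y"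
  by (simp add: coord_trunc_def)

lemma coord_trunc_measurable [measurable]:
  assumes j: "j \<in> {1..d}" and [measurable]: "g \<in> borel_measurable (borel_Rd d)"
  shows "coord_trunc j e g \<in> borel_measurable (borel_Rd d)"
proof -
  note [measurable] = fun_upd_measurable[OF j] component_measurable_Rd[OF j]
  show ?thesis unfolding coord_trunc_def[abs_def] trunc_hilbert_def by measurable
qed

lemma section_measurable:
  assumes j: "j \<in> {1..d}" and g: "g \<in> borel_measurable (borel_Rd d)"
    and x: "x \<in> space (PiM ({1..d} - {j}) (\<lambda>_. lborel :: real measure)) \<or> x \<in> space (borel_Rd d)"
  shows "(\<lambda>s. g (x(j := s))) \<in> borel_measurable borel"
proof -
  have "(\<lambda>s. x(j := s)) \<in> measurable borel (borel_Rd d)"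
    using x
  proof
    assume "x \<in> space (borel_Rd d)"
    then show ?thesis using j by (intro measurable_fun_upd[where J = "{1..d}"]) auto
  qed (rule fun_upd_section_measurable[OF j])
  from measurable_compose[OF this g] show ?thesis .
qed

lemma hilbert_coord_eq:
  assumes "(\<lambda>s. g (x(j := s))) \<in> borel_measurable borel"
  shows "hilbert_coord j g x = Lim (at_right 0) (\<lambda>e. 1 / pi * coord_trunc j e g x)"
  unfolding hilbert_coord_def coord_trunc_def
  using set_integral_lebesgue_trunc_hilbert[OF assms] by simp

interpretation RS: sigma_finite_measure "borel_Rd d" for d
  by (rule sigma_finite_borel_Rd)

lemma nn_integral_section_measurable:
  fixes f :: "(nat \<Rightarrow> real) \<Rightarrow> ennreal"
  assumes j: "j \<in> {1..d}" and f: "f \<in> borel_measurable (borel_Rd d)"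
  shows "(\<lambda>x. (\<integral>\<^sup>+y. f (x(j := y)) \<partial>lborel)) \<in> borel_measurable (PiM ({1..d} - {j}) (\<lambda>_. lborel))"
proof (rule lborel.borel_measurable_nn_integral)
  have "(\<lambda>p. (fst p)(j := snd p)) \<in> measurable (PiM ({1..d} - {j}) (\<lambda>_. lborel :: real measure) \<Otimes>\<^sub>M lborel) (borel_Rd d)"
    by (rule measurable_fun_upd[where J = "{1..d} - {j}"]) (use j in auto)
  from measurable_compose[OF this f]
  show "(\<lambda>(x, y). f (x(j := y))) \<in> borel_measurable (PiM ({1..d} - {j}) (\<lambda>_. lborel) \<Otimes>\<^sub>M lborel)"
    by (simp only: case_prod_unfold)
qed

text \<open>A weak type bound is an estimate for the measure of a set on each line parallel to the
  \<open>j\<close>-th axis, so it can be integrated over these lines with the same constant.\<close>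

lemma coord_maximal_weak:
  assumes j: "j \<in> {1..d}" and [measurable]: "g \<in> borel_measurable (borel_Rd d)"
    and fin: "(\<integral>\<^sup>+x. ennreal \<bar>g x\<bar> \<partial>borel_Rd d) < \<infinity>" and l: "l > 0"
  shows "emeasure (borel_Rd d) {x \<in> space (borel_Rd d). max_trunc_gt (\<lambda>s. g (x(j := s))) l (x j)}
    \<le> ennreal (160 / l) * (\<integral>\<^sup>+x. ennreal \<bar>g x\<bar> \<partial>borel_Rd d)"
    and "AE x in PiM ({1..d} - {j}) (\<lambda>_. lborel). integrable lborel (\<lambda>s. g (x(j := s)))"
    and "{x \<in> space (borel_Rd d). max_trunc_gt (\<lambda>s. g (x(j := s))) l (x j)} \<in> sets (borel_Rd d)"
proof -
  let ?I = "PiM ({1..d} - {j}) (\<lambda>_. lborel :: real measure)"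
  let ?A = "{x \<in> space (borel_Rd d). max_trunc_gt (\<lambda>s. g (x(j := s))) l (x j)}"
  have "?A = {x \<in> space (borel_Rd d). \<exists>q::rat. 0 < q \<and> l < \<bar>coord_trunc j (of_rat q) g x\<bar>}"
    by (simp add: max_trunc_gt_def coord_trunc_def)
  also have "\<dots> \<in> sets (borel_Rd d)" using j by measurable
  finally show A: "?A \<in> sets (borel_Rd d)" .
  have eqg: "(\<integral>\<^sup>+x. ennreal \<bar>g x\<bar> \<partial>borel_Rd d) = (\<integral>\<^sup>+x. (\<integral>\<^sup>+y. ennreal \<bar>g (x(j := y))\<bar> \<partial>lborel) \<partial>?I)"
    by (rule nn_integral_split_coord[OF j]) measurable
  have mI: "(\<lambda>x. (\<integral>\<^sup>+y. ennreal \<bar>g (x(j := y))\<bar> \<partial>lborel)) \<in> borel_measurable ?I"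
    by (rule nn_integral_section_measurable[OF j]) measurable
  have "AE x in ?I. (\<integral>\<^sup>+y. ennreal \<bar>g (x(j := y))\<bar> \<partial>lborel) \<noteq> \<infinity>"
    by (rule nn_integral_noteq_infinite[OF mI]) (use fin eqg in auto)
  with AE_space show int: "AE x in ?I. integrable lborel (\<lambda>s. g (x(j := s)))"
  proof eventually_elim
    case (elim x)
    then show ?case using section_measurable[OF j assms(2), of x]
      by (auto simp: integrable_iff_bounded less_top)
  qed
  have "emeasure (borel_Rd d) ?A = (\<integral>\<^sup>+x. emeasure lborel {y. x(j := y) \<in> ?A} \<partial>?I)"
    by (rule emeasure_split_coord[OF j A])
  also have "\<dots> \<le> (\<integral>\<^sup>+x. ennreal (160 / l) * (\<integral>\<^sup>+y. ennreal \<bar>g (x(j := y))\<bar> \<partial>lborel) \<partial>?I)"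
  proof (rule nn_integral_mono_AE)
    show "AE x in ?I. emeasure lborel {y. x(j := y) \<in> ?A} \<le> ennreal (160 / l) * (\<integral>\<^sup>+y. ennreal \<bar>g (x(j := y))\<bar> \<partial>lborel)"
      using int
    proof eventually_elim
      case (elim x)
      let ?g = "\<lambda>s. g (x(j := s))"
      have [measurable]: "?g \<in> borel_measurable borel" using elim by auto
      have "emeasure lborel {y. x(j := y) \<in> ?A} \<le> emeasure lborel {y. max_trunc_gt ?g l y}"
        by (intro emeasure_mono) auto
      also have "\<dots> \<le> ennreal (160 * (LBINT s. \<bar>?g s\<bar>) / l)" by (rule maximal_weak[OF elim l])
      also have "\<dots> = ennreal (160 / l * (LBINT s. \<bar>?g s\<bar>))" by (simp add: field_simps)
      also have "\<dots> = ennreal (160 / l) * ennreal (LBINT s. \<bar>?g s\<bar>)"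
        using l by (intro ennreal_mult) auto
      also have "ennreal (LBINT s. \<bar>?g s\<bar>) = (\<integral>\<^sup>+y. ennreal \<bar>g (x(j := y))\<bar> \<partial>lborel)"
        using elim by (intro nn_integral_eq_integral[symmetric]) auto
      finally show ?case .
    qed
  qed
  also have "\<dots> = ennreal (160 / l) * (\<integral>\<^sup>+x. ennreal \<bar>g x\<bar> \<partial>borel_Rd d)"
    unfolding eqg by (rule nn_integral_cmult[OF mI])
  finally show "emeasure (borel_Rd d) ?A \<le> ennreal (160 / l) * (\<integral>\<^sup>+x. ennreal \<bar>g x\<bar> \<partial>borel_Rd d)" .
qed

lemma coord_trunc_weak:
  assumes j: "j \<in> {1..d}" and [measurable]: "g \<in> borel_measurable (borel_Rd d)"
    and fin: "(\<integral>\<^sup>+x. ennreal \<bar>g x\<bar> \<partial>borel_Rd d) < \<infinity>" and l: "l > 0" and e: "e > 0"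
  shows "emeasure (borel_Rd d) {x \<in> space (borel_Rd d). l < \<bar>coord_trunc j e g x\<bar>}
    \<le> ennreal (160 / l) * (\<integral>\<^sup>+x. ennreal \<bar>g x\<bar> \<partial>borel_Rd d)"
proof -
  have "AE x in borel_Rd d. l < \<bar>coord_trunc j e g x\<bar> \<longrightarrow> max_trunc_gt (\<lambda>s. g (x(j := s))) l (x j)"
  proof (rule AE_split_coord[OF j])
    have [measurable]: "Measurable.pred (borel_Rd d) (\<lambda>x. max_trunc_gt (\<lambda>s. g (x(j := s))) l (x j))"
      using coord_maximal_weak(3)[OF j assms(2) fin l] by (simp add: pred_def)
    show "Measurable.pred (borel_Rd d) (\<lambda>x. l < \<bar>coord_trunc j e g x\<bar> \<longrightarrow> max_trunc_gt (\<lambda>s. g (x(j := s))) l (x j))"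
      using j by measurable
    show "AE x in PiM ({1..d} - {j}) (\<lambda>_. lborel). AE y in lborel.
      l < \<bar>coord_trunc j e g (x(j := y))\<bar> \<longrightarrow> max_trunc_gt (\<lambda>s. g ((x(j := y))(j := s))) l ((x(j := y)) j)"
      using coord_maximal_weak(2)[OF j assms(2) fin l]
    proof eventually_elim
      case (elim x)
      show ?case
        unfolding coord_trunc_upd fun_upd_upd fun_upd_same
        by (intro AE_I2 impI max_trunc_gtI[OF elim e])
    qed
  qed
  then have "emeasure (borel_Rd d) {x \<in> space (borel_Rd d). l < \<bar>coord_trunc j e g x\<bar>}
    \<le> emeasure (borel_Rd d) {x \<in> space (borel_Rd d). max_trunc_gt (\<lambda>s. g (x(j := s))) l (x j)}"
    using coord_maximal_weak(3)[OF j assms(2) fin l] by (intro emeasure_mono_AE) auto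
  also have "\<dots> \<le> ennreal (160 / l) * (\<integral>\<^sup>+x. ennreal \<bar>g x\<bar> \<partial>borel_Rd d)"
    by (rule coord_maximal_weak(1)[OF j assms(2) fin l])
  finally show ?thesis .
qed

lemma coord_trunc_L2:
  assumes j: "j \<in> {1..d}" and [measurable]: "g \<in> borel_measurable (borel_Rd d)"
    and fin: "(\<integral>\<^sup>+x. ennreal \<bar>g x\<bar> \<partial>borel_Rd d) < \<infinity>" and e: "e > 0"
  shows "(\<integral>\<^sup>+x. ennreal ((coord_trunc j e g x)\<^sup>2) \<partial>borel_Rd d) \<le> 16 * (\<integral>\<^sup>+x. ennreal ((g x)\<^sup>2) \<partial>borel_Rd d)"
proof -
  let ?I = "PiM ({1..d} - {j}) (\<lambda>_. lborel :: real measure)"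
  have mI: "(\<lambda>x. (\<integral>\<^sup>+y. ennreal ((g (x(j := y)))\<^sup>2) \<partial>lborel)) \<in> borel_measurable ?I"
    by (rule nn_integral_section_measurable[OF j]) measurable
  have "(\<integral>\<^sup>+x. ennreal ((coord_trunc j e g x)\<^sup>2) \<partial>borel_Rd d)
    = (\<integral>\<^sup>+x. (\<integral>\<^sup>+y. ennreal ((coord_trunc j e g (x(j := y)))\<^sup>2) \<partial>lborel) \<partial>?I)"
    by (rule nn_integral_split_coord[OF j]) (use j in measurable)
  also have "\<dots> \<le> (\<integral>\<^sup>+x. 16 * (\<integral>\<^sup>+y. ennreal ((g (x(j := y)))\<^sup>2) \<partial>lborel) \<partial>?I)"
  proof (rule nn_integral_mono_AE)
    show "AE x in ?I. (\<integral>\<^sup>+y. ennreal ((coord_trunc j e g (x(j := y)))\<^sup>2) \<partial>lborel)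
      \<le> 16 * (\<integral>\<^sup>+y. ennreal ((g (x(j := y)))\<^sup>2) \<partial>lborel)"
      using coord_maximal_weak(2)[OF j assms(2) fin zero_less_one]
      by eventually_elim (use trunc_hilbert_L2[OF _ e] in \<open>simp add: coord_trunc_upd\<close>)
  qed
  also have "\<dots> = 16 * (\<integral>\<^sup>+x. (\<integral>\<^sup>+y. ennreal ((g (x(j := y)))\<^sup>2) \<partial>lborel) \<partial>?I)"
    by (rule nn_integral_cmult[OF mI])
  also have "(\<integral>\<^sup>+x. (\<integral>\<^sup>+y. ennreal ((g (x(j := y)))\<^sup>2) \<partial>lborel) \<partial>?I) = (\<integral>\<^sup>+x. ennreal ((g x)\<^sup>2) \<partial>borel_Rd d)"
    by (rule nn_integral_split_coord[OF j, symmetric]) measurable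
  finally show ?thesis .
qed

section \<open>Means of the truncated transform over bounded sets\<close>

definition box_Rd :: "nat \<Rightarrow> real \<Rightarrow> (nat \<Rightarrow> real) set" where
  "box_Rd d R = PiE {1..d} (\<lambda>_. {- R..R})"

lemma box_Rd_sets [measurable]: "box_Rd d R \<in> sets (borel_Rd d)"
  unfolding box_Rd_def by (rule sets_PiM_I_finite) auto

lemma emeasure_box_Rd: "emeasure (borel_Rd d) (box_Rd d R) < \<infinity>"
proof -
  have "emeasure (borel_Rd d) (box_Rd d R) = (\<Prod>i\<in>{1..d}. emeasure lborel {- R..R})"
    unfolding box_Rd_def by (rule PS.emeasure_PiM) auto
  also have "\<dots> < \<infinity>" by (simp add: emeasure_lborel_Icc_eq power_less_top_ennreal)
  finally show ?thesis .
qed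

lemma space_borel_Rd_box: "space (borel_Rd d) = (\<Union>n. box_Rd d (real n))"
proof (intro equalityI subsetI)
  fix x assume x: "x \<in> space (borel_Rd d)"
  obtain n where n: "Max (insert 0 ((\<lambda>i. \<bar>x i\<bar>) ` {1..d})) \<le> real n" using real_arch_simple by blast
  have "\<bar>x i\<bar> \<le> real n" if "i \<in> {1..d}" for i
    using n that by (subst (asm) Max_le_iff) auto
  then have "x \<in> box_Rd d (real n)"
    using x by (auto simp: box_Rd_def space_PiM PiE_iff abs_le_iff minus_le_iff)
  then show "x \<in> (\<Union>n. box_Rd d (real n))" by blast
qed (auto simp: box_Rd_def space_PiM PiE_iff)

lemma coord_trunc_duality:
  assumes j: "j \<in> {1..d}" and g[measurable]: "g \<in> borel_measurable (borel_Rd d)"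
    and tail: "AE x in PiM ({1..d} - {j}) (\<lambda>_. lborel). tail_integrable (\<lambda>s. g (x(j := s)))"
    and e: "e > 0" and E[measurable]: "E \<in> sets (borel_Rd d)" "E \<subseteq> box_Rd d R"
  defines "h \<equiv> \<lambda>x. sgn (coord_trunc j e g x) * indicator E x"
  shows "(\<integral>\<^sup>+x \<in> E. ennreal \<bar>coord_trunc j e g x\<bar> \<partial>borel_Rd d)
    \<le> (\<integral>\<^sup>+x. ennreal \<bar>g x\<bar> * ennreal \<bar>coord_trunc j e h x\<bar> \<partial>borel_Rd d)"
proof -
  let ?I = "PiM ({1..d} - {j}) (\<lambda>_. lborel :: real measure)"
  have cm[measurable]: "coord_trunc j e g \<in> borel_measurable (borel_Rd d)"
    by (rule coord_trunc_measurable[OF j g])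
  have hm[measurable]: "h \<in> borel_measurable (borel_Rd d)" unfolding h_def by measurable
  have cm2[measurable]: "coord_trunc j e h \<in> borel_measurable (borel_Rd d)"
    by (rule coord_trunc_measurable[OF j hm])
  have "(\<integral>\<^sup>+x \<in> E. ennreal \<bar>coord_trunc j e g x\<bar> \<partial>borel_Rd d)
    = (\<integral>\<^sup>+x. (\<integral>\<^sup>+y. ennreal \<bar>coord_trunc j e g (x(j := y))\<bar> * indicator E (x(j := y)) \<partial>lborel) \<partial>?I)"
    by (rule nn_integral_split_coord[OF j]) measurable
  also have "\<dots> \<le> (\<integral>\<^sup>+x. (\<integral>\<^sup>+y. ennreal \<bar>g (x(j := y))\<bar> * ennreal \<bar>coord_trunc j e h (x(j := y))\<bar> \<partial>lborel) \<partial>?I)"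
  proof (rule nn_integral_mono_AE)
    show "AE x in ?I. (\<integral>\<^sup>+y. ennreal \<bar>coord_trunc j e g (x(j := y))\<bar> * indicator E (x(j := y)) \<partial>lborel)
      \<le> (\<integral>\<^sup>+y. ennreal \<bar>g (x(j := y))\<bar> * ennreal \<bar>coord_trunc j e h (x(j := y))\<bar> \<partial>lborel)"
      using tail AE_space
    proof eventually_elim
      case (elim x)
      let ?E = "{y. x(j := y) \<in> E}" and ?g = "\<lambda>s. g (x(j := s))"
      have Em: "?E \<in> sets borel"
        using measurable_sets[OF fun_upd_section_measurable[OF j elim(2)] E(1)] by (simp add: vimage_def)
      have ER: "?E \<subseteq> {- R..R}"
      proof
        fix y assume "y \<in> ?E"
        then have "x(j := y) \<in> box_Rd d R" using E(2) by auto
        then show "y \<in> {- R..R}" using PiE_mem[of "x(j := y)" "{1..d}" "\<lambda>_. {- R..R}" j] j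
          by (simp add: box_Rd_def)
      qed
      have hs: "h (x(j := s)) = sgn (trunc_hilbert e ?g s) * indicator ?E s" for s
        unfolding h_def coord_trunc_upd by (simp add: indicator_def)
      have "(\<integral>\<^sup>+y. ennreal \<bar>coord_trunc j e g (x(j := y))\<bar> * indicator E (x(j := y)) \<partial>lborel)
        = (\<integral>\<^sup>+y \<in> ?E. ennreal \<bar>trunc_hilbert e ?g y\<bar> \<partial>lborel)"
        unfolding coord_trunc_upd by (intro nn_integral_cong) (simp add: indicator_def)
      also have "\<dots> \<le> (\<integral>\<^sup>+s. ennreal \<bar>?g s\<bar> * ennreal \<bar>trunc_hilbert e (\<lambda>y. sgn (trunc_hilbert e ?g y) * indicator ?E y) s\<bar> \<partial>lborel)"
        by (rule trunc_hilbert_duality[OF elim(1) e Em ER])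
      also have "\<dots> = (\<integral>\<^sup>+y. ennreal \<bar>g (x(j := y))\<bar> * ennreal \<bar>coord_trunc j e h (x(j := y))\<bar> \<partial>lborel)"
        unfolding coord_trunc_upd hs ..
      finally show ?case .
    qed
  qed
  also have "\<dots> = (\<integral>\<^sup>+x. ennreal \<bar>g x\<bar> * ennreal \<bar>coord_trunc j e h x\<bar> \<partial>borel_Rd d)"
    by (rule nn_integral_split_coord[OF j, symmetric]) measurable
  finally show ?thesis .
qed

text \<open>The function is bounded, so the mean of its transform over a bounded set can be moved by
  duality onto the transform of a bounded function supported on that set.\<close>

lemma coord_trunc_mean:
  assumes j: "j \<in> {1..d}" and g[measurable]: "g \<in> borel_measurable (borel_Rd d)"
    and f[measurable]: "f \<in> borel_measurable (borel_Rd d)"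
    and gf: "\<And>x. \<bar>g x\<bar> = min \<bar>f x\<bar> m" and m: "m \<ge> 0"
    and tail: "AE x in PiM ({1..d} - {j}) (\<lambda>_. lborel). tail_integrable (\<lambda>s. g (x(j := s)))"
    and fin: "\<And>s. s > 0 \<Longrightarrow> emeasure (borel_Rd d) {x \<in> space (borel_Rd d). s < \<bar>f x\<bar>} < \<infinity>"
    and e: "e > 0" and E[measurable]: "E \<in> sets (borel_Rd d)" "E \<subseteq> box_Rd d R"
    and t: "t > 0" "ennreal t \<le> emeasure (borel_Rd d) E"
  shows "(\<integral>\<^sup>+x \<in> E. ennreal \<bar>coord_trunc j e g x\<bar> \<partial>borel_Rd d)
    \<le> 161 * emeasure (borel_Rd d) E * (ennreal m + (\<integral>\<^sup>+u \<in> {t<..}. rearrangement (borel_Rd d) f u * ennreal (1 / u) \<partial>lborel))"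
proof -
  let ?M = "borel_Rd d"
  let ?h = "\<lambda>x. sgn (coord_trunc j e g x) * indicator E x"
  let ?J = "\<integral>\<^sup>+u \<in> {t<..}. rearrangement ?M f u * ennreal (1 / u) \<partial>lborel"
  have cm[measurable]: "coord_trunc j e g \<in> borel_measurable (borel_Rd d)"
    by (rule coord_trunc_measurable[OF j g])
  have hm[measurable]: "?h \<in> borel_measurable ?M" by measurable
  have "emeasure ?M E \<le> emeasure ?M (box_Rd d R)" by (rule emeasure_mono[OF E(2) box_Rd_sets])
  then have Ef: "emeasure ?M E < \<infinity>" using emeasure_box_Rd[of d R] by (simp add: le_less_trans)
  define b where "b = enn2real (emeasure ?M E)"
  have b: "emeasure ?M E = ennreal b" "b \<ge> 0" using Ef by (auto simp: b_def)
  have tb: "t \<le> b" using t b by (simp add: ennreal_le_iff)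
  have h1: "(\<integral>\<^sup>+x. ennreal \<bar>?h x\<bar> \<partial>?M) \<le> ennreal b"
  proof -
    have "(\<integral>\<^sup>+x. ennreal \<bar>?h x\<bar> \<partial>?M) \<le> (\<integral>\<^sup>+x. indicator E x \<partial>?M)"
      by (intro nn_integral_mono) (auto simp: indicator_def sgn_if)
    then show ?thesis using b E(1) by simp
  qed
  have h2: "(\<integral>\<^sup>+x. ennreal ((?h x)\<^sup>2) \<partial>?M) \<le> ennreal b"
  proof -
    have "(\<integral>\<^sup>+x. ennreal ((?h x)\<^sup>2) \<partial>?M) \<le> (\<integral>\<^sup>+x. indicator E x \<partial>?M)"
      by (intro nn_integral_mono) (auto simp: indicator_def sgn_if)
    then show ?thesis using b E(1) by simp
  qed
  have hf: "(\<integral>\<^sup>+x. ennreal \<bar>?h x\<bar> \<partial>?M) < \<infinity>" using h1 by (simp add: le_less_trans)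
  have cm2[measurable]: "coord_trunc j e ?h \<in> borel_measurable ?M"
    by (rule coord_trunc_measurable[OF j hm])
  have "(\<integral>\<^sup>+x \<in> E. ennreal \<bar>coord_trunc j e g x\<bar> \<partial>?M)
    \<le> (\<integral>\<^sup>+x. ennreal \<bar>g x\<bar> * ennreal \<bar>coord_trunc j e ?h x\<bar> \<partial>?M)"
    by (rule coord_trunc_duality[OF j g tail e E])
  also have "\<dots> = (\<integral>\<^sup>+x. ennreal (min \<bar>f x\<bar> m) * ennreal \<bar>coord_trunc j e ?h x\<bar> \<partial>?M)"
    unfolding gf ..
  \<comment> \<open>The same \<open>K = 160 * b\<close> serves for both decay bounds: the weak type
    estimate gives \<open>160 b / l\<close>, and the \<open>L^2\<close> estimate gives
    \<open>16 b / l^2\<close>, which is enlarged.\<close>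
  also have "\<dots> \<le> ennreal ((t + 160 * b) * m) + ennreal (160 * b) * ?J"
  proof (rule RS.rearrangement_pairing)
    fix l :: real assume l: "l > 0"
    have "emeasure ?M {x \<in> space ?M. l < \<bar>coord_trunc j e ?h x\<bar>} \<le> ennreal (160 / l) * (\<integral>\<^sup>+x. ennreal \<bar>?h x\<bar> \<partial>?M)"
      by (rule coord_trunc_weak[OF j hm hf l e])
    also have "\<dots> \<le> ennreal (160 / l) * ennreal b" by (intro mult_left_mono h1) simp
    also have "\<dots> = ennreal (160 * b / l)" using l b by (simp flip: ennreal_mult)
    finally show "emeasure ?M {x \<in> space ?M. l < \<bar>coord_trunc j e ?h x\<bar>} \<le> ennreal (160 * b / l)" .
    have "emeasure ?M {x \<in> space ?M. l < \<bar>coord_trunc j e ?h x\<bar>}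
      \<le> (\<integral>\<^sup>+x. ennreal (1 / l\<^sup>2) * ennreal ((coord_trunc j e ?h x)\<^sup>2) \<partial>?M)"
    proof -
      have "emeasure ?M {x \<in> space ?M. l < \<bar>coord_trunc j e ?h x\<bar>}
        = (\<integral>\<^sup>+x. indicator {x \<in> space ?M. l < \<bar>coord_trunc j e ?h x\<bar>} x \<partial>?M)"
        by (rule nn_integral_indicator[symmetric]) measurable
      also have "\<dots> \<le> (\<integral>\<^sup>+x. ennreal (1 / l\<^sup>2) * ennreal ((coord_trunc j e ?h x)\<^sup>2) \<partial>?M)"
      proof (intro nn_integral_mono)
        fix x
        show "indicator {x \<in> space ?M. l < \<bar>coord_trunc j e ?h x\<bar>} x \<le> ennreal (1 / l\<^sup>2) * ennreal ((coord_trunc j e ?h x)\<^sup>2)"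
        proof (cases "l < \<bar>coord_trunc j e ?h x\<bar>")
          case True
          then have "l\<^sup>2 \<le> (coord_trunc j e ?h x)\<^sup>2" using l by (simp add: abs_le_square_iff[symmetric])
          then have "1 \<le> 1 / l\<^sup>2 * (coord_trunc j e ?h x)\<^sup>2" using l by simp
          then have "ennreal 1 \<le> ennreal (1 / l\<^sup>2 * (coord_trunc j e ?h x)\<^sup>2)" by (rule ennreal_leI)
          also have "\<dots> = ennreal (1 / l\<^sup>2) * ennreal ((coord_trunc j e ?h x)\<^sup>2)" by (intro ennreal_mult) auto
          finally show ?thesis by (auto simp: indicator_def)
        qed simp
      qed
      finally show ?thesis .
    qed
    also have "\<dots> = ennreal (1 / l\<^sup>2) * (\<integral>\<^sup>+x. ennreal ((coord_trunc j e ?h x)\<^sup>2) \<partial>?M)"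
      by (intro nn_integral_cmult) measurable
    also have "\<dots> \<le> ennreal (1 / l\<^sup>2) * (16 * (\<integral>\<^sup>+x. ennreal ((?h x)\<^sup>2) \<partial>?M))"
      by (intro mult_left_mono coord_trunc_L2[OF j hm hf e]) simp
    also have "\<dots> \<le> ennreal (1 / l\<^sup>2) * (ennreal 160 * ennreal b)"
      by (intro mult_left_mono mult_mono h2) auto
    also have "ennreal 160 * ennreal b = ennreal (160 * b)" using b by (intro ennreal_mult[symmetric]) auto
    also have "ennreal (1 / l\<^sup>2) * ennreal (160 * b) = ennreal (1 / l\<^sup>2 * (160 * b))"
      using b by (intro ennreal_mult[symmetric]) auto
    also have "1 / l\<^sup>2 * (160 * b) = 160 * b / l\<^sup>2" by simp
    finally show "emeasure ?M {x \<in> space ?M. l < \<bar>coord_trunc j e ?h x\<bar>} \<le> ennreal (160 * b / l\<^sup>2)" .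
  qed (use fin t m b f cm2 in auto)
  also have "\<dots> \<le> ennreal (161 * b) * ennreal m + ennreal (161 * b) * ?J"
  proof (intro add_mono mult_right_mono ennreal_leI)
    have "ennreal ((t + 160 * b) * m) \<le> ennreal (161 * b * m)"
      using tb m by (intro ennreal_leI mult_right_mono) auto
    also have "\<dots> = ennreal (161 * b) * ennreal m" using b m by (intro ennreal_mult) auto
    finally show "ennreal ((t + 160 * b) * m) \<le> ennreal (161 * b) * ennreal m" .
  qed (use b in auto)
  also have "\<dots> = 161 * emeasure ?M E * (ennreal m + ?J)"
    using b by (simp add: distrib_left ennreal_mult)
  finally show ?thesis .
qed

section \<open>Consequences of a finite Calderon operator\<close>

lemma calderon_finiteD:
  assumes "calderon g t < \<infinity>" "t > 0"
  shows "(\<integral>\<^sup>+u \<in> {0<..<t}. g u \<partial>lborel) < \<infinity>" "(\<integral>\<^sup>+u \<in> {t<..}. g u * ennreal (1 / u) \<partial>lborel) < \<infinity>"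
  using assms unfolding calderon_def by (auto simp: ennreal_mult_less_top)

lemma antimono_average:
  fixes g :: "real \<Rightarrow> ennreal"
  assumes g: "\<And>x y. x \<le> y \<Longrightarrow> g y \<le> g x" and t: "t > 0"
  shows "g t \<le> ennreal (1 / t) * (\<integral>\<^sup>+u \<in> {0<..<t}. g u \<partial>lborel)"
proof -
  have "g t = ennreal (1 / t) * (g t * ennreal t)"
    using t by (simp add: mult.left_commute flip: ennreal_mult)
  also have "g t * ennreal t = (\<integral>\<^sup>+u \<in> {0<..<t}. g t \<partial>lborel)"
    using t by (simp add: nn_integral_cmult_indicator)
  also have "\<dots> \<le> (\<integral>\<^sup>+u \<in> {0<..<t}. g u \<partial>lborel)"
    using g by (intro nn_integral_mono) (auto simp: indicator_def)
  finally show ?thesis by (simp add: mult_left_mono)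
qed

lemma rearrangement_finite:
  assumes "calderon (rearrangement M f) t < \<infinity>" "t > 0"
  shows "rearrangement M f t < \<infinity>"
proof -
  have "rearrangement M f t \<le> ennreal (1 / t) * (\<integral>\<^sup>+u \<in> {0<..<t}. rearrangement M f u \<partial>lborel)"
    using assms(2) by (intro antimono_average rearrangement_antimono)
  also have "\<dots> < \<infinity>" using calderon_finiteD(1)[OF assms] by (simp add: ennreal_mult_less_top)
  finally show ?thesis .
qed

text \<open>If a level set had infinite measure, the rearrangement would exceed \<open>s\<close>
  everywhere and its integral against \<open>1 / u\<close> would diverge logarithmically.\<close>

lemma distribution_finite:
  assumes c: "calderon (rearrangement M f) 1 < \<infinity>" and f: "f \<in> borel_measurable M" and s: "s > 0"
  shows "emeasure M {x \<in> space M. s < \<bar>f x\<bar>} < \<infinity>"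
proof (rule ccontr)
  assume "\<not> ?thesis"
  then have gt: "ennreal s < rearrangement M f u" for u
    using rearrangement_gt_iff[OF f, of s u] s by (simp add: not_less top_unique)
  have b: "ennreal (s * ln (real (Suc n))) \<le> (\<integral>\<^sup>+u \<in> {1<..}. rearrangement M f u * ennreal (1 / u) \<partial>lborel)" for n
  proof -
    have "ennreal (s * ln (real (Suc n))) = ennreal s * (\<integral>\<^sup>+x. ennreal (1 / x) * indicator {1..real (Suc n)} x \<partial>lborel)"
      using s by (subst nn_integral_inverse_Icc) (auto simp: ennreal_mult)
    also have "\<dots> = (\<integral>\<^sup>+x. ennreal s * (ennreal (1 / x) * indicator {1..real (Suc n)} x) \<partial>lborel)"
      by (rule nn_integral_cmult[symmetric]) measurable
    also have "\<dots> \<le> (\<integral>\<^sup>+u \<in> {1<..}. rearrangement M f u * ennreal (1 / u) \<partial>lborel)"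
    proof (rule nn_integral_mono_AE)
      have "AE u in lborel. u \<noteq> (1::real)" by (rule AE_lborel_singleton)
      then show "AE u in lborel. ennreal s * (ennreal (1 / u) * indicator {1..real (Suc n)} u)
        \<le> rearrangement M f u * ennreal (1 / u) * indicator {1<..} u"
      proof eventually_elim
        case (elim u)
        then show ?case
          using mult_right_mono[OF less_imp_le[OF gt[of u]], of "ennreal (1 / u)"]
          by (auto simp: indicator_def)
      qed
    qed
    finally show ?thesis .
  qed
  let ?J = "\<integral>\<^sup>+u \<in> {1<..}. rearrangement M f u * ennreal (1 / u) \<partial>lborel"
  define a where "a = enn2real ?J"
  have "?J < \<infinity>" by (rule calderon_finiteD(2)[OF c]) simp
  then have a: "?J = ennreal a" "a \<ge> 0" by (simp_all add: a_def)
  obtain n where n: "exp ((a + 1) / s) < real n" using reals_Archimedean2 by blast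
  have "exp ((a + 1) / s) < real (Suc n)" using n by simp
  then have "ln (exp ((a + 1) / s)) < ln (real (Suc n))" by (subst ln_less_cancel_iff) auto
  then have "(a + 1) / s < ln (real (Suc n))" by simp
  then have "a + 1 < s * ln (real (Suc n))" using s by (simp add: field_simps)
  moreover have "s * ln (real (Suc n)) \<le> a" using b[of n] a by (simp add: ennreal_le_iff)
  ultimately show False by simp
qed

lemma emeasure_slab_Rd:
  assumes j: "j \<in> {1..d}" and "R \<ge> 0" "a \<ge> 0"
  shows "emeasure (borel_Rd d) (PiE {1..d} (\<lambda>i. if i = j then {- a..a} else {- R..R})) = ennreal (2 * (2 * R) ^ (d - 1) * a)"
proof -
  have "emeasure (borel_Rd d) (PiE {1..d} (\<lambda>i. if i = j then {- a..a} else {- R..R}))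
    = (\<Prod>i\<in>{1..d}. emeasure lborel (if i = j then {- a..a} else {- R..R}))"
    by (rule PS.emeasure_PiM) auto
  also have "\<dots> = emeasure lborel {- a..a} * (\<Prod>i\<in>{1..d} - {j}. emeasure lborel {- R..R})"
    using j by (subst prod.remove[of _ j]) auto
  also have "(\<Prod>i\<in>{1..d} - {j}. emeasure lborel {- R..R}) = ennreal (2 * R) ^ (d - 1)"
    using j assms(2) by simp
  also have "emeasure lborel {- a..a} * ennreal (2 * R) ^ (d - 1) = ennreal (2 * (2 * R) ^ (d - 1) * a)"
    using assms by (simp add: ennreal_power ennreal_mult[symmetric] mult_ac)
  finally show ?thesis .
qed

text \<open>The weight \<open>1 / (1 + \<bar>x j\<bar>)\<close>, restricted to bounded values of the
  other coordinates, is at most 1 and has level sets of measure at most \<open>K / l\<close>. The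
  pairing estimate applies to it as to a transform, and Fubini passes from a finite integral to
  almost every line.\<close>

lemma sections_tail_integrable:
  assumes j: "j \<in> {1..d}" and g[measurable]: "g \<in> borel_measurable (borel_Rd d)"
    and c: "calderon (rearrangement (borel_Rd d) g) 1 < \<infinity>"
  shows "AE x in PiM ({1..d} - {j}) (\<lambda>_. lborel). tail_integrable (\<lambda>s. g (x(j := s)))"
proof -
  let ?M = "borel_Rd d" and ?I = "PiM ({1..d} - {j}) (\<lambda>_. lborel :: real measure)"
  define m where "m = enn2real (rearrangement ?M g 1)"
  have "rearrangement ?M g 1 < \<infinity>" by (rule rearrangement_finite[OF c]) simp
  then have mr: "ennreal m = rearrangement ?M g 1" by (simp add: m_def)
  have m0: "m \<ge> 0" by (simp add: m_def)
  have bm: "emeasure ?M {x \<in> space ?M. m < \<bar>g x\<bar>} \<le> ennreal 1"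
    using rearrangement_gt_iff[OF g m0, of 1] mr by (simp add: not_less)
  have R: "AE x in ?I. (\<forall>i\<in>{1..d} - {j}. \<bar>x i\<bar> \<le> real n) \<longrightarrow> tail_integrable (\<lambda>s. g (x(j := s)))" for n
  proof -
    define R where "R = real n"
    have R0: "R \<ge> 0" by (simp add: R_def)
    define B where "B = {x \<in> space ?M. \<forall>i\<in>{1..d} - {j}. \<bar>x i\<bar> \<le> R}"
    have Bm[measurable]: "B \<in> sets ?M"
    proof -
      have "B = {x \<in> space ?M. \<forall>i\<in>{1..d}. i \<noteq> j \<longrightarrow> \<bar>x i\<bar> \<le> R}" by (auto simp: B_def)
      also have "\<dots> \<in> sets ?M"
      proof (intro sets.sets_Collect_finite_All)
        fix i assume "i \<in> {1..d}"
        then have [measurable]: "(\<lambda>x. x i) \<in> borel_measurable ?M" by (rule component_measurable_Rd)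
        show "{x \<in> space ?M. i \<noteq> j \<longrightarrow> \<bar>x i\<bar> \<le> R} \<in> sets ?M" by measurable
      qed auto
      finally show ?thesis .
    qed
    let ?W = "\<lambda>x. indicator B x / (1 + \<bar>x j\<bar>)"
    have [measurable]: "(\<lambda>x. x j) \<in> borel_measurable ?M" by (rule component_measurable_Rd[OF j])
    have Wm[measurable]: "?W \<in> borel_measurable ?M" by measurable
    have gW: "(\<lambda>x. ennreal \<bar>g x\<bar> * ennreal \<bar>?W x\<bar>) \<in> borel_measurable ?M" by measurable
    define K where "K = 2 * (2 * R) ^ (d - 1)"
    have K0: "K \<ge> 0" using R0 by (simp add: K_def)
    have W: "emeasure ?M {x \<in> space ?M. l < \<bar>?W x\<bar>} \<le> ennreal (K / l)"
        "l \<ge> 1 \<Longrightarrow> emeasure ?M {x \<in> space ?M. l < \<bar>?W x\<bar>} = 0" if l: "l > 0" for l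
    proof -
      have sub: "{x \<in> space ?M. l < \<bar>?W x\<bar>} \<subseteq> PiE {1..d} (\<lambda>i. if i = j then {- (1 / l)..1 / l} else {- R..R})"
      proof
        fix x assume x: "x \<in> {x \<in> space ?M. l < \<bar>?W x\<bar>}"
        have xB: "x \<in> B"
        proof (rule ccontr)
          assume "x \<notin> B"
          then show False using x l by simp
        qed
        have "l < 1 / (1 + \<bar>x j\<bar>)" using x xB by simp
        then have "l * (1 + \<bar>x j\<bar>) < 1" by (simp add: divide_simps)
        then have "l * \<bar>x j\<bar> \<le> 1" using l by (simp add: distrib_left)
        then have "\<bar>x j\<bar> \<le> 1 / l" using l by (simp add: field_simps)
        moreover have "\<bar>x i\<bar> \<le> R" if "i \<in> {1..d}" "i \<noteq> j" for i using xB that by (auto simp: B_def)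
        ultimately show "x \<in> PiE {1..d} (\<lambda>i. if i = j then {- (1 / l)..1 / l} else {- R..R})"
          using x by (auto simp: space_PiM PiE_iff abs_le_iff minus_le_iff)
      qed
      have "emeasure ?M {x \<in> space ?M. l < \<bar>?W x\<bar>} \<le> emeasure ?M (PiE {1..d} (\<lambda>i. if i = j then {- (1 / l)..1 / l} else {- R..R}))"
        by (rule emeasure_mono[OF sub]) (rule sets_PiM_I_finite, auto)
      also have "\<dots> = ennreal (2 * (2 * R) ^ (d - 1) * (1 / l))"
        using l R0 by (intro emeasure_slab_Rd[OF j]) auto
      finally show "emeasure ?M {x \<in> space ?M. l < \<bar>?W x\<bar>} \<le> ennreal (K / l)" by (simp add: K_def)
      show "emeasure ?M {x \<in> space ?M. l < \<bar>?W x\<bar>} = 0" if "l \<ge> 1"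
      proof -
        have "\<bar>?W x\<bar> \<le> 1" for x by (simp add: indicator_def divide_simps)
        then have "\<not> l < \<bar>?W x\<bar>" for x using that by (meson le_less_trans not_less)
        then show ?thesis by simp
      qed
    qed
    have W2: "emeasure ?M {x \<in> space ?M. l < \<bar>?W x\<bar>} \<le> ennreal (K / l\<^sup>2)" if l: "l > 0" for l
    proof (cases "l \<ge> 1")
      case True then show ?thesis using W(2)[OF l True] by simp
    next
      case False
      have "l\<^sup>2 \<le> l" using False l by (simp add: power2_eq_square mult_le_cancel_left2)
      then have "K / l \<le> K / l\<^sup>2" using K0 l by (intro divide_left_mono) auto
      then show ?thesis using W(1)[OF l] by (meson ennreal_leI order_trans)
    qed
    \<comment> \<open>Above the height \<open>m\<close> the excess is integrable and the weight is
      at most 1; below \<open>m\<close> the pairing estimate is used.\<close>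
    have "(\<integral>\<^sup>+x. ennreal \<bar>g x\<bar> * ennreal \<bar>?W x\<bar> \<partial>?M)
      \<le> (\<integral>\<^sup>+x. ennreal (\<bar>g x\<bar> - m) + ennreal (min \<bar>g x\<bar> m) * ennreal \<bar>?W x\<bar> \<partial>?M)"
    proof (intro nn_integral_mono)
      fix x
      have w: "\<bar>?W x\<bar> \<le> 1" by (simp add: indicator_def divide_simps)
      show "ennreal \<bar>g x\<bar> * ennreal \<bar>?W x\<bar> \<le> ennreal (\<bar>g x\<bar> - m) + ennreal (min \<bar>g x\<bar> m) * ennreal \<bar>?W x\<bar>"
      proof (cases "\<bar>g x\<bar> \<le> m")
        case True then show ?thesis by (simp add: min_def)
      next
        case False
        then have "ennreal \<bar>g x\<bar> = ennreal (\<bar>g x\<bar> - m) + ennreal m" using m0 by (simp flip: ennreal_plus)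
        then have "ennreal \<bar>g x\<bar> * ennreal \<bar>?W x\<bar> = ennreal (\<bar>g x\<bar> - m) * ennreal \<bar>?W x\<bar> + ennreal m * ennreal \<bar>?W x\<bar>"
          by (simp add: distrib_right)
        also have "ennreal (\<bar>g x\<bar> - m) * ennreal \<bar>?W x\<bar> \<le> ennreal (\<bar>g x\<bar> - m) * 1"
          using w by (intro mult_left_mono) (auto simp: ennreal_le_1)
        finally show ?thesis using False by (simp add: min_def)
      qed
    qed
    also have "\<dots> = (\<integral>\<^sup>+x. ennreal (\<bar>g x\<bar> - m) \<partial>?M) + (\<integral>\<^sup>+x. ennreal (min \<bar>g x\<bar> m) * ennreal \<bar>?W x\<bar> \<partial>?M)"
      by (intro nn_integral_add) measurable
    also have "\<dots> \<le> (\<integral>\<^sup>+u \<in> {0<..<1}. rearrangement ?M g u \<partial>lborel)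
      + (ennreal ((1 + K) * m) + ennreal K * (\<integral>\<^sup>+u \<in> {1<..}. rearrangement ?M g u * ennreal (1 / u) \<partial>lborel))"
      using W W2 K0 m0 bm distribution_finite[OF c g]
      by (intro add_mono RS.excess_le_rearrangement RS.rearrangement_pairing g Wm) auto
    also have "\<dots> < \<infinity>"
      using calderon_finiteD[OF c] by (simp add: ennreal_mult_less_top)
    finally have fin: "(\<integral>\<^sup>+x. ennreal \<bar>g x\<bar> * ennreal \<bar>?W x\<bar> \<partial>?M) < \<infinity>" .
    have "(\<integral>\<^sup>+x. ennreal \<bar>g x\<bar> * ennreal \<bar>?W x\<bar> \<partial>?M)
      = (\<integral>\<^sup>+x. (\<integral>\<^sup>+y. ennreal \<bar>g (x(j := y))\<bar> * ennreal \<bar>?W (x(j := y))\<bar> \<partial>lborel) \<partial>?I)"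
      by (rule nn_integral_split_coord[OF j gW])
    then have "AE x in ?I. (\<integral>\<^sup>+y. ennreal \<bar>g (x(j := y))\<bar> * ennreal \<bar>?W (x(j := y))\<bar> \<partial>lborel) \<noteq> \<infinity>"
      using fin by (intro nn_integral_noteq_infinite nn_integral_section_measurable[OF j gW]) auto
    with AE_space show ?thesis
    proof eventually_elim
      case (elim x)
      show ?case
      proof
        assume xR: "\<forall>i\<in>{1..d} - {j}. \<bar>x i\<bar> \<le> real n"
        have gm: "(\<lambda>s. g (x(j := s))) \<in> borel_measurable borel"
          using section_measurable[OF j g, of x] elim(1) by simp
        have "x(j := y) \<in> space ?M" for y
          using measurable_space[OF fun_upd_section_measurable[OF j elim(1)]] by simp
        then have xB: "x(j := y) \<in> B" for y using xR by (auto simp: B_def R_def)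
        have "(\<integral>\<^sup>+y. ennreal (norm (g (x(j := y)) / (1 + \<bar>y\<bar>))) \<partial>lborel)
          = (\<integral>\<^sup>+y. ennreal \<bar>g (x(j := y))\<bar> * ennreal \<bar>?W (x(j := y))\<bar> \<partial>lborel)"
          using xB by (intro nn_integral_cong) (simp flip: ennreal_mult)
        then show "tail_integrable (\<lambda>s. g (x(j := s)))"
          using elim(2) gm by (auto simp: tail_integrable_def integrable_iff_bounded less_top)
      qed
    qed
  qed
  then have "AE x in ?I. \<forall>n::nat. (\<forall>i\<in>{1..d} - {j}. \<bar>x i\<bar> \<le> real n) \<longrightarrow> tail_integrable (\<lambda>s. g (x(j := s)))"
    unfolding AE_all_countable by blast
  then show ?thesis
  proof eventually_elim
    case (elim x)
    obtain n where n: "Max (insert 0 ((\<lambda>i. \<bar>x i\<bar>) ` ({1..d} - {j}))) \<le> real n" using real_arch_simple by blast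
    have "\<bar>x i\<bar> \<le> real n" if "i \<in> {1..d} - {j}" for i
      using n that by (subst (asm) Max_le_iff) auto
    then show ?case using elim by blast
  qed
qed

section \<open>Rearrangement of the coordinate transform\<close>

text \<open>A Cauchy condition over countably many truncations, so that the existence of the
  principal value becomes a measurable property of the point.\<close>

definition pv_cauchy :: "(real \<Rightarrow> real) \<Rightarrow> real \<Rightarrow> bool" where
  "pv_cauchy f x \<longleftrightarrow> (\<forall>k::nat. \<exists>n::nat. \<forall>q r::rat. 0 < q \<and> real_of_rat q < 1 / real (Suc n)
    \<and> 0 < r \<and> real_of_rat r < 1 / real (Suc n)
    \<longrightarrow> \<bar>trunc_hilbert (of_rat q) f x - trunc_hilbert (of_rat r) f x\<bar> \<le> 1 / real (Suc k))"

lemma pv_cauchyI: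
  assumes "pv_exists f x"
  shows "pv_cauchy f x"
  unfolding pv_cauchy_def
proof
  fix k :: nat
  obtain L where L: "((\<lambda>e. trunc_hilbert e f x) \<longlongrightarrow> L) (at_right 0)"
    using assms by (auto simp: pv_exists_def)
  define d where "d = 1 / (2 * real (Suc k))"
  have d: "d > 0" "1 / real (Suc k) = d + d" by (simp_all add: d_def field_simps)
  have "\<forall>\<^sub>F e in at_right 0. dist (trunc_hilbert e f x) L < d"
    by (rule tendstoD[OF L d(1)])
  then obtain b where b: "b > 0" "\<And>e. 0 < e \<Longrightarrow> e < b \<Longrightarrow> dist (trunc_hilbert e f x) L < d"
    by (auto simp: eventually_at_right_field)
  obtain n where n: "1 / real (Suc n) < b" using reals_Archimedean[OF b(1)] by (auto simp: inverse_eq_divide)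
  have "\<bar>trunc_hilbert (of_rat q) f x - trunc_hilbert (of_rat r) f x\<bar> \<le> 1 / real (Suc k)"
    if "0 < q" "real_of_rat q < 1 / real (Suc n)" "0 < r" "real_of_rat r < 1 / real (Suc n)" for q r :: rat
  proof -
    have "\<bar>trunc_hilbert (of_rat q) f x - L\<bar> < d" "\<bar>trunc_hilbert (of_rat r) f x - L\<bar> < d"
      using b(2)[of "of_rat q"] b(2)[of "of_rat r"] that n by (auto simp: dist_real_def)
    then show ?thesis unfolding d(2) by linarith
  qed
  then show "\<exists>n::nat. \<forall>q r::rat. 0 < q \<and> real_of_rat q < 1 / real (Suc n)
    \<and> 0 < r \<and> real_of_rat r < 1 / real (Suc n)
    \<longrightarrow> \<bar>trunc_hilbert (of_rat q) f x - trunc_hilbert (of_rat r) f x\<bar> \<le> 1 / real (Suc k)" by blast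
qed

text \<open>Right continuity in the truncation parameter extends the Cauchy bound from rational to
  all small truncations; a single rational truncation then serves as constant approximant for each
  tolerance.\<close>

lemma pv_cauchyD:
  assumes f: "tail_integrable f" and c: "pv_cauchy f x"
  shows "pv_exists f x"
  unfolding pv_exists_def
proof (rule tendsto_exists_uniform_approx)
  fix k :: nat
  obtain n where n: "\<And>q r::rat. 0 < q \<Longrightarrow> real_of_rat q < 1 / real (Suc n)
    \<Longrightarrow> 0 < r \<Longrightarrow> real_of_rat r < 1 / real (Suc n)
    \<Longrightarrow> \<bar>trunc_hilbert (of_rat q) f x - trunc_hilbert (of_rat r) f x\<bar> \<le> 1 / real (Suc k)"
    using c unfolding pv_cauchy_def by blast
  obtain r :: rat where r: "0 < real_of_rat r" "real_of_rat r < 1 / real (Suc n)"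
    using of_rat_dense[of 0 "1 / real (Suc n)"] by auto
  have "\<bar>trunc_hilbert e f x - trunc_hilbert (of_rat r) f x\<bar> \<le> 1 / real (Suc k)"
    if e: "0 < e" "e < 1 / real (Suc n)" for e
  proof -
    obtain X :: "nat \<Rightarrow> rat" where X: "\<And>n. of_rat (X n) > e" "(\<lambda>n. of_rat (X n)) \<longlonglongrightarrow> e"
      using rational_right_approx[of e] by blast
    have "(\<lambda>n. trunc_hilbert (of_rat (X n)) f x) \<longlonglongrightarrow> trunc_hilbert e f x"
      using X e f by (intro trunc_hilbert_right_continuous[of _ e] tail_integrable_trunc_hilbert)
        (auto intro: less_imp_le simp: tail_integrable_def)
    then have lim: "(\<lambda>n. \<bar>trunc_hilbert (of_rat (X n)) f x - trunc_hilbert (of_rat r) f x\<bar>)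
      \<longlonglongrightarrow> \<bar>trunc_hilbert e f x - trunc_hilbert (of_rat r) f x\<bar>"
      by (intro tendsto_intros)
    have "\<forall>\<^sub>F m in sequentially. real_of_rat (X m) < 1 / real (Suc n)"
      using order_tendstoD(2)[OF X(2) e(2)] .
    then have "\<forall>\<^sub>F m in sequentially. \<bar>trunc_hilbert (of_rat (X m)) f x - trunc_hilbert (of_rat r) f x\<bar> \<le> 1 / real (Suc k)"
    proof eventually_elim
      case (elim m)
      have "0 < real_of_rat (X m)" using X(1)[of m] e by linarith
      then show ?case using elim r by (intro n) auto
    qed
    then show ?thesis by (intro tendsto_upperbound[OF lim]) auto
  qed
  then have "\<forall>\<^sub>F e in at_right 0. \<bar>trunc_hilbert e f x - trunc_hilbert (of_rat r) f x\<bar> \<le> 1 / real (Suc k)"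
    unfolding eventually_at_right_field by (intro exI[of _ "1 / real (Suc n)"]) simp
  then show "\<exists>u L. (u \<longlongrightarrow> L) (at_right 0) \<and> (\<forall>\<^sub>F e in at_right 0. \<bar>trunc_hilbert e f x - u e\<bar> \<le> 1 / real (Suc k))"
    by (intro exI[of _ "\<lambda>_. trunc_hilbert (of_rat r) f x"] exI[of _ "trunc_hilbert (of_rat r) f x"]) auto
qed simp

text \<open>Almost everywhere on almost every line has to become almost everywhere in the product
  space. This requires a measurable predicate, hence the countable Cauchy condition and the finite
  integral in place of the two properties themselves.\<close>

lemma AE_coord_pv_exists:
  assumes j: "j \<in> {1..d}" and g[measurable]: "g \<in> borel_measurable (borel_Rd d)"
    and tail: "AE x in PiM ({1..d} - {j}) (\<lambda>_. lborel). tail_integrable (\<lambda>s. g (x(j := s)))"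
  shows "AE x in borel_Rd d. tail_integrable (\<lambda>s. g (x(j := s))) \<and> pv_exists (\<lambda>s. g (x(j := s))) (x j)"
proof -
  let ?s = "\<lambda>x s. g (x(j := s))"
  let ?P = "\<lambda>x. (\<integral>\<^sup>+s. ennreal (norm (?s x s / (1 + \<bar>s\<bar>))) \<partial>lborel) < \<infinity> \<and> pv_cauchy (?s x) (x j)"
  have tl: "tail_integrable (?s x) \<longleftrightarrow> (\<integral>\<^sup>+s. ennreal (norm (?s x s / (1 + \<bar>s\<bar>))) \<partial>lborel) < \<infinity>"
    if "?s x \<in> borel_measurable borel" for x
    using that by (auto simp: tail_integrable_def integrable_iff_bounded)
  have "AE x in borel_Rd d. ?P x"
  proof (rule AE_split_coord[OF j])
    note [measurable] = fun_upd_measurable[OF j]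
    have [measurable]: "(\<lambda>x. trunc_hilbert e (?s x) (x j)) \<in> borel_measurable (borel_Rd d)" for e
      using coord_trunc_measurable[OF j g, of e] unfolding coord_trunc_def[abs_def] .
    show "Measurable.pred (borel_Rd d) ?P"
      unfolding pv_cauchy_def by measurable
    show "AE x in PiM ({1..d} - {j}) (\<lambda>_. lborel). AE y in lborel. ?P (x(j := y))"
      using tail
    proof eventually_elim
      case (elim x)
      then have "(\<integral>\<^sup>+s. ennreal (norm (?s x s / (1 + \<bar>s\<bar>))) \<partial>lborel) < \<infinity>"
        by (auto simp: tail_integrable_def integrable_iff_bounded)
      moreover from pv_exists_tail_integrable[OF elim] have "AE y in lborel. pv_cauchy (?s x) y"
        by eventually_elim (rule pv_cauchyI)
      ultimately show ?case unfolding fun_upd_upd fun_upd_same by simp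
    qed
  qed
  with AE_space show ?thesis
  proof eventually_elim
    case (elim x)
    have "tail_integrable (?s x)"
      using elim tl[OF section_measurable[OF j g]] by auto
    then show ?case using elim pv_cauchyD by blast
  qed
qed

text \<open>A measurable version of the coordinate transform: the limit is taken along one sequence
  of truncations, and it agrees with \<open>hilbert_coord\<close> wherever the section is tail
  integrable and the principal value exists.\<close>

definition coord_lim :: "nat \<Rightarrow> ((nat \<Rightarrow> real) \<Rightarrow> real) \<Rightarrow> (nat \<Rightarrow> real) \<Rightarrow> real" where
  "coord_lim j g x = lim (\<lambda>n. 1 / pi * coord_trunc j (1 / real (Suc n)) g x)"

lemma coord_lim_measurable:
  assumes j: "j \<in> {1..d}" and g: "g \<in> borel_measurable (borel_Rd d)"
  shows "coord_lim j g \<in> borel_measurable (borel_Rd d)"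
proof -
  note [measurable] = coord_trunc_measurable[OF j g]
  show ?thesis unfolding coord_lim_def[abs_def] by measurable
qed

lemma inverse_Suc_at_right: "filterlim (\<lambda>n. 1 / real (Suc n)) (at_right 0) sequentially"
proof -
  have "(\<lambda>n. 1 / real (Suc n)) \<longlonglongrightarrow> 0" by (rule LIMSEQ_Suc[OF lim_1_over_n])
  moreover have "\<forall>\<^sub>F n in sequentially. 1 / real (Suc n) \<in> {0<..} \<and> 1 / real (Suc n) \<noteq> 0" by simp
  ultimately show ?thesis unfolding filterlim_at by blast
qed

lemma coord_lim_eq:
  assumes "((\<lambda>e. coord_trunc j e g x) \<longlongrightarrow> L) (at_right 0)"
  shows "coord_lim j g x = L / pi"
  unfolding coord_lim_def
proof (rule limI)
  have "(\<lambda>n. coord_trunc j (1 / real (Suc n)) g x) \<longlonglongrightarrow> L"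
    by (rule filterlim_compose[OF assms inverse_Suc_at_right])
  from tendsto_mult_left[OF this, of "1 / pi"]
  show "(\<lambda>n. 1 / pi * coord_trunc j (1 / real (Suc n)) g x) \<longlonglongrightarrow> L / pi" by simp
qed

lemma hilbert_coord_eq_lim:
  assumes "tail_integrable (\<lambda>s. g (x(j := s)))" "pv_exists (\<lambda>s. g (x(j := s))) (x j)"
  shows "hilbert_coord j g x = coord_lim j g x"
proof -
  obtain L where L: "((\<lambda>e. coord_trunc j e g x) \<longlongrightarrow> L) (at_right 0)"
    using assms(2) by (auto simp: pv_exists_def coord_trunc_def)
  have "hilbert_coord j g x = Lim (at_right 0) (\<lambda>e. 1 / pi * coord_trunc j e g x)"
    using assms(1) by (intro hilbert_coord_eq) (auto simp: tail_integrable_def)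
  also have "\<dots> = L / pi"
    using tendsto_mult_left[OF L, of "1 / pi"] by (intro tendsto_Lim) auto
  also have "\<dots> = coord_lim j g x" using coord_lim_eq[OF L] by simp
  finally show ?thesis .
qed

text \<open>If the set had measure above \<open>t\<close>, it would contain a bounded set of measure
  above \<open>t\<close> on which one and the same truncation exceeds \<open>l\<close>. The mean of
  that truncation over this set would then violate \<open>coord_trunc_mean\<close>.\<close>

lemma bounded_part_distribution:
  assumes j: "j \<in> {1..d}" and g[measurable]: "g \<in> borel_measurable (borel_Rd d)"
    and f[measurable]: "f \<in> borel_measurable (borel_Rd d)"
    and gf: "\<And>x. \<bar>g x\<bar> = min \<bar>f x\<bar> m" and m: "m \<ge> 0"
    and tail: "AE x in PiM ({1..d} - {j}) (\<lambda>_. lborel). tail_integrable (\<lambda>s. g (x(j := s)))"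
    and fin: "\<And>s. s > 0 \<Longrightarrow> emeasure (borel_Rd d) {x \<in> space (borel_Rd d). s < \<bar>f x\<bar>} < \<infinity>"
    and t: "t > 0"
    and l: "161 * (ennreal m + (\<integral>\<^sup>+u \<in> {t<..}. rearrangement (borel_Rd d) f u * ennreal (1 / u) \<partial>lborel)) < ennreal l"
  shows "emeasure (borel_Rd d) {x \<in> space (borel_Rd d). \<exists>N. \<forall>n\<ge>N. l < \<bar>coord_trunc j (1 / real (Suc n)) g x\<bar>} \<le> ennreal t"
proof (rule ccontr)
  let ?M = "borel_Rd d"
  let ?T = "\<lambda>n x. coord_trunc j (1 / real (Suc n)) g x"
  have Tm[measurable]: "coord_trunc j e g \<in> borel_measurable ?M" for e
    by (rule coord_trunc_measurable[OF j g])
  \<comment> \<open>A single index controls both the truncations and the box, which makes the sets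
    increase with \<open>N\<close>.\<close>
  let ?E = "\<lambda>N. {x \<in> space ?M. \<forall>n\<ge>N. l < \<bar>?T n x\<bar>} \<inter> box_Rd d (real N)"
  have Em: "?E N \<in> sets ?M" for N
    by (intro sets.Int box_Rd_sets) measurable
  assume "\<not> ?thesis"
  then have "ennreal t < emeasure ?M {x \<in> space ?M. \<exists>N. \<forall>n\<ge>N. l < \<bar>?T n x\<bar>}" by simp
  also have "{x \<in> space ?M. \<exists>N. \<forall>n\<ge>N. l < \<bar>?T n x\<bar>} = (\<Union>N. ?E N)"
  proof (intro equalityI subsetI)
    fix x assume x: "x \<in> {x \<in> space ?M. \<exists>N. \<forall>n\<ge>N. l < \<bar>?T n x\<bar>}"
    then obtain N where N: "\<forall>n\<ge>N. l < \<bar>?T n x\<bar>" by blast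
    obtain K where K: "x \<in> box_Rd d (real K)" using x space_borel_Rd_box[of d] by blast
    have "box_Rd d (real K) \<subseteq> box_Rd d (real (max N K))"
      unfolding box_Rd_def by (intro PiE_mono) auto
    then have "x \<in> ?E (max N K)" using x N K by auto
    then show "x \<in> (\<Union>N. ?E N)" by blast
  qed auto
  also have "emeasure ?M (\<Union>N. ?E N) = (SUP N. emeasure ?M (?E N))"
  proof (intro SUP_emeasure_incseq[symmetric])
    show "incseq ?E"
    proof (rule incseq_SucI)
      fix N
      have "box_Rd d (real N) \<subseteq> box_Rd d (real (Suc N))"
        unfolding box_Rd_def by (intro PiE_mono) auto
      then show "?E N \<subseteq> ?E (Suc N)" by auto
    qed
  qed (use Em in blast)
  finally obtain N where N: "ennreal t < emeasure ?M (?E N)" by (auto simp: less_SUP_iff)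
  let ?b = "emeasure ?M (?E N)"
  have "?b \<le> emeasure ?M (box_Rd d (real N))" by (intro emeasure_mono box_Rd_sets) auto
  then have bf: "?b < \<infinity>" using emeasure_box_Rd[of d "real N"] by (simp add: le_less_trans)
  have b0: "?b > 0" using N t by (simp add: le_less_trans)
  let ?X = "ennreal m + (\<integral>\<^sup>+u \<in> {t<..}. rearrangement ?M f u * ennreal (1 / u) \<partial>lborel)"
  have 1: "ennreal l * ?b = (\<integral>\<^sup>+x \<in> ?E N. ennreal l \<partial>?M)"
    by (rule nn_integral_cmult_indicator[symmetric, OF Em])
  have 2: "(\<integral>\<^sup>+x \<in> ?E N. ennreal l \<partial>?M) \<le> (\<integral>\<^sup>+x \<in> ?E N. ennreal \<bar>?T N x\<bar> \<partial>?M)"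
  proof (rule nn_integral_mono)
    fix x
    show "ennreal l * indicator (?E N) x \<le> ennreal \<bar>?T N x\<bar> * indicator (?E N) x"
    proof (cases "x \<in> ?E N")
      case True
      then have "l < \<bar>?T N x\<bar>" by blast
      then have "ennreal l \<le> ennreal \<bar>?T N x\<bar>" by (intro ennreal_leI less_imp_le)
      then show ?thesis by (rule mult_right_mono) simp
    qed simp
  qed
  have 3: "(\<integral>\<^sup>+x \<in> ?E N. ennreal \<bar>?T N x\<bar> \<partial>?M) \<le> 161 * ?b * ?X"
  proof (rule coord_trunc_mean[OF j g f gf m tail fin])
    show "?E N \<subseteq> box_Rd d (real N)" by blast
    show "ennreal t \<le> ?b" using N by simp
    show "?E N \<in> sets ?M" by (rule Em)
  qed (use t in auto)
  have 4: "161 * ?X * ?b < ennreal l * ?b"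
    by (rule ennreal_mult_strict_right_mono[OF l b0 bf[unfolded infinity_ennreal_def]])
  have ar: "161 * b * X = 161 * X * b" for b X :: ennreal by (simp add: mult_ac)
  show False using order_trans[OF 2 3] 4 unfolding 1[symmetric] ar[of ?b] by (meson not_le)
qed

theorem coord_lim_rearrangement:
  assumes j: "j \<in> {1..d}" and g[measurable]: "g \<in> borel_measurable (borel_Rd d)"
    and c: "\<And>t. t > 0 \<Longrightarrow> calderon (rearrangement (borel_Rd d) g) t < \<infinity>" and t: "t > 0"
  shows "rearrangement (borel_Rd d) (coord_lim j g) t \<le> 1000 * calderon (rearrangement (borel_Rd d) g) t"
proof -
  let ?M = "borel_Rd d" and ?mu = "rearrangement (borel_Rd d) g"
  \<comment> \<open>The budget \<open>t\<close> is split: the height is the rearrangement at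
    \<open>t / 2\<close>, and each of the two parts may exceed its level on a set of measure
    \<open>t / 2\<close>.\<close>
  define r where "r = t / 2"
  have r: "r > 0" "t = r + r" using t by (auto simp: r_def)
  define m where "m = enn2real (?mu r)"
  have mr: "ennreal m = ?mu r" using rearrangement_finite[OF c[OF r(1)] r(1)] by (simp add: m_def)
  have m0: "m \<ge> 0" by (simp add: m_def)
  define g2 where "g2 x = max (- m) (min m (g x))" for x
  define g1 where "g1 x = g x - g2 x" for x
  have g2m[measurable]: "g2 \<in> borel_measurable ?M" unfolding g2_def by measurable
  have g1m[measurable]: "g1 \<in> borel_measurable ?M" unfolding g1_def by measurable
  have g2a: "\<bar>g2 x\<bar> = min \<bar>g x\<bar> m" for x using m0 by (auto simp: g2_def)
  have g1a: "ennreal \<bar>g1 x\<bar> = ennreal (\<bar>g x\<bar> - m)" for x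
  proof -
    consider "m < g x" | "g x < - m" | "\<bar>g x\<bar> \<le> m" by linarith
    then show ?thesis
    proof cases
      case 1 then show ?thesis using m0 by (simp add: g1_def g2_def)
    next
      case 2 then show ?thesis using m0 by (simp add: g1_def g2_def)
    next
      case 3
      then have "g2 x = g x" by (simp add: g2_def)
      then show ?thesis using 3 by (simp add: g1_def ennreal_neg)
    qed
  qed
  have g12: "(\<lambda>x. g1 x + g2 x) = g" by (simp add: g1_def fun_eq_iff)
  let ?I1 = "\<integral>\<^sup>+u \<in> {0<..<r}. ?mu u \<partial>lborel"
  let ?I2 = "\<integral>\<^sup>+u \<in> {r<..}. ?mu u * ennreal (1 / u) \<partial>lborel"
  have bm: "emeasure ?M {x \<in> space ?M. m < \<bar>g x\<bar>} \<le> ennreal r"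
    using rearrangement_gt_iff[OF g m0, of r] mr by (simp add: not_less)
  have n1: "(\<integral>\<^sup>+x. ennreal \<bar>g1 x\<bar> \<partial>?M) \<le> ?I1"
    unfolding g1a by (rule RS.excess_le_rearrangement[OF g m0 bm])
  have I1f: "?I1 < \<infinity>" and I2f: "?I2 < \<infinity>" using calderon_finiteD[OF c[OF r(1)] r(1)] by auto
  have n1f: "(\<integral>\<^sup>+x. ennreal \<bar>g1 x\<bar> \<partial>?M) < \<infinity>" using n1 I1f by (rule le_less_trans)
  have tail: "AE x in PiM ({1..d} - {j}) (\<lambda>_. lborel). tail_integrable (\<lambda>s. g (x(j := s)))"
    by (rule sections_tail_integrable[OF j g c]) simp
  have tail2: "AE x in PiM ({1..d} - {j}) (\<lambda>_. lborel). tail_integrable (\<lambda>s. g2 (x(j := s)))"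
    using tail
  proof eventually_elim
    case (elim x)
    then have [measurable]: "(\<lambda>s. g (x(j := s))) \<in> borel_measurable borel"
      and i: "integrable lborel (\<lambda>s. g (x(j := s)) / (1 + \<bar>s\<bar>))" by (auto simp: tail_integrable_def)
    have "(\<lambda>s. g2 (x(j := s))) \<in> borel_measurable borel" unfolding g2_def by measurable
    then show ?case unfolding tail_integrable_def
    proof (intro conjI Bochner_Integration.integrable_bound[OF i] AE_I2)
      fix s
      show "norm (g2 (x(j := s)) / (1 + \<bar>s\<bar>)) \<le> norm (g (x(j := s)) / (1 + \<bar>s\<bar>))"
        unfolding real_norm_def abs_divide g2a by (intro divide_right_mono) auto
    qed simp_all
  qed
  have tail1: "AE x in PiM ({1..d} - {j}) (\<lambda>_. lborel). tail_integrable (\<lambda>s. g1 (x(j := s)))"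
    using coord_maximal_weak(2)[OF j g1m n1f zero_less_one]
    by eventually_elim (rule integrable_imp_tail_integrable)
  let ?A = "\<lambda>l. {x \<in> space ?M. max_trunc_gt (\<lambda>s. g1 (x(j := s))) l (x j)}"
  let ?B = "\<lambda>l. {x \<in> space ?M. \<exists>N. \<forall>n\<ge>N. l < \<bar>coord_trunc j (1 / real (Suc n)) g2 x\<bar>}"
  have bound: "emeasure ?M {x \<in> space ?M. l1 + l2 < \<bar>coord_lim j g x\<bar>} \<le> ennreal t"
    if l1: "l1 > 0" "160 * ?I1 \<le> ennreal (l1 * r)" and l2: "161 * (ennreal m + ?I2) < ennreal l2" for l1 l2
  proof -
    have Am: "?A l1 \<in> sets ?M" by (rule coord_maximal_weak(3)[OF j g1m n1f l1(1)])
    have Bm: "?B l2 \<in> sets ?M"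
    proof -
      have [measurable]: "coord_trunc j e g2 \<in> borel_measurable ?M" for e
        by (rule coord_trunc_measurable[OF j g2m])
      show ?thesis by measurable
    qed
    have intA: "AE x in borel_Rd d. \<forall>e>0. l1 < \<bar>coord_trunc j e g1 x\<bar> \<longrightarrow> x \<in> ?A l1"
    proof -
      have "AE x in borel_Rd d. (\<integral>\<^sup>+s. ennreal \<bar>g1 (x(j := s))\<bar> \<partial>lborel) < \<infinity>"
      proof (rule AE_split_coord[OF j])
        note [measurable] = fun_upd_measurable[OF j]
        show "Measurable.pred (borel_Rd d) (\<lambda>x. (\<integral>\<^sup>+s. ennreal \<bar>g1 (x(j := s))\<bar> \<partial>lborel) < \<infinity>)"
          by measurable
        show "AE x in PiM ({1..d} - {j}) (\<lambda>_. lborel). AE y in lborel. (\<integral>\<^sup>+s. ennreal \<bar>g1 ((x(j := y))(j := s))\<bar> \<partial>lborel) < \<infinity>"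
          using coord_maximal_weak(2)[OF j g1m n1f zero_less_one]
          by eventually_elim (auto simp: integrable_iff_bounded)
      qed
      with AE_space show ?thesis
      proof eventually_elim
        case (elim x)
        have "integrable lborel (\<lambda>s. g1 (x(j := s)))"
          using elim section_measurable[OF j g1m, of x] by (auto simp: integrable_iff_bounded)
        then show ?case using max_trunc_gtI elim(1) unfolding coord_trunc_def by blast
      qed
    qed
    have "AE x in ?M. l1 + l2 < \<bar>coord_lim j g x\<bar> \<longrightarrow> x \<in> ?A l1 \<union> ?B l2"
      using AE_coord_pv_exists[OF j g tail] AE_coord_pv_exists[OF j g1m tail1]
        AE_coord_pv_exists[OF j g2m tail2] intA AE_space
    proof eventually_elim
      case pv: (elim x)
      obtain L1 where L1: "((\<lambda>e. coord_trunc j e g1 x) \<longlongrightarrow> L1) (at_right 0)"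
        using pv(2) unfolding pv_exists_def coord_trunc_def by blast
      obtain L2 where L2: "((\<lambda>e. coord_trunc j e g2 x) \<longlongrightarrow> L2) (at_right 0)"
        using pv(3) unfolding pv_exists_def coord_trunc_def by blast
      have "\<forall>\<^sub>F e in at_right 0. coord_trunc j e g1 x + coord_trunc j e g2 x = coord_trunc j e g x"
        using eventually_at_right_less[of 0]
      proof eventually_elim
        case (elim e)
        have "coord_trunc j e (\<lambda>x. g1 x + g2 x) x = coord_trunc j e g1 x + coord_trunc j e g2 x"
          unfolding coord_trunc_def
          by (rule trunc_hilbert_add[OF tail_integrable_trunc_hilbert[OF conjunct1[OF pv(2)] elim]
                tail_integrable_trunc_hilbert[OF conjunct1[OF pv(3)] elim]])
        then show ?case unfolding g12 by simp
      qed
      from Lim_transform_eventually[OF tendsto_add[OF L1 L2] this]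
      have "coord_lim j g x = (L1 + L2) / pi" by (rule coord_lim_eq)
      show ?case
      proof
        assume "l1 + l2 < \<bar>coord_lim j g x\<bar>"
        also have "\<dots> = \<bar>L1 + L2\<bar> / pi" using \<open>coord_lim j g x = _\<close> by simp
        \<comment> \<open>The factor \<open>1 / pi\<close> only helps and is dropped.\<close>
        also have "\<dots> \<le> \<bar>L1 + L2\<bar>" using pi_gt3 by (simp add: divide_simps mult_le_cancel_left1)
        finally consider "l1 < \<bar>L1\<bar>" | "l2 < \<bar>L2\<bar>" by linarith
        then show "x \<in> ?A l1 \<union> ?B l2"
        proof cases
          case 1
          have "\<forall>\<^sub>F e in at_right 0. l1 < \<bar>coord_trunc j e g1 x\<bar> \<and> 0 < e"
            using order_tendstoD(1)[OF tendsto_rabs[OF L1] 1] eventually_at_right_less[of 0]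
            by eventually_elim simp
          then obtain e where "l1 < \<bar>coord_trunc j e g1 x\<bar>" "0 < e"
            by (auto dest!: eventually_happens)
          then show ?thesis using pv(4) by blast
        next
          case 2
          have "(\<lambda>n. coord_trunc j (1 / real (Suc n)) g2 x) \<longlonglongrightarrow> L2"
            by (rule filterlim_compose[OF L2 inverse_Suc_at_right])
          from order_tendstoD(1)[OF tendsto_rabs[OF this] 2]
          show ?thesis using pv(5) by (auto simp: eventually_sequentially)
        qed
      qed
    qed
    then have "AE x in ?M. x \<in> {x \<in> space ?M. l1 + l2 < \<bar>coord_lim j g x\<bar>} \<longrightarrow> x \<in> ?A l1 \<union> ?B l2"
      by eventually_elim blast
    then have s0: "emeasure ?M {x \<in> space ?M. l1 + l2 < \<bar>coord_lim j g x\<bar>} \<le> emeasure ?M (?A l1 \<union> ?B l2)"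
      by (rule emeasure_mono_AE[OF _ sets.Un[OF Am Bm]])
    have s1: "emeasure ?M (?A l1 \<union> ?B l2) \<le> emeasure ?M (?A l1) + emeasure ?M (?B l2)"
      by (rule emeasure_subadditive[OF Am Bm])
    have s2: "emeasure ?M (?A l1) \<le> ennreal r"
    proof -
      have p1: "ennreal (160 / l1) * ?I1 = ennreal (1 / l1) * (160 * ?I1)"
      proof -
        have "ennreal (160 / l1) = ennreal (1 / l1) * 160"
          using l1 ennreal_mult[of "1 / l1" 160] by simp
        then show ?thesis by (simp only: mult.assoc)
      qed
      have p2: "ennreal (1 / l1) * (160 * ?I1) \<le> ennreal (1 / l1) * ennreal (l1 * r)"
        by (rule mult_left_mono[OF l1(2)]) simp
      have p3: "ennreal (1 / l1) * ennreal (l1 * r) = ennreal r"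
        using l1 r by (simp flip: ennreal_mult)
      have p4: "emeasure ?M (?A l1) \<le> ennreal (160 / l1) * ?I1"
        by (rule order_trans[OF coord_maximal_weak(1)[OF j g1m n1f l1(1)] mult_left_mono[OF n1]]) simp
      show ?thesis by (rule order_trans[OF p4[unfolded p1] p2[unfolded p3]])
    qed
    have s3: "emeasure ?M (?B l2) \<le> ennreal r"
    proof (rule bounded_part_distribution[OF j g2m g g2a m0 tail2])
      show "emeasure ?M {x \<in> space ?M. s < \<bar>g x\<bar>} < \<infinity>" if "s > 0" for s
        by (rule distribution_finite[OF c[OF zero_less_one] g that])
    qed (use r l2 in auto)
    have "ennreal r + ennreal r = ennreal t" using r by (simp flip: ennreal_plus)
    then show ?thesis using order_trans[OF s0 order_trans[OF s1 add_mono[OF s2 s3]]] by simp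
  qed
  have rt: "ennreal (1 / r) = 2 * ennreal (1 / t)"
    using r ennreal_mult[of 2 "1 / t"] by simp
  have c1: "ennreal (1 / r) * ?I1 \<le> 2 * (ennreal (1 / t) * (\<integral>\<^sup>+u \<in> {0<..<t}. ?mu u \<partial>lborel))" (is "_ \<le> 2 * ?P")
  proof -
    have "?I1 \<le> (\<integral>\<^sup>+u \<in> {0<..<t}. ?mu u \<partial>lborel)"
      using r by (intro nn_integral_mono) (auto simp: indicator_def)
    then have "ennreal (1 / r) * ?I1 \<le> ennreal (1 / r) * (\<integral>\<^sup>+u \<in> {0<..<t}. ?mu u \<partial>lborel)"
      by (intro mult_left_mono) auto
    also have "ennreal (1 / r) * (\<integral>\<^sup>+u \<in> {0<..<t}. ?mu u \<partial>lborel) = 2 * ?P"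
      by (simp only: rt mult.assoc)
    finally show ?thesis .
  qed
  let ?Q = "\<integral>\<^sup>+u \<in> {t<..}. ?mu u * ennreal (1 / u) \<partial>lborel"
  have c2: "ennreal m \<le> 2 * ?P"
    unfolding mr using antimono_average[of ?mu r, OF rearrangement_antimono r(1)] c1 by (rule order_trans)
  have c3: "?I2 \<le> 2 * ?P + ?Q"
  proof -
    have "?I2 \<le> (\<integral>\<^sup>+u. ennreal (1 / r) * (?mu u * indicator {0<..<t} u) + ?mu u * ennreal (1 / u) * indicator {t<..} u \<partial>lborel)"
    proof (rule nn_integral_mono_AE)
      have "AE u in lborel. u \<noteq> t" by (rule AE_lborel_singleton)
      then show "AE u in lborel. ?mu u * ennreal (1 / u) * indicator {r<..} u
        \<le> ennreal (1 / r) * (?mu u * indicator {0<..<t} u) + ?mu u * ennreal (1 / u) * indicator {t<..} u"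
      proof eventually_elim
        case (elim u)
        consider "u \<le> r" | "r < u" "u < t" | "t < u" using elim by linarith
        then show ?case
        proof cases
          case 2
          then have "ennreal (1 / u) \<le> ennreal (1 / r)" using r by (intro ennreal_leI divide_left_mono) auto
          then have "?mu u * ennreal (1 / u) \<le> ennreal (1 / r) * ?mu u"
            by (subst mult.commute) (intro mult_right_mono, auto)
          then show ?thesis using 2 r by (simp add: indicator_def)
        qed (auto simp: indicator_def)
      qed
    qed
    also have "\<dots> = ennreal (1 / r) * (\<integral>\<^sup>+u \<in> {0<..<t}. ?mu u \<partial>lborel) + ?Q"
      by (subst nn_integral_add, measurable, subst nn_integral_cmult) measurable
    also have "ennreal (1 / r) * (\<integral>\<^sup>+u \<in> {0<..<t}. ?mu u \<partial>lborel) = 2 * ?P"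
      by (simp only: rt mult.assoc)
    finally show ?thesis .
  qed
  have cal: "calderon ?mu t = ?P + ?Q" by (simp add: calderon_def)
  have "ennreal (160 / r) * ?I1 + 161 * (ennreal m + ?I2) \<le> 160 * (2 * ?P) + 161 * (2 * ?P + (2 * ?P + ?Q))"
  proof (intro add_mono mult_left_mono c2 c3)
    have "ennreal (160 / r) = 160 * ennreal (1 / r)" using r ennreal_mult[of 160 "1 / r"] by simp
    then have e160: "ennreal (160 / r) * ?I1 = 160 * (ennreal (1 / r) * ?I1)" by (simp only: mult.assoc)
    show "ennreal (160 / r) * ?I1 \<le> 160 * (2 * ?P)" unfolding e160 by (rule mult_left_mono[OF c1]) simp
  qed auto
  \<comment> \<open>Here 964 is \<open>160 * 2 + 161 * 2 + 161 * 2\<close>; each factor 2 is the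
    price of passing from \<open>r = t / 2\<close> back to \<open>t\<close>. The sum is rounded up
    to 1000.\<close>
  also have "\<dots> = 964 * ?P + 161 * ?Q"
  proof -
    have "160 * (2 * p) + 161 * (2 * p + (2 * p + q)) = (160 * 2 + 161 * 2 + 161 * 2) * p + 161 * q" for p q :: ennreal
      by (simp only: distrib_left distrib_right mult.assoc add.assoc)
    then show ?thesis by simp
  qed
  also have "\<dots> \<le> 1000 * ?P + 1000 * ?Q" by (intro add_mono mult_right_mono) auto
  also have "\<dots> = 1000 * calderon ?mu t" unfolding cal by (simp add: distrib_left)
  finally have total: "ennreal (160 / r) * ?I1 + 161 * (ennreal m + ?I2) \<le> 1000 * calderon ?mu t" .
  define a where "a = enn2real ?I1"
  have a: "?I1 = ennreal a" "a \<ge> 0" using I1f by (auto simp: a_def)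
  define b where "b = enn2real (161 * (ennreal m + ?I2))"
  have "161 * (ennreal m + ?I2) < \<infinity>" using I2f by (simp add: ennreal_mult_less_top)
  then have b: "161 * (ennreal m + ?I2) = ennreal b" "b \<ge> 0" by (auto simp: b_def)
  \<comment> \<open>Both levels are raised by \<open>e / 2\<close>: the first must be positive, and
    the condition on the second is a strict inequality.\<close>
  have "rearrangement ?M (coord_lim j g) t \<le> ennreal (160 / r * a + b)"
  proof (rule ennreal_le_epsilon)
    fix e :: real assume e: "e > 0"
    have "rearrangement ?M (coord_lim j g) t \<le> ennreal ((160 / r * a + e / 2) + (b + e / 2))"
    proof (rule rearrangement_le[OF _ bound])
      show "0 < 160 / r * a + e / 2" using r a e by (intro add_nonneg_pos) auto
      have "160 * ?I1 = ennreal (160 * a)" unfolding a(1) using a(2) by (simp add: ennreal_mult)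
      also have "\<dots> \<le> ennreal ((160 / r * a + e / 2) * r)"
        using r a e by (intro ennreal_leI) (simp add: field_simps)
      finally show "160 * ?I1 \<le> ennreal ((160 / r * a + e / 2) * r)" .
      show "161 * (ennreal m + ?I2) < ennreal (b + e / 2)"
        unfolding b(1) using b(2) e by (intro ennreal_lessI) auto
    qed (use r a b e in auto)
    also have "\<dots> = ennreal (160 / r * a + b) + ennreal e"
      using r a b e by (subst ennreal_plus[symmetric]) (auto simp: field_simps)
    finally show "rearrangement ?M (coord_lim j g) t \<le> ennreal (160 / r * a + b) + ennreal e" .
  qed
  also have "\<dots> = ennreal (160 / r) * ?I1 + 161 * (ennreal m + ?I2)"
  proof -
    have "ennreal (160 / r * a) = ennreal (160 / r) * ennreal a" using r a by (intro ennreal_mult) auto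
    then show ?thesis unfolding a(1) b(1) using r a b by (subst ennreal_plus) auto
  qed
  also note total
  finally show ?thesis .
qed

section \<open>From Borel to Lebesgue measurable functions\<close>

lemma measurable_completion_AE:
  fixes f g :: "'a \<Rightarrow> real"
  assumes g[measurable]: "g \<in> borel_measurable M" and ae: "AE x in M. f x = g x"
  shows "f \<in> borel_measurable (completion M)"
proof (rule measurableI)
  fix A :: "real set" assume A[measurable]: "A \<in> sets borel"
  let ?S = "space (completion M)"
  have 1: "{x \<in> ?S. f x \<noteq> g x \<and> f x \<in> A} \<in> sets (completion M)"
    unfolding pred_def[symmetric] by (rule sets_completion_AE) (use ae in \<open>eventually_elim, simp\<close>)
  have 2: "{x \<in> ?S. f x \<noteq> g x} \<in> sets (completion M)"
    unfolding pred_def[symmetric] by (rule sets_completion_AE) (use ae in \<open>eventually_elim, simp\<close>)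
  have 3: "g -` A \<inter> ?S \<in> sets (completion M)"
    by (rule measurable_sets[OF measurable_completion[OF g] A])
  have "{x \<in> ?S. f x \<noteq> g x \<and> f x \<in> A} \<union> (g -` A \<inter> ?S - {x \<in> ?S. f x \<noteq> g x}) \<in> sets (completion M)"
    by (intro sets.Un sets.Diff 1 2 3)
  also have "{x \<in> ?S. f x \<noteq> g x \<and> f x \<in> A} \<union> (g -` A \<inter> ?S - {x \<in> ?S. f x \<noteq> g x}) = f -` A \<inter> ?S"
    by auto
  finally show "f -` A \<inter> space (completion M) \<in> sets (completion M)" .
qed simp

lemma rearrangement_completion_AE:
  assumes g[measurable]: "g \<in> borel_measurable M" and ae: "AE x in M. f x = g x"
  shows "rearrangement (completion M) f t = rearrangement M g t"
proof -
  have "emeasure (completion M) {x \<in> space (completion M). s < \<bar>f x\<bar>} = emeasure M {x \<in> space M. s < \<bar>g x\<bar>}" for s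
  proof -
    have [measurable]: "f \<in> borel_measurable (completion M)" by (rule measurable_completion_AE[OF g ae])
    have [measurable]: "g \<in> borel_measurable (completion M)" by (rule measurable_completion[OF g])
    have A: "{x \<in> space (completion M). s < \<bar>f x\<bar>} \<in> sets (completion M)"
      "{x \<in> space (completion M). s < \<bar>g x\<bar>} \<in> sets (completion M)" by measurable
    have "AE x in completion M. f x = g x" using ae by (simp add: AE_completion_iff)
    then have "emeasure (completion M) {x \<in> space (completion M). s < \<bar>f x\<bar>}
      = emeasure (completion M) {x \<in> space (completion M). s < \<bar>g x\<bar>}"
      by (intro emeasure_eq_AE[OF _ A]) (auto elim!: eventually_mono)
    also have "\<dots> = emeasure M {x \<in> space M. s < \<bar>g x\<bar>}" by simp
    finally show ?thesis .
  qed
  then show ?thesis unfolding rearrangement_def by simp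
qed

text \<open>A null set meets almost every line parallel to the \<open>j\<close>-th axis in a null
  set, and almost every point lies on such a line. The transform at a point involves the whole line
  through it, so equality almost everywhere in the product space would not be enough.\<close>

lemma AE_all_sections_eq:
  assumes j: "j \<in> {1..d}" and ae: "AE x in borel_Rd d. f x = g x"
  shows "AE x in borel_Rd d. AE y in lborel. f (x(j := x j - y)) = g (x(j := x j - y))"
proof -
  obtain N where N: "N \<in> sets (borel_Rd d)" "emeasure (borel_Rd d) N = 0" "{x \<in> space (borel_Rd d). \<not> f x = g x} \<subseteq> N"
    using ae by (auto elim: AE_E)
  have Nm[measurable]: "indicator N \<in> borel_measurable (borel_Rd d)" using N(1) by simp
  let ?P = "\<lambda>x. (\<integral>\<^sup>+s. indicator N (x(j := s)) \<partial>lborel) = (0::ennreal)"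
  have "AE x in borel_Rd d. ?P x"
  proof (rule AE_split_coord[OF j])
    note [measurable] = fun_upd_measurable[OF j] measurable_compose[OF _ Nm]
    have "(\<lambda>x. \<integral>\<^sup>+s. indicator N (x(j := s)) \<partial>lborel :: ennreal) \<in> borel_measurable (borel_Rd d)"
      by (rule lborel.borel_measurable_nn_integral, unfold case_prod_unfold, rule measurable_compose[OF _ Nm]) measurable
    then show "Measurable.pred (borel_Rd d) ?P" by measurable
    have "(\<integral>\<^sup>+x. (\<integral>\<^sup>+y. indicator N (x(j := y)) \<partial>lborel) \<partial>PiM ({1..d} - {j}) (\<lambda>_. lborel)) = (0::ennreal)"
      using nn_integral_split_coord[OF j Nm] N(1,2) by simp
    then have "AE x in PiM ({1..d} - {j}) (\<lambda>_. lborel). ?P x"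
      using nn_integral_0_iff_AE[OF nn_integral_section_measurable[OF j Nm]] by simp
    then show "AE x in PiM ({1..d} - {j}) (\<lambda>_. lborel). AE y in lborel. ?P (x(j := y))"
      by eventually_elim (simp only: fun_upd_upd, simp)
  qed
  with AE_space show ?thesis
  proof eventually_elim
    case (elim x)
    have up: "(\<lambda>s. x(j := s)) \<in> measurable borel (borel_Rd d)"
      using elim(1) j by (intro measurable_fun_upd[where J = "{1..d}"]) auto
    have m: "(\<lambda>s. indicator N (x(j := s)) :: ennreal) \<in> borel_measurable borel"
      by (rule measurable_compose[OF up Nm])
    have "(\<integral>\<^sup>+y. indicator N (x(j := x j - y)) \<partial>lborel) = (0::ennreal)"
      using elim(2) nn_integral_real_affine[OF m, of "-1" "x j"] by simp
    moreover have "(\<lambda>y. indicator N (x(j := x j - y)) :: ennreal) \<in> borel_measurable lborel"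
      using measurable_compose[OF _ m, of "\<lambda>y. x j - y" lborel] by simp
    ultimately have "AE y in lborel. indicator N (x(j := x j - y)) = (0::ennreal)"
      using nn_integral_0_iff_AE by blast
    then show ?case
    proof eventually_elim
      case (elim y)
      then have "x(j := x j - y) \<notin> N" by (simp add: indicator_def split: if_splits)
      moreover have "x(j := x j - y) \<in> space (borel_Rd d)" using measurable_space[OF up] by simp
      ultimately show ?case using N(3) by blast
    qed
  qed
qed

lemma hilbert_coord_cong_AE:
  assumes m: "(\<lambda>s. g (x(j := s))) \<in> borel_measurable borel"
    and ae: "AE y in lborel. f (x(j := x j - y)) = g (x(j := x j - y))"
  shows "hilbert_coord j f x = hilbert_coord j g x"
proof -
  have "(LINT y:{y. \<bar>y\<bar> > e}|lebesgue. f (x(j := x j - y)) / y) = (LINT y:{y. \<bar>y\<bar> > e}|lebesgue. g (x(j := x j - y)) / y)" for e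
    unfolding set_lebesgue_integral_def
  proof (rule integral_cong_AE)
    have gm: "(\<lambda>y. indicator {y. \<bar>y\<bar> > e} y *\<^sub>R (g (x(j := x j - y)) / y)) \<in> borel_measurable lborel"
      using measurable_compose[OF _ m, of "\<lambda>y. x j - y" lborel] by simp
    then show "(\<lambda>y. indicator {y. \<bar>y\<bar> > e} y *\<^sub>R (g (x(j := x j - y)) / y)) \<in> borel_measurable lebesgue"
      by (rule measurable_completion)
    show "(\<lambda>y. indicator {y. \<bar>y\<bar> > e} y *\<^sub>R (f (x(j := x j - y)) / y)) \<in> borel_measurable lebesgue"
      by (rule measurable_completion_AE[OF gm]) (use ae in \<open>eventually_elim, simp\<close>)
    show "AE y in lebesgue. indicator {y. \<bar>y\<bar> > e} y *\<^sub>R (f (x(j := x j - y)) / y)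
      = indicator {y. \<bar>y\<bar> > e} y *\<^sub>R (g (x(j := x j - y)) / y)"
      unfolding AE_completion_iff using ae by eventually_elim simp
  qed
  then show ?thesis unfolding hilbert_coord_def by simp
qed

theorem hilbert_coord_rearrangement:
  assumes j: "j \<in> {1..d}" and g: "g \<in> borel_measurable (lebesgue_Rd d)"
    and c: "\<And>t. t > 0 \<Longrightarrow> calderon (rearrangement (lebesgue_Rd d) g) t < \<infinity>"
  shows "hilbert_coord j g \<in> borel_measurable (lebesgue_Rd d)"
    and "t > 0 \<Longrightarrow> rearrangement (lebesgue_Rd d) (hilbert_coord j g) t \<le> 1000 * calderon (rearrangement (lebesgue_Rd d) g) t"
proof -
  obtain g' where g'[measurable]: "g' \<in> borel_measurable (borel_Rd d)" and ae: "AE x in borel_Rd d. g x = g' x"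
    using completion_ex_borel_measurable_real g unfolding lebesgue_Rd_def by blast
  have req: "rearrangement (lebesgue_Rd d) g = rearrangement (borel_Rd d) g'"
    unfolding lebesgue_Rd_def by (rule ext) (rule rearrangement_completion_AE[OF g' ae])
  have c': "t > 0 \<Longrightarrow> calderon (rearrangement (borel_Rd d) g') t < \<infinity>" for t
    using c[of t] by (simp add: req)
  have "AE x in borel_Rd d. hilbert_coord j g x = coord_lim j g' x"
    using AE_all_sections_eq[OF j ae] AE_coord_pv_exists[OF j g' sections_tail_integrable[OF j g' c'[OF zero_less_one]]] AE_space
  proof eventually_elim
    case (elim x)
    have "hilbert_coord j g x = hilbert_coord j g' x"
      using elim(1,3) section_measurable[OF j g'] by (intro hilbert_coord_cong_AE) blast+
    also have "\<dots> = coord_lim j g' x"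
      using elim(2) by (intro hilbert_coord_eq_lim) blast+
    finally show ?case .
  qed
  note ae2 = this
  show "hilbert_coord j g \<in> borel_measurable (lebesgue_Rd d)"
    unfolding lebesgue_Rd_def by (rule measurable_completion_AE[OF coord_lim_measurable[OF j g'] ae2])
  assume t: "t > 0"
  have "rearrangement (lebesgue_Rd d) (hilbert_coord j g) t = rearrangement (borel_Rd d) (coord_lim j g') t"
    unfolding lebesgue_Rd_def by (rule rearrangement_completion_AE[OF coord_lim_measurable[OF j g'] ae2])
  also have "\<dots> \<le> 1000 * calderon (rearrangement (lebesgue_Rd d) g) t"
    unfolding req by (rule coord_lim_rearrangement[OF j g' c' t])
  finally show "rearrangement (lebesgue_Rd d) (hilbert_coord j g) t \<le> 1000 * calderon (rearrangement (lebesgue_Rd d) g) t" .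
qed

section \<open>Iteration over the coordinates\<close>

lemma calderon_mono:
  assumes "\<And>u. u > 0 \<Longrightarrow> g u \<le> h u" "t > 0"
  shows "calderon g t \<le> calderon h t"
proof -
  have "g s * indicator {0<..<t} s \<le> h s * indicator {0<..<t} s" for s
    using assms(1)[of s] by (auto simp: indicator_def)
  moreover have "g s * ennreal (1 / s) * indicator {t<..} s \<le> h s * ennreal (1 / s) * indicator {t<..} s" for s
    using assms(1)[of s] assms(2) by (auto simp: indicator_def intro: mult_right_mono)
  ultimately show ?thesis
    unfolding calderon_def by (intro add_mono mult_left_mono nn_integral_mono) auto
qed

lemma calderon_measurable [measurable]:
  assumes [measurable]: "g \<in> borel_measurable borel"
  shows "calderon g \<in> borel_measurable borel"
proof -
  have eq: "calderon g t = ennreal (1 / t) * (\<integral>\<^sup>+s. g s * indicator {p. 0 < snd p \<and> snd p < fst p} (t, s) \<partial>lborel)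
     + (\<integral>\<^sup>+s. g s * ennreal (1 / s) * indicator {p. fst p < snd p} (t, s) \<partial>lborel)" for t
    unfolding calderon_def by (intro arg_cong2[of _ _ _ _ "(+)"] arg_cong2[of _ _ _ _ "(*)"] refl nn_integral_cong)
      (auto simp: indicator_def)
  have [measurable]: "{p :: real \<times> real. 0 < snd p \<and> snd p < fst p} \<in> sets (borel \<Otimes>\<^sub>M borel)"
    "{p :: real \<times> real. fst p < snd p} \<in> sets (borel \<Otimes>\<^sub>M borel)"
  proof -
    have "{p \<in> space (borel \<Otimes>\<^sub>M borel :: (real \<times> real) measure). 0 < snd p \<and> snd p < fst p} \<in> sets (borel \<Otimes>\<^sub>M borel)"
      "{p \<in> space (borel \<Otimes>\<^sub>M borel :: (real \<times> real) measure). fst p < snd p} \<in> sets (borel \<Otimes>\<^sub>M borel)"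
      by measurable
    then show "{p :: real \<times> real. 0 < snd p \<and> snd p < fst p} \<in> sets (borel \<Otimes>\<^sub>M borel)"
      "{p :: real \<times> real. fst p < snd p} \<in> sets (borel \<Otimes>\<^sub>M borel)" by (simp_all add: space_pair_measure)
  qed
  show ?thesis unfolding eq[abs_def] by measurable
qed

lemma calderon_funpow_measurable [measurable]:
  "g \<in> borel_measurable borel \<Longrightarrow> (calderon ^^ n) g \<in> borel_measurable borel"
  by (induction n) auto

lemma calderon_cmult:
  assumes [measurable]: "g \<in> borel_measurable borel"
  shows "calderon (\<lambda>u. c * g u) t = c * calderon g t"
proof -
  have "(\<integral>\<^sup>+s \<in> {0<..<t}. c * g s \<partial>lborel) = c * (\<integral>\<^sup>+s \<in> {0<..<t}. g s \<partial>lborel)"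
    by (simp add: mult.assoc nn_integral_cmult)
  moreover have "(\<integral>\<^sup>+s \<in> {t<..}. c * g s * ennreal (1 / s) \<partial>lborel) = c * (\<integral>\<^sup>+s \<in> {t<..}. g s * ennreal (1 / s) \<partial>lborel)"
    by (simp add: mult.assoc nn_integral_cmult)
  ultimately show ?thesis unfolding calderon_def by (simp add: distrib_left mult.left_commute)
qed

text \<open>Monotonicity and homogeneity of the Calderon operator carry the bound for the inner
  transforms through the next one. The finiteness of one more power is what guarantees the existence
  of the next principal value.\<close>

theorem hilbert_foldr_rearrangement:
  assumes g: "g \<in> borel_measurable (lebesgue_Rd d)"
    and c: "\<And>n t. n \<le> length js \<Longrightarrow> t > 0 \<Longrightarrow> (calderon ^^ n) (rearrangement (lebesgue_Rd d) g) t < \<infinity>"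
    and js: "set js \<subseteq> {1..d}"
  shows "foldr hilbert_coord js g \<in> borel_measurable (lebesgue_Rd d) \<and>
    (\<forall>t>0. rearrangement (lebesgue_Rd d) (foldr hilbert_coord js g) t
      \<le> 1000 ^ length js * (calderon ^^ length js) (rearrangement (lebesgue_Rd d) g) t)"
  using c js
proof (induction js)
  case Nil
  then show ?case using g by simp
next
  case (Cons j js)
  let ?mu = "rearrangement (lebesgue_Rd d) g" and ?h = "foldr hilbert_coord js g" and ?n = "length js"
  have IH: "?h \<in> borel_measurable (lebesgue_Rd d)"
    "\<And>t. t > 0 \<Longrightarrow> rearrangement (lebesgue_Rd d) ?h t \<le> 1000 ^ ?n * (calderon ^^ ?n) ?mu t"
    using Cons by auto
  have step: "calderon (rearrangement (lebesgue_Rd d) ?h) t \<le> 1000 ^ ?n * (calderon ^^ Suc ?n) ?mu t" if "t > 0" for t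
  proof -
    have "calderon (rearrangement (lebesgue_Rd d) ?h) t \<le> calderon (\<lambda>t. 1000 ^ ?n * (calderon ^^ ?n) ?mu t) t"
      using IH(2) that by (intro calderon_mono)
    also have "\<dots> = 1000 ^ ?n * (calderon ^^ Suc ?n) ?mu t"
      by (subst calderon_cmult) simp_all
    finally show ?thesis .
  qed
  have fin: "calderon (rearrangement (lebesgue_Rd d) ?h) t < \<infinity>" if "t > 0" for t
  proof -
    have "(calderon ^^ Suc ?n) ?mu t < \<infinity>" using Cons(2)[of "Suc ?n" t] that by simp
    then have "1000 ^ ?n * (calderon ^^ Suc ?n) ?mu t < \<infinity>"
      by (simp add: ennreal_mult_less_top power_less_top_ennreal)
    with step[OF that] show ?thesis by (rule le_less_trans)
  qed
  have j: "j \<in> {1..d}" using Cons(3) by simp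
  show ?case
  proof (intro conjI allI impI)
    show "foldr hilbert_coord (j # js) g \<in> borel_measurable (lebesgue_Rd d)"
      using hilbert_coord_rearrangement(1)[OF j IH(1) fin] by simp
    fix t :: real assume t: "t > 0"
    have "rearrangement (lebesgue_Rd d) (foldr hilbert_coord (j # js) g) t \<le> 1000 * calderon (rearrangement (lebesgue_Rd d) ?h) t"
      using hilbert_coord_rearrangement(2)[OF j IH(1) fin t] by simp
    also have "\<dots> \<le> 1000 * (1000 ^ ?n * (calderon ^^ Suc ?n) ?mu t)" by (intro mult_left_mono step t) simp
    also have "\<dots> = 1000 ^ length (j # js) * (calderon ^^ length (j # js)) ?mu t" by (simp add: mult.assoc)
    finally show "rearrangement (lebesgue_Rd d) (foldr hilbert_coord (j # js) g) t
      \<le> 1000 ^ length (j # js) * (calderon ^^ length (j # js)) ?mu t" .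
  qed
qed

section \<open>Hardy operators\<close>

definition hardy :: "(real \<Rightarrow> ennreal) \<Rightarrow> real \<Rightarrow> ennreal" where
  "hardy g t = ennreal (1 / t) * (\<integral>\<^sup>+ s \<in> {0<..<t}. g s \<partial>lborel)"

definition dual_hardy :: "(real \<Rightarrow> ennreal) \<Rightarrow> real \<Rightarrow> ennreal" where
  "dual_hardy g t = (\<integral>\<^sup>+ s \<in> {t<..}. g s * ennreal (1 / s) \<partial>lborel)"

lemma calderon_eq_hardy: "calderon g t = hardy g t + dual_hardy g t"
  by (simp add: calderon_def hardy_def dual_hardy_def)

lemma lower_triangle_sets [measurable]:
  "{p :: real \<times> real. 0 < snd p \<and> snd p < fst p} \<in> sets (borel \<Otimes>\<^sub>M borel)"
  "{p :: real \<times> real. fst p < snd p} \<in> sets (borel \<Otimes>\<^sub>M borel)"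
proof -
  have "{p \<in> space (borel \<Otimes>\<^sub>M borel :: (real \<times> real) measure). 0 < snd p \<and> snd p < fst p} \<in> sets (borel \<Otimes>\<^sub>M borel)"
    "{p \<in> space (borel \<Otimes>\<^sub>M borel :: (real \<times> real) measure). fst p < snd p} \<in> sets (borel \<Otimes>\<^sub>M borel)"
    by measurable
  then show "{p :: real \<times> real. 0 < snd p \<and> snd p < fst p} \<in> sets (borel \<Otimes>\<^sub>M borel)"
    "{p :: real \<times> real. fst p < snd p} \<in> sets (borel \<Otimes>\<^sub>M borel)" by (simp_all add: space_pair_measure)
qed

lemma indicator_lower_triangle:
  "indicator {0<..<t} s = (indicator {p. 0 < snd p \<and> snd p < fst p} (t, s) :: ennreal)"
  "indicator {t<..} s = (indicator {p. fst p < snd p} (t, s) :: ennreal)"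
  for t s :: real
  by (auto simp: indicator_def)

lemma hardy_measurable [measurable]:
  assumes [measurable]: "g \<in> borel_measurable borel"
  shows "hardy g \<in> borel_measurable borel"
  unfolding hardy_def[abs_def] indicator_lower_triangle by measurable

lemma dual_hardy_measurable [measurable]:
  assumes [measurable]: "g \<in> borel_measurable borel"
  shows "dual_hardy g \<in> borel_measurable borel"
  unfolding dual_hardy_def[abs_def] indicator_lower_triangle by measurable

lemma funpow_measurable:
  fixes T :: "(real \<Rightarrow> ennreal) \<Rightarrow> real \<Rightarrow> ennreal"
  assumes "\<And>g. g \<in> borel_measurable borel \<Longrightarrow> T g \<in> borel_measurable borel" "g \<in> borel_measurable borel"
  shows "(T ^^ n) g \<in> borel_measurable borel"
  using assms by (induction n) auto

lemma hardy_cong: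
  assumes "\<And>u. u > 0 \<Longrightarrow> g u = h u"
  shows "hardy g t = hardy h t"
proof -
  have "g s * indicator {0<..<t} s = h s * indicator {0<..<t} s" for s
    using assms[of s] by (simp add: indicator_def)
  then show ?thesis unfolding hardy_def by simp
qed

lemma dual_hardy_cong:
  assumes "\<And>u. u > 0 \<Longrightarrow> g u = h u" "t > 0"
  shows "dual_hardy g t = dual_hardy h t"
proof -
  have "g s * ennreal (1 / s) * indicator {t<..} s = h s * ennreal (1 / s) * indicator {t<..} s" for s
    using assms(1)[of s] assms(2) by (simp add: indicator_def)
  then show ?thesis unfolding dual_hardy_def by simp
qed

lemma hardy_add:
  assumes [measurable]: "g \<in> borel_measurable borel" "h \<in> borel_measurable borel"
  shows "hardy (\<lambda>u. g u + h u) t = hardy g t + hardy h t"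
proof -
  have "(\<integral>\<^sup>+ s \<in> {0<..<t}. g s + h s \<partial>lborel) = (\<integral>\<^sup>+ s \<in> {0<..<t}. g s \<partial>lborel) + (\<integral>\<^sup>+ s \<in> {0<..<t}. h s \<partial>lborel)"
    unfolding distrib_right by (rule nn_integral_add) measurable
  then show ?thesis by (simp add: hardy_def distrib_left)
qed

lemma dual_hardy_add:
  assumes [measurable]: "g \<in> borel_measurable borel" "h \<in> borel_measurable borel"
  shows "dual_hardy (\<lambda>u. g u + h u) t = dual_hardy g t + dual_hardy h t"
  unfolding dual_hardy_def distrib_right by (rule nn_integral_add) measurable

lemma funpow_hardy_cong:
  "(\<And>u. u > 0 \<Longrightarrow> g u = h u) \<Longrightarrow> t > 0 \<Longrightarrow> (hardy ^^ n) g t = (hardy ^^ n) h t"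
  by (induction n arbitrary: t) (auto intro: hardy_cong)

lemma funpow_dual_hardy_cong:
  "(\<And>u. u > 0 \<Longrightarrow> g u = h u) \<Longrightarrow> t > 0 \<Longrightarrow> (dual_hardy ^^ n) g t = (dual_hardy ^^ n) h t"
  by (induction n arbitrary: t) (auto intro: dual_hardy_cong)

lemma funpow_hardy_add:
  assumes g: "g \<in> borel_measurable borel" and h: "h \<in> borel_measurable borel"
  shows "(hardy ^^ n) (\<lambda>u. g u + h u) t = (hardy ^^ n) g t + (hardy ^^ n) h t"
proof (induction n arbitrary: t)
  case (Suc n)
  have "(hardy ^^ n) (\<lambda>u. g u + h u) = (\<lambda>u. (hardy ^^ n) g u + (hardy ^^ n) h u)"
    using Suc by (rule ext)
  then show ?case
    using hardy_add[OF funpow_measurable[of hardy g n] funpow_measurable[of hardy h n]] g h by simp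
qed simp

lemma funpow_dual_hardy_add:
  assumes g: "g \<in> borel_measurable borel" and h: "h \<in> borel_measurable borel"
  shows "(dual_hardy ^^ n) (\<lambda>u. g u + h u) t = (dual_hardy ^^ n) g t + (dual_hardy ^^ n) h t"
proof (induction n arbitrary: t)
  case (Suc n)
  have "(dual_hardy ^^ n) (\<lambda>u. g u + h u) = (\<lambda>u. (dual_hardy ^^ n) g u + (dual_hardy ^^ n) h u)"
    using Suc by (rule ext)
  then show ?case
    using dual_hardy_add[OF funpow_measurable[of dual_hardy g n] funpow_measurable[of dual_hardy h n]] g h by simp
qed simp

lemma hardy_nested:
  fixes k :: "real \<Rightarrow> real \<Rightarrow> ennreal"
  assumes [measurable]: "g \<in> borel_measurable borel" "(\<lambda>p. k (fst p) (snd p)) \<in> borel_measurable (borel \<Otimes>\<^sub>M borel)"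
    and t: "t > 0"
  shows "(\<integral>\<^sup>+ u \<in> {0<..<t}. (\<integral>\<^sup>+ s \<in> {0<..<u}. g s * k u s \<partial>lborel) \<partial>lborel)
    = (\<integral>\<^sup>+ s \<in> {0<..<t}. g s * (\<integral>\<^sup>+ u \<in> {s<..<t}. k u s \<partial>lborel) \<partial>lborel)"
proof -
  have [measurable]: "k u \<in> borel_measurable borel" "(\<lambda>u. k u s) \<in> borel_measurable borel" for u s
    using measurable_compose[OF measurable_Pair1' assms(2), of u] measurable_compose[OF measurable_Pair2' assms(2), of s]
    by simp_all
  have "(\<integral>\<^sup>+ u \<in> {0<..<t}. (\<integral>\<^sup>+ s \<in> {0<..<u}. g s * k u s \<partial>lborel) \<partial>lborel)
    = (\<integral>\<^sup>+ u. (\<integral>\<^sup>+ s. g s * k u s * indicator {p. 0 < snd p \<and> snd p < fst p} (u, s) * indicator {0<..<t} u \<partial>lborel) \<partial>lborel)"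
  proof (rule nn_integral_cong)
    fix u :: real
    have e: "(indicator {p. 0 < snd p \<and> snd p < fst p} (u, s) :: ennreal) = indicator {0<..<u} s" for s
      by (auto simp: indicator_def)
    show "(\<integral>\<^sup>+ s \<in> {0<..<u}. g s * k u s \<partial>lborel) * indicator {0<..<t} u
      = (\<integral>\<^sup>+ s. g s * k u s * indicator {p. 0 < snd p \<and> snd p < fst p} (u, s) * indicator {0<..<t} u \<partial>lborel)"
      unfolding e by (rule nn_integral_multc[symmetric]) measurable
  qed
  also have "\<dots> = (\<integral>\<^sup>+ s. (\<integral>\<^sup>+ u. g s * k u s * indicator {p. 0 < snd p \<and> snd p < fst p} (u, s) * indicator {0<..<t} u \<partial>lborel) \<partial>lborel)"
    by (rule lborel_pair.Fubini'[symmetric]) (simp add: case_prod_beta')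
  also have "\<dots> = (\<integral>\<^sup>+ s. (\<integral>\<^sup>+ u. (g s * indicator {0<..<t} s) * (k u s * indicator {s<..<t} u) \<partial>lborel) \<partial>lborel)"
    by (intro nn_integral_cong) (auto simp: indicator_def)
  also have "\<dots> = (\<integral>\<^sup>+ s. (g s * indicator {0<..<t} s) * (\<integral>\<^sup>+ u. k u s * indicator {s<..<t} u \<partial>lborel) \<partial>lborel)"
    by (intro nn_integral_cong nn_integral_cmult) measurable
  finally show ?thesis by (simp add: mult_ac)
qed

lemma dual_hardy_nested:
  fixes k :: "real \<Rightarrow> real \<Rightarrow> ennreal"
  assumes [measurable]: "g \<in> borel_measurable borel" "(\<lambda>p. k (fst p) (snd p)) \<in> borel_measurable (borel \<Otimes>\<^sub>M borel)"
    and t: "t > 0"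
  shows "(\<integral>\<^sup>+ u \<in> {t<..}. (\<integral>\<^sup>+ s \<in> {u<..}. g s * k u s \<partial>lborel) \<partial>lborel)
    = (\<integral>\<^sup>+ s \<in> {t<..}. g s * (\<integral>\<^sup>+ u \<in> {t<..<s}. k u s \<partial>lborel) \<partial>lborel)"
proof -
  have [measurable]: "k u \<in> borel_measurable borel" "(\<lambda>u. k u s) \<in> borel_measurable borel" for u s
    using measurable_compose[OF measurable_Pair1' assms(2), of u] measurable_compose[OF measurable_Pair2' assms(2), of s]
    by simp_all
  have "(\<integral>\<^sup>+ u \<in> {t<..}. (\<integral>\<^sup>+ s \<in> {u<..}. g s * k u s \<partial>lborel) \<partial>lborel)
    = (\<integral>\<^sup>+ u. (\<integral>\<^sup>+ s. g s * k u s * indicator {p. fst p < snd p} (u, s) * indicator {t<..} u \<partial>lborel) \<partial>lborel)"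
  proof (rule nn_integral_cong)
    fix u :: real
    have e: "(indicator {p. fst p < snd p} (u, s) :: ennreal) = indicator {u<..} s" for s
      by (auto simp: indicator_def)
    show "(\<integral>\<^sup>+ s \<in> {u<..}. g s * k u s \<partial>lborel) * indicator {t<..} u
      = (\<integral>\<^sup>+ s. g s * k u s * indicator {p. fst p < snd p} (u, s) * indicator {t<..} u \<partial>lborel)"
      unfolding e by (rule nn_integral_multc[symmetric]) measurable
  qed
  also have "\<dots> = (\<integral>\<^sup>+ s. (\<integral>\<^sup>+ u. g s * k u s * indicator {p. fst p < snd p} (u, s) * indicator {t<..} u \<partial>lborel) \<partial>lborel)"
    by (rule lborel_pair.Fubini'[symmetric]) (simp add: case_prod_beta')
  also have "\<dots> = (\<integral>\<^sup>+ s. (\<integral>\<^sup>+ u. (g s * indicator {t<..} s) * (k u s * indicator {t<..<s} u) \<partial>lborel) \<partial>lborel)"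
    by (intro nn_integral_cong) (auto simp: indicator_def)
  also have "\<dots> = (\<integral>\<^sup>+ s. (g s * indicator {t<..} s) * (\<integral>\<^sup>+ u. k u s * indicator {t<..<s} u \<partial>lborel) \<partial>lborel)"
    by (intro nn_integral_cong nn_integral_cmult) measurable
  finally show ?thesis by (simp add: mult_ac)
qed

lemma nn_integral_Ioo_eq_Icc:
  fixes a b :: real
  shows "(\<integral>\<^sup>+x. f x * indicator {a<..<b} x \<partial>lborel) = (\<integral>\<^sup>+x. f x * indicator {a..b} x \<partial>lborel)"
proof (rule nn_integral_cong_AE)
  have "AE x in lborel. x \<noteq> a \<and> x \<noteq> b"
    using AE_lborel_singleton[of a] AE_lborel_singleton[of b] by auto
  then show "AE x in lborel. f x * indicator {a<..<b} x = f x * indicator {a..b} x"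
    by eventually_elim (auto simp: indicator_def)
qed

lemma nn_integral_ln_power_left:
  assumes "0 < s" "s \<le> t"
  shows "(\<integral>\<^sup>+ u \<in> {s<..<t}. ennreal (1 / u * ln (u / s) ^ i / fact i) \<partial>lborel) = ennreal (ln (t / s) ^ Suc i / fact (Suc i))"
proof -
  have "(\<integral>\<^sup>+ u. ennreal (1 / u * ln (u / s) ^ i / fact i) * indicator {s..t} u \<partial>lborel)
    = ennreal (ln (t / s) ^ Suc i / fact (Suc i) - ln (s / s) ^ Suc i / fact (Suc i))"
  proof (rule nn_integral_FTC_Icc)
    fix u assume u: "u \<in> {s..t}"
    then have "u > 0" using assms by auto
    show "0 \<le> 1 / u * ln (u / s) ^ i / fact i" using u assms by (auto simp: zero_le_mult_iff)
    have D: "((\<lambda>u. ln (u / s)) has_real_derivative 1 / u) (at u)"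
      using \<open>u > 0\<close> assms by (auto intro!: derivative_eq_intros simp: field_simps)
    show "((\<lambda>u. ln (u / s) ^ Suc i / fact (Suc i)) has_real_derivative 1 / u * ln (u / s) ^ i / fact i) (at u)"
      by (rule DERIV_cong[OF DERIV_cdivide[OF DERIV_power[OF D, of "Suc i"]]])
        (simp add: divide_simps)
  qed (use assms in auto)
  then show ?thesis unfolding nn_integral_Ioo_eq_Icc using assms by simp
qed

lemma nn_integral_ln_power_right:
  assumes "0 < t" "t \<le> s"
  shows "(\<integral>\<^sup>+ u \<in> {t<..<s}. ennreal (1 / u * ln (s / u) ^ i / fact i) \<partial>lborel) = ennreal (ln (s / t) ^ Suc i / fact (Suc i))"
proof -
  have "(\<integral>\<^sup>+ u. ennreal (1 / u * ln (s / u) ^ i / fact i) * indicator {t..s} u \<partial>lborel)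
    = ennreal (- (ln (s / s) ^ Suc i / fact (Suc i)) - - (ln (s / t) ^ Suc i / fact (Suc i)))"
  proof (rule nn_integral_FTC_Icc)
    fix u assume u: "u \<in> {t..s}"
    then have "u > 0" using assms by auto
    show "0 \<le> 1 / u * ln (s / u) ^ i / fact i" using u assms by (auto simp: zero_le_mult_iff)
    have D: "((\<lambda>u. ln (s / u)) has_real_derivative - (1 / u)) (at u)"
      using \<open>u > 0\<close> assms by (auto intro!: derivative_eq_intros simp: field_simps)
    show "((\<lambda>u. - (ln (s / u) ^ Suc i / fact (Suc i))) has_real_derivative 1 / u * ln (s / u) ^ i / fact i) (at u)"
      by (rule DERIV_cong[OF DERIV_minus[OF DERIV_cdivide[OF DERIV_power[OF D, of "Suc i"]]]])
        (simp add: divide_simps)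
  qed (use assms in auto)
  then show ?thesis unfolding nn_integral_Ioo_eq_Icc using assms by simp
qed

text \<open>By Fubini each further average integrates the kernel against \<open>1 / u\<close>
  between \<open>s\<close> and \<open>t\<close>, which raises the power of the logarithm by one and
  completes the factorial.\<close>

lemma funpow_hardy_kernel:
  assumes g[measurable]: "g \<in> borel_measurable borel" and t: "t > 0"
  shows "(hardy ^^ Suc i) g t = (\<integral>\<^sup>+ s \<in> {0<..<t}. g s * ennreal (1 / t * ln (t / s) ^ i / fact i) \<partial>lborel)"
  using t
proof (induction i arbitrary: t)
  case 0
  have "(\<integral>\<^sup>+ s \<in> {0<..<t}. g s * ennreal (1 / t) \<partial>lborel) = (\<integral>\<^sup>+ s. ennreal (1 / t) * (g s * indicator {0<..<t} s) \<partial>lborel)"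
    by (intro nn_integral_cong) (simp add: mult_ac)
  also have "\<dots> = hardy g t" unfolding hardy_def by (rule nn_integral_cmult) measurable
  finally show ?case by simp
next
  case (Suc i)
  have "(hardy ^^ Suc (Suc i)) g t = hardy ((hardy ^^ Suc i) g) t" by simp
  also have "\<dots> = hardy (\<lambda>u. \<integral>\<^sup>+ s \<in> {0<..<u}. g s * ennreal (1 / u * ln (u / s) ^ i / fact i) \<partial>lborel) t"
    using Suc.IH by (intro hardy_cong)
  also have "\<dots> = ennreal (1 / t) * (\<integral>\<^sup>+ s \<in> {0<..<t}. g s * (\<integral>\<^sup>+ u \<in> {s<..<t}. ennreal (1 / u * ln (u / s) ^ i / fact i) \<partial>lborel) \<partial>lborel)"
    unfolding hardy_def using Suc.prems by (subst hardy_nested[OF g]) auto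
  also have "\<dots> = ennreal (1 / t) * (\<integral>\<^sup>+ s \<in> {0<..<t}. g s * ennreal (ln (t / s) ^ Suc i / fact (Suc i)) \<partial>lborel)"
  proof -
    have "(\<integral>\<^sup>+ u \<in> {s<..<t}. ennreal (1 / u * ln (u / s) ^ i / fact i) \<partial>lborel) = ennreal (ln (t / s) ^ Suc i / fact (Suc i))"
      if "s \<in> {0<..<t}" for s
      using that by (intro nn_integral_ln_power_left) auto
    then have "g s * (\<integral>\<^sup>+ u \<in> {s<..<t}. ennreal (1 / u * ln (u / s) ^ i / fact i) \<partial>lborel) * indicator {0<..<t} s
      = g s * ennreal (ln (t / s) ^ Suc i / fact (Suc i)) * indicator {0<..<t} s" for s
      by (cases "s \<in> {0<..<t}") (simp_all only: indicator_simps mult_zero_right not_False_eq_True)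
    then show ?thesis by simp
  qed
  also have "\<dots> = (\<integral>\<^sup>+ s. ennreal (1 / t) * (g s * ennreal (ln (t / s) ^ Suc i / fact (Suc i)) * indicator {0<..<t} s) \<partial>lborel)"
    by (rule nn_integral_cmult[symmetric]) measurable
  also have "\<dots> = (\<integral>\<^sup>+ s \<in> {0<..<t}. g s * ennreal (1 / t * ln (t / s) ^ Suc i / fact (Suc i)) \<partial>lborel)"
  proof (intro nn_integral_cong)
    fix s
    show "ennreal (1 / t) * (g s * ennreal (ln (t / s) ^ Suc i / fact (Suc i)) * indicator {0<..<t} s)
      = g s * ennreal (1 / t * ln (t / s) ^ Suc i / fact (Suc i)) * indicator {0<..<t} s"
    proof (cases "s \<in> {0<..<t}")
      case True
      have "ennreal (1 / t * ln (t / s) ^ Suc i / fact (Suc i)) = ennreal (1 / t) * ennreal (ln (t / s) ^ Suc i / fact (Suc i))"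
        using True by (subst ennreal_mult[symmetric]) (auto simp del: power_Suc fact_Suc)
      then show ?thesis by (simp only: mult_ac)
    qed simp
  qed
  finally show ?case .
qed

lemma funpow_dual_hardy_kernel:
  assumes g[measurable]: "g \<in> borel_measurable borel" and t: "t > 0"
  shows "(dual_hardy ^^ Suc i) g t = (\<integral>\<^sup>+ s \<in> {t<..}. g s * ennreal (1 / s * ln (s / t) ^ i / fact i) \<partial>lborel)"
  using t
proof (induction i arbitrary: t)
  case 0
  then show ?case by (simp add: dual_hardy_def)
next
  case (Suc i)
  have "(dual_hardy ^^ Suc (Suc i)) g t = dual_hardy ((dual_hardy ^^ Suc i) g) t" by simp
  also have "\<dots> = dual_hardy (\<lambda>u. \<integral>\<^sup>+ s \<in> {u<..}. g s * ennreal (1 / s * ln (s / u) ^ i / fact i) \<partial>lborel) t"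
    using Suc by (intro dual_hardy_cong) auto
  also have "\<dots> = (\<integral>\<^sup>+ u \<in> {t<..}. (\<integral>\<^sup>+ s \<in> {u<..}. (g s * ennreal (1 / s)) * ennreal (1 / u * ln (s / u) ^ i / fact i) \<partial>lborel) \<partial>lborel)"
    unfolding dual_hardy_def
  proof (intro nn_integral_cong)
    fix u :: real
    show "(\<integral>\<^sup>+ s \<in> {u<..}. g s * ennreal (1 / s * ln (s / u) ^ i / fact i) \<partial>lborel) * ennreal (1 / u) * indicator {t<..} u
      = (\<integral>\<^sup>+ s \<in> {u<..}. (g s * ennreal (1 / s)) * ennreal (1 / u * ln (s / u) ^ i / fact i) \<partial>lborel) * indicator {t<..} u"
    proof (cases "t < u")
      case True
      then have "u > 0" using Suc.prems by simp
      have "(\<integral>\<^sup>+ s \<in> {u<..}. g s * ennreal (1 / s * ln (s / u) ^ i / fact i) \<partial>lborel) * ennreal (1 / u)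
        = (\<integral>\<^sup>+ s. g s * ennreal (1 / s * ln (s / u) ^ i / fact i) * indicator {u<..} s * ennreal (1 / u) \<partial>lborel)"
        by (rule nn_integral_multc[symmetric]) measurable
      also have "\<dots> = (\<integral>\<^sup>+ s \<in> {u<..}. (g s * ennreal (1 / s)) * ennreal (1 / u * ln (s / u) ^ i / fact i) \<partial>lborel)"
      proof (intro nn_integral_cong)
        fix s
        show "g s * ennreal (1 / s * ln (s / u) ^ i / fact i) * indicator {u<..} s * ennreal (1 / u)
          = (g s * ennreal (1 / s)) * ennreal (1 / u * ln (s / u) ^ i / fact i) * indicator {u<..} s"
        proof (cases "u < s")
          case True
          then have n: "0 \<le> ln (s / u) ^ i / fact i" "0 \<le> 1 / s" "0 \<le> 1 / u" using \<open>u > 0\<close> by auto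
          have "ennreal (1 / s * ln (s / u) ^ i / fact i) = ennreal (1 / s) * ennreal (ln (s / u) ^ i / fact i)"
            using n by (subst ennreal_mult[symmetric]) auto
          moreover have "ennreal (1 / u * ln (s / u) ^ i / fact i) = ennreal (1 / u) * ennreal (ln (s / u) ^ i / fact i)"
            using n by (subst ennreal_mult[symmetric]) auto
          ultimately show ?thesis by (simp only: mult_ac)
        qed simp
      qed
      finally show ?thesis by simp
    qed simp
  qed
  also have "\<dots> = (\<integral>\<^sup>+ s \<in> {t<..}. (g s * ennreal (1 / s)) * (\<integral>\<^sup>+ u \<in> {t<..<s}. ennreal (1 / u * ln (s / u) ^ i / fact i) \<partial>lborel) \<partial>lborel)"
    by (rule dual_hardy_nested) (use Suc.prems in auto)
  also have "\<dots> = (\<integral>\<^sup>+ s \<in> {t<..}. g s * ennreal (1 / s * ln (s / t) ^ Suc i / fact (Suc i)) \<partial>lborel)"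
  proof (intro nn_integral_cong)
    fix s
    show "g s * ennreal (1 / s) * (\<integral>\<^sup>+ u \<in> {t<..<s}. ennreal (1 / u * ln (s / u) ^ i / fact i) \<partial>lborel) * indicator {t<..} s
      = g s * ennreal (1 / s * ln (s / t) ^ Suc i / fact (Suc i)) * indicator {t<..} s"
    proof (cases "t < s")
      case True
      have "ennreal (1 / s * ln (s / t) ^ Suc i / fact (Suc i)) = ennreal (1 / s) * ennreal (ln (s / t) ^ Suc i / fact (Suc i))"
        using True Suc.prems by (subst ennreal_mult[symmetric]) (auto simp del: power_Suc fact_Suc)
      then show ?thesis using True Suc.prems by (subst nn_integral_ln_power_right) (auto simp only: mult_ac)
    qed simp
  qed
  finally show ?case .
qed

text \<open>After the exchange of the integrals \<open>g s\<close> carries the weight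
  \<open>min s t / (s * t)\<close>, and this is the Calderon kernel
  \<open>min (1 / t) (1 / s)\<close>.\<close>

lemma hardy_dual_hardy:
  assumes g[measurable]: "g \<in> borel_measurable borel" and t: "t > 0"
  shows "hardy (dual_hardy g) t = calderon g t"
proof -
  have "(\<integral>\<^sup>+ u \<in> {0<..<t}. dual_hardy g u \<partial>lborel)
    = (\<integral>\<^sup>+ u. (\<integral>\<^sup>+ s. g s * ennreal (1 / s) * indicator {p. fst p < snd p} (u, s) * indicator {0<..<t} u \<partial>lborel) \<partial>lborel)"
    unfolding dual_hardy_def indicator_lower_triangle(2) by (intro nn_integral_cong nn_integral_multc[symmetric]) measurable
  also have "\<dots> = (\<integral>\<^sup>+ s. (\<integral>\<^sup>+ u. g s * ennreal (1 / s) * indicator {p. fst p < snd p} (u, s) * indicator {0<..<t} u \<partial>lborel) \<partial>lborel)"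
    by (rule lborel_pair.Fubini'[symmetric]) (simp add: case_prod_beta')
  also have "\<dots> = (\<integral>\<^sup>+ s. g s * ennreal (1 / s) * ennreal (min s t) \<partial>lborel)"
  proof (intro nn_integral_cong)
    fix s
    have "(\<integral>\<^sup>+ u. g s * ennreal (1 / s) * indicator {p. fst p < snd p} (u, s) * indicator {0<..<t} u \<partial>lborel)
      = (\<integral>\<^sup>+ u. g s * ennreal (1 / s) * indicator {0<..<min s t} u \<partial>lborel)"
      by (intro nn_integral_cong) (auto simp: indicator_def)
    also have "\<dots> = g s * ennreal (1 / s) * ennreal (min s t)"
    proof (cases "min s t \<ge> 0")
      case True
      then show ?thesis by (simp add: nn_integral_cmult_indicator)
    next
      case False
      then have e: "{0<..<min s t} = {}" "ennreal (min s t) = 0" by (auto simp: ennreal_neg)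
      show ?thesis unfolding e by simp
    qed
    finally show "(\<integral>\<^sup>+ u. g s * ennreal (1 / s) * indicator {p. fst p < snd p} (u, s) * indicator {0<..<t} u \<partial>lborel)
      = g s * ennreal (1 / s) * ennreal (min s t)" .
  qed
  also have "\<dots> = (\<integral>\<^sup>+ s. g s * indicator {0<..<t} s + ennreal t * (g s * ennreal (1 / s) * indicator {t<..} s) \<partial>lborel)"
  proof (rule nn_integral_cong_AE)
    have "AE s in lborel. s \<noteq> t" by (rule AE_lborel_singleton)
    then show "AE s in lborel. g s * ennreal (1 / s) * ennreal (min s t)
      = g s * indicator {0<..<t} s + ennreal t * (g s * ennreal (1 / s) * indicator {t<..} s)"
    proof eventually_elim
      case (elim s)
      consider "s \<le> 0" | "0 < s" "s < t" | "t < s" using elim by linarith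
      then show ?case
      proof cases
        case 1
        then show ?thesis using t by (simp add: ennreal_neg)
      next
        case 2
        have "ennreal (1 / s) * ennreal s = 1" using 2 by (simp flip: ennreal_mult)
        then show ?thesis using 2 by (simp add: mult.assoc)
      next
        case 3
        then show ?thesis using t by (simp add: mult_ac)
      qed
    qed
  qed
  also have "\<dots> = (\<integral>\<^sup>+ s \<in> {0<..<t}. g s \<partial>lborel) + ennreal t * dual_hardy g t"
    unfolding dual_hardy_def by (subst nn_integral_add, measurable, subst nn_integral_cmult) measurable
  finally have "hardy (dual_hardy g) t = hardy g t + (ennreal (1 / t) * ennreal t) * dual_hardy g t"
    unfolding hardy_def by (simp add: distrib_left mult.assoc)
  also have "ennreal (1 / t) * ennreal t = 1" using t by (simp flip: ennreal_mult)
  finally show ?thesis by (simp add: calderon_eq_hardy)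
qed

text \<open>In this order the weight of \<open>g s\<close> is the integral of \<open>1 / u^2\<close>
  beyond \<open>max s t\<close>, which is the same kernel.\<close>

lemma dual_hardy_hardy:
  assumes g[measurable]: "g \<in> borel_measurable borel" and t: "t > 0"
  shows "dual_hardy (hardy g) t = calderon g t"
proof -
  have "dual_hardy (hardy g) t
    = (\<integral>\<^sup>+ u. (\<integral>\<^sup>+ s. g s * indicator {p. 0 < snd p \<and> snd p < fst p} (u, s) * (ennreal (1 / u\<^sup>2) * indicator {t<..} u) \<partial>lborel) \<partial>lborel)"
    unfolding dual_hardy_def hardy_def
  proof (intro nn_integral_cong)
    fix u :: real
    show "ennreal (1 / u) * (\<integral>\<^sup>+ s \<in> {0<..<u}. g s \<partial>lborel) * ennreal (1 / u) * indicator {t<..} u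
      = (\<integral>\<^sup>+ s. g s * indicator {p. 0 < snd p \<and> snd p < fst p} (u, s) * (ennreal (1 / u\<^sup>2) * indicator {t<..} u) \<partial>lborel)"
    proof (cases "t < u")
      case True
      have e: "ennreal (1 / u\<^sup>2) = ennreal (1 / u) * ennreal (1 / u)"
        using True t by (simp add: power2_eq_square flip: ennreal_mult)
      have "(\<integral>\<^sup>+ s. g s * indicator {p. 0 < snd p \<and> snd p < fst p} (u, s) * (ennreal (1 / u\<^sup>2) * indicator {t<..} u) \<partial>lborel)
        = (\<integral>\<^sup>+ s. g s * indicator {p. 0 < snd p \<and> snd p < fst p} (u, s) \<partial>lborel) * (ennreal (1 / u\<^sup>2) * indicator {t<..} u)"
        by (rule nn_integral_multc) measurable
      then show ?thesis unfolding indicator_lower_triangle(1)[symmetric] e using True by (simp add: mult_ac)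
    qed simp
  qed
  also have "\<dots> = (\<integral>\<^sup>+ s. (\<integral>\<^sup>+ u. g s * indicator {p. 0 < snd p \<and> snd p < fst p} (u, s) * (ennreal (1 / u\<^sup>2) * indicator {t<..} u) \<partial>lborel) \<partial>lborel)"
    by (rule lborel_pair.Fubini'[symmetric]) (simp add: case_prod_beta')
  also have "\<dots> = (\<integral>\<^sup>+ s. g s * indicator {0<..} s * ennreal (1 / max s t) \<partial>lborel)"
  proof (intro nn_integral_cong)
    fix s
    have "(\<integral>\<^sup>+ u. g s * indicator {p. 0 < snd p \<and> snd p < fst p} (u, s) * (ennreal (1 / u\<^sup>2) * indicator {t<..} u) \<partial>lborel)
      = (\<integral>\<^sup>+ u. g s * indicator {0<..} s * (ennreal (1 / u\<^sup>2) * indicator {max s t..} u) \<partial>lborel)"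
    proof (rule nn_integral_cong_AE)
      have "AE u in lborel. u \<noteq> max s t" by (rule AE_lborel_singleton)
      then show "AE u in lborel. g s * indicator {p. 0 < snd p \<and> snd p < fst p} (u, s) * (ennreal (1 / u\<^sup>2) * indicator {t<..} u)
        = g s * indicator {0<..} s * (ennreal (1 / u\<^sup>2) * indicator {max s t..} u)"
        by eventually_elim (auto simp: indicator_def)
    qed
    also have "\<dots> = g s * indicator {0<..} s * (\<integral>\<^sup>+ u. ennreal (1 / u\<^sup>2) * indicator {max s t..} u \<partial>lborel)"
      by (rule nn_integral_cmult) measurable
    also have "\<dots> = g s * indicator {0<..} s * ennreal (1 / max s t)"
      using t by (subst nn_integral_inverse_square_atLeast) auto
    finally show "(\<integral>\<^sup>+ u. g s * indicator {p. 0 < snd p \<and> snd p < fst p} (u, s) * (ennreal (1 / u\<^sup>2) * indicator {t<..} u) \<partial>lborel)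
      = g s * indicator {0<..} s * ennreal (1 / max s t)" .
  qed
  also have "\<dots> = (\<integral>\<^sup>+ s. ennreal (1 / t) * (g s * indicator {0<..<t} s) + g s * ennreal (1 / s) * indicator {t<..} s \<partial>lborel)"
  proof (rule nn_integral_cong_AE)
    have "AE s in lborel. s \<noteq> t" by (rule AE_lborel_singleton)
    then show "AE s in lborel. g s * indicator {0<..} s * ennreal (1 / max s t)
      = ennreal (1 / t) * (g s * indicator {0<..<t} s) + g s * ennreal (1 / s) * indicator {t<..} s"
      by eventually_elim (use t in \<open>auto simp: indicator_def max_def mult.commute\<close>)
  qed
  also have "\<dots> = hardy g t + dual_hardy g t"
    unfolding dual_hardy_def hardy_def by (subst nn_integral_add, measurable, subst nn_integral_cmult) measurable
  finally show ?thesis by (simp add: calderon_eq_hardy)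
qed

section \<open>Reduction of Calderon powers to powers of the Hardy operators\<close>

definition hardy_finite :: "nat \<Rightarrow> (real \<Rightarrow> ennreal) \<Rightarrow> bool" where
  "hardy_finite n g \<longleftrightarrow> (\<forall>i\<in>{1..n}. \<forall>t>0. (hardy ^^ i) g t < \<infinity> \<and> (dual_hardy ^^ i) g t < \<infinity>)"

text \<open>With \<open>P\<close> and \<open>Q\<close> for the two operators,
  \<open>P^(i+1) Q = P^i (P + Q) = P^(i+1) + P^i Q\<close>: a mixed power is a pure one plus a mixed
  one of lower order. The other mixed power is symmetric.\<close>

lemma funpow_hardy_dual_finite:
  assumes g: "g \<in> borel_measurable borel" and fin: "hardy_finite n g" and n: "n \<ge> 1" and t: "t > 0"
  shows "i \<le> n \<Longrightarrow> (hardy ^^ i) (dual_hardy g) t < \<infinity> \<and> (dual_hardy ^^ i) (hardy g) t < \<infinity>"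
proof (induction i)
  case 0
  have "(hardy ^^ 1) g t < \<infinity> \<and> (dual_hardy ^^ 1) g t < \<infinity>"
    using fin n t unfolding hardy_finite_def by (metis atLeastAtMost_iff le_refl)
  then show ?case by simp
next
  case (Suc i)
  have S: "(hardy ^^ Suc i) g t < \<infinity>" "(dual_hardy ^^ Suc i) g t < \<infinity>"
    using fin Suc.prems t unfolding hardy_finite_def by (metis Suc_eq_plus1 atLeastAtMost_iff le_add2)+
  have "(hardy ^^ Suc i) (dual_hardy g) t = (hardy ^^ i) (hardy (dual_hardy g)) t"
    by (simp only: funpow_Suc_right comp_apply)
  also have "\<dots> = (hardy ^^ i) (\<lambda>u. hardy g u + dual_hardy g u) t"
    using hardy_dual_hardy[OF g] t by (intro funpow_hardy_cong) (auto simp: calderon_eq_hardy)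
  also have "\<dots> = (hardy ^^ i) (hardy g) t + (hardy ^^ i) (dual_hardy g) t"
    by (intro funpow_hardy_add hardy_measurable dual_hardy_measurable g)
  also have "(hardy ^^ i) (hardy g) t = (hardy ^^ Suc i) g t" by (simp only: funpow_Suc_right comp_apply)
  finally have 1: "(hardy ^^ Suc i) (dual_hardy g) t < \<infinity>" using S Suc by simp
  have "(dual_hardy ^^ Suc i) (hardy g) t = (dual_hardy ^^ i) (dual_hardy (hardy g)) t"
    by (simp only: funpow_Suc_right comp_apply)
  also have "\<dots> = (dual_hardy ^^ i) (\<lambda>u. hardy g u + dual_hardy g u) t"
    using dual_hardy_hardy[OF g] t by (intro funpow_dual_hardy_cong) (auto simp: calderon_eq_hardy)
  also have "\<dots> = (dual_hardy ^^ i) (hardy g) t + (dual_hardy ^^ i) (dual_hardy g) t"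
    by (intro funpow_dual_hardy_add hardy_measurable dual_hardy_measurable g)
  also have "(dual_hardy ^^ i) (dual_hardy g) t = (dual_hardy ^^ Suc i) g t" by (simp only: funpow_Suc_right comp_apply)
  finally have 2: "(dual_hardy ^^ Suc i) (hardy g) t < \<infinity>" using S Suc by simp
  from 1 2 show ?case by blast
qed

text \<open>Each application of the Calderon operator uses up one pure power, because
  \<open>P^i\<close> applied to \<open>P + Q\<close> contains \<open>P^(i+1)\<close>.\<close>

lemma hardy_finite_calderon:
  assumes g: "g \<in> borel_measurable borel" and fin: "hardy_finite (Suc n) g"
  shows "hardy_finite n (calderon g)"
  unfolding hardy_finite_def
proof (intro ballI allI impI)
  fix i and t :: real assume i: "i \<in> {1..n}" and t: "t > 0"
  have c: "calderon g = (\<lambda>u. hardy g u + dual_hardy g u)" by (simp add: fun_eq_iff calderon_eq_hardy)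
  have S: "(hardy ^^ Suc i) g t < \<infinity>" "(dual_hardy ^^ Suc i) g t < \<infinity>"
  proof -
    have "Suc i \<in> {1..Suc n}" using i by auto
    then show "(hardy ^^ Suc i) g t < \<infinity>" "(dual_hardy ^^ Suc i) g t < \<infinity>"
      using fin t unfolding hardy_finite_def by blast+
  qed
  have D: "(hardy ^^ i) (dual_hardy g) t < \<infinity> \<and> (dual_hardy ^^ i) (hardy g) t < \<infinity>"
    by (rule funpow_hardy_dual_finite[OF g fin _ t]) (use i in auto)
  have "(hardy ^^ i) (calderon g) t = (hardy ^^ i) (hardy g) t + (hardy ^^ i) (dual_hardy g) t"
    unfolding c by (intro funpow_hardy_add hardy_measurable dual_hardy_measurable g)
  moreover have "(hardy ^^ i) (hardy g) t = (hardy ^^ Suc i) g t" by (simp only: funpow_Suc_right comp_apply)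
  moreover have "(dual_hardy ^^ i) (calderon g) t = (dual_hardy ^^ i) (hardy g) t + (dual_hardy ^^ i) (dual_hardy g) t"
    unfolding c by (intro funpow_dual_hardy_add hardy_measurable dual_hardy_measurable g)
  moreover have "(dual_hardy ^^ i) (dual_hardy g) t = (dual_hardy ^^ Suc i) g t" by (simp only: funpow_Suc_right comp_apply)
  ultimately show "(hardy ^^ i) (calderon g) t < \<infinity> \<and> (dual_hardy ^^ i) (calderon g) t < \<infinity>"
    using S D by simp
qed

text \<open>The two Hardy operators satisfy \<open>P Q = Q P = P + Q\<close>, so every power of \<open>P + Q\<close> is a
  combination of pure powers of \<open>P\<close> and of \<open>Q\<close>.\<close>

lemma calderon_funpow_finite:
  assumes "g \<in> borel_measurable borel" "hardy_finite n g" "n \<ge> 1" "t > 0"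
  shows "(calderon ^^ n) g t < \<infinity>"
  using assms
proof (induction n arbitrary: g)
  case (Suc n)
  show ?case
  proof (cases "n = 0")
    case True
    have "(hardy ^^ 1) g t < \<infinity> \<and> (dual_hardy ^^ 1) g t < \<infinity>"
      using Suc.prems True unfolding hardy_finite_def by (metis One_nat_def atLeastAtMost_iff le_refl)
    then show ?thesis using True by (simp add: calderon_eq_hardy)
  next
    case False
    have "(calderon ^^ Suc n) g t = (calderon ^^ n) (calderon g) t"
      by (simp only: funpow_Suc_right comp_apply)
    also have "\<dots> < \<infinity>"
      using Suc.IH[of "calderon g"] Suc.prems False hardy_finite_calderon by simp
    finally show ?thesis .
  qed
qed simp

section \<open>Finiteness on the Lorentz space\<close>

lemma hardy_one: "t > 0 \<Longrightarrow> hardy (\<lambda>_. 1) t = 1"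
  unfolding hardy_def by (simp flip: ennreal_mult)

text \<open>The constant 1 is a fixed point of averaging, so the kernel formula for the powers of
  the Hardy operator, taken at \<open>t = 1\<close>, evaluates the integral.\<close>

lemma nn_integral_ln_power_unit:
  "(\<integral>\<^sup>+ s \<in> {0<..<1}. ennreal (ln (1 / s) ^ n) \<partial>lborel) = ennreal (fact n)"
proof -
  have h: "t > 0 \<Longrightarrow> (hardy ^^ n) (\<lambda>_. 1) t = 1" for n t
  proof (induction n arbitrary: t)
    case (Suc n)
    then have "hardy ((hardy ^^ n) (\<lambda>_. 1)) t = hardy (\<lambda>_. 1) t" by (intro hardy_cong) auto
    then show ?case using hardy_one[OF Suc.prems] by simp
  qed simp
  have "(\<integral>\<^sup>+ s \<in> {0<..<1}. ennreal (ln (1 / s) ^ n) \<partial>lborel)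
    = (\<integral>\<^sup>+ s. ennreal (fact n) * (1 * ennreal (1 / 1 * ln (1 / s) ^ n / fact n) * indicator {0<..<1} s) \<partial>lborel)"
  proof (rule nn_integral_cong)
    fix s :: real
    show "ennreal (ln (1 / s) ^ n) * indicator {0<..<1} s
      = ennreal (fact n) * (1 * ennreal (1 / 1 * ln (1 / s) ^ n / fact n) * indicator {0<..<1} s)"
    proof (cases "s \<in> {0<..<1}")
      case True
      have "ennreal (fact n) * ennreal (ln (1 / s) ^ n / fact n) = ennreal (ln (1 / s) ^ n)"
        using True by (subst ennreal_mult[symmetric]) auto
      then show ?thesis by (simp add: mult.assoc[symmetric])
    qed simp
  qed
  also have "\<dots> = ennreal (fact n) * (\<integral>\<^sup>+ s \<in> {0<..<1}. 1 * ennreal (1 / 1 * ln (1 / s) ^ n / fact n) \<partial>lborel)"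
    by (rule nn_integral_cmult) measurable
  also have "(\<integral>\<^sup>+ s \<in> {0<..<1}. 1 * ennreal (1 / 1 * ln (1 / s) ^ n / fact n) \<partial>lborel) = (hardy ^^ Suc n) (\<lambda>_. 1) 1"
    by (rule funpow_hardy_kernel[symmetric]) auto
  also have "\<dots> = 1" by (rule h) simp
  finally show ?thesis by simp
qed

section \<open>The density of the Stieltjes measure of \<open>phi d\<close>\<close>

lemma ln_power_set_integral:
  assumes t: "t \<le> 1"
  shows "set_integrable lborel {0<..<t} (\<lambda>s. ln (1 / s) ^ n)"
    and "(\<integral>\<^sup>+ s \<in> {0<..<t}. ennreal (ln (1 / s) ^ n) \<partial>lborel) = ennreal (LBINT s:{0<..<t}. ln (1 / s) ^ n)"
    and "(LBINT s:{0<..<t}. ln (1 / s) ^ n) \<ge> 0"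
    and "(LBINT s:{0<..<t}. ln (1 / s) ^ n) \<le> fact n"
proof -
  let ?f = "\<lambda>s. indicator {0<..<t} s *\<^sub>R ln (1 / s) ^ n"
  have nn: "?f s \<ge> 0" for s using t by (auto simp: indicator_def)
  have eq: "ennreal (?f s) = ennreal (ln (1 / s) ^ n) * indicator {0<..<t} s" for s by (auto simp: indicator_def)
  have le: "(\<integral>\<^sup>+ s. ennreal (?f s) \<partial>lborel) \<le> ennreal (fact n)"
    unfolding nn_integral_ln_power_unit[symmetric] eq using t
    by (intro nn_integral_mono) (auto simp: indicator_def)
  show i: "set_integrable lborel {0<..<t} (\<lambda>s. ln (1 / s) ^ n)"
    unfolding set_integrable_def using le nn by (intro integrableI_nonneg) (auto simp: le_less_trans)
  show e: "(\<integral>\<^sup>+ s \<in> {0<..<t}. ennreal (ln (1 / s) ^ n) \<partial>lborel) = ennreal (LBINT s:{0<..<t}. ln (1 / s) ^ n)"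
    unfolding set_lebesgue_integral_def eq[symmetric] using i nn
    by (intro nn_integral_eq_integral) (auto simp: set_integrable_def)
  show "(LBINT s:{0<..<t}. ln (1 / s) ^ n) \<ge> 0"
    unfolding set_lebesgue_integral_def using nn by (intro integral_nonneg_AE) auto
  have "ennreal (LBINT s:{0<..<t}. ln (1 / s) ^ n) \<le> ennreal (fact n)" using le unfolding e[symmetric] eq .
  then show "(LBINT s:{0<..<t}. ln (1 / s) ^ n) \<le> fact n" by (simp add: ennreal_le_iff)
qed

text \<open>For \<open>s \<ge> 1\<close> the substitution \<open>v = ln (1 / u)\<close> shows that
  this is the upper incomplete Gamma function with parameter \<open>n + 1\<close> at
  \<open>ln s\<close>.\<close>

definition inner_int :: "nat \<Rightarrow> real \<Rightarrow> real" where
  "inner_int n s = (LBINT u:{0<..<1 / s}. ln (1 / u) ^ n)"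

lemma inner_int_measurable [measurable]: "inner_int n \<in> borel_measurable borel"
proof -
  have "inner_int n s = (LBINT u. indicator {p. 0 < snd p \<and> snd p < 1 / fst p} (s, u) *\<^sub>R ln (1 / u) ^ n)" for s
    unfolding inner_int_def set_lebesgue_integral_def
    by (intro Bochner_Integration.integral_cong refl) (auto simp: indicator_def)
  moreover have [measurable]: "{p :: real \<times> real. 0 < snd p \<and> snd p < 1 / fst p} \<in> sets (borel \<Otimes>\<^sub>M borel)"
  proof -
    have "{p \<in> space (borel \<Otimes>\<^sub>M borel :: (real \<times> real) measure). 0 < snd p \<and> snd p < 1 / fst p} \<in> sets (borel \<Otimes>\<^sub>M borel)"
      by measurable
    then show ?thesis by (simp add: space_pair_measure)
  qed
  ultimately show ?thesis unfolding fun_eq_iff[symmetric] by (subst measurable_cong) auto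
qed

text \<open>Two lower bounds complement each other: the logarithm is the size for large
  \<open>s\<close>, but it degenerates near \<open>s = 1\<close>, where the bound with the factorial
  takes over. The latter follows by scaling the unit interval to length \<open>1 / s\<close>, which
  only increases the logarithm.\<close>

lemma inner_int_bounds:
  assumes s: "s \<ge> 1"
  shows "0 \<le> inner_int n s" "inner_int n s \<le> fact n" "1 / s * ln s ^ n \<le> inner_int n s" "1 / s * fact n \<le> inner_int n s"
proof -
  have t: "1 / s \<le> 1" using s by simp
  show "0 \<le> inner_int n s" "inner_int n s \<le> fact n"
    unfolding inner_int_def using ln_power_set_integral(3,4)[OF t] by auto
  have e: "ennreal (inner_int n s) = (\<integral>\<^sup>+ u \<in> {0<..<1 / s}. ennreal (ln (1 / u) ^ n) \<partial>lborel)"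
    unfolding inner_int_def using ln_power_set_integral(2)[OF t] by simp
  have "ennreal (1 / s * ln s ^ n) = (\<integral>\<^sup>+ u \<in> {0<..<1 / s}. ennreal (ln s ^ n) \<partial>lborel)"
    using s by (simp add: nn_integral_cmult_indicator mult.commute flip: ennreal_mult)
  also have "\<dots> \<le> (\<integral>\<^sup>+ u \<in> {0<..<1 / s}. ennreal (ln (1 / u) ^ n) \<partial>lborel)"
  proof (rule nn_integral_mono)
    fix u
    show "ennreal (ln s ^ n) * indicator {0<..<1 / s} u \<le> ennreal (ln (1 / u) ^ n) * indicator {0<..<1 / s} u"
    proof (cases "u \<in> {0<..<1 / s}")
      case True
      then have "s \<le> 1 / u" using s by (simp add: field_simps)
      then have "ln s ^ n \<le> ln (1 / u) ^ n" using s True by (intro power_mono) auto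
      then show ?thesis using True by (simp add: ennreal_leI)
    qed simp
  qed
  finally show "1 / s * ln s ^ n \<le> inner_int n s"
    using \<open>0 \<le> inner_int n s\<close> unfolding e[symmetric] by (simp add: ennreal_le_iff)
  have "ennreal (1 / s * fact n) = ennreal (1 / s) * (\<integral>\<^sup>+ v \<in> {0<..<1}. ennreal (ln (1 / v) ^ n) \<partial>lborel)"
    unfolding nn_integral_ln_power_unit using s by (intro ennreal_mult) auto
  also have "\<dots> \<le> ennreal (1 / s) * (\<integral>\<^sup>+ v. ennreal (ln (1 / (0 + 1 / s * v)) ^ n) * indicator {0<..<1 / s} (0 + 1 / s * v) \<partial>lborel)"
  proof (intro mult_left_mono nn_integral_mono)
    fix v
    show "ennreal (ln (1 / v) ^ n) * indicator {0<..<1} v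
      \<le> ennreal (ln (1 / (0 + 1 / s * v)) ^ n) * indicator {0<..<1 / s} (0 + 1 / s * v)"
    proof (cases "v \<in> {0<..<1}")
      case True
      then have "0 + 1 / s * v \<in> {0<..<1 / s}" using s by (simp add: divide_simps)
      moreover have "ln (1 / v) ^ n \<le> ln (1 / (0 + 1 / s * v)) ^ n"
        using True s by (intro power_mono) (auto simp: field_simps)
      ultimately show ?thesis
        using True by (simp only: indicator_simps mult_1_right) (rule ennreal_leI)
    qed simp
  qed simp
  also have "\<dots> = (\<integral>\<^sup>+ u \<in> {0<..<1 / s}. ennreal (ln (1 / u) ^ n) \<partial>lborel)"
    using nn_integral_real_affine[of "\<lambda>u. ennreal (ln (1 / u) ^ n) * indicator {0<..<1 / s} u" "1 / s" 0] s by simp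
  finally show "1 / s * fact n \<le> inner_int n s"
    using \<open>0 \<le> inner_int n s\<close> unfolding e[symmetric] by (simp add: ennreal_le_iff)
qed

definition phi_deriv :: "nat \<Rightarrow> real \<Rightarrow> real" where
  "phi_deriv d s = (if s \<le> 0 then 0 else if s < 1 then ln (1 / s) ^ d / fact d + 1
    else inner_int (d - 1) s / fact (d - 1))"

lemma phi_deriv_measurable [measurable]: "phi_deriv d \<in> borel_measurable borel"
  unfolding phi_deriv_def[abs_def] by measurable

lemma phi_deriv_nonneg: "phi_deriv d s \<ge> 0"
  using inner_int_bounds(1)[of s "d - 1"] by (auto simp: phi_deriv_def)

lemma phi_eq_nn_integral:
  assumes d: "d \<ge> 1"
  shows "phi d t \<ge> 0" "(\<integral>\<^sup>+ s \<in> {..t}. ennreal (phi_deriv d s) \<partial>lborel) = ennreal (phi d t)"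
proof -
  have G: "Gamma (real d + 1) = fact d" "Gamma (real d) = fact (d - 1)"
    using Gamma_fact[of d, where 'a = real] Gamma_fact[of "d - 1", where 'a = real] d by (simp_all add: add.commute of_nat_diff)
  have low: "(\<integral>\<^sup>+ s \<in> {..t}. ennreal (phi_deriv d s) \<partial>lborel) = ennreal (1 / fact d * (LBINT s:{0<..<t}. ln (1 / s) ^ d) + t)"
    if t: "0 < t" "t \<le> 1" for t
  proof -
    have "(\<integral>\<^sup>+ s \<in> {..t}. ennreal (phi_deriv d s) \<partial>lborel)
      = (\<integral>\<^sup>+ s. ennreal (1 / fact d) * (ennreal (ln (1 / s) ^ d) * indicator {0<..<t} s) + indicator {0<..<t} s \<partial>lborel)"
    proof (rule nn_integral_cong_AE)
      have "AE s in lborel. s \<noteq> t" by (rule AE_lborel_singleton)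
      then show "AE s in lborel. ennreal (phi_deriv d s) * indicator {..t} s
        = ennreal (1 / fact d) * (ennreal (ln (1 / s) ^ d) * indicator {0<..<t} s) + indicator {0<..<t} s"
      proof eventually_elim
        case (elim s)
        consider "s \<le> 0" | "0 < s" "s < t" | "t < s" using elim by linarith
        then show ?case
        proof cases
          case 2
          then have "ennreal (phi_deriv d s) = ennreal (1 / fact d * ln (1 / s) ^ d + 1)" using t by (simp add: phi_deriv_def)
          also have "\<dots> = ennreal (1 / fact d * ln (1 / s) ^ d) + 1" using 2 t by (subst ennreal_plus) auto
          also have "ennreal (1 / fact d * ln (1 / s) ^ d) = ennreal (1 / fact d) * ennreal (ln (1 / s) ^ d)"
            using 2 t by (intro ennreal_mult) auto
          finally show ?thesis using 2 by simp
        qed (auto simp: phi_deriv_def)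
      qed
    qed
    also have "\<dots> = (\<integral>\<^sup>+ s. ennreal (1 / fact d) * (ennreal (ln (1 / s) ^ d) * indicator {0<..<t} s) \<partial>lborel)
      + (\<integral>\<^sup>+ s. indicator {0<..<t} s \<partial>lborel)"
      by (rule nn_integral_add) measurable
    also have "(\<integral>\<^sup>+ s. ennreal (1 / fact d) * (ennreal (ln (1 / s) ^ d) * indicator {0<..<t} s) \<partial>lborel)
      = ennreal (1 / fact d) * (\<integral>\<^sup>+ s \<in> {0<..<t}. ennreal (ln (1 / s) ^ d) \<partial>lborel)"
      by (rule nn_integral_cmult) measurable
    also have "(\<integral>\<^sup>+ s \<in> {0<..<t}. ennreal (ln (1 / s) ^ d) \<partial>lborel) = ennreal (LBINT s:{0<..<t}. ln (1 / s) ^ d)"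
      by (rule ln_power_set_integral(2)[OF t(2)])
    also have "ennreal (1 / fact d) * ennreal (LBINT s:{0<..<t}. ln (1 / s) ^ d) = ennreal (1 / fact d * (LBINT s:{0<..<t}. ln (1 / s) ^ d))"
      using ln_power_set_integral(3)[OF t(2), of d] by (intro ennreal_mult[symmetric]) auto
    also have "(\<integral>\<^sup>+ s. indicator {0<..<t} s \<partial>lborel) = ennreal t" using t by simp
    also have "ennreal (1 / fact d * (LBINT s:{0<..<t}. ln (1 / s) ^ d)) + ennreal t = ennreal (1 / fact d * (LBINT s:{0<..<t}. ln (1 / s) ^ d) + t)"
      using ln_power_set_integral(3)[OF t(2), of d] t by (intro ennreal_plus[symmetric]) auto
    finally show ?thesis .
  qed
  \<comment> \<open>This value gives \<open>phi d\<close> the left limit \<open>1 + 1\<close> at 1,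
    matching the constant 2 of the second branch; the Stieltjes measure has no atom there.\<close>
  have one: "(LBINT s:{0<..<1}. ln (1 / s) ^ d) = (fact d :: real)"
  proof -
    have "ennreal (LBINT s:{0<..<1}. ln (1 / s) ^ d) = ennreal (fact d)"
      using ln_power_set_integral(2)[of 1 d] nn_integral_ln_power_unit[of d] by simp
    then show ?thesis using ln_power_set_integral(3)[of 1 d] by (simp add: ennreal_inj)
  qed
  consider "t \<le> 0" | "0 < t" "t < 1" | "1 \<le> t" by linarith
  then have "phi d t \<ge> 0 \<and> (\<integral>\<^sup>+ s \<in> {..t}. ennreal (phi_deriv d s) \<partial>lborel) = ennreal (phi d t)"
  proof cases
    case 1
    then have "(\<lambda>s. ennreal (phi_deriv d s) * indicator {..t} s) = (\<lambda>s. 0)" by (auto simp: phi_deriv_def indicator_def fun_eq_iff)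
    then have "(\<integral>\<^sup>+ s \<in> {..t}. ennreal (phi_deriv d s) \<partial>lborel) = 0" by simp
    then show ?thesis using 1 by (simp add: phi_def)
  next
    case 2
    then show ?thesis using low[of t] ln_power_set_integral(3)[of t d] by (simp add: phi_def G)
  next
    case 3
    let ?I = "\<lambda>s. indicator {1<..<t} s *\<^sub>R inner_int (d - 1) s"
    have I0: "?I s \<ge> 0" for s using inner_int_bounds(1)[of s] by (auto simp: indicator_def)
    have Ii: "integrable lborel ?I"
    proof (rule Bochner_Integration.integrable_bound)
      show "integrable lborel (\<lambda>s. fact (d - 1) * indicator {1..t} s :: real)"
        by (intro integrable_mult_right integrable_indicator_Icc)
      show "AE s in lborel. norm (?I s) \<le> norm (fact (d - 1) * indicator {1..t} s :: real)"
        using inner_int_bounds(1,2) by (intro AE_I2) (auto simp: indicator_def)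
    qed measurable
    have ph: "phi d t = 2 + 1 / fact (d - 1) * (LBINT s. ?I s)"
      using 3 by (simp add: phi_def G inner_int_def set_lebesgue_integral_def)
    have L0: "(LBINT s. ?I s) \<ge> 0" using I0 by (intro integral_nonneg_AE) auto
    have "(\<integral>\<^sup>+ s \<in> {..t}. ennreal (phi_deriv d s) \<partial>lborel)
      = (\<integral>\<^sup>+ s. ennreal (phi_deriv d s) * indicator {..1} s + ennreal (1 / fact (d - 1)) * ennreal (?I s) \<partial>lborel)"
    proof (rule nn_integral_cong_AE)
      have "AE s in lborel. s \<noteq> t \<and> s \<noteq> 1"
        using AE_lborel_singleton[of t] AE_lborel_singleton[of 1] by auto
      then show "AE s in lborel. ennreal (phi_deriv d s) * indicator {..t} s
        = ennreal (phi_deriv d s) * indicator {..1} s + ennreal (1 / fact (d - 1)) * ennreal (?I s)"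
      proof eventually_elim
        case (elim s)
        consider "s < 1" | "1 < s" "s < t" | "t < s" using elim 3 by linarith
        then show ?case
        proof cases
          case 2
          then have "ennreal (phi_deriv d s) = ennreal (1 / fact (d - 1) * inner_int (d - 1) s)" by (simp add: phi_deriv_def)
          also have "\<dots> = ennreal (1 / fact (d - 1)) * ennreal (inner_int (d - 1) s)"
            using inner_int_bounds(1)[of s] 2 by (intro ennreal_mult) auto
          finally show ?thesis using 2 by simp
        qed (use 3 in auto)
      qed
    qed
    also have "\<dots> = (\<integral>\<^sup>+ s \<in> {..1}. ennreal (phi_deriv d s) \<partial>lborel) + ennreal (1 / fact (d - 1)) * (\<integral>\<^sup>+ s. ennreal (?I s) \<partial>lborel)"
      by (subst nn_integral_cmult[symmetric], measurable) (rule nn_integral_add; measurable)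
    also have "(\<integral>\<^sup>+ s. ennreal (?I s) \<partial>lborel) = ennreal (LBINT s. ?I s)"
      using I0 by (intro nn_integral_eq_integral Ii) auto
    also have "(\<integral>\<^sup>+ s \<in> {..1}. ennreal (phi_deriv d s) \<partial>lborel) = ennreal 2"
      using low[of 1] by (simp add: one)
    also have "ennreal (1 / fact (d - 1)) * ennreal (LBINT s. ?I s) = ennreal (1 / fact (d - 1) * (LBINT s. ?I s))"
      using L0 by (intro ennreal_mult[symmetric]) auto
    also have "ennreal 2 + \<dots> = ennreal (phi d t)"
      unfolding ph using L0 by (intro ennreal_plus[symmetric]) auto
    finally show ?thesis using ph L0 by simp
  qed
  then show "phi d t \<ge> 0" "(\<integral>\<^sup>+ s \<in> {..t}. ennreal (phi_deriv d s) \<partial>lborel) = ennreal (phi d t)" by auto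
qed

text \<open>Monotonicity and right continuity of \<open>phi d\<close>, which give the Stieltjes
  measure its values on intervals, are read off from the measure with density
  \<open>phi_deriv d\<close>. The two measures then agree on half-open intervals.\<close>

lemma interval_measure_phi:
  assumes d: "d \<ge> 1"
  shows "interval_measure (phi d) = density lborel (\<lambda>s. ennreal (phi_deriv d s))"
proof -
  let ?N = "density lborel (\<lambda>s. ennreal (phi_deriv d s))"
  have N: "emeasure ?N {..t} = ennreal (phi d t)" for t
    using phi_eq_nn_integral(2)[OF d] by (simp add: emeasure_density)
  have mono: "phi d x \<le> phi d y" if "x \<le> y" for x y
  proof -
    have "emeasure ?N {..x} \<le> emeasure ?N {..y}" using that by (intro emeasure_mono) auto
    then show ?thesis unfolding N using phi_eq_nn_integral(1)[OF d] by (simp add: ennreal_le_iff)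
  qed
  have cont: "continuous (at_right a) (phi d)" for a
    unfolding continuous_within
  proof (rule tendsto_at_right_sequentially[of a "a + 1"])
    fix S :: "nat \<Rightarrow> real" assume S: "\<And>n. a < S n" "decseq S" "S \<longlonglongrightarrow> a"
    have "(\<lambda>n. emeasure ?N {..S n}) \<longlonglongrightarrow> emeasure ?N (\<Inter>n. {..S n})"
      using S(2) by (intro Lim_emeasure_decseq) (auto simp: N decseq_def)
    also have "(\<Inter>n. {..S n}) = {..a}"
    proof (intro equalityI subsetI)
      fix x assume "x \<in> (\<Inter>n. {..S n})"
      then have "\<And>n. x \<le> S n" by auto
      then show "x \<in> {..a}" using LIMSEQ_le_const[OF S(3)] by auto
    qed (use S(1) in \<open>auto intro: less_imp_le order_trans\<close>)
    finally have "(\<lambda>n. ennreal (phi d (S n))) \<longlonglongrightarrow> ennreal (phi d a)" unfolding N .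
    then show "(\<lambda>n. phi d (S n)) \<longlonglongrightarrow> phi d a"
      by (rule tendsto_ennrealD) (use phi_eq_nn_integral(1)[OF d] in auto)
  qed simp
  have I: "emeasure (interval_measure (phi d)) {a<..b} = emeasure ?N {a<..b}" for a b
  proof (cases "a \<le> b")
    case True
    have "{a<..b} = {..b} - {..a}" by auto
    then have "emeasure ?N {a<..b} = emeasure ?N {..b} - emeasure ?N {..a}"
      using True by (simp, intro emeasure_Diff) (auto simp: N)
    also have "\<dots> = ennreal (phi d b - phi d a)"
      unfolding N using phi_eq_nn_integral(1)[OF d] by (simp add: ennreal_minus)
    also have "\<dots> = emeasure (interval_measure (phi d)) {a<..b}"
      using emeasure_interval_measure_Ioc[OF True mono cont] by simp
    finally show ?thesis ..
  qed simp
  show ?thesis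
  proof (rule measure_eqI_generator_eq[where E = "range (\<lambda>(a, b). {a<..b})" and \<Omega> = UNIV and A = "\<lambda>n. {- real n<..real n}"])
    show "Int_stable (range (\<lambda>(a, b). {a<..b::real}))"
    proof (rule Int_stableI)
      fix A B assume "A \<in> range (\<lambda>(a, b). {a<..b::real})" "B \<in> range (\<lambda>(a, b). {a<..b::real})"
      then obtain a b c e where "A = {a<..b}" "B = {c<..e}" by auto
      then have "A \<inter> B = {max a c<..min b e}" by auto
      then show "A \<inter> B \<in> range (\<lambda>(a, b). {a<..b::real})" by (auto intro!: image_eqI[of _ _ "(max a c, min b e)"])
    qed
    show "(\<Union>i. {- real i<..real i}) = (UNIV :: real set)"
    proof -
      have "\<exists>n. x \<in> {- real n<..real n}" for x
      proof -
        obtain n where "\<bar>x\<bar> < real n" using reals_Archimedean2 by blast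
        then show ?thesis by (intro exI[of _ n]) auto
      qed
      then show ?thesis by blast
    qed
    show "emeasure (interval_measure (phi d)) {- real i<..real i} \<noteq> \<infinity>" for i
      using emeasure_interval_measure_Ioc[OF _ mono cont, of "- real i" "real i"] by simp
  qed (auto simp: I borel_sigma_sets_Ioc)
qed

lemma power_add_le:
  fixes x y :: real
  assumes "x \<ge> 0" "y \<ge> 0"
  shows "(x + y) ^ n \<le> 2 ^ n * (x ^ n + y ^ n)"
proof -
  have "(x + y) ^ n \<le> (2 * max x y) ^ n" using assms by (intro power_mono) auto
  also have "\<dots> = 2 ^ n * max x y ^ n" by (simp add: power_mult_distrib)
  also have "max x y ^ n \<le> x ^ n + y ^ n" using assms by (simp add: max_def)
  finally show ?thesis by simp
qed

text \<open>The left-hand side contains the kernels of both Hardy powers of order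
  \<open>i + 1\<close>, one for \<open>s < t\<close> and one for \<open>s > t\<close>. As only
  finiteness is at stake, the constant may depend on \<open>t\<close>.\<close>

lemma log_kernel_le_phi_deriv:
  assumes d: "d \<ge> 1" and i: "i < d" and t: "t > 0"
  shows "\<exists>C\<ge>0. \<forall>s>0. s \<noteq> 1 \<longrightarrow> min (1 / t) (1 / s) * (\<bar>ln t - ln s\<bar> ^ i / fact i) \<le> C * phi_deriv d s"
proof -
  define D where "D = d - 1"
  define a where "a = 1 + \<bar>ln t\<bar>"
  define C where "C = max 1 (1 / t) * (2 ^ D * a ^ D)"
  have a: "a \<ge> 1" by (simp add: a_def)
  have C0: "C \<ge> 0" using a by (auto simp: C_def)
  \<comment> \<open>The case \<open>t = 1\<close> up to constants. Near 0 the power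
    \<open>d - 1\<close> of the logarithm is below the power \<open>d\<close> plus 1; at infinity
    the inner integral has the order of \<open>ln s ^ (d - 1) / s\<close> and is at least
    \<open>1 / s\<close>.\<close>
  have v: "min 1 (1 / s) * (1 + \<bar>ln s\<bar> ^ D) \<le> 2 * fact d * phi_deriv d s" if s: "s > 0" "s \<noteq> 1" for s
  proof (cases "s < 1")
    case True
    let ?x = "ln (1 / s)"
    have x: "?x \<ge> 0" "\<bar>ln s\<bar> = ?x" using s True by (auto simp: ln_div)
    have "?x ^ D \<le> 1 + ?x ^ d"
    proof (cases "?x \<le> 1")
      case True
      then have "?x ^ D \<le> 1" using x by (intro power_le_one) auto
      then show ?thesis using x by (simp add: add_increasing2)
    next
      case False
      then have "?x ^ D \<le> ?x ^ d" by (intro power_increasing) (auto simp: D_def)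
      then show ?thesis by simp
    qed
    then have "1 + ?x ^ D \<le> 2 * (?x ^ d + 1)" using zero_le_power[OF x(1), of d] unfolding distrib_left by linarith
    also have "?x ^ d + 1 \<le> fact d * (?x ^ d / fact d + 1)" by (simp add: distrib_left)
    finally have "1 + ?x ^ D \<le> 2 * fact d * phi_deriv d s" using s True by (simp add: phi_deriv_def)
    moreover have "min 1 (1 / s) = 1" using s True by simp
    ultimately show ?thesis using x by simp
  next
    case False
    then have s1: "s > 1" using s by simp
    have "1 / s * 1 \<le> 1 / s * fact D" using s1 by (intro mult_left_mono) auto
    then have "1 / s \<le> inner_int D s" using inner_int_bounds(4)[of s D] s1 by simp
    then have "1 / s * (1 + ln s ^ D) \<le> 2 * inner_int D s"
      using inner_int_bounds(3)[of s D] s1 by (simp add: distrib_left)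
    also have "inner_int D s = fact D * phi_deriv d s" using s1 by (simp add: phi_deriv_def D_def)
    also have "2 * (fact D * phi_deriv d s) \<le> 2 * (fact d * phi_deriv d s)"
      using phi_deriv_nonneg[of d s] by (intro mult_left_mono mult_right_mono fact_mono) (auto simp: D_def)
    finally show ?thesis using s1 by (simp add: min_def)
  qed
  have "min (1 / t) (1 / s) * (\<bar>ln t - ln s\<bar> ^ i / fact i) \<le> C * (2 * fact d) * phi_deriv d s" if s: "s > 0" "s \<noteq> 1" for s
  proof -
    have "\<bar>ln t - ln s\<bar> ^ i / fact i \<le> \<bar>ln t - ln s\<bar> ^ i / 1" by (intro divide_left_mono) auto
    also have "\<bar>ln t - ln s\<bar> ^ i / 1 \<le> (a + \<bar>ln s\<bar>) ^ i" unfolding a_def by (simp, intro power_mono) auto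
    also have "\<dots> \<le> (a + \<bar>ln s\<bar>) ^ D" using a i by (intro power_increasing) (auto simp: D_def)
    also have "\<dots> \<le> 2 ^ D * (a ^ D + \<bar>ln s\<bar> ^ D)" using a by (intro power_add_le) auto
    also have "\<dots> \<le> 2 ^ D * (a ^ D * (1 + \<bar>ln s\<bar> ^ D))"
    proof (intro mult_left_mono)
      have "1 * \<bar>ln s\<bar> ^ D \<le> a ^ D * \<bar>ln s\<bar> ^ D" using a by (intro mult_right_mono) auto
      then show "a ^ D + \<bar>ln s\<bar> ^ D \<le> a ^ D * (1 + \<bar>ln s\<bar> ^ D)" by (simp add: distrib_left)
    qed simp
    finally have k: "\<bar>ln t - ln s\<bar> ^ i / fact i \<le> 2 ^ D * a ^ D * (1 + \<bar>ln s\<bar> ^ D)" by (simp add: mult.assoc)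
    have m: "min (1 / t) (1 / s) \<le> max 1 (1 / t) * min 1 (1 / s)"
    proof (cases "s \<le> 1")
      case True
      then have "min 1 (1 / s) = 1" using s by simp
      then show ?thesis by simp
    next
      case False
      then have "min 1 (1 / s) = 1 / s" by (simp add: min_def)
      moreover have "1 * (1 / s) \<le> max 1 (1 / t) * (1 / s)" using s by (intro mult_right_mono) auto
      ultimately show ?thesis by simp
    qed
    have "min (1 / t) (1 / s) * (\<bar>ln t - ln s\<bar> ^ i / fact i)
      \<le> (max 1 (1 / t) * min 1 (1 / s)) * (2 ^ D * a ^ D * (1 + \<bar>ln s\<bar> ^ D))"
      using m k a s t by (intro mult_mono) auto
    also have "\<dots> = C * (min 1 (1 / s) * (1 + \<bar>ln s\<bar> ^ D))" by (simp add: C_def mult_ac)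
    also have "\<dots> \<le> C * (2 * fact d * phi_deriv d s)" using C0 by (intro mult_left_mono v s)
    finally show ?thesis by (simp add: mult.assoc)
  qed
  then show ?thesis using C0 by (intro exI[of _ "C * (2 * fact d)"]) auto
qed

lemma hardy_finite_of_phi:
  assumes d: "d \<ge> 1" and g[measurable]: "g \<in> borel_measurable borel"
    and fin: "(\<integral>\<^sup>+ s \<in> {0<..}. g s \<partial>interval_measure (phi d)) < \<infinity>"
  shows "hardy_finite d g"
  unfolding hardy_finite_def
proof (intro ballI allI impI)
  fix k and t :: real assume k: "k \<in> {1..d}" and t: "t > 0"
  obtain i where i: "k = Suc i" "i < d" using k by (cases k) auto
  obtain C where C: "C \<ge> 0" "\<And>s. s > 0 \<Longrightarrow> s \<noteq> 1 \<Longrightarrow> min (1 / t) (1 / s) * (\<bar>ln t - ln s\<bar> ^ i / fact i) \<le> C * phi_deriv d s"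
    using log_kernel_le_phi_deriv[OF d i(2) t] by blast
  have "(\<integral>\<^sup>+ s \<in> {0<..}. g s \<partial>interval_measure (phi d)) = (\<integral>\<^sup>+ s. ennreal (phi_deriv d s) * (g s * indicator {0<..} s) \<partial>lborel)"
    unfolding interval_measure_phi[OF d] by (rule nn_integral_density) measurable
  then have W: "(\<integral>\<^sup>+ s. ennreal C * (ennreal (phi_deriv d s) * (g s * indicator {0<..} s)) \<partial>lborel) < \<infinity>"
    using fin by (subst nn_integral_cmult) (auto simp: ennreal_mult_less_top)
  have bound: "g s * ennreal K \<le> ennreal C * (ennreal (phi_deriv d s) * (g s * indicator {0<..} s))"
    if "s > 0" "s \<noteq> 1" "K = min (1 / t) (1 / s) * (\<bar>ln t - ln s\<bar> ^ i / fact i)" for s K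
  proof -
    have "ennreal K \<le> ennreal (C * phi_deriv d s)" using C(2) that by (intro ennreal_leI) simp
    also have "\<dots> = ennreal C * ennreal (phi_deriv d s)" using C(1) phi_deriv_nonneg by (intro ennreal_mult) auto
    finally have "g s * ennreal K \<le> g s * (ennreal C * ennreal (phi_deriv d s))" by (intro mult_left_mono) auto
    then show ?thesis using that by (simp add: mult_ac)
  qed
  have "(hardy ^^ Suc i) g t = (\<integral>\<^sup>+ s \<in> {0<..<t}. g s * ennreal (1 / t * ln (t / s) ^ i / fact i) \<partial>lborel)"
    by (rule funpow_hardy_kernel[OF g t])
  also have "\<dots> \<le> (\<integral>\<^sup>+ s. ennreal C * (ennreal (phi_deriv d s) * (g s * indicator {0<..} s)) \<partial>lborel)"
  proof (rule nn_integral_mono_AE)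
    have "AE s in lborel. s \<noteq> (1::real)" by (rule AE_lborel_singleton)
    then show "AE s in lborel. g s * ennreal (1 / t * ln (t / s) ^ i / fact i) * indicator {0<..<t} s
      \<le> ennreal C * (ennreal (phi_deriv d s) * (g s * indicator {0<..} s))"
    proof eventually_elim
      case (elim s)
      show ?case
      proof (cases "s \<in> {0<..<t}")
        case True
        then have "1 / t \<le> 1 / s" using t by (intro divide_left_mono) auto
        moreover have "\<bar>ln t - ln s\<bar> = ln (t / s)" using True t by (simp add: ln_div)
        ultimately show ?thesis using True elim bound[of s "1 / t * ln (t / s) ^ i / fact i"] by (simp add: min_def)
      qed simp
    qed
  qed
  finally have 1: "(hardy ^^ Suc i) g t < \<infinity>" using W by (rule le_less_trans)
  have "(dual_hardy ^^ Suc i) g t = (\<integral>\<^sup>+ s \<in> {t<..}. g s * ennreal (1 / s * ln (s / t) ^ i / fact i) \<partial>lborel)"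
    by (rule funpow_dual_hardy_kernel[OF g t])
  also have "\<dots> \<le> (\<integral>\<^sup>+ s. ennreal C * (ennreal (phi_deriv d s) * (g s * indicator {0<..} s)) \<partial>lborel)"
  proof (rule nn_integral_mono_AE)
    have "AE s in lborel. s \<noteq> (1::real)" by (rule AE_lborel_singleton)
    then show "AE s in lborel. g s * ennreal (1 / s * ln (s / t) ^ i / fact i) * indicator {t<..} s
      \<le> ennreal C * (ennreal (phi_deriv d s) * (g s * indicator {0<..} s))"
    proof eventually_elim
      case (elim s)
      show ?case
      proof (cases "s \<in> {t<..}")
        case True
        then have "1 / s \<le> 1 / t" using t by (intro divide_left_mono) auto
        moreover have "\<bar>ln t - ln s\<bar> = ln (s / t)" using True t by (simp add: ln_div)
        ultimately show ?thesis using True t elim bound[of s "1 / s * ln (s / t) ^ i / fact i"] by (simp add: min_absorb2)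
      qed simp
    qed
  qed
  finally have 2: "(dual_hardy ^^ Suc i) g t < \<infinity>" using W by (rule le_less_trans)
  from 1 2 show "(hardy ^^ k) g t < \<infinity> \<and> (dual_hardy ^^ k) g t < \<infinity>" unfolding i(1) by blast
qed

lemma emeasure_space_lebesgue_Rd:
  assumes "d \<ge> 1"
  shows "emeasure (lebesgue_Rd d) (space (lebesgue_Rd d)) = \<infinity>"
proof -
  have "emeasure (lebesgue_Rd d) (space (lebesgue_Rd d)) = emeasure (borel_Rd d) (space (borel_Rd d))"
    by (simp add: lebesgue_Rd_def)
  also have "\<dots> = emeasure (borel_Rd d) (PiE {1..d} (\<lambda>_. UNIV))" by (simp add: space_PiM)
  also have "\<dots> = (\<Prod>i\<in>{1..d}. emeasure lborel (UNIV :: real set))" by (rule PS.emeasure_PiM) auto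
  also have "\<dots> = \<infinity>" using assms by (simp add: power_eq_top_ennreal)
  finally show ?thesis .
qed

theorem Lorentz_space_calderon_finite:
  assumes d: "d \<ge> 1" and f: "f \<in> Lorentz_space (phi d) (lebesgue_Rd d)" and n: "n \<le> d" and t: "t > 0"
  shows "(calderon ^^ n) (rearrangement (lebesgue_Rd d) f) t < \<infinity>"
proof -
  let ?mu = "rearrangement (lebesgue_Rd d) f"
  have "(\<integral>\<^sup>+ s \<in> {0<..}. ?mu s \<partial>interval_measure (phi d)) < \<infinity>"
    using f unfolding Lorentz_space_def emeasure_space_lebesgue_Rd[OF d] by (simp add: greaterThan_def)
  then have h: "hardy_finite d ?mu" by (intro hardy_finite_of_phi d) simp_all
  show ?thesis
  proof (cases "n = 0")
    case True
    \<comment> \<open>\<open>hardy_finite\<close> starts with the first power; the rearrangement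
      itself is finite because, being decreasing, it is below its average.\<close>
    have "(calderon ^^ 1) ?mu t < \<infinity>"
    proof (rule calderon_funpow_finite)
      show "hardy_finite 1 ?mu" using h d unfolding hardy_finite_def by (meson atLeastAtMost_iff order_trans)
    qed (use t in simp_all)
    then show ?thesis using True rearrangement_finite[of "lebesgue_Rd d" f t] t by simp
  next
    case False
    have "hardy_finite n ?mu" using h n by (auto simp: hardy_finite_def)
    then show ?thesis using False t by (intro calderon_funpow_finite) auto
  qed
qed

section \<open>Truncated Calderon operators\<close>

lemma calderon_min_kernel:
  assumes [measurable]: "g \<in> borel_measurable borel" and t: "t > 0"
  shows "calderon g t = (\<integral>\<^sup>+ s \<in> {0<..}. g s * ennreal (min (1 / t) (1 / s)) \<partial>lborel)"
proof -
  have "(\<integral>\<^sup>+ s \<in> {0<..}. g s * ennreal (min (1 / t) (1 / s)) \<partial>lborel)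
    = (\<integral>\<^sup>+ s. ennreal (1 / t) * (g s * indicator {0<..<t} s) + g s * ennreal (1 / s) * indicator {t<..} s \<partial>lborel)"
  proof (rule nn_integral_cong_AE)
    have "AE s in lborel. s \<noteq> t" by (rule AE_lborel_singleton)
    then show "AE s in lborel. g s * ennreal (min (1 / t) (1 / s)) * indicator {0<..} s
      = ennreal (1 / t) * (g s * indicator {0<..<t} s) + g s * ennreal (1 / s) * indicator {t<..} s"
    proof eventually_elim
      case (elim s)
      consider "s \<le> 0" | "0 < s" "s < t" | "t < s" using elim by linarith
      then show ?case
      proof cases
        case 1
        then show ?thesis using t by simp
      next
        case 2
        then have "min (1 / t) (1 / s) = 1 / t" using t by (intro min_absorb1 divide_left_mono) auto
        then show ?thesis using 2 by (simp add: mult.commute)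
      next
        case 3
        then have "min (1 / t) (1 / s) = 1 / s" using t by (intro min_absorb2 divide_left_mono) auto
        then show ?thesis using 3 t by simp
      qed
    qed
  qed
  also have "\<dots> = (\<integral>\<^sup>+ s. ennreal (1 / t) * (g s * indicator {0<..<t} s) \<partial>lborel)
    + (\<integral>\<^sup>+ s \<in> {t<..}. g s * ennreal (1 / s) \<partial>lborel)"
    by (rule nn_integral_add) measurable
  also have "(\<integral>\<^sup>+ s. ennreal (1 / t) * (g s * indicator {0<..<t} s) \<partial>lborel) = ennreal (1 / t) * (\<integral>\<^sup>+ s \<in> {0<..<t}. g s \<partial>lborel)"
    by (rule nn_integral_cmult) measurable
  finally show ?thesis unfolding calderon_def by simp
qed

lemma calderon_dilate:
  assumes [measurable]: "g \<in> borel_measurable borel" and t: "t > 0"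
  shows "calderon g t = (\<integral>\<^sup>+ r \<in> {0<..}. g (t * r) * ennreal (min 1 (1 / r)) \<partial>lborel)"
proof -
  have "calderon g t = ennreal \<bar>t\<bar> * (\<integral>\<^sup>+ r. g (0 + t * r) * ennreal (min (1 / t) (1 / (0 + t * r))) * indicator {0<..} (0 + t * r) \<partial>lborel)"
    unfolding calderon_min_kernel[OF assms] using t by (intro nn_integral_real_affine) auto
  also have "\<dots> = (\<integral>\<^sup>+ r. ennreal \<bar>t\<bar> * (g (0 + t * r) * ennreal (min (1 / t) (1 / (0 + t * r))) * indicator {0<..} (0 + t * r)) \<partial>lborel)"
    by (rule nn_integral_cmult[symmetric]) measurable
  also have "\<dots> = (\<integral>\<^sup>+ r \<in> {0<..}. g (t * r) * ennreal (min 1 (1 / r)) \<partial>lborel)"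
  proof (rule nn_integral_cong)
    fix r
    show "ennreal \<bar>t\<bar> * (g (0 + t * r) * ennreal (min (1 / t) (1 / (0 + t * r))) * indicator {0<..} (0 + t * r))
      = g (t * r) * ennreal (min 1 (1 / r)) * indicator {0<..} r"
    proof (cases "r > 0")
      case True
      have "t * min (1 / t) (1 / (t * r)) = min 1 (1 / r)" using t True by (simp add: min_mult_distrib_left)
      then have "ennreal t * ennreal (min (1 / t) (1 / (t * r))) = ennreal (min 1 (1 / r))"
        using t True by (subst ennreal_mult[symmetric]) auto
      then have "ennreal t * (g (t * r) * ennreal (min (1 / t) (1 / (t * r)))) = g (t * r) * ennreal (min 1 (1 / r))"
        by (metis mult.left_commute)
      then show ?thesis using t True by simp
    next
      case False
      then have "t * r \<le> 0" using t by (simp add: mult_nonneg_nonpos)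
      then show ?thesis using False by simp
    qed
  qed
  finally show ?thesis .
qed

text \<open>Replacing \<open>t\<close> by \<open>c * t\<close> diminishes the kernel
  \<open>min (1 / t) (1 / s)\<close> by at most the factor \<open>c\<close>. This undoes the
  dilation of \<open>t\<close> that arises in the lower bound.\<close>

lemma calderon_le_dilate:
  assumes [measurable]: "g \<in> borel_measurable borel" and t: "t > 0" and c: "c \<ge> 1"
  shows "calderon g t \<le> ennreal c * calderon g (c * t)"
proof -
  have ct: "c * t > 0" using t c by simp
  have "(\<integral>\<^sup>+ s \<in> {0<..}. g s * ennreal (min (1 / t) (1 / s)) \<partial>lborel)
    \<le> (\<integral>\<^sup>+ s. ennreal c * (g s * ennreal (min (1 / (c * t)) (1 / s)) * indicator {0<..} s) \<partial>lborel)"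
  proof (rule nn_integral_mono)
    fix s
    show "g s * ennreal (min (1 / t) (1 / s)) * indicator {0<..} s
      \<le> ennreal c * (g s * ennreal (min (1 / (c * t)) (1 / s)) * indicator {0<..} s)"
    proof (cases "s > 0")
      case True
      have "1 * (1 / s) \<le> c * (1 / s)" using c True by (intro mult_right_mono) auto
      then have "min (1 / t) (1 / s) \<le> c * min (1 / (c * t)) (1 / s)"
        using c t True by (simp add: min_mult_distrib_left min_le_iff_disj)
      then have "ennreal (min (1 / t) (1 / s)) \<le> ennreal (c * min (1 / (c * t)) (1 / s))" by (rule ennreal_leI)
      also have "\<dots> = ennreal c * ennreal (min (1 / (c * t)) (1 / s))" using c t True by (intro ennreal_mult) auto
      finally have "g s * ennreal (min (1 / t) (1 / s)) \<le> g s * (ennreal c * ennreal (min (1 / (c * t)) (1 / s)))"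
        by (intro mult_left_mono) auto
      then show ?thesis using True by (simp add: mult_ac)
    qed simp
  qed
  also have "\<dots> = ennreal c * (\<integral>\<^sup>+ s \<in> {0<..}. g s * ennreal (min (1 / (c * t)) (1 / s)) \<partial>lborel)"
    by (rule nn_integral_cmult) measurable
  finally show ?thesis by (simp only: calderon_min_kernel[OF assms(1) t] calderon_min_kernel[OF assms(1) ct])
qed

text \<open>The Calderon operator in the variable \<open>r = s / t\<close>, cut off in this ratio
  and not in \<open>s\<close>. The truncated operator therefore still commutes with dilations and
  preserves monotonicity.\<close>

definition trunc_calderon :: "real \<Rightarrow> (real \<Rightarrow> ennreal) \<Rightarrow> real \<Rightarrow> ennreal" where
  "trunc_calderon A g t = (\<integral>\<^sup>+ r \<in> {exp (- A)<..<exp A}. g (t * r) * ennreal (min 1 (1 / r)) \<partial>lborel)"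

lemma trunc_calderon_measurable [measurable]:
  assumes [measurable]: "g \<in> borel_measurable borel"
  shows "trunc_calderon A g \<in> borel_measurable borel"
  unfolding trunc_calderon_def[abs_def] by measurable

lemma funpow_trunc_calderon_measurable [measurable]:
  "g \<in> borel_measurable borel \<Longrightarrow> (trunc_calderon A ^^ k) g \<in> borel_measurable borel"
  by (induction k) auto

lemma funpow_trunc_calderon_antimono:
  assumes "\<And>t t'. 0 < t \<Longrightarrow> t \<le> t' \<Longrightarrow> g t' \<le> g t" "0 < t" "t \<le> t'"
  shows "(trunc_calderon A ^^ k) g t' \<le> (trunc_calderon A ^^ k) g t"
  using assms(2,3)
proof (induction k arbitrary: t t')
  case (Suc k)
  have "(trunc_calderon A ^^ k) g (t' * r) * ennreal (min 1 (1 / r)) * indicator {exp (- A)<..<exp A} r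
    \<le> (trunc_calderon A ^^ k) g (t * r) * ennreal (min 1 (1 / r)) * indicator {exp (- A)<..<exp A} r" for r
  proof (cases "r \<in> {exp (- A)<..<exp A}")
    case True
    then have "r > 0" using exp_gt_zero[of "- A"] by (auto simp del: exp_gt_zero)
    then have "(trunc_calderon A ^^ k) g (t' * r) \<le> (trunc_calderon A ^^ k) g (t * r)"
      using Suc.prems by (intro Suc.IH) auto
    then show ?thesis by (intro mult_right_mono) auto
  qed simp
  then show ?case unfolding funpow.simps comp_def trunc_calderon_def[of A "(trunc_calderon A ^^ k) g"]
    by (intro nn_integral_mono)
qed (use assms in simp)

lemma funpow_trunc_calderon_scale:
  "(trunc_calderon A ^^ k) (\<lambda>u. g (c * u)) = (\<lambda>t. (trunc_calderon A ^^ k) g (c * t))"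
  by (induction k) (auto simp: trunc_calderon_def fun_eq_iff mult.assoc)

text \<open>The truncation and the function grow with the same index, so monotone convergence
  applies to both at once, and the conclusion again has the form required for the next
  power.\<close>

lemma SUP_trunc_calderon:
  assumes [measurable]: "\<And>N. G N \<in> borel_measurable borel"
    and inc: "\<And>t. t > 0 \<Longrightarrow> incseq (\<lambda>N. G N t)" and t: "t > 0"
  shows "incseq (\<lambda>N. trunc_calderon (real (Suc N)) (G N) t)"
    and "(SUP N. trunc_calderon (real (Suc N)) (G N) t) = calderon (\<lambda>t. SUP N. G N t) t"
proof -
  let ?h = "\<lambda>N r. G N (t * r) * ennreal (min 1 (1 / r)) * indicator {exp (- real (Suc N))<..<exp (real (Suc N))} r"
  have inch: "incseq (\<lambda>N. ?h N r)" for r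
  proof (rule incseq_SucI)
    fix N
    show "?h N r \<le> ?h (Suc N) r"
    proof (cases "r \<in> {exp (- real (Suc N))<..<exp (real (Suc N))}")
      case True
      have "r > 0" using True exp_gt_zero[of "- real (Suc N)"] by (auto simp del: exp_gt_zero)
      then have "G N (t * r) \<le> G (Suc N) (t * r)" using inc[of "t * r"] t by (intro incseq_SucD) auto
      moreover have "exp (- real (Suc (Suc N))) \<le> exp (- real (Suc N))" "exp (real (Suc N)) \<le> exp (real (Suc (Suc N)))" by simp_all
      then have "r \<in> {exp (- real (Suc (Suc N)))<..<exp (real (Suc (Suc N)))}" using True by (auto simp del: exp_le_cancel_iff of_nat_Suc)
      ultimately show ?thesis using True by (simp only: indicator_simps mult_1_right) (intro mult_right_mono; simp)
    qed simp
  qed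
  have lim: "(SUP N. ?h N r) = (SUP N. G N (t * r)) * ennreal (min 1 (1 / r)) * indicator {0<..} r" for r
  proof (cases "r > 0")
    case True
    have i: "incseq (\<lambda>N. G N (t * r) * ennreal (min 1 (1 / r)))"
      using inc[of "t * r"] t True by (auto simp: incseq_def intro: mult_right_mono)
    have ev: "eventually (\<lambda>N. G N (t * r) * ennreal (min 1 (1 / r)) = ?h N r) sequentially"
      using eventually_ge_at_top[of "nat \<lceil>\<bar>ln r\<bar>\<rceil>"]
    proof eventually_elim
      case (elim N)
      then have "\<bar>ln r\<bar> < real (Suc N)" by linarith
      then have "exp (- real (Suc N)) < exp (ln r)" "exp (ln r) < exp (real (Suc N))" unfolding exp_less_cancel_iff by linarith+
      then have "r \<in> {exp (- real (Suc N))<..<exp (real (Suc N))}" using True by simp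
      then show ?case by (simp only: indicator_simps mult_1_right)
    qed
    have "(\<lambda>N. ?h N r) \<longlonglongrightarrow> (SUP N. G N (t * r) * ennreal (min 1 (1 / r)))"
      using LIMSEQ_SUP[OF i] by (rule Lim_transform_eventually[OF _ ev])
    then have "(SUP N. ?h N r) = (SUP N. G N (t * r) * ennreal (min 1 (1 / r)))"
      using LIMSEQ_SUP[OF inch[of r]] by (rule LIMSEQ_unique[rotated])
    then show ?thesis using True by (simp add: SUP_mult_right_ennreal)
  next
    case False
    have "?h N r = 0" for N
    proof -
      have "r \<notin> {exp (- real (Suc N))<..<exp (real (Suc N))}" using False exp_gt_zero[of "- real (Suc N)"] by (auto simp del: exp_gt_zero of_nat_Suc)
      then show ?thesis by simp
    qed
    then have "(SUP N. ?h N r) = 0" by (simp only: SUP_const[OF UNIV_not_empty])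
    then show ?thesis using False by simp
  qed
  show "incseq (\<lambda>N. trunc_calderon (real (Suc N)) (G N) t)"
    unfolding trunc_calderon_def using inch by (auto intro!: incseq_SucI nn_integral_mono dest: incseq_SucD)
  have "(SUP N. \<integral>\<^sup>+ r. ?h N r \<partial>lborel) = (\<integral>\<^sup>+ r. (SUP N. ?h N r) \<partial>lborel)"
    by (rule nn_integral_monotone_convergence_SUP[symmetric]) (use inch in \<open>auto simp: incseq_def le_fun_def\<close>)
  also have "\<dots> = calderon (\<lambda>t. SUP N. G N t) t"
    unfolding lim using t by (intro calderon_dilate[symmetric]) measurable
  finally show "(SUP N. trunc_calderon (real (Suc N)) (G N) t) = calderon (\<lambda>t. SUP N. G N t) t"
    unfolding trunc_calderon_def .
qed

lemma SUP_funpow_trunc_calderon: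
  assumes [measurable]: "\<And>N. G N \<in> borel_measurable borel"
    and inc: "\<And>t. t > 0 \<Longrightarrow> incseq (\<lambda>N. G N t)" and t: "t > 0"
  shows "incseq (\<lambda>N. (trunc_calderon (real (Suc N)) ^^ k) (G N) t) \<and>
    (SUP N. (trunc_calderon (real (Suc N)) ^^ k) (G N) t) = (calderon ^^ k) (\<lambda>t. SUP N. G N t) t"
  using t
proof (induction k arbitrary: t)
  case 0
  then show ?case using inc by simp
next
  case (Suc k)
  let ?T = "\<lambda>N. (trunc_calderon (real (Suc N)) ^^ k) (G N)"
  have m: "?T N \<in> borel_measurable borel" for N by measurable
  have i: "incseq (\<lambda>N. ?T N u)" if "u > 0" for u using Suc.IH[OF that] by blast
  \<comment> \<open>The two arguments are known to agree only at positive points, hence two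
    inequalities from monotonicity instead of a rewrite.\<close>
  have "calderon (\<lambda>t. SUP N. ?T N t) t = calderon ((calderon ^^ k) (\<lambda>t. SUP N. G N t)) t"
  proof (rule antisym)
    show "calderon (\<lambda>t. SUP N. ?T N t) t \<le> calderon ((calderon ^^ k) (\<lambda>t. SUP N. G N t)) t"
      using Suc.IH Suc.prems by (intro calderon_mono) auto
    show "calderon ((calderon ^^ k) (\<lambda>t. SUP N. G N t)) t \<le> calderon (\<lambda>t. SUP N. ?T N t) t"
      using Suc.IH Suc.prems by (intro calderon_mono) auto
  qed
  then show ?case
    using SUP_trunc_calderon[of ?T, OF m i Suc.prems] unfolding funpow.simps comp_def by simp
qed

section \<open>The extremal functions\<close>

lemma nn_integral_reflect:
  fixes f :: "real \<Rightarrow> ennreal" and \<theta> :: real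
  assumes "f \<in> borel_measurable borel" "\<bar>\<theta>\<bar> = 1"
  shows "(\<integral>\<^sup>+ y. f (\<theta> * y) \<partial>lborel) = (\<integral>\<^sup>+ y. f y \<partial>lborel)"
  using nn_integral_real_affine[OF assms(1), of \<theta> 0] assms(2) by auto

lemma nn_integral_dilate:
  fixes f :: "real \<Rightarrow> ennreal"
  assumes [measurable]: "f \<in> borel_measurable borel" and c: "c > 0"
  shows "(\<integral>\<^sup>+ y \<in> {0<..}. f (c * y) \<partial>lborel) = ennreal (1 / c) * (\<integral>\<^sup>+ y \<in> {0<..}. f y \<partial>lborel)"
proof -
  have "(\<integral>\<^sup>+ y \<in> {0<..}. f y \<partial>lborel) = ennreal \<bar>c\<bar> * (\<integral>\<^sup>+ y. f (0 + c * y) * indicator {0<..} (0 + c * y) \<partial>lborel)"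
    using c by (intro nn_integral_real_affine) auto
  also have "(\<lambda>y. f (0 + c * y) * indicator {0<..} (0 + c * y)) = (\<lambda>y. f (c * y) * indicator {0<..} y)"
    using c by (auto simp: fun_eq_iff indicator_def zero_less_mult_iff)
  finally have "ennreal (1 / c) * (\<integral>\<^sup>+ y \<in> {0<..}. f y \<partial>lborel)
    = (ennreal (1 / c) * ennreal c) * (\<integral>\<^sup>+ y \<in> {0<..}. f (c * y) \<partial>lborel)" using c by (simp add: mult.assoc)
  also have "ennreal (1 / c) * ennreal c = 1" using c by (simp flip: ennreal_mult)
  finally show ?thesis by simp
qed

text \<open>The sign \<open>\<theta> = 1\<close> describes the support of the extremal function,
  \<open>\<theta> = -1\<close> the points at which its transform is evaluated. The size of the first
  coordinate is left free, so that the product of the coordinates takes all positive values.\<close>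

definition slab :: "real \<Rightarrow> real \<Rightarrow> real \<Rightarrow> nat \<Rightarrow> (nat \<Rightarrow> real) \<Rightarrow> bool" where
  "slab \<theta> a b k x \<longleftrightarrow> (\<forall>i\<in>{1..k}. 0 < \<theta> * x i \<and> (2 \<le> i \<longrightarrow> a < \<theta> * x i \<and> \<theta> * x i < b))"

lemma slab_Suc: "slab \<theta> a b (Suc k) (x(Suc k := y)) \<longleftrightarrow>
    slab \<theta> a b k x \<and> 0 < \<theta> * y \<and> (1 \<le> k \<longrightarrow> a < \<theta> * y \<and> \<theta> * y < b)"
  by (auto simp: slab_def atLeastAtMostSuc_conv)

lemma slab_measurable: "Measurable.pred (borel_Rd k) (slab \<theta> a b k)"
proof -
  have "Measurable.pred (borel_Rd k) (\<lambda>x. 0 < \<theta> * x i \<and> (2 \<le> i \<longrightarrow> a < \<theta> * x i \<and> \<theta> * x i < b))" if "i \<in> {1..k}" for i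
  proof -
    have [measurable]: "(\<lambda>x. x i) \<in> borel_measurable (borel_Rd k)" using that by (rule component_measurable_Rd)
    show ?thesis by measurable
  qed
  then show ?thesis unfolding slab_def[abs_def] by (intro pred_intros_finite finite_atLeastAtMost)
qed

lemma prod_component_measurable: "(\<lambda>x. \<Prod>i\<in>{1..k}. \<theta> * x i) \<in> borel_measurable (borel_Rd k)" for \<theta> :: real
  by (intro borel_measurable_prod borel_measurable_times borel_measurable_const component_measurable_Rd)

lemma nn_integral_inverse_Ioo:
  assumes "0 < a" "a \<le> b"
  shows "(\<integral>\<^sup>+ y \<in> {a<..<b}. ennreal (1 / y) \<partial>lborel) = ennreal (ln (b / a))"
  using nn_integral_inverse_Icc[OF assms] by (simp add: nn_integral_Ioo_eq_Icc)

text \<open>Fixing the last coordinate \<open>y\<close> dilates the product of the others by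
  \<open>\<bar>y\<bar>\<close>, which costs the factor \<open>1 / \<bar>y\<bar>\<close>. Each
  bounded coordinate thus contributes the integral of \<open>1 / y\<close> from \<open>a\<close> to
  \<open>b\<close>.\<close>

lemma nn_integral_slab:
  assumes \<theta>: "\<bar>\<theta>\<bar> = 1" and ab: "0 < a" "a \<le> b" and G[measurable]: "G \<in> borel_measurable borel"
  shows "(\<integral>\<^sup>+ x. G (\<Prod>i\<in>{1..Suc k}. \<theta> * x i) * indicator {x. slab \<theta> a b (Suc k) x} x \<partial>borel_Rd (Suc k))
    = ennreal (ln (b / a)) ^ k * (\<integral>\<^sup>+ r \<in> {0<..}. G r \<partial>lborel)"
  using G
proof (induction k arbitrary: G)
  case 0
  note [measurable] = 0
  have "(\<integral>\<^sup>+ x. G (\<Prod>i\<in>{1..Suc 0}. \<theta> * x i) * indicator {x. slab \<theta> a b (Suc 0) x} x \<partial>borel_Rd (Suc 0))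
    = (\<integral>\<^sup>+ x. G (\<theta> * x 1) * indicator {0<..} (\<theta> * x 1) \<partial>PiM {1::nat} (\<lambda>_. lborel))"
    unfolding One_nat_def[symmetric] atLeastAtMost_singleton by (intro nn_integral_cong) (auto simp: slab_def indicator_def)
  also have "\<dots> = (\<integral>\<^sup>+ y. G (\<theta> * y) * indicator {0<..} (\<theta> * y) \<partial>lborel)"
    by (rule PS.product_nn_integral_singleton) measurable
  also have "\<dots> = (\<integral>\<^sup>+ r \<in> {0<..}. G r \<partial>lborel)"
    using nn_integral_reflect[OF _ \<theta>, of "\<lambda>y. G y * indicator {0<..} y"] by simp
  finally show ?case by simp
next
  case (Suc k)
  note [measurable] = Suc.prems slab_measurable prod_component_measurable
  let ?n = "Suc (Suc k)"
  let ?f = "\<lambda>x. G (\<Prod>i\<in>{1..?n}. \<theta> * x i) * indicator {x. slab \<theta> a b ?n x} x"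
  have ins: "{1..?n} = insert ?n {1..Suc k}" by auto
  have f: "?f \<in> borel_measurable (borel_Rd ?n)" by measurable
  have "(\<integral>\<^sup>+ x. ?f x \<partial>borel_Rd ?n) = (\<integral>\<^sup>+ y. (\<integral>\<^sup>+ x. ?f (x(?n := y)) \<partial>borel_Rd (Suc k)) \<partial>lborel)"
    unfolding ins
  proof (rule PS.product_nn_integral_insert_rev)
    show "finite {1..Suc k}" "?n \<notin> {1..Suc k}" by simp_all
  qed (use f in \<open>simp only: ins\<close>)
  also have "\<dots> = (\<integral>\<^sup>+ y. ennreal (ln (b / a)) ^ k * (\<integral>\<^sup>+ r \<in> {0<..}. G r \<partial>lborel) * (ennreal (1 / (\<theta> * y)) * indicator {a<..<b} (\<theta> * y)) \<partial>lborel)"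
  proof (rule nn_integral_cong)
    fix y :: real
    show "(\<integral>\<^sup>+ x. ?f (x(?n := y)) \<partial>borel_Rd (Suc k))
      = ennreal (ln (b / a)) ^ k * (\<integral>\<^sup>+ r \<in> {0<..}. G r \<partial>lborel) * (ennreal (1 / (\<theta> * y)) * indicator {a<..<b} (\<theta> * y))"
    proof (cases "\<theta> * y \<in> {a<..<b}")
      case True
      then have y: "\<theta> * y > 0" using ab by auto
      have p: "(\<Prod>i\<in>{1..?n}. \<theta> * (x(?n := y)) i) = (\<theta> * y) * (\<Prod>i\<in>{1..Suc k}. \<theta> * x i)" for x
        unfolding ins by (subst prod.insert) auto
      have s: "indicator {x. slab \<theta> a b ?n x} (x(?n := y)) = (indicator {x. slab \<theta> a b (Suc k) x} x :: ennreal)" for x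
        using True y by (auto simp: indicator_def slab_Suc)
      have "(\<integral>\<^sup>+ x. ?f (x(?n := y)) \<partial>borel_Rd (Suc k))
        = (\<integral>\<^sup>+ x. G ((\<theta> * y) * (\<Prod>i\<in>{1..Suc k}. \<theta> * x i)) * indicator {x. slab \<theta> a b (Suc k) x} x \<partial>borel_Rd (Suc k))"
        unfolding p s ..
      also have "\<dots> = ennreal (ln (b / a)) ^ k * (\<integral>\<^sup>+ r \<in> {0<..}. G ((\<theta> * y) * r) \<partial>lborel)"
        by (rule Suc.IH) measurable
      also have "(\<integral>\<^sup>+ r \<in> {0<..}. G ((\<theta> * y) * r) \<partial>lborel) = ennreal (1 / (\<theta> * y)) * (\<integral>\<^sup>+ r \<in> {0<..}. G r \<partial>lborel)"
        using y by (rule nn_integral_dilate[OF Suc.prems])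
      finally have q: "(\<integral>\<^sup>+ x. ?f (x(?n := y)) \<partial>borel_Rd (Suc k))
        = ennreal (ln (b / a)) ^ k * (ennreal (1 / (\<theta> * y)) * (\<integral>\<^sup>+ r \<in> {0<..}. G r \<partial>lborel))" .
      show ?thesis unfolding q indicator_simps(1)[OF True] by (simp only: mult_1_left mult_1_right mult_ac)
    next
      case False
      then have "(\<lambda>x. ?f (x(?n := y))) = (\<lambda>x. 0)" by (auto simp: slab_Suc fun_eq_iff)
      then have "(\<integral>\<^sup>+ x. ?f (x(?n := y)) \<partial>borel_Rd (Suc k)) = 0" by (simp only: nn_integral_const mult_zero_left)
      moreover have "indicator {a<..<b} (\<theta> * y) = (0 :: ennreal)" using False by (rule indicator_simps(2))
      ultimately show ?thesis by (simp only: mult_zero_right)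
    qed
  qed
  also have "\<dots> = ennreal (ln (b / a)) ^ k * (\<integral>\<^sup>+ r \<in> {0<..}. G r \<partial>lborel)
      * (\<integral>\<^sup>+ y. ennreal (1 / (\<theta> * y)) * indicator {a<..<b} (\<theta> * y) \<partial>lborel)"
    by (rule nn_integral_cmult) measurable
  also have "(\<integral>\<^sup>+ y. ennreal (1 / (\<theta> * y)) * indicator {a<..<b} (\<theta> * y) \<partial>lborel) = ennreal (ln (b / a))"
    using nn_integral_reflect[OF _ \<theta>, of "\<lambda>y. ennreal (1 / y) * indicator {a<..<b} y"] nn_integral_inverse_Ioo[OF ab] by simp
  finally show ?case by (simp add: mult_ac)
qed

text \<open>The part of the region \<open>slab 1 1 (exp L) d\<close> on which the product of the coordinates is below
  \<open>u\<close> has measure \<open>L ^ (d - 1) * u\<close>; with this factor \<open>extremal\<close> is equidistributed with \<open>g\<close>.\<close>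

definition extremal :: "nat \<Rightarrow> real \<Rightarrow> (real \<Rightarrow> ennreal) \<Rightarrow> (nat \<Rightarrow> real) \<Rightarrow> real" where
  "extremal d L g x = enn2real (g (L ^ (d - 1) * (\<Prod>i\<in>{1..d}. x i))) * indicator {x. slab 1 1 (exp L) d x} x"

lemma extremal_measurable:
  assumes [measurable]: "g \<in> borel_measurable borel"
  shows "extremal d L g \<in> borel_measurable (borel_Rd d)"
proof -
  note [measurable] = slab_measurable prod_component_measurable[of d 1, simplified]
  show ?thesis unfolding extremal_def[abs_def] by measurable
qed

lemma extremal_distribution:
  assumes d: "d \<ge> 1" and L: "L > 0" and g[measurable]: "g \<in> borel_measurable borel" and s: "s \<ge> 0"
  shows "emeasure (borel_Rd d) {x \<in> space (borel_Rd d). s < \<bar>extremal d L g x\<bar>}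
    = emeasure lborel {u. 0 < u \<and> s < enn2real (g u)}"
proof -
  define c where "c = L ^ (d - 1)"
  have c: "c > 0" using L by (simp add: c_def)
  let ?G = "\<lambda>u. indicator {u. s < enn2real (g u)} u :: ennreal"
  have [measurable]: "?G \<in> borel_measurable borel" by measurable
  obtain k where k: "d = Suc k" using d by (cases d) auto
  have "{x \<in> space (borel_Rd d). s < \<bar>extremal d L g x\<bar>} \<in> sets (borel_Rd d)"
    using extremal_measurable[OF g] by measurable
  then have "emeasure (borel_Rd d) {x \<in> space (borel_Rd d). s < \<bar>extremal d L g x\<bar>}
    = (\<integral>\<^sup>+ x. indicator {x \<in> space (borel_Rd d). s < \<bar>extremal d L g x\<bar>} x \<partial>borel_Rd d)"
    by (rule nn_integral_indicator[symmetric])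
  also have "\<dots> = (\<integral>\<^sup>+ x. ?G (c * (\<Prod>i\<in>{1..d}. 1 * x i)) * indicator {x. slab 1 1 (exp L) d x} x \<partial>borel_Rd d)"
    by (rule nn_integral_cong) (use s in \<open>auto simp: extremal_def c_def indicator_def\<close>)
  also have "\<dots> = ennreal (ln (exp L / 1)) ^ (d - 1) * (\<integral>\<^sup>+ r \<in> {0<..}. ?G (c * r) \<partial>lborel)"
    unfolding k diff_Suc_1 by (rule nn_integral_slab) (use L in auto)
  also have "(\<integral>\<^sup>+ r \<in> {0<..}. ?G (c * r) \<partial>lborel) = ennreal (1 / c) * (\<integral>\<^sup>+ r \<in> {0<..}. ?G r \<partial>lborel)"
    by (rule nn_integral_dilate) (use c in auto)
  also have "ennreal (ln (exp L / 1)) ^ (d - 1) = ennreal c" using L by (simp add: c_def ennreal_power)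
  also have "ennreal c * (ennreal (1 / c) * (\<integral>\<^sup>+ r \<in> {0<..}. ?G r \<partial>lborel)) = (\<integral>\<^sup>+ r \<in> {0<..}. ?G r \<partial>lborel)"
    using c by (simp add: mult.assoc[symmetric] flip: ennreal_mult)
  also have "\<dots> = (\<integral>\<^sup>+ r. indicator {u. 0 < u \<and> s < enn2real (g u)} r \<partial>lborel)"
    by (rule nn_integral_cong) (auto simp: indicator_def)
  also have "\<dots> = emeasure lborel {u. 0 < u \<and> s < enn2real (g u)}"
    by (rule nn_integral_indicator) measurable
  finally show ?thesis .
qed

text \<open>Cutting the rearrangement off at \<open>T\<close> replaces each value of the
  distribution function by its minimum with \<open>T\<close>. For \<open>t < T\<close> the minimum
  does not affect the infimum, and for \<open>t \<ge> T\<close> it forces the value 0.\<close>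

lemma extremal_rearrangement:
  assumes d: "d \<ge> 1" and L: "L > 0" and f: "f \<in> borel_measurable N"
    and fin: "\<And>t. t > 0 \<Longrightarrow> rearrangement N f t < \<infinity>" and T: "T \<ge> 0" and t: "t > 0"
  shows "rearrangement (lebesgue_Rd d) (extremal d L (\<lambda>u. rearrangement N f u * indicator {0<..<T} u)) t
    = rearrangement N f t * indicator {0<..<T} t"
proof -
  let ?g = "\<lambda>u. rearrangement N f u * indicator {0<..<T} u"
  have g: "?g \<in> borel_measurable borel" by measurable
  have D: "emeasure (borel_Rd d) {x \<in> space (borel_Rd d). s < \<bar>extremal d L ?g x\<bar>}
    = min (ennreal T) (emeasure N {x \<in> space N. s < \<bar>f x\<bar>})" if s: "s \<ge> 0" for s
  proof -
    let ?D = "emeasure N {x \<in> space N. s < \<bar>f x\<bar>}"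
    have "s < enn2real (?g u) \<longleftrightarrow> u < T \<and> ennreal u < ?D" if u: "u > 0" for u
    proof (cases "u < T")
      case True
      then have "?g u = rearrangement N f u" using u by simp
      moreover have "s < enn2real (rearrangement N f u) \<longleftrightarrow> ennreal s < rearrangement N f u"
        using fin[OF u] s by (cases "rearrangement N f u") (auto simp: ennreal_less_iff)
      ultimately show ?thesis using rearrangement_gt_iff[OF f s, of u] True by simp
    qed (use s in simp)
    then have "{u. 0 < u \<and> s < enn2real (?g u)} = {u. 0 < u \<and> u < T \<and> ennreal u < ?D}" by blast
    moreover have "emeasure lborel {u. 0 < u \<and> u < T \<and> ennreal u < ?D} = min (ennreal T) ?D"
    proof (cases "ennreal T \<le> ?D")
      case True
      have "ennreal u < ?D" if "0 < u" "u < T" for u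
        by (rule less_le_trans[OF _ True]) (use that in \<open>auto simp: ennreal_less_iff\<close>)
      then have "{u. 0 < u \<and> u < T \<and> ennreal u < ?D} = {0<..<T}" by auto
      then show ?thesis using True T by (simp add: min_absorb1)
    next
      case False
      then obtain r where r: "?D = ennreal r" "r \<ge> 0" by (cases ?D) auto
      then have "r < T" using False by (simp add: ennreal_le_iff2 not_le)
      then have "{u. 0 < u \<and> u < T \<and> ennreal u < ?D} = {0<..<r}"
        unfolding r using r(2) by (auto simp: ennreal_less_iff)
      then show ?thesis using False r by (simp add: min_absorb2)
    qed
    ultimately show ?thesis using extremal_distribution[OF d L g s] by simp
  qed
  have "rearrangement (lebesgue_Rd d) (extremal d L ?g) t = rearrangement (borel_Rd d) (extremal d L ?g) t"
    unfolding lebesgue_Rd_def by (rule rearrangement_completion_AE[OF extremal_measurable[OF g]]) simp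
  also have "\<dots> = ?g t"
  proof (cases "t < T")
    case True
    then have "\<not> ennreal T \<le> ennreal t" using t by (simp add: ennreal_le_iff2)
    then have "{ennreal s | s. s \<ge> 0 \<and> emeasure (borel_Rd d) {x \<in> space (borel_Rd d). \<bar>extremal d L ?g x\<bar> > s} \<le> ennreal t}
      = {ennreal s | s. s \<ge> 0 \<and> emeasure N {x \<in> space N. \<bar>f x\<bar> > s} \<le> ennreal t}"
      using D by (auto simp: min_le_iff_disj)
    then have "rearrangement (borel_Rd d) (extremal d L ?g) t = rearrangement N f t"
      unfolding rearrangement_def by (rule arg_cong)
    then show ?thesis using True t by simp
  next
    case False
    have "rearrangement (borel_Rd d) (extremal d L ?g) t \<le> ennreal 0"
    proof (rule rearrangement_le)
      show "emeasure (borel_Rd d) {x \<in> space (borel_Rd d). 0 < \<bar>extremal d L ?g x\<bar>} \<le> ennreal t"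
        unfolding D[OF order_refl] using False by (intro min.coboundedI1 ennreal_leI) simp
    qed simp
    then show ?thesis using False by simp
  qed
  finally show ?thesis .
qed

text \<open>Up to sign, the Hilbert transform in the \<open>j\<close>-th variable at points with
  \<open>x j < 0\<close> of a function that lives on positive \<open>j\<close>-th coordinates: the
  singularity is never met. With values in \<open>ennreal\<close> it can be iterated before
  finiteness is known.\<close>

definition cross_int :: "nat \<Rightarrow> ((nat \<Rightarrow> real) \<Rightarrow> ennreal) \<Rightarrow> (nat \<Rightarrow> real) \<Rightarrow> ennreal" where
  "cross_int j w x = ennreal (1 / pi) * (\<integral>\<^sup>+ s \<in> {0<..}. w (x(j := s)) * ennreal (1 / (s - x j)) \<partial>lborel)"

lemma hilbert_coord_off_support:
  assumes m: "(\<lambda>s. w (x(j := s))) \<in> borel_measurable borel"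
    and zero: "\<And>s. s \<le> 0 \<Longrightarrow> w (x(j := s)) = 0"
    and fin: "\<And>s. w (x(j := s)) < \<infinity>"
    and u: "\<And>s. u (x(j := s)) = \<sigma> * enn2real (w (x(j := s)))"
    and xj: "x j < 0"
  shows "hilbert_coord j u x = - \<sigma> * enn2real (cross_int j w x)"
proof -
  note [measurable] = m
  let ?f = "\<lambda>s. enn2real (w (x(j := s))) * (indicator {0<..} s / (s - x j))"
  have um: "(\<lambda>s. u (x(j := s))) \<in> borel_measurable borel" unfolding u by measurable
  have f0: "?f s \<ge> 0" for s using xj by (auto simp: indicator_def)
  have I: "(LBINT s. ?f s) = enn2real (\<integral>\<^sup>+ s \<in> {0<..}. w (x(j := s)) * ennreal (1 / (s - x j)) \<partial>lborel)"
  proof -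
    have "(LBINT s. ?f s) = enn2real (\<integral>\<^sup>+ s. ennreal (?f s) \<partial>lborel)"
      by (rule integral_eq_nn_integral) (use f0 in auto)
    also have "(\<integral>\<^sup>+ s. ennreal (?f s) \<partial>lborel) = (\<integral>\<^sup>+ s \<in> {0<..}. w (x(j := s)) * ennreal (1 / (s - x j)) \<partial>lborel)"
    proof (rule nn_integral_cong)
      fix s
      show "ennreal (?f s) = w (x(j := s)) * ennreal (1 / (s - x j)) * indicator {0<..} s"
      proof (cases "s > 0")
        case True
        have "ennreal (?f s) = ennreal (enn2real (w (x(j := s)))) * ennreal (1 / (s - x j))"
          using True xj by (subst ennreal_mult[symmetric]) auto
        then show ?thesis using True fin[of s] by simp
      qed simp
    qed
    finally show ?thesis .
  qed
  have "eventually (\<lambda>e. e \<in> {0<..<- x j}) (at_right 0)"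
    using xj by (intro eventually_at_right_real) simp
  then have "eventually (\<lambda>e. 1 / pi * coord_trunc j e u x = - \<sigma> * enn2real (cross_int j w x)) (at_right 0)"
  proof eventually_elim
    case e: (elim e)
    have "coord_trunc j e u x = (LBINT s. - \<sigma> * ?f s)"
      unfolding coord_trunc_def trunc_hilbert_def u
    proof (intro Bochner_Integration.integral_cong refl)
      fix s
      show "\<sigma> * enn2real (w (x(j := s))) * trunc_kernel e (x j - s) = - \<sigma> * ?f s"
      proof (cases "s > 0")
        case True
        have "trunc_kernel e (x j - s) = 1 / (x j - s)" using True e by (simp add: trunc_kernel_def)
        also have "\<dots> = - (1 / (s - x j))" by (metis minus_diff_eq minus_divide_right)
        finally show ?thesis using True by simp
      qed (simp add: zero)
    qed
    also have "\<dots> = - \<sigma> * (LBINT s. ?f s)" by (rule integral_mult_right_zero)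
    finally show ?case
      unfolding I cross_int_def by (simp add: enn2real_mult)
  qed
  then have "((\<lambda>e. 1 / pi * coord_trunc j e u x) \<longlongrightarrow> - \<sigma> * enn2real (cross_int j w x)) (at_right 0)"
    by (rule tendsto_eventually)
  then show ?thesis unfolding hilbert_coord_eq[OF um] by (intro tendsto_Lim) auto
qed

lemma cross_int_measurable:
  assumes j: "j \<in> {1..d}" and w: "w \<in> borel_measurable (borel_Rd d)"
  shows "cross_int j w \<in> borel_measurable (borel_Rd d)"
proof -
  have [measurable]: "(\<lambda>p. (fst p)(j := snd p)) \<in> measurable (borel_Rd d \<Otimes>\<^sub>M lborel) (borel_Rd d)"
    by (rule fun_upd_measurable[OF j]) measurable
  have [measurable]: "(\<lambda>x. x j) \<in> borel_measurable (borel_Rd d)" using j by (rule component_measurable_Rd)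
  note [measurable] = w
  have "(\<lambda>x. \<integral>\<^sup>+ s. w ((fst (x, s))(j := snd (x, s))) * ennreal (1 / (snd (x, s) - fst (x, s) j)) * indicator {0<..} (snd (x, s)) \<partial>lborel)
    \<in> borel_measurable (borel_Rd d)"
    by (rule lborel.borel_measurable_nn_integral_fst) measurable
  then show ?thesis unfolding cross_int_def[abs_def] fst_conv snd_conv by measurable
qed

section \<open>The iterated transform of the extremal function\<close>

locale extremal_problem =
  fixes d :: nat and L :: real and g :: "real \<Rightarrow> ennreal"
  assumes d: "d \<ge> 1" and L: "L > 0" and g: "g \<in> borel_measurable borel"
    and g_antimono: "0 < t \<Longrightarrow> t \<le> t' \<Longrightarrow> g t' \<le> g t"
    and g_finite: "0 < t \<Longrightarrow> g t < \<infinity>"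
begin

abbreviation "cst \<equiv> L ^ (d - 1)"

text \<open>At index \<open>k\<close> the coordinates from \<open>k\<close> to \<open>d\<close> have
  been transformed: \<open>d + 1\<close> is the function itself and \<open>1\<close> the full
  iterate.\<close>

definition cross_iter :: "nat \<Rightarrow> (nat \<Rightarrow> real) \<Rightarrow> ennreal" where
  "cross_iter k = foldr cross_int [k..<d + 1] (\<lambda>x. ennreal (extremal d L g x))"

lemma cross_iter_last: "cross_iter (Suc d) = (\<lambda>x. ennreal (extremal d L g x))"
  by (simp add: cross_iter_def)

lemma cross_iter_step: "k \<le> d \<Longrightarrow> cross_iter k = cross_int k (cross_iter (Suc k))"
  unfolding cross_iter_def by (subst upt_conv_Cons) simp_all

lemma cst_pos: "cst > 0" using L by simp

lemma cross_iter_measurable: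
  assumes "1 \<le> k" "k \<le> Suc d"
  shows "cross_iter k \<in> borel_measurable (borel_Rd d)"
  using assms(2)
proof (induction k rule: inc_induct)
  case base
  then show ?case using extremal_measurable[OF g, of d L] by (simp add: cross_iter_last)
next
  case (step n)
  have "n \<in> {1..d}" "n \<le> d" using step assms(1) by auto
  then show ?case unfolding cross_iter_step[OF \<open>n \<le> d\<close>] by (intro cross_int_measurable step.IH)
qed

lemma slab_upd: "slab \<theta> a b k (x(k := y)) \<longleftrightarrow>
    slab \<theta> a b (k - 1) x \<and> 0 < \<theta> * y \<and> (2 \<le> k \<longrightarrow> a < \<theta> * y \<and> \<theta> * y < b)" if "k \<ge> 1"
  using that slab_Suc[of \<theta> a b "k - 1" x y] by auto

lemma cross_iter_zero:
  assumes "1 \<le> k" "k \<le> Suc d" and "\<not> slab 1 1 (exp L) (k - 1) x"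
  shows "cross_iter k x = 0"
  using assms(2,3)
proof (induction k arbitrary: x rule: inc_induct)
  case base
  then show ?case by (simp add: cross_iter_last extremal_def)
next
  case (step n)
  have "cross_iter (Suc n) (x(n := s)) = 0" for s
  proof (rule step.IH)
    show "\<not> slab 1 1 (exp L) (Suc n - 1) (x(n := s))"
      using step assms(1) slab_upd[of n 1 1 "exp L" x s] by simp
  qed
  then show ?case using step by (subst cross_iter_step) (auto simp: cross_int_def)
qed

text \<open>A crude bound, used only for finiteness. On the support the coordinates from the second
  on exceed 1, so monotonicity bounds \<open>g\<close> by its value at \<open>cst * x 1\<close>, and
  each of their integrals is at most that of \<open>1 / s\<close> from 1 to
  \<open>exp L\<close>.\<close>

lemma cross_iter_upper:
  assumes "2 \<le> k" "k \<le> Suc d" and "x 1 > 0" "\<And>i. i \<in> {k..d} \<Longrightarrow> x i < 0"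
  shows "cross_iter k x \<le> g (cst * x 1) * ennreal (L / pi) ^ (d + 1 - k)"
  using assms(2-)
proof (induction k arbitrary: x rule: inc_induct)
  case base
  show ?case
  proof (cases "slab 1 1 (exp L) d x")
    case True
    have ins: "{1..d} = insert 1 {2..d}" using d by auto
    have "(\<Prod>i\<in>{1..d}. x i) = x 1 * (\<Prod>i\<in>{2..d}. x i)" unfolding ins by (subst prod.insert) auto
    moreover have "(\<Prod>i\<in>{2..d}. x i) \<ge> 1" using True by (intro prod_ge_1) (auto simp: slab_def less_imp_le)
    then have "x 1 * 1 \<le> x 1 * (\<Prod>i\<in>{2..d}. x i)" using base by (intro mult_left_mono) auto
    ultimately have le: "cst * x 1 \<le> cst * (\<Prod>i\<in>{1..d}. x i)" using cst_pos by (intro mult_left_mono) auto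
    have p: "cst * x 1 > 0" using cst_pos base by simp
    have "g (cst * (\<Prod>i\<in>{1..d}. x i)) \<le> g (cst * x 1)" using p le by (rule g_antimono)
    moreover have "g (cst * (\<Prod>i\<in>{1..d}. x i)) < \<infinity>" using less_le_trans[OF p le] by (rule g_finite)
    ultimately have "g (cst * (\<Prod>i\<in>{1..d}. x i)) \<le> g (cst * x 1)" "g (cst * (\<Prod>i\<in>{1..d}. x i)) < \<infinity>" .
    then show ?thesis using True by (simp add: cross_iter_last extremal_def)
  next
    case False
    then show ?thesis by (simp add: cross_iter_last extremal_def)
  qed
next
  case (step n)
  have n: "2 \<le> n" "n \<le> d" using step assms(1) by auto
  let ?K = "g (cst * x 1) * ennreal (L / pi) ^ (d - n)"
  have xn: "x n < 0" using step n by auto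
  have "(\<integral>\<^sup>+ s \<in> {0<..}. cross_iter (Suc n) (x(n := s)) * ennreal (1 / (s - x n)) \<partial>lborel)
    \<le> (\<integral>\<^sup>+ s. ?K * (ennreal (1 / s) * indicator {1<..<exp L} s) \<partial>lborel)"
  proof (rule nn_integral_mono)
    fix s
    show "cross_iter (Suc n) (x(n := s)) * ennreal (1 / (s - x n)) * indicator {0<..} s \<le> ?K * (ennreal (1 / s) * indicator {1<..<exp L} s)"
    proof (cases "1 < s \<and> s < exp L")
      case True
      have "cross_iter (Suc n) (x(n := s)) \<le> g (cst * (x(n := s)) 1) * ennreal (L / pi) ^ (d + 1 - Suc n)"
        by (rule step.IH) (use step.prems n in auto)
      moreover have "(x(n := s)) 1 = x 1" using n by simp
      ultimately have a: "cross_iter (Suc n) (x(n := s)) \<le> ?K" by simp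
      have b: "ennreal (1 / (s - x n)) \<le> ennreal (1 / s)" using True xn by (intro ennreal_leI divide_left_mono) auto
      have i: "s \<in> {1<..<exp L}" "s \<in> {0<..}" using True by auto
      show ?thesis using mult_mono[OF a b] by (simp only: indicator_simps(1)[OF i(1)] indicator_simps(1)[OF i(2)] mult_1_right) simp
    next
      case False
      then have "\<not> slab 1 1 (exp L) n (x(n := s))" using n slab_upd[of n 1 1 "exp L" x s] by auto
      then have "cross_iter (Suc n) (x(n := s)) = 0" using n by (intro cross_iter_zero) auto
      then show ?thesis by simp
    qed
  qed
  moreover have "(\<integral>\<^sup>+ s. ?K * (ennreal (1 / s) * indicator {1<..<exp L} s) \<partial>lborel) = ?K * ennreal L"
  proof -
    have "(\<integral>\<^sup>+ s. ?K * (ennreal (1 / s) * indicator {1<..<exp L} s) \<partial>lborel)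
      = ?K * (\<integral>\<^sup>+ s \<in> {1<..<exp L}. ennreal (1 / s) \<partial>lborel)"
      by (rule nn_integral_cmult) measurable
    then show ?thesis using nn_integral_inverse_Ioo[of 1 "exp L"] L by simp
  qed
  ultimately have "cross_int n (cross_iter (Suc n)) x \<le> ennreal (1 / pi) * (?K * ennreal L)"
    unfolding cross_int_def by (intro mult_left_mono) auto
  also have "\<dots> = ?K * (ennreal (1 / pi) * ennreal L)" by (simp only: mult_ac)
  also have "ennreal (1 / pi) * ennreal L = ennreal (L / pi)" using L by (simp flip: ennreal_mult)
  also have "?K * ennreal (L / pi) = g (cst * x 1) * ennreal (L / pi) ^ (d + 1 - n)"
    using n by (simp add: Suc_diff_le mult_ac)
  finally show ?case using n by (simp only: cross_iter_step)
qed

lemma cross_iter_finite: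
  assumes "2 \<le> k" "k \<le> Suc d" and "\<And>i. i \<in> {k..d} \<Longrightarrow> x i < 0"
  shows "cross_iter k x < \<infinity>"
proof (cases "slab 1 1 (exp L) (k - 1) x")
  case True
  then have x1: "x 1 > 0" using assms(1) by (auto simp: slab_def)
  have "g (cst * x 1) * ennreal (L / pi) ^ (d + 1 - k) < \<infinity>"
    using g_finite[of "cst * x 1"] x1 cst_pos L by (simp add: ennreal_mult_less_top ennreal_power)
  moreover have "cross_iter k x \<le> g (cst * x 1) * ennreal (L / pi) ^ (d + 1 - k)"
    by (rule cross_iter_upper) (use assms x1 in auto)
  ultimately show ?thesis by (rule le_less_trans[rotated])
next
  case False
  then show ?thesis using cross_iter_zero[of k x] assms by simp
qed

text \<open>Each transform at a negative coordinate reverses the sign. Passing between real and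
  extended values requires a finite integrand at every stage, which \<open>cross_iter_finite\<close>
  supplies for all indices from 2 on.\<close>

lemma hilbert_foldr_extremal:
  assumes "1 \<le> k" "k \<le> Suc d" and "x \<in> space (borel_Rd d)" "\<And>i. i \<in> {k..d} \<Longrightarrow> x i < 0"
  shows "foldr hilbert_coord [k..<d + 1] (extremal d L g) x = (- 1) ^ (d + 1 - k) * enn2real (cross_iter k x)"
  using assms(2-)
proof (induction k arbitrary: x rule: inc_induct)
  case base
  show ?case by (simp add: cross_iter_last extremal_def)
next
  case (step n)
  have n: "1 \<le> n" "n \<le> d" using step assms(1) by auto
  have "foldr hilbert_coord [n..<d + 1] (extremal d L g) x = hilbert_coord n (foldr hilbert_coord [Suc n..<d + 1] (extremal d L g)) x"
    using n by (subst upt_conv_Cons) simp_all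
  also have "\<dots> = - ((- 1) ^ (d - n)) * enn2real (cross_int n (cross_iter (Suc n)) x)"
  proof (rule hilbert_coord_off_support)
    show "(\<lambda>s. cross_iter (Suc n) (x(n := s))) \<in> borel_measurable borel"
    proof -
      have u: "(\<lambda>s. x(n := s)) \<in> measurable borel (borel_Rd d)"
      proof (rule fun_upd_measurable)
        show "n \<in> {1..d}" using n by simp
        show "(\<lambda>s. x) \<in> measurable borel (borel_Rd d)" using step.prems(1) by (rule measurable_const)
      qed simp
      show ?thesis using measurable_compose[OF u cross_iter_measurable[of "Suc n"]] n by simp
    qed
    show "cross_iter (Suc n) (x(n := s)) = 0" if "s \<le> 0" for s
      using that n slab_upd[of n 1 1 "exp L" x s] by (intro cross_iter_zero) auto
    show "cross_iter (Suc n) (x(n := s)) < \<infinity>" for s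
      using n step.prems by (intro cross_iter_finite) auto
    show "foldr hilbert_coord [Suc n..<d + 1] (extremal d L g) (x(n := s)) = (- 1) ^ (d - n) * enn2real (cross_iter (Suc n) (x(n := s)))" for s
    proof -
      have "x(n := s) \<in> space (borel_Rd d)" using step.prems(1) n by (auto simp: space_PiM PiE_def extensional_def)
      then have "foldr hilbert_coord [Suc n..<d + 1] (extremal d L g) (x(n := s)) = (- 1) ^ (d + 1 - Suc n) * enn2real (cross_iter (Suc n) (x(n := s)))"
        by (rule step.IH) (use step.prems in auto)
      then show ?thesis by simp
    qed
    show "x n < 0" using step.prems n by auto
  qed
  also have "\<dots> = (- 1) ^ (d + 1 - n) * enn2real (cross_iter n x)" using n by (simp add: cross_iter_step Suc_diff_le)
  finally show ?case .
qed

end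

section \<open>Lower bounds for the iterated transform\<close>

context extremal_problem
begin

text \<open>With \<open>y = - x n\<close> the substitution \<open>s = y * r\<close> turns
  \<open>ds / (s + y)\<close> into \<open>dr / (1 + r)\<close>, which is at least half of
  \<open>min 1 (1 / r) dr\<close>, and multiplies the product of the coordinates by
  \<open>r\<close>. For \<open>exp (- A) < r < exp A\<close> the margins
  \<open>exp A < y < exp (L - A)\<close> keep \<open>s\<close> between 1 and \<open>exp L\<close>,
  so the whole truncated operator is seen.\<close>

lemma cross_iter_lower:
  assumes A: "A > 0" and k: "1 \<le> k" "k \<le> Suc d" and x: "x \<in> space (borel_Rd d)"
    and pos: "slab 1 1 (exp L) (k - 1) x"
    and neg: "\<And>i. i \<in> {k..d} \<Longrightarrow> x i < 0 \<and> (2 \<le> i \<longrightarrow> exp A < - x i \<and> - x i < exp (L - A))"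
  shows "ennreal (1 / (2 * pi)) ^ (d + 1 - k) * (trunc_calderon A ^^ (d + 1 - k)) (\<lambda>u. g (cst * u)) (\<Prod>i\<in>{1..d}. \<bar>x i\<bar>)
    \<le> cross_iter k x"
  using k(2) x pos neg
proof (induction k arbitrary: x rule: inc_induct)
  case base
  then have sl: "slab 1 1 (exp L) d x" by simp
  then have xp: "x i > 0" if "i \<in> {1..d}" for i using that by (auto simp: slab_def)
  then have "\<bar>x i\<bar> = x i" if "i \<in> {1..d}" for i using xp[OF that] by simp
  with xp have p: "(\<Prod>i\<in>{1..d}. \<bar>x i\<bar>) = (\<Prod>i\<in>{1..d}. x i)" "(\<Prod>i\<in>{1..d}. x i) > 0"
    by (auto intro!: prod.cong prod_pos)
  have "g (cst * (\<Prod>i\<in>{1..d}. x i)) < \<infinity>" using p cst_pos by (intro g_finite mult_pos_pos)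
  then show ?case using sl p by (simp add: cross_iter_last extremal_def)
next
  case (step n)
  have n: "1 \<le> n" "n \<le> d" using step k(1) by auto
  let ?m = "d - n"
  let ?T = "(trunc_calderon A ^^ ?m) (\<lambda>u. g (cst * u))"
  let ?P = "\<Prod>i\<in>{1..d}. \<bar>x i\<bar>"
  define y where "y = - x n"
  have xn: "x n < 0 \<and> (2 \<le> n \<longrightarrow> exp A < - x n \<and> - x n < exp (L - A))" by (rule step.prems) (use n in auto)
  then have y: "y > 0" "2 \<le> n \<Longrightarrow> exp A < y \<and> y < exp (L - A)" by (auto simp: y_def)
  let ?h = "\<lambda>s. cross_iter (Suc n) (x(n := s)) * ennreal (1 / (s - x n)) * indicator {0<..} s"
  have u: "(\<lambda>s. x(n := s)) \<in> measurable borel (borel_Rd d)"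
  proof (rule fun_upd_measurable)
    show "n \<in> {1..d}" using n by simp
    show "(\<lambda>s. x) \<in> measurable borel (borel_Rd d)" using step.prems(1) by (rule measurable_const)
  qed simp
  have [measurable]: "(\<lambda>s. cross_iter (Suc n) (x(n := s))) \<in> borel_measurable borel"
    using measurable_compose[OF u cross_iter_measurable[of "Suc n"]] n by simp
  have h: "?h \<in> borel_measurable borel" by measurable
  have [measurable]: "g \<in> borel_measurable borel" by (rule g)
  have bound: "ennreal (1 / 2) * ennreal (1 / (2 * pi)) ^ ?m * (?T (?P * r) * ennreal (min 1 (1 / r)) * indicator {exp (- A)<..<exp A} r)
    \<le> ennreal \<bar>y\<bar> * ?h (0 + y * r)" for r
  proof (cases "r \<in> {exp (- A)<..<exp A}")
    case True
    have r: "r > 0" using True exp_gt_zero[of "- A"] by (auto simp del: exp_gt_zero)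
    have yr: "y * r > 0" using y r by simp
    have ins: "{1..d} = insert n ({1..d} - {n})" using n by auto
    have "(\<Prod>i\<in>{1..d}. \<bar>(x(n := y * r)) i\<bar>) = \<bar>y * r\<bar> * (\<Prod>i\<in>{1..d} - {n}. \<bar>x i\<bar>)"
      by (subst ins, subst prod.insert) (auto intro!: prod.cong)
    also have "\<dots> = ?P * r"
      by (subst (2) ins, subst prod.insert) (use y r in \<open>auto simp: y_def abs_mult\<close>)
    finally have P: "(\<Prod>i\<in>{1..d}. \<bar>(x(n := y * r)) i\<bar>) = ?P * r" .
    have "ennreal (1 / (2 * pi)) ^ (d + 1 - Suc n) * (trunc_calderon A ^^ (d + 1 - Suc n)) (\<lambda>u. g (cst * u)) (\<Prod>i\<in>{1..d}. \<bar>(x(n := y * r)) i\<bar>)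
      \<le> cross_iter (Suc n) (x(n := y * r))"
    proof (rule step.IH)
      show "x(n := y * r) \<in> space (borel_Rd d)" using step.prems(1) n by (auto simp: space_PiM PiE_def extensional_def)
      have "1 < 1 * (y * r) \<and> 1 * (y * r) < exp L" if "2 \<le> n"
      proof -
        have "exp A * exp (- A) < y * r" using True y(2)[OF that] r by (intro mult_strict_mono) auto
        moreover have "y * r < exp (L - A) * exp A" using True y(2)[OF that] y r by (intro mult_strict_mono) auto
        ultimately show ?thesis by (simp flip: exp_add)
      qed
      then show "slab 1 1 (exp L) (Suc n - 1) (x(n := y * r))"
        using slab_upd[OF n(1), of 1 1 "exp L" x "y * r"] step.prems(2) yr by simp
      show "(x(n := y * r)) i < 0 \<and> (2 \<le> i \<longrightarrow> exp A < - (x(n := y * r)) i \<and> - (x(n := y * r)) i < exp (L - A))" if "i \<in> {Suc n..d}" for i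
        using step.prems(3)[of i] that by auto
    qed
    then have w: "ennreal (1 / (2 * pi)) ^ ?m * ?T (?P * r) \<le> cross_iter (Suc n) (x(n := y * r))" unfolding P by simp
    have "(1 / 2) * min 1 (1 / r) \<le> 1 / (1 + r)" using r by (auto simp: min_def field_simps)
    also have "1 / (1 + r) = y * (1 / (y * r - x n))"
    proof -
      have "y * r - x n = y * (1 + r)" by (simp add: y_def algebra_simps)
      then show ?thesis using y r by simp
    qed
    finally have "ennreal ((1 / 2) * min 1 (1 / r)) \<le> ennreal (y * (1 / (y * r - x n)))" by (rule ennreal_leI)
    moreover have "ennreal ((1 / 2) * min 1 (1 / r)) = ennreal (1 / 2) * ennreal (min 1 (1 / r))" using r by (intro ennreal_mult) auto
    moreover have "ennreal (y * (1 / (y * r - x n))) = ennreal y * ennreal (1 / (y * r - x n))" using y yr xn by (intro ennreal_mult) auto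
    ultimately have e: "ennreal (1 / 2) * ennreal (min 1 (1 / r)) \<le> ennreal y * ennreal (1 / (y * r - x n))" by simp
    have i: "indicator {0<..} (0 + y * r) = (1 :: ennreal)" using yr by simp
    have "ennreal (1 / 2) * ennreal (1 / (2 * pi)) ^ ?m * (?T (?P * r) * ennreal (min 1 (1 / r)) * indicator {exp (- A)<..<exp A} r)
      = (ennreal (1 / (2 * pi)) ^ ?m * ?T (?P * r)) * (ennreal (1 / 2) * ennreal (min 1 (1 / r)))"
      unfolding indicator_simps(1)[OF True] by (simp only: mult_1_right mult_1_left mult_ac)
    also have "\<dots> \<le> cross_iter (Suc n) (x(n := y * r)) * (ennreal y * ennreal (1 / (y * r - x n)))"
      using w e by (rule mult_mono) auto
    also have "\<dots> = ennreal \<bar>y\<bar> * ?h (0 + y * r)"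
      unfolding i using y by (simp only: mult_1_right mult_1_left mult_ac add_0_left abs_of_pos)
    finally show ?thesis .
  qed simp
  have "ennreal (1 / 2) * ennreal (1 / (2 * pi)) ^ ?m * trunc_calderon A ?T ?P
    = (\<integral>\<^sup>+ r. ennreal (1 / 2) * ennreal (1 / (2 * pi)) ^ ?m * (?T (?P * r) * ennreal (min 1 (1 / r)) * indicator {exp (- A)<..<exp A} r) \<partial>lborel)"
    unfolding trunc_calderon_def[of A ?T] by (rule nn_integral_cmult[symmetric]) measurable
  moreover have "\<dots> \<le> (\<integral>\<^sup>+ r. ennreal \<bar>y\<bar> * ?h (0 + y * r) \<partial>lborel)"
    using bound by (intro nn_integral_mono)
  moreover have "(\<integral>\<^sup>+ r. ennreal \<bar>y\<bar> * ?h (0 + y * r) \<partial>lborel) = ennreal \<bar>y\<bar> * (\<integral>\<^sup>+ r. ?h (0 + y * r) \<partial>lborel)"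
    by (rule nn_integral_cmult) measurable
  moreover have "ennreal \<bar>y\<bar> * (\<integral>\<^sup>+ r. ?h (0 + y * r) \<partial>lborel) = (\<integral>\<^sup>+ s. ?h s \<partial>lborel)"
    using y by (intro nn_integral_real_affine[symmetric] h) simp
  ultimately have fin: "ennreal (1 / 2) * ennreal (1 / (2 * pi)) ^ ?m * trunc_calderon A ?T ?P \<le> (\<integral>\<^sup>+ s. ?h s \<partial>lborel)" by simp
  have c: "ennreal (1 / (2 * pi)) = ennreal (1 / pi) * ennreal (1 / 2)"
    by (subst ennreal_mult[symmetric]) simp_all
  have "ennreal (1 / (2 * pi)) ^ (d + 1 - n) * (trunc_calderon A ^^ (d + 1 - n)) (\<lambda>u. g (cst * u)) ?P
    = ennreal (1 / (2 * pi)) * ennreal (1 / (2 * pi)) ^ ?m * trunc_calderon A ?T ?P"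
    using n by (simp add: Suc_diff_le)
  also have "\<dots> = ennreal (1 / pi) * (ennreal (1 / 2) * ennreal (1 / (2 * pi)) ^ ?m * trunc_calderon A ?T ?P)"
    by (subst c) (simp only: mult_ac)
  also have "\<dots> \<le> cross_int n (cross_iter (Suc n)) x" unfolding cross_int_def using fin by (intro mult_left_mono) auto
  also have "\<dots> = cross_iter n x" using n by (simp add: cross_iter_step)
  finally show ?case .
qed

text \<open>The last integration runs over all positive \<open>x 1\<close>, with kernel at most
  \<open>1 / \<bar>x 1\<bar>\<close>, so here the integrability of \<open>g\<close> enters. The
  cutoff of the rearrangement at \<open>N^d\<close> provides it.\<close>

lemma cross_iter_one_finite:
  assumes int: "(\<integral>\<^sup>+ s \<in> {0<..}. g s \<partial>lborel) < \<infinity>" and neg: "\<And>i. i \<in> {1..d} \<Longrightarrow> x i < 0"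
  shows "cross_iter 1 x < \<infinity>"
proof -
  have [measurable]: "g \<in> borel_measurable borel" by (rule g)
  let ?K = "ennreal (1 / - x 1) * ennreal (L / pi) ^ (d - 1)"
  have x1: "x 1 < 0" using neg d by simp
  have "(\<integral>\<^sup>+ s \<in> {0<..}. cross_iter (Suc 1) (x(1 := s)) * ennreal (1 / (s - x 1)) \<partial>lborel)
    \<le> (\<integral>\<^sup>+ s. ?K * (g (cst * s) * indicator {0<..} s) \<partial>lborel)"
  proof (rule nn_integral_mono)
    fix s
    show "cross_iter (Suc 1) (x(1 := s)) * ennreal (1 / (s - x 1)) * indicator {0<..} s \<le> ?K * (g (cst * s) * indicator {0<..} s)"
    proof (cases "s > 0")
      case True
      have "cross_iter (Suc 1) (x(1 := s)) \<le> g (cst * (x(1 := s)) 1) * ennreal (L / pi) ^ (d + 1 - Suc 1)"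
        by (rule cross_iter_upper) (use True neg d in auto)
      then have a: "cross_iter (Suc 1) (x(1 := s)) \<le> g (cst * s) * ennreal (L / pi) ^ (d - 1)" by simp
      have b: "ennreal (1 / (s - x 1)) \<le> ennreal (1 / - x 1)" using True x1 mult_pos_neg[of "s - x 1" "x 1"] by (intro ennreal_leI divide_left_mono) auto
      have i: "s \<in> {0<..}" using True by auto
      have "cross_iter (Suc 1) (x(1 := s)) * ennreal (1 / (s - x 1)) \<le> g (cst * s) * ennreal (L / pi) ^ (d - 1) * ennreal (1 / - x 1)"
        using a b by (rule mult_mono) auto
      then show ?thesis by (simp only: indicator_simps(1)[OF i] mult_1_right mult_1_left mult_ac)
    qed simp
  qed
  also have "(\<integral>\<^sup>+ s. ?K * (g (cst * s) * indicator {0<..} s) \<partial>lborel) = ?K * (\<integral>\<^sup>+ s \<in> {0<..}. g (cst * s) \<partial>lborel)"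
    by (rule nn_integral_cmult) measurable
  also have "(\<integral>\<^sup>+ s \<in> {0<..}. g (cst * s) \<partial>lborel) = ennreal (1 / cst) * (\<integral>\<^sup>+ s \<in> {0<..}. g s \<partial>lborel)"
    by (rule nn_integral_dilate[OF g cst_pos])
  also have "?K * (ennreal (1 / cst) * (\<integral>\<^sup>+ s \<in> {0<..}. g s \<partial>lborel)) < \<infinity>"
    using int L by (simp add: ennreal_mult_less_top ennreal_power)
  finally have fin: "(\<integral>\<^sup>+ s \<in> {0<..}. cross_iter (Suc 1) (x(1 := s)) * ennreal (1 / (s - x 1)) \<partial>lborel) < \<infinity>" .
  have "I < \<infinity> \<Longrightarrow> ennreal (1 / pi) * I < \<infinity>" for I by (simp add: ennreal_mult_less_top)
  then show ?thesis unfolding cross_iter_step[OF d] cross_int_def using fin .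
qed

text \<open>On the region of points with all margins respected and product below \<sigma>, the
  transform is at least the truncated Calderon power at \<open>cst * \<sigma>\<close>, by
  monotonicity. The region has measure \<open>\<sigma> * (L - 2 * A) ^ (d - 1)\<close>, which
  exceeds \<open>t\<close>.\<close>

lemma rearrangement_extremal_lower:
  assumes A: "A > 0" "2 * A < L" and int: "(\<integral>\<^sup>+ s \<in> {0<..}. g s \<partial>lborel) < \<infinity>"
    and m: "multiple_hilbert d (extremal d L g) \<in> borel_measurable (lebesgue_Rd d)"
    and \<sigma>: "\<sigma> > 0" and t: "t \<ge> 0" "t < \<sigma> * (L - 2 * A) ^ (d - 1)"
  shows "ennreal (1 / (2 * pi)) ^ d * (trunc_calderon A ^^ d) g (cst * \<sigma>)
    \<le> rearrangement (lebesgue_Rd d) (multiple_hilbert d (extremal d L g)) t"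
proof (rule dense_le)
  \<comment> \<open>Approaching the value from below leaves room for the strict inequality that
    defines the level set.\<close>
  fix q assume q: "q < ennreal (1 / (2 * pi)) ^ d * (trunc_calderon A ^^ d) g (cst * \<sigma>)"
  then obtain s where s: "q = ennreal s" "s \<ge> 0" by (cases q) auto
  let ?H = "multiple_hilbert d (extremal d L g)"
  let ?R = "{x \<in> space (borel_Rd d). slab (-1) (exp A) (exp (L - A)) d x \<and> (\<Prod>i\<in>{1..d}. - 1 * x i) < \<sigma>}"
  note [measurable] = slab_measurable prod_component_measurable
  have R: "?R \<in> sets (borel_Rd d)" by measurable
  obtain k where k: "d = Suc k" using d by (cases d) auto
  have "emeasure (borel_Rd d) ?R = (\<integral>\<^sup>+ x. indicator ?R x \<partial>borel_Rd d)" using R by (rule nn_integral_indicator[symmetric])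
  also have "\<dots> = (\<integral>\<^sup>+ x. indicator {..<\<sigma>} (\<Prod>i\<in>{1..d}. - 1 * x i) * indicator {x. slab (-1) (exp A) (exp (L - A)) d x} x \<partial>borel_Rd d)"
    by (rule nn_integral_cong) (auto simp: indicator_def)
  also have "\<dots> = ennreal (ln (exp (L - A) / exp A)) ^ (d - 1) * (\<integral>\<^sup>+ r \<in> {0<..}. indicator {..<\<sigma>} r \<partial>lborel)"
    unfolding k diff_Suc_1 by (rule nn_integral_slab) (use A in auto)
  also have "ennreal (ln (exp (L - A) / exp A)) = ennreal (L - 2 * A)" by (simp flip: exp_diff)
  also have "(\<integral>\<^sup>+ r \<in> {0<..}. indicator {..<\<sigma>} r \<partial>lborel) = (\<integral>\<^sup>+ r. indicator {0<..<\<sigma>} r \<partial>lborel)"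
    by (rule nn_integral_cong) (auto simp: indicator_def)
  also have "\<dots> = ennreal \<sigma>" using \<sigma> by simp
  also have "ennreal (L - 2 * A) ^ (d - 1) * ennreal \<sigma> = ennreal (\<sigma> * (L - 2 * A) ^ (d - 1))"
    using A \<sigma> by (simp add: ennreal_power mult.commute flip: ennreal_mult)
  finally have eR: "emeasure (borel_Rd d) ?R = ennreal (\<sigma> * (L - 2 * A) ^ (d - 1))" .
  have sub: "?R \<subseteq> {x \<in> space (lebesgue_Rd d). s < \<bar>?H x\<bar>}"
  proof (rule subsetI)
    fix x assume x: "x \<in> ?R"
    then have sp: "x \<in> space (borel_Rd d)" and sl: "slab (-1) (exp A) (exp (L - A)) d x" and ps: "(\<Prod>i\<in>{1..d}. - 1 * x i) < \<sigma>" by auto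
    have neg: "x i < 0 \<and> (2 \<le> i \<longrightarrow> exp A < - x i \<and> - x i < exp (L - A))" if "i \<in> {1..d}" for i
      using sl that by (auto simp: slab_def)
    have "- 1 * x i = \<bar>x i\<bar>" if "i \<in> {1..d}" for i using neg[OF that] by simp
    then have "(\<Prod>i\<in>{1..d}. - 1 * x i) = (\<Prod>i\<in>{1..d}. \<bar>x i\<bar>)" by (rule prod.cong[OF refl])
    then have P1: "(\<Prod>i\<in>{1..d}. \<bar>x i\<bar>) \<le> \<sigma>" using ps by (simp only: less_imp_le)
    have "\<bar>x i\<bar> > 0" if "i \<in> {1..d}" for i using neg[OF that] by simp
    then have P2: "(\<Prod>i\<in>{1..d}. \<bar>x i\<bar>) > 0" by (rule prod_pos)
    note P = P1 P2
    have H: "?H x = (- 1) ^ (d + 1 - 1) * enn2real (cross_iter 1 x)"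
      unfolding multiple_hilbert_def using sp neg by (intro hilbert_foldr_extremal) auto
    have Wf: "cross_iter 1 x < \<infinity>" using neg by (intro cross_iter_one_finite int) auto
    have "(trunc_calderon A ^^ d) (\<lambda>u. g (cst * u)) \<sigma> \<le> (trunc_calderon A ^^ d) (\<lambda>u. g (cst * u)) (\<Prod>i\<in>{1..d}. \<bar>x i\<bar>)"
      using P cst_pos by (intro funpow_trunc_calderon_antimono g_antimono mult_left_mono) auto
    then have "ennreal (1 / (2 * pi)) ^ d * (trunc_calderon A ^^ d) g (cst * \<sigma>)
      \<le> ennreal (1 / (2 * pi)) ^ d * (trunc_calderon A ^^ d) (\<lambda>u. g (cst * u)) (\<Prod>i\<in>{1..d}. \<bar>x i\<bar>)"
      unfolding funpow_trunc_calderon_scale by (rule mult_left_mono) simp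
    also have "\<dots> \<le> cross_iter 1 x"
      using cross_iter_lower[of A 1 x] A(1) sp neg by (simp add: slab_def)
    finally have "q < cross_iter 1 x" using q by (rule less_le_trans[rotated])
    then have "s < enn2real (cross_iter 1 x)" using Wf s by (cases "cross_iter 1 x") (auto simp: ennreal_less_iff)
    moreover have "\<bar>?H x\<bar> = enn2real (cross_iter 1 x)" unfolding H by (simp add: abs_mult power_abs)
    ultimately show "x \<in> {x \<in> space (lebesgue_Rd d). s < \<bar>?H x\<bar>}"
      using sp by (simp only: mem_Collect_eq lebesgue_Rd_def space_completion simp_thms)
  qed
  have "ennreal t < ennreal (\<sigma> * (L - 2 * A) ^ (d - 1))" using t by (simp add: ennreal_less_iff)
  also have "\<dots> = emeasure (lebesgue_Rd d) ?R" unfolding eR[symmetric] lebesgue_Rd_def using R by simp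
  also have "\<dots> \<le> emeasure (lebesgue_Rd d) {x \<in> space (lebesgue_Rd d). s < \<bar>?H x\<bar>}"
    using sub by (rule emeasure_mono) (use m in measurable)
  finally have "ennreal t < emeasure (lebesgue_Rd d) {x \<in> space (lebesgue_Rd d). s < \<bar>?H x\<bar>}" .
  then have "ennreal s < rearrangement (lebesgue_Rd d) ?H t" by (simp only: rearrangement_gt_iff[OF m s(2)])
  then show "q \<le> rearrangement (lebesgue_Rd d) ?H t" unfolding s(1) by (rule less_imp_le)
qed

end

section \<open>Proof of the theorem\<close>

lemma calderon_funpow_mono:
  assumes "\<And>u. u > 0 \<Longrightarrow> g u \<le> h u" "t > 0"
  shows "(calderon ^^ n) g t \<le> (calderon ^^ n) h t"
  using assms(2) by (induction n arbitrary: t) (auto intro!: calderon_mono assms(1))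

lemma multiple_hilbert_rearrangement:
  assumes g: "g \<in> borel_measurable (lebesgue_Rd d)"
    and c: "\<And>n t. n \<le> d \<Longrightarrow> t > 0 \<Longrightarrow> (calderon ^^ n) (rearrangement (lebesgue_Rd d) g) t < \<infinity>"
  shows "multiple_hilbert d g \<in> borel_measurable (lebesgue_Rd d)"
    and "t > 0 \<Longrightarrow> rearrangement (lebesgue_Rd d) (multiple_hilbert d g) t
      \<le> 1000 ^ d * (calderon ^^ d) (rearrangement (lebesgue_Rd d) g) t"
proof -
  have l: "length [1..<d + 1] = d" "set [1..<d + 1] \<subseteq> {1..d}" by auto
  note H = hilbert_foldr_rearrangement[of g d "[1..<d + 1]", unfolded l(1), OF g c l(2), folded multiple_hilbert_def]
  show "multiple_hilbert d g \<in> borel_measurable (lebesgue_Rd d)" using H by blast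
  show "t > 0 \<Longrightarrow> rearrangement (lebesgue_Rd d) (multiple_hilbert d g) t
      \<le> 1000 ^ d * (calderon ^^ d) (rearrangement (lebesgue_Rd d) g) t" using H by blast
qed

text \<open>The length is \<open>4 * Suc N\<close> because it has to be positive also for
  \<open>N = 0\<close>, where the cutoff interval is empty.\<close>

lemma liminf_extremal:
  fixes d :: nat
  assumes d: "d \<ge> 1" and f: "f \<in> Lorentz_space (phi d) (lebesgue_Rd d)" and t: "t > 0"
  defines "\<mu> \<equiv> rearrangement (lebesgue_Rd d) f"
  defines "F \<equiv> \<lambda>N. extremal d (4 * real (Suc N)) (\<lambda>u. \<mu> u * indicator {0<..<real N ^ d} u)"
  shows "rearrangement (lebesgue_Rd d) (F N) t = \<mu> t * indicator {0<..<real N ^ d} t"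
    and "ennreal ((1 / (4 * pi)) ^ d) * (calderon ^^ d) \<mu> t
      \<le> liminf (\<lambda>N. rearrangement (lebesgue_Rd d) (multiple_hilbert d (F N)) t)"
proof -
  let ?g = "\<lambda>N u. \<mu> u * indicator {0<..<real N ^ d} u"
  have fm: "f \<in> borel_measurable (lebesgue_Rd d)" using f by (simp add: Lorentz_space_def S_space_def)
  have \<mu>m[measurable]: "\<mu> \<in> borel_measurable borel" unfolding \<mu>_def by (rule rearrangement_measurable)
  have fin: "(calderon ^^ n) \<mu> t < \<infinity>" if "n \<le> d" "t > 0" for n t
    unfolding \<mu>_def using that by (intro Lorentz_space_calderon_finite d f)
  have mufin: "\<mu> t < \<infinity>" if "t > 0" for t using fin[of 0 t] that by simp
  have gm: "?g N \<in> borel_measurable borel" for N by measurable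
  have reF: "rearrangement (lebesgue_Rd d) (F N) t = ?g N t" if "t > 0" for N t
    unfolding F_def \<mu>_def by (rule extremal_rearrangement[OF d _ fm]) (use mufin that in \<open>auto simp: \<mu>_def\<close>)
  then show "rearrangement (lebesgue_Rd d) (F N) t = \<mu> t * indicator {0<..<real N ^ d} t" using t by simp
  let ?S = "\<lambda>N. (trunc_calderon (real (Suc N)) ^^ d) (?g N) (2 ^ d * t)"
  have lower: "ennreal (1 / (2 * pi)) ^ d * ?S N \<le> rearrangement (lebesgue_Rd d) (multiple_hilbert d (F N)) t" for N
  proof -
    define A where "A = real (Suc N)"
    have A: "A > 0" by (simp add: A_def)
    interpret E: extremal_problem d "4 * A" "?g N"
    proof
      show "?g N t' \<le> ?g N t" if "0 < t" "t \<le> t'" for t t'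
        using that rearrangement_antimono[of t t' "lebesgue_Rd d" f] by (auto simp: indicator_def \<mu>_def)
      show "?g N t < \<infinity>" if "0 < t" for t using mufin[OF that] by (auto simp: indicator_def)
    qed (use d A gm in auto)
    have Fm: "F N \<in> borel_measurable (lebesgue_Rd d)"
      unfolding F_def lebesgue_Rd_def by (intro measurable_completion extremal_measurable gm)
    have c: "(calderon ^^ n) (rearrangement (lebesgue_Rd d) (F N)) u < \<infinity>" if "n \<le> d" "u > 0" for n u
    proof -
      \<comment> \<open>The cut-off rearrangement lies below that of \<open>f\<close>, so every
        finiteness statement is inherited.\<close>
      have "(calderon ^^ n) (rearrangement (lebesgue_Rd d) (F N)) u \<le> (calderon ^^ n) \<mu> u"
        by (rule calderon_funpow_mono) (use that in \<open>auto simp: reF indicator_def\<close>)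
      then show ?thesis using fin[OF that] by (rule le_less_trans)
    qed
    have Hm: "multiple_hilbert d (F N) \<in> borel_measurable (lebesgue_Rd d)"
      using Fm c by (rule multiple_hilbert_rearrangement(1))
    have "(\<integral>\<^sup>+ s \<in> {0<..}. ?g N s \<partial>lborel) \<le> (\<integral>\<^sup>+ s \<in> {0<..<real N ^ d + 1}. \<mu> s \<partial>lborel)"
      by (intro nn_integral_mono) (auto simp: indicator_def)
    also have "\<dots> < \<infinity>" using fin[of 1 "real N ^ d + 1"] d by (intro calderon_finiteD(1)) (auto simp: add_nonneg_pos)
    finally have int: "(\<integral>\<^sup>+ s \<in> {0<..}. ?g N s \<partial>lborel) < \<infinity>" .
    \<comment> \<open>With \<open>L = 4 * A\<close> the region of
      \<open>rearrangement_extremal_lower\<close> has measure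
      \<open>\<sigma> * (2 * A) ^ (d - 1)\<close>, and this choice makes it \<open>2 * t\<close>.
      The argument \<open>(4 * A) ^ (d - 1) * \<sigma>\<close> of the lower bound then becomes
      \<open>2 ^ d * t\<close>, independent of \<open>A\<close>.\<close>
    define \<sigma> where "\<sigma> = 2 * t / (2 * A) ^ (d - 1)"
    have \<sigma>: "\<sigma> > 0" using t A by (simp add: \<sigma>_def)
    have "\<sigma> * (2 * A) ^ (d - 1) = 2 * t" using A by (simp add: \<sigma>_def)
    then have t2: "t < \<sigma> * (4 * A - 2 * A) ^ (d - 1)" using t by simp
    have "(4 * A) ^ (d - 1) = 2 ^ (d - 1) * (2 * A) ^ (d - 1)" by (subst power_mult_distrib[symmetric]) simp
    then have "(4 * A) ^ (d - 1) * \<sigma> = 2 * 2 ^ (d - 1) * t" using A by (simp add: \<sigma>_def)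
    also have "2 * 2 ^ (d - 1) = (2 ^ d :: real)" using d by (cases d) auto
    finally have cs: "(4 * A) ^ (d - 1) * \<sigma> = 2 ^ d * t" .
    have FA: "F N = extremal d (4 * A) (?g N)" by (simp add: F_def A_def)
    show ?thesis
      using E.rearrangement_extremal_lower[of A \<sigma> t] A int Hm \<sigma> t t2 unfolding FA[symmetric] cs A_def[symmetric] by simp
  qed
  have inc: "incseq (\<lambda>N. ?g N u)" for u
  proof (rule incseq_SucI)
    fix N
    have "real N ^ d \<le> real (Suc N) ^ d" by (intro power_mono) auto
    then show "?g N u \<le> ?g (Suc N) u" by (auto simp: indicator_def)
  qed
  have sup: "(SUP N. ?g N u) = \<mu> u" if u: "u > 0" for u
  proof (rule antisym)
    show "(SUP N. ?g N u) \<le> \<mu> u" by (rule SUP_least) (auto simp: indicator_def)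
    obtain n where n: "u < real n" using reals_Archimedean2 by blast
    then have "n \<ge> 1" using u by (cases n) auto
    then have "real n ^ 1 \<le> real n ^ d" using d by (intro power_increasing) auto
    then have "u \<in> {0<..<real n ^ d}" using n u unfolding greaterThanLessThan_iff power_one_right by linarith
    then have e: "?g n u = \<mu> u" by simp
    have "?g n u \<le> (SUP N. ?g N u)" by (rule SUP_upper) (rule UNIV_I)
    then show "\<mu> u \<le> (SUP N. ?g N u)" unfolding e .
  qed
  have t2: "2 ^ d * t > 0" using t by simp
  have S: "incseq ?S" "(SUP N. ?S N) = (calderon ^^ d) (\<lambda>u. SUP N. ?g N u) (2 ^ d * t)"
    using SUP_funpow_trunc_calderon[of ?g, OF gm inc t2, of d] by blast+
  have "(calderon ^^ d) \<mu> (2 ^ d * t) \<le> (calderon ^^ d) (\<lambda>u. SUP N. ?g N u) (2 ^ d * t)"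
    using t2 by (intro calderon_funpow_mono) (simp_all only: sup order_refl)
  then have "ennreal (1 / (2 * pi)) ^ d * (calderon ^^ d) \<mu> (2 ^ d * t) \<le> ennreal (1 / (2 * pi)) ^ d * (SUP N. ?S N)"
    unfolding S by (rule mult_left_mono) simp
  also have "\<dots> = liminf (\<lambda>N. ennreal (1 / (2 * pi)) ^ d * ?S N)"
  proof -
    have "incseq (\<lambda>N. ennreal (1 / (2 * pi)) ^ d * ?S N)"
      using S(1) unfolding incseq_def by (blast intro: mult_left_mono zero_le)
    then have "liminf (\<lambda>N. ennreal (1 / (2 * pi)) ^ d * ?S N) = (SUP N. ennreal (1 / (2 * pi)) ^ d * ?S N)"
      by (intro lim_imp_Liminf LIMSEQ_SUP) auto
    then show ?thesis by (simp only: SUP_mult_left_ennreal)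
  qed
  also have "\<dots> \<le> liminf (\<lambda>N. rearrangement (lebesgue_Rd d) (multiple_hilbert d (F N)) t)"
    using lower by (intro Liminf_mono always_eventually allI)
  finally have a: "ennreal (1 / (2 * pi)) ^ d * (calderon ^^ d) \<mu> (2 ^ d * t)
    \<le> liminf (\<lambda>N. rearrangement (lebesgue_Rd d) (multiple_hilbert d (F N)) t)" .
  obtain k where k: "d = Suc k" using d by (cases d) auto
  \<comment> \<open>Only the outermost of the \<open>d\<close> operators has to absorb the dilation.
    Its factor \<open>2 ^ d\<close> turns the power of \<open>1 / (2 * pi)\<close> into that of
    \<open>1 / (4 * pi)\<close>.\<close>
  have "(calderon ^^ d) \<mu> t \<le> ennreal (2 ^ d) * (calderon ^^ d) \<mu> (2 ^ d * t)"
    unfolding k funpow.simps comp_def using t one_le_power[of "2::real" "Suc k"]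
    by (intro calderon_le_dilate calderon_funpow_measurable \<mu>m) simp_all
  then have "ennreal ((1 / (4 * pi)) ^ d) * (calderon ^^ d) \<mu> t
    \<le> ennreal ((1 / (4 * pi)) ^ d) * (ennreal (2 ^ d) * (calderon ^^ d) \<mu> (2 ^ d * t))" by (rule mult_left_mono) simp
  also have "\<dots> = ennreal (1 / (2 * pi)) ^ d * (calderon ^^ d) \<mu> (2 ^ d * t)"
  proof -
    have "ennreal ((1 / (4 * pi)) ^ d) * ennreal (2 ^ d) = ennreal ((1 / (4 * pi)) ^ d * 2 ^ d)" by (intro ennreal_mult[symmetric]) auto
    also have "(1 / (4 * pi)) ^ d * 2 ^ d = (1 / (2 * pi)) ^ d" by (subst power_mult_distrib[symmetric]) simp
    also have "ennreal ((1 / (2 * pi)) ^ d) = ennreal (1 / (2 * pi)) ^ d" by (simp add: ennreal_power)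
    finally show ?thesis by (simp only: mult.assoc[symmetric])
  qed
  also note a
  finally show "ennreal ((1 / (4 * pi)) ^ d) * (calderon ^^ d) \<mu> t
    \<le> liminf (\<lambda>N. rearrangement (lebesgue_Rd d) (multiple_hilbert d (F N)) t)" .
qed

theorem theorem1:
  fixes d :: nat
  assumes "d \<ge> 1"
  shows "\<exists>c c' :: real. c > 0 \<and> c' > 0 \<and>
    (\<forall>f \<in> Lorentz_space (phi d) (lebesgue_Rd d).
      (\<forall>t>0. rearrangement (lebesgue_Rd d) (multiple_hilbert d f) t
               \<le> ennreal c * (calderon ^^ d) (rearrangement (lebesgue_Rd d) f) t) \<and>
      (\<exists>F :: nat \<Rightarrow> (nat \<Rightarrow> real) \<Rightarrow> real.
        (\<forall>N. F N \<in> borel_measurable (lebesgue_Rd d)) \<and>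
        (\<forall>N. \<forall>t>0. rearrangement (lebesgue_Rd d) (F N) t
                 = rearrangement (lebesgue_Rd d) f t * indicator {0<..<real N ^ d} t) \<and>
        (\<forall>t>0. liminf (\<lambda>N. rearrangement (lebesgue_Rd d) (multiple_hilbert d (F N)) t)
               \<ge> ennreal c' * (calderon ^^ d) (rearrangement (lebesgue_Rd d) f) t)))"
proof (intro exI conjI ballI)
  fix f assume f: "f \<in> Lorentz_space (phi d) (lebesgue_Rd d)"
  let ?\<mu> = "rearrangement (lebesgue_Rd d) f"
  let ?F = "\<lambda>N. extremal d (4 * real (Suc N)) (\<lambda>u. ?\<mu> u * indicator {0<..<real N ^ d} u)"
  have fm: "f \<in> borel_measurable (lebesgue_Rd d)" using f by (simp add: Lorentz_space_def S_space_def)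
  have "ennreal (1000 ^ d) = 1000 ^ d" by (simp flip: ennreal_power)
  then show "\<forall>t>0. rearrangement (lebesgue_Rd d) (multiple_hilbert d f) t \<le> ennreal (1000 ^ d) * (calderon ^^ d) ?\<mu> t"
    using multiple_hilbert_rearrangement(2)[OF fm Lorentz_space_calderon_finite[OF assms f]] by simp
  show "\<forall>N. ?F N \<in> borel_measurable (lebesgue_Rd d)"
    unfolding lebesgue_Rd_def by (intro allI measurable_completion extremal_measurable) measurable
  show "\<forall>N. \<forall>t>0. rearrangement (lebesgue_Rd d) (?F N) t = ?\<mu> t * indicator {0<..<real N ^ d} t"
    using liminf_extremal(1)[OF assms f] by blast
  show "\<forall>t>0. ennreal ((1 / (4 * pi)) ^ d) * (calderon ^^ d) ?\<mu> t
    \<le> liminf (\<lambda>N. rearrangement (lebesgue_Rd d) (multiple_hilbert d (?F N)) t)"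
    using liminf_extremal(2)[OF assms f] by blast
qed simp_all

end
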